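(* Let $d,m,n\ge1$ be integers and $\delta>0$. There exists a constant $N=N(d,n,m,\delta)$ such that the following holds. Let $T\in(-\infty,\infty]$ and let $A^{\alpha\beta}=A^{\alpha\beta}(t)$, $|\alpha|=|\beta|=m$, be measurable $n\times n$ complex matrix-valued functions of $t\in\mathbb R$ only, satisfying $|A^{\alpha\beta}|\le\delta^{-1}$ and the Legendre–Hadamard condition with constant $\delta$. Put $\mathcal L_0u=\sum_{|\alpha|=|\beta|=m}A^{\alpha\beta}(t)D^\alpha D^\beta u$ and $\mathcal O_T^+=(-\infty,T)\times\mathbb R^d_+$. Then $$\|u_t\|_{L_2(\mathcal O_T^+)}+\sum_{|\alpha|\le2m}\lambda^{1-\frac{|\alpha|}{2m}}\|D^\alpha u\|_{L_2(\mathcal O_T^+)}\le N\|u_t+(-1)^m\mathcal L_0u+\lambda u\|_{L_2(\mathcal O_T^+)}$$ for all $\lambda\ge0$ and all $u\in W_2^{1,2m}(\mathcal O_T^+)$ satisfying $$u(t,0,x')=\cdots=D_1^{m-1}u(t,0,x')=0\quad\text{on }(-\infty,T)\times\mathbb R^{d-1}.$$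
   Context: $\mathbb R^d_+=\{x=(x_1,x')\in\mathbb R\times\mathbb R^{d-1}:x_1>0\}$. Functions are $\mathbb C^n$-valued, $D^\alpha$ denotes spatial derivatives, boundary conditions are in the sense of traces. $W_2^{1,2m}(\mathcal O_T^+)=\{u:u_t,D^\alpha u\in L_2(\mathcal O_T^+),|\alpha|\le2m\}$. The Legendre–Hadamard condition with constant $\delta$: $\Re\big(\sum_{|\alpha|=|\beta|=m}\theta^{\mathrm{tr}}\xi^\alpha\xi^\beta A^{\alpha\beta}(t)\bar\theta\big)\ge\delta|\xi|^{2m}|\theta|^2$ for all $t\in\mathbb R$, $\xi\in\mathbb R^d$, $\theta\in\mathbb C^n$. For $\lambda=0$, $\lambda^0=1$. *)

theory Defs
  imports "HOL-Analysis.Analysis"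
begin

section \<open>Smooth functions and weak derivatives\<close>

definition pdiff :: "'a::euclidean_space \<Rightarrow> ('a \<Rightarrow> 'b::real_normed_vector) \<Rightarrow> 'a \<Rightarrow> 'b"
  where "pdiff v f = (\<lambda>z. frechet_derivative f (at z) v)"

primrec C_k :: "nat \<Rightarrow> ('a::euclidean_space \<Rightarrow> 'b::real_normed_vector) \<Rightarrow> bool"
  where
    "C_k 0 f \<longleftrightarrow> continuous_on UNIV f"
  | "C_k (Suc k) f \<longleftrightarrow> (\<forall>z. f differentiable (at z)) \<and> (\<forall>b\<in>Basis. C_k k (pdiff b f))"

definition smooth :: "('a::euclidean_space \<Rightarrow> 'b::real_normed_vector) \<Rightarrow> bool"
  where "smooth f \<longleftrightarrow> (\<forall>k. C_k k f)"

definition supp :: "('a::topological_space \<Rightarrow> 'b::zero) \<Rightarrow> 'a set"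
  where "supp f = closure {z. f z \<noteq> 0}"

definition smooth_cpt :: "'a::euclidean_space set \<Rightarrow> ('a \<Rightarrow> 'b::real_normed_vector) set"
  where "smooth_cpt S = {f. smooth f \<and> compact (supp f) \<and> supp f \<subseteq> S}"

definition loc_integrable :: "'a::euclidean_space set \<Rightarrow> ('a \<Rightarrow> 'b::euclidean_space) \<Rightarrow> bool"
  where "loc_integrable S f \<longleftrightarrow> (\<forall>K. compact K \<and> K \<subseteq> S \<longrightarrow> f absolutely_integrable_on K)"

text \<open>\<open>g\<close> is the weak derivative of \<open>f\<close> on the open set \<open>S\<close> along the directions listed in
  \<open>vs\<close>. Only the values on \<open>S\<close> matter, and \<open>g\<close> is determined almost everywhere on \<open>S\<close>.\<close>

definition has_weak_deriv ::
    "'a::euclidean_space set \<Rightarrow> 'a list \<Rightarrow> ('a \<Rightarrow> 'b::euclidean_space) \<Rightarrow> ('a \<Rightarrow> 'b) \<Rightarrow> bool"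
  where "has_weak_deriv S vs f g \<longleftrightarrow>
    loc_integrable S f \<and> loc_integrable S g \<and>
    (\<forall>\<phi> \<in> smooth_cpt S :: ('a \<Rightarrow> real) set.
       (LINT z|lebesgue_on S. foldr pdiff vs \<phi> z *\<^sub>R f z)
         = (-1) ^ length vs *\<^sub>R (LINT z|lebesgue_on S. \<phi> z *\<^sub>R g z))"

text \<open>A representative of the weak derivative; meaningful only where one exists.\<close>

definition weak_deriv ::
    "'a::euclidean_space set \<Rightarrow> 'a list \<Rightarrow> ('a \<Rightarrow> 'b::euclidean_space) \<Rightarrow> 'a \<Rightarrow> 'b"
  where "weak_deriv S vs f = (SOME g. has_weak_deriv S vs f g)"


section \<open>The space \<open>L\<^sub>2\<close>\<close>

definition in_L2 :: "'a measure \<Rightarrow> ('a \<Rightarrow> 'b::euclidean_space) \<Rightarrow> bool"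
  where "in_L2 M f \<longleftrightarrow> f \<in> borel_measurable M \<and> integrable M (\<lambda>z. (norm (f z))\<^sup>2)"

definition L2_norm :: "'a measure \<Rightarrow> ('a \<Rightarrow> 'b::euclidean_space) \<Rightarrow> real"
  where "L2_norm M f = sqrt (LINT z|M. (norm (f z))\<^sup>2)"

definition L2_tendsto ::
    "'a measure \<Rightarrow> (nat \<Rightarrow> 'a \<Rightarrow> 'b::euclidean_space) \<Rightarrow> ('a \<Rightarrow> 'b) \<Rightarrow> bool"
  where "L2_tendsto M F f \<longleftrightarrow>
    (\<forall>k. in_L2 M (\<lambda>z. F k z - f z)) \<and> (\<lambda>k. L2_norm M (\<lambda>z. F k z - f z)) \<longlonglongrightarrow> 0"


section \<open>Space-time, multi-indices and the half-space\<close>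

text \<open>Points of space-time are pairs \<open>(t, x)\<close>. The linear order on the index type \<open>'d\<close> numbers
  the coordinates of \<open>x\<close>; the least index plays the role of the index \<open>1\<close> in \<open>x\<^sub>1\<close>.\<close>

type_synonym 'd spacetime = "real \<times> (real, 'd) vec"

type_synonym ('d, 'n) vfield = "'d spacetime \<Rightarrow> (complex, 'n) vec"

type_synonym 'd multi_index = "'d \<Rightarrow> nat"

definition mi_size :: "'d::finite multi_index \<Rightarrow> nat"
  where "mi_size \<alpha> = (\<Sum>i\<in>UNIV. \<alpha> i)"

definition mi_power :: "(real, 'd::finite) vec \<Rightarrow> 'd multi_index \<Rightarrow> real"
  where "mi_power \<xi> \<alpha> = (\<Prod>i\<in>UNIV. (\<xi> $ i) ^ \<alpha> i)"

definition mi_eq :: "nat \<Rightarrow> 'd::finite multi_index set"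
  where "mi_eq k = {\<alpha>. mi_size \<alpha> = k}"

definition mi_le :: "nat \<Rightarrow> 'd::finite multi_index set"
  where "mi_le k = {\<alpha>. mi_size \<alpha> \<le> k}"

lemma finite_mi_le: "finite (mi_le k :: 'd::finite multi_index set)"
proof (rule finite_subset)
  show "mi_le k \<subseteq> {\<alpha> :: 'd \<Rightarrow> nat. \<forall>i. \<alpha> i \<in> {..k}}"
  proof
    fix \<alpha> :: "'d multi_index"
    assume "\<alpha> \<in> mi_le k"
    then have "sum \<alpha> UNIV \<le> k"
      by (simp add: mi_le_def mi_size_def)
    moreover have "\<alpha> i \<le> sum \<alpha> UNIV" for i
      by (rule member_le_sum) simp_all
    ultimately have "\<alpha> i \<le> k" for i
      using order_trans by blast
    then show "\<alpha> \<in> {\<alpha>. \<forall>i. \<alpha> i \<in> {..k}}"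
      by simp
  qed
  have "finite (PiE (UNIV :: 'd set) (\<lambda>_. {..k}))"
    by (rule finite_PiE) simp_all
  then show "finite {\<alpha> :: 'd \<Rightarrow> nat. \<forall>i. \<alpha> i \<in> {..k}}"
    by (simp add: PiE_UNIV_domain Pi_def)
qed

lemma finite_mi_eq: "finite (mi_eq k :: 'd::finite multi_index set)"
  by (rule finite_subset[OF _ finite_mi_le[of k]]) (auto simp: mi_eq_def mi_le_def)

definition first_coord :: "'d::{finite,linorder}"
  where "first_coord = Min UNIV"

definition t_dir :: "'d::finite spacetime"
  where "t_dir = (1, 0)"

definition x_dir :: "'d::finite \<Rightarrow> 'd spacetime"
  where "x_dir i = (0, axis i 1)"

definition mi_dirs :: "'d::{finite,linorder} multi_index \<Rightarrow> 'd spacetime list"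
  where "mi_dirs \<alpha> = concat (map (\<lambda>i. replicate (\<alpha> i) (x_dir i)) (sorted_list_of_set UNIV))"

definition half_cyl :: "ereal \<Rightarrow> 'd::{finite,linorder} spacetime set"
  where "half_cyl T = {(t, x). ereal t < T \<and> 0 < x $ first_coord}"

abbreviation leb_cyl :: "ereal \<Rightarrow> 'd::{finite,linorder} spacetime measure"
  where "leb_cyl T \<equiv> lebesgue_on (half_cyl T)"

definition Dt :: "ereal \<Rightarrow> ('d::{finite,linorder}, 'n::finite) vfield
    \<Rightarrow> ('d, 'n) vfield"
  where "Dt T u = weak_deriv (half_cyl T) [t_dir] u"

definition Dx :: "ereal \<Rightarrow> 'd multi_index
    \<Rightarrow> ('d::{finite,linorder}, 'n::finite) vfield
    \<Rightarrow> ('d, 'n) vfield"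
  where "Dx T \<alpha> u = weak_deriv (half_cyl T) (mi_dirs \<alpha>) u"

text \<open>The space \<open>W\<^sub>2\<^bsup>1,k\<^esup>\<close> on \<open>half_cyl T\<close>.\<close>

definition sobolev_W :: "ereal \<Rightarrow> nat
    \<Rightarrow> ('d::{finite,linorder}, 'n::finite) vfield set"
  where "sobolev_W T k = {u.
    (\<exists>v. has_weak_deriv (half_cyl T) [t_dir] u v) \<and> in_L2 (leb_cyl T) (Dt T u) \<and>
    (\<forall>\<alpha> \<in> mi_le k. (\<exists>v. has_weak_deriv (half_cyl T) (mi_dirs \<alpha>) u v) \<and>
       in_L2 (leb_cyl T) (Dx T \<alpha> u))}"


section \<open>Traces on the lateral boundary\<close>

text \<open>The product Lebesgue measure on \<open>(-\<infinity>,T) \<times> \<real>\<^bsup>d-1\<^esup>\<close>, carried by the hyperplane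
  \<open>x\<^sub>1 = 0\<close> of space-time. For \<open>d = 1\<close> the spatial factor is the unit mass at the origin.\<close>

definition bdry_measure :: "ereal \<Rightarrow> 'd::{finite,linorder} spacetime measure"
  where "bdry_measure T = restrict_space
    (distr (lborel \<Otimes>\<^sub>M (\<Pi>\<^sub>M i\<in>UNIV - {first_coord :: 'd}. lborel)) borel
       (\<lambda>(t, y). (t, \<chi> i. if i = first_coord then 0 else y i)))
    {(t, x). ereal t < T}"

text \<open>The trace operator on \<open>{w. w, D\<^sub>1 w, \<dots>, D\<^sub>d w \<in> L\<^sub>2}\<close> is the continuous extension of the
  restriction map \<open>\<phi> \<mapsto> \<phi>(\<cdot>,0,\<cdot>)\<close> from functions that are smooth up to the boundary; here
  it is given as a relation, by its graph.\<close>

definition has_trace :: "ereal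
    \<Rightarrow> ('d::{finite,linorder}, 'n::finite) vfield
    \<Rightarrow> ('d, 'n) vfield \<Rightarrow> bool"
  where "has_trace T w g \<longleftrightarrow>
    (\<exists>\<phi>. (\<forall>k. \<phi> k \<in> smooth_cpt UNIV) \<and>
       L2_tendsto (leb_cyl T) \<phi> w \<and>
       (\<forall>i. \<exists>v. has_weak_deriv (half_cyl T) [x_dir i] w v \<and>
          L2_tendsto (leb_cyl T) (\<lambda>k. pdiff (x_dir i) (\<phi> k)) v) \<and>
       L2_tendsto (bdry_measure T) \<phi> g)"

text \<open>\<open>u = D\<^sub>1 u = \<dots> = D\<^sub>1\<^bsup>m-1\<^esup> u = 0\<close> on \<open>x\<^sub>1 = 0\<close>.\<close>

definition zero_dirichlet :: "ereal \<Rightarrow> nat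
    \<Rightarrow> ('d::{finite,linorder}, 'n::finite) vfield \<Rightarrow> bool"
  where "zero_dirichlet T m u \<longleftrightarrow>
    (\<forall>j<m. has_trace T (Dx T ((\<lambda>_. 0)(first_coord := j)) u) (\<lambda>_. 0))"


section \<open>The operator\<close>

type_synonym ('d, 'n) coeffs = "'d multi_index \<Rightarrow> 'd multi_index \<Rightarrow> real \<Rightarrow> ((complex, 'n) vec, 'n) vec"

definition legendre_hadamard :: "nat \<Rightarrow> real \<Rightarrow> ('d::finite, 'n::finite) coeffs \<Rightarrow> bool"
  where "legendre_hadamard m \<delta> A \<longleftrightarrow>
    (\<forall>t (\<xi> :: (real, 'd) vec) (\<theta> :: (complex, 'n) vec).
       Re (\<Sum>\<alpha>\<in>mi_eq m. \<Sum>\<beta>\<in>mi_eq m. \<Sum>i\<in>UNIV. \<Sum>j\<in>UNIV.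
             \<theta> $ i * of_real (mi_power \<xi> \<alpha> * mi_power \<xi> \<beta>) * A \<alpha> \<beta> t $ i $ j * cnj (\<theta> $ j))
         \<ge> \<delta> * norm \<xi> ^ (2 * m) * (norm \<theta>)\<^sup>2)"

text \<open>Measurability is Lebesgue measurability, and \<open>norm\<close> on matrices is the Euclidean
  (Frobenius) norm.\<close>

definition admissible_coeffs :: "nat \<Rightarrow> real \<Rightarrow> ('d::finite, 'n::finite) coeffs \<Rightarrow> bool"
  where "admissible_coeffs m \<delta> A \<longleftrightarrow>
    (\<forall>\<alpha>\<in>mi_eq m. \<forall>\<beta>\<in>mi_eq m.
       A \<alpha> \<beta> \<in> borel_measurable lebesgue \<and> (\<forall>t. norm (A \<alpha> \<beta> t) \<le> inverse \<delta>)) \<and>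
    legendre_hadamard m \<delta> A"

definition L0 :: "ereal \<Rightarrow> nat \<Rightarrow> ('d, 'n) coeffs
    \<Rightarrow> ('d::{finite,linorder}, 'n::finite) vfield
    \<Rightarrow> ('d, 'n) vfield"
  where "L0 T m A u = (\<lambda>z. \<Sum>\<alpha>\<in>mi_eq m. \<Sum>\<beta>\<in>mi_eq m. A \<alpha> \<beta> (fst z) *v Dx T \<alpha> (Dx T \<beta> u) z)"

text \<open>Real powers with the convention \<open>0\<^sup>0 = 1\<close>; note that \<open>0 powr 0 = 0\<close> in the library.\<close>

definition rpow :: "real \<Rightarrow> real \<Rightarrow> real"
  where "rpow x a = (if a = 0 then 1 else x powr a)"

end

theory Submission
  imports Defs "HOL-Library.Multiset" "HOL-Real_Asymp.Real_Asymp"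
begin

text \<open>Extended by zero to all of space-time, u and its spatial derivatives of order at most 2m
  become vectors \<open>U M\<close> of an L2 space, indexed by multisets M of directions. On this
  space act the spatial translations, the time delays, the projection \<open>E\<close> onto
  functions carried by the half-cylinder, and multiplication by the coefficients. The coefficients
  depend on t alone, so the last operation commutes with every spatial translation and with
  \<open>E\<close>. Derivatives are limits of difference quotients in norm: two-sided on the whole
  space (\<open>D2\<close>), which holds across the boundary as long as fewer than m normal
  derivatives have been taken, and one-sided and seen only through \<open>E\<close>
  (\<open>DH\<close>) at every order. Integration by parts
  (\<open>integration_by_parts_multi\<close>) pairs a factor of the first kind with one of the
  second, and so has no boundary term.

  Three sign facts drive the estimate. First, \<open>coercivity\<close>: the sum of the inner
  products of A M N (V M) with V N is at least \<delta> |V K|^2 for each K of size m. For finitely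
  supported lattice sequences this is Parseval plus the Legendre-Hadamard condition
  (\<open>form_nonneg_seq\<close>). It transfers to any group of isometries by sampling an orbit on
  a large box, whose boundary layer is negligible (\<open>form_nonneg_cdiffs\<close>), and then the
  step tends to 0. Secondly, \<open>time_nonneg\<close>: (-1)^|\<beta>| times the inner product of
  u_t with D^(2\<beta>) u is nonnegative for |\<beta>| \<le> m, because delaying is an isometry.
  Thirdly, the Legendre-Hadamard condition in the normal direction alone makes the coefficient of
  D_1^(2m) coercive.

  Let F be the right-hand side. Coercivity for tangential difference quotients of u bounds every
  derivative of order 2m with at least m tangential directions by |F| / \<delta>
  (\<open>tangential\<close>). Pairing the equation with D_1^(2m) u bounds this derivative by F and
  the other derivatives of order 2m (\<open>normal\<close>). By \<open>mixed_interpolation\<close>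
  the norms of order 2m are log-convex in the number of normal directions, up to a factor 49. Hence
  the derivatives in between are at most a small multiple of D_1^(2m) u plus a multiple of F, and
  the small multiple is absorbed (\<open>top_order_bound\<close>). The equation now bounds u_t + lam
  u, whose two terms have nonnegative inner product, so each term is bounded
  (\<open>time_and_zero_order\<close>). Interpolation between the orders 0 and 2m
  (\<open>pure_interpolation\<close>) yields the powers of lam (\<open>all_orders_bound\<close>).

  The interpolation inequalities concern derivatives without boundary conditions. There f is
  replaced by f(t, x) - f(t, 2 x_1, x'), which vanishes at x_1 = 0; little is lost, since the
  operator that acts on the first normal derivative, 1 - 2R with R the dilation, is bounded below.

  The rest connects this with the concrete notions. Weak derivatives are norm limits of difference
  quotients (\<open>weak_derivative_difference_quotient\<close>); a vanishing trace makes the zero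
  extension weakly differentiable across the boundary (\<open>zero_trace_weak\<close>); and
  \<open>D2_tangential\<close> carries this from D_1^j u over to its tangential derivatives
  (\<open>normal_derivative_two_sided\<close>).\<close>

section \<open>Positivity of lattice forms\<close>

definition ibox :: "int \<Rightarrow> (int, 'd::finite) vec set"
  where "ibox r = {k. \<forall>i. \<bar>k $ i\<bar> \<le> r}"

lemma bij_betw_ibox:
  "bij_betw vec_lambda (PiE UNIV (\<lambda>_::'d::finite. {-r..r})) (ibox r :: (int, 'd) vec set)"
proof (rule bij_betw_byWitness[where f' = vec_nth])
  show "vec_lambda ` (PiE UNIV (\<lambda>_::'d. {-r..r})) \<subseteq> ibox r"
    unfolding ibox_def PiE_UNIV_domain by (auto simp: abs_le_iff minus_le_iff dest!: PiE_mem)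
  show "vec_nth ` ibox r \<subseteq> PiE UNIV (\<lambda>_::'d. {-r..r})"
    unfolding ibox_def PiE_UNIV_domain by (auto simp: abs_le_iff minus_le_iff)
qed (simp_all add: vec_lambda_inverse fun_eq_iff)

lemma finite_ibox [simp]: "finite (ibox r :: (int, 'd::finite) vec set)"
  using bij_betw_finite[OF bij_betw_ibox[of r]] by (simp add: finite_PiE)

lemma card_ibox:
  assumes "0 \<le> r"
  shows "card (ibox r :: (int, 'd::finite) vec set) = nat (2 * r + 1) ^ CARD('d)"
  using bij_betw_same_card[OF bij_betw_ibox[of r, where ?'d = 'd]] assms
  by (simp add: card_PiE)

lemma ibox_mono: "r \<le> s \<Longrightarrow> ibox r \<subseteq> ibox s"
  by (auto simp: ibox_def intro: order_trans)

lemma ibox_add_axis: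
  assumes "k \<in> ibox r" "\<bar>c\<bar> \<le> 1"
  shows "k + axis i c \<in> ibox (r + 1)" "k - axis i c \<in> ibox (r + 1)"
proof -
  have k: "\<bar>k $ j\<bar> \<le> r" for j
    using assms by (simp add: ibox_def)
  have "\<bar>axis i c $ j\<bar> \<le> 1" for j
    using assms by (simp add: axis_def)
  then have "\<bar>k $ j + axis i c $ j\<bar> \<le> r + 1" "\<bar>k $ j - axis i c $ j\<bar> \<le> r + 1" for j
    using k[of j] by (smt (verit))+
  then show "k + axis i c \<in> ibox (r + 1)" "k - axis i c \<in> ibox (r + 1)"
    by (simp_all add: ibox_def)
qed

text \<open>Centred, so that the Fourier symbol is a real number times a fixed imaginary unit. A
  forward difference would have a genuinely complex symbol, about which the Legendre-Hadamard
  condition says nothing.\<close>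

definition sdiff :: "'d::finite \<Rightarrow> ((int, 'd) vec \<Rightarrow> 'h::real_vector) \<Rightarrow> (int, 'd) vec \<Rightarrow> 'h"
  where "sdiff i a k = a (k + axis i 1) - a (k - axis i 1)"

lemma sdiff_commute: "sdiff i (sdiff j a) = sdiff j (sdiff i a)"
  by (auto simp: sdiff_def fun_eq_iff algebra_simps)

interpretation sdiff: comp_fun_commute sdiff
  by standard (rule ext, simp add: sdiff_commute)

definition sdiffs :: "'d::finite multiset \<Rightarrow> ((int, 'd) vec \<Rightarrow> 'h::real_vector) \<Rightarrow> (int, 'd) vec \<Rightarrow> 'h"
  where "sdiffs M a = fold_mset sdiff a M"

lemma sdiffs_empty [simp]: "sdiffs {#} a = a"
  by (simp add: sdiffs_def)

lemma sdiffs_add [simp]: "sdiffs (add_mset i M) a = sdiff i (sdiffs M a)"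
  by (simp add: sdiffs_def)

definition sup_in :: "int \<Rightarrow> ((int, 'd::finite) vec \<Rightarrow> 'h::real_vector) \<Rightarrow> bool"
  where "sup_in r a \<longleftrightarrow> (\<forall>k. k \<notin> ibox r \<longrightarrow> a k = 0)"

lemma sup_in_mono: "sup_in r a \<Longrightarrow> r \<le> s \<Longrightarrow> sup_in s a"
  using ibox_mono by (force simp: sup_in_def)

lemma sup_in_sdiff:
  fixes a :: "(int, 'd::finite) vec \<Rightarrow> 'h::real_vector"
  shows "sup_in r a \<Longrightarrow> sup_in (r + 1) (sdiff i a)"
  unfolding sup_in_def sdiff_def
proof (intro allI impI)
  fix k :: "(int, 'd) vec"
  assume a: "\<forall>k. k \<notin> ibox r \<longrightarrow> a k = 0" and k: "k \<notin> ibox (r + 1)"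
  have "k + axis i 1 \<notin> ibox r"
    using ibox_add_axis(2)[of "k + axis i 1" r 1 i] k by auto
  moreover have "k - axis i 1 \<notin> ibox r"
    using ibox_add_axis(1)[of "k - axis i 1" r 1 i] k by auto
  ultimately show "a (k + axis i 1) - a (k - axis i 1) = 0"
    using a by simp
qed

lemma sup_in_sdiffs: "sup_in r a \<Longrightarrow> sup_in (r + int (size M)) (sdiffs M a)"
proof (induction M)
  case (add i M)
  then show ?case using sup_in_sdiff[of "r + int (size M)" "sdiffs M a" i] by (simp add: algebra_simps)
qed simp

definition phase :: "nat \<Rightarrow> ('d::finite \<Rightarrow> nat) \<Rightarrow> (int, 'd) vec \<Rightarrow> real"
  where "phase L l k = (\<Sum>i\<in>UNIV. 2 * pi * real (l i) * of_int (k $ i) / real L)"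

lemma phase_add: "phase L l (k + k') = phase L l k + phase L l k'"
  by (simp add: phase_def sum.distrib[symmetric] add_divide_distrib[symmetric] algebra_simps)

lemma phase_diff: "phase L l (k - k') = phase L l k - phase L l k'"
  by (simp add: phase_def sum_subtractf[symmetric] diff_divide_distrib[symmetric] algebra_simps)

text \<open>A geometric sum of L-th roots of unity, with ratio different from 1 because L does not
  divide n.\<close>

lemma sum_roots_of_unity:
  fixes n :: int
  assumes "0 < L" "\<bar>n\<bar> < int L" "n \<noteq> 0"
  shows "(\<Sum>j<L. cis (2 * pi * real j * of_int n / real L)) = 0"
proof -
  define w where "w = cis (2 * pi * of_int n / real L)"
  have w: "w \<noteq> 1"
  proof
    assume "w = 1"
    then have "cos (2 * pi * of_int n / real L) = 1"
      unfolding w_def by (simp add: complex_eq_iff)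
    then obtain q :: int where q: "2 * pi * of_int n / real L = of_int q * 2 * pi"
      unfolding cos_one_2pi_int by auto
    then have "of_int n = of_int q * real L"
      using assms(1) by (simp add: field_simps)
    then have "real_of_int n = real_of_int (q * int L)"
      by simp
    then have "n = q * int L"
      by (simp only: of_int_eq_iff)
    then have n: "\<bar>n\<bar> = \<bar>q\<bar> * int L"
      by (simp add: abs_mult)
    have "1 \<le> \<bar>q\<bar>"
      using \<open>n = q * int L\<close> assms(3) by auto
    then have "1 * int L \<le> \<bar>q\<bar> * int L"
      by (intro mult_right_mono) auto
    with n assms(2) show False
      by simp
  qed
  have "cis (2 * pi * real j * of_int n / real L) = w ^ j" for j
    unfolding w_def by (simp add: Complex.DeMoivre algebra_simps)
  then have "(\<Sum>j<L. cis (2 * pi * real j * of_int n / real L)) = (\<Sum>j<L. w ^ j)"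
    by simp
  also have "\<dots> = (w ^ L - 1) / (w - 1)"
    using w by (simp add: geometric_sum)
  also have "w ^ L = cis (2 * pi * of_int n)"
    unfolding w_def using assms(1) by (simp add: Complex.DeMoivre)
  also have "\<dots> = 1"
    by simp
  finally show ?thesis by simp
qed

abbreviation freqs :: "nat \<Rightarrow> ('d::finite \<Rightarrow> nat) set"
  where "freqs L \<equiv> PiE UNIV (\<lambda>_. {..<L})"

text \<open>The sum of the characters is a product of geometric sums, one per coordinate, and a
  coordinate in which k is nonzero kills it. The cosine sum is its real part.\<close>

lemma sum_cos_phase:
  fixes k :: "(int, 'd::finite) vec"
  assumes "0 < L" "\<And>i. \<bar>k $ i\<bar> < int L"
  shows "(\<Sum>l\<in>freqs L. cos (phase L l k)) = (if k = 0 then real L ^ CARD('d) else 0)"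
proof (cases "k = 0")
  case True
  then show ?thesis by (simp add: phase_def card_PiE)
next
  case False
  then obtain i0 where i0: "k $ i0 \<noteq> 0"
    by (auto simp: vec_eq_iff)
  have cis_sum: "cis (phase L l k) = (\<Prod>i\<in>UNIV. cis (2 * pi * real (l i) * of_int (k $ i) / real L))" for l
    unfolding phase_def by (simp add: cis_conv_exp exp_sum sum_distrib_left of_real_sum)
  have "(\<Sum>l\<in>freqs L. cis (phase L l k))
      = (\<Prod>i\<in>UNIV. \<Sum>j<L. cis (2 * pi * real j * of_int (k $ i) / real L))"
    by (simp add: cis_sum prod_sum_PiE)
  also have "\<dots> = 0"
    using sum_roots_of_unity[OF assms(1) assms(2) i0] by (intro prod_zero) auto
  finally have "Re (\<Sum>l\<in>freqs L. cis (phase L l k)) = 0"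
    by simp
  then show ?thesis using False by simp
qed

definition mpow :: "('d \<Rightarrow> real) \<Rightarrow> 'd multiset \<Rightarrow> real"
  where "mpow \<xi> M = prod_mset (image_mset \<xi> M)"

text \<open>A pair is a vector of the complexification, real part first; \<open>rot n\<close>
  multiplies it by the n-th power of -i.\<close>

fun rot :: "nat \<Rightarrow> 'h::real_vector \<times> 'h \<Rightarrow> 'h \<times> 'h"
  where
    "rot 0 p = p"
  | "rot (Suc n) p = (snd (rot n p), - fst (rot n p))"

text \<open>The quadratic form of \<open>G\<close>, extended to the complexification by its real
  part, does not see a unimodular factor.\<close>

lemma inner_rot:
  fixes p :: "'h::real_inner \<times> 'h"
  assumes "linear G"
  shows "inner (G (fst (rot n p))) (fst (rot n p)) + inner (G (snd (rot n p))) (snd (rot n p))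
    = inner (G (fst p)) (fst p) + inner (G (snd p)) (snd p)"
  using assms by (induction n) (auto simp: linear_neg)

text \<open>L is the number of lattice points on a side of the box of radius R. Coordinates of
  differences of two points are at most 2R < L in modulus, so the box may be treated as a discrete
  torus without identifying points.\<close>

context
  fixes R :: int and L :: nat
  assumes R: "0 \<le> R" "int L = 2 * R + 1"
begin

definition ctrans :: "('d::finite \<Rightarrow> nat) \<Rightarrow> ((int, 'd) vec \<Rightarrow> 'h::real_vector) \<Rightarrow> 'h"
  where "ctrans l a = (\<Sum>k\<in>ibox R. cos (phase L l k) *\<^sub>R a k)"

definition strans :: "('d::finite \<Rightarrow> nat) \<Rightarrow> ((int, 'd) vec \<Rightarrow> 'h::real_vector) \<Rightarrow> 'h"
  where "strans l a = (\<Sum>k\<in>ibox R. sin (phase L l k) *\<^sub>R a k)"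

text \<open>Cosine and sine transforms stay separate because the vectors are real. The two products
  add up to the cosine of the phase difference, and summation over all frequencies leaves only the
  diagonal.\<close>

lemma parseval:
  fixes a b :: "(int, 'd::finite) vec \<Rightarrow> 'h::real_inner"
  assumes "linear G"
  shows "(\<Sum>l\<in>freqs L. inner (G (ctrans l a)) (ctrans l b) + inner (G (strans l a)) (strans l b))
    = real L ^ CARD('d) * (\<Sum>k\<in>ibox R. inner (G (a k)) (b k))"
proof -
  interpret G: linear G by fact
  have L: "0 < L" using R by linarith
  have bil: "inner (G (\<Sum>k\<in>ibox R. c k *\<^sub>R a k)) (\<Sum>k\<in>ibox R. c k *\<^sub>R b k)
      = (\<Sum>k\<in>ibox R. \<Sum>k'\<in>ibox R. c k * c k' * inner (G (a k)) (b k'))" for c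
    unfolding G.sum inner_sum_left
    by (intro sum.cong refl) (simp add: G.scale inner_sum_right mult_ac)
  have "(\<Sum>l\<in>freqs L. inner (G (ctrans l a)) (ctrans l b) + inner (G (strans l a)) (strans l b))
    = (\<Sum>l\<in>freqs L. \<Sum>k\<in>ibox R. \<Sum>k'\<in>ibox R. cos (phase L l (k - k')) * inner (G (a k)) (b k'))"
    unfolding ctrans_def strans_def bil
    by (simp only: sum.distrib[symmetric] phase_diff cos_diff distrib_right)
  also have "\<dots> = (\<Sum>k\<in>ibox R. \<Sum>k'\<in>ibox R. (\<Sum>l\<in>freqs L. cos (phase L l (k - k'))) * inner (G (a k)) (b k'))"
    unfolding sum_distrib_right
    by (subst sum.swap, intro sum.cong refl, subst sum.swap, rule refl)
  also have "\<dots> = (\<Sum>k\<in>ibox R. \<Sum>k'\<in>ibox R. (if k = k' then real L ^ CARD('d) * inner (G (a k)) (b k') else 0))"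
  proof (intro sum.cong refl)
    fix k k' :: "(int, 'd) vec" assume k: "k \<in> ibox R" "k' \<in> ibox R"
    have "\<bar>(k - k') $ i\<bar> < int L" for i
    proof -
      have "\<bar>k $ i\<bar> \<le> R" "\<bar>k' $ i\<bar> \<le> R" using k by (auto simp: ibox_def)
      then show ?thesis using R by auto
    qed
    from sum_cos_phase[OF L this]
    show "(\<Sum>l\<in>freqs L. cos (phase L l (k - k'))) * inner (G (a k)) (b k')
       = (if k = k' then real L ^ CARD('d) * inner (G (a k)) (b k') else 0)"
      by simp
  qed
  also have "\<dots> = real L ^ CARD('d) * (\<Sum>k\<in>ibox R. inner (G (a k)) (b k))"
    by (simp add: sum_distrib_left)
  finally show ?thesis .
qed

definition symb :: "('d::finite \<Rightarrow> nat) \<Rightarrow> 'd \<Rightarrow> real"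
  where "symb l i = 2 * sin (phase L l (axis i 1))"

lemma sum_ibox_shift:
  fixes a :: "(int, 'd::finite) vec \<Rightarrow> 'h::real_vector"
  assumes "sup_in r a" "r + 1 \<le> R" "\<bar>c\<bar> \<le> 1"
  shows "(\<Sum>k\<in>ibox R. f k *\<^sub>R a (k + axis i c)) = (\<Sum>k\<in>ibox R. f (k - axis i c) *\<^sub>R a k)"
\<comment> \<open>Only indices where \<open>a\<close> can be nonzero have to correspond under the
  shift; the margin between r and R keeps them in the box.\<close>
proof (rule sum.reindex_bij_witness_not_neutral[where i = "\<lambda>k. k - axis i c" and j = "\<lambda>k. k + axis i c"
    and S' = "{k\<in>ibox R. k + axis i c \<notin> ibox r}" and T' = "{k\<in>ibox R. k \<notin> ibox r}"])
  have *: "ibox (r + 1) \<subseteq> (ibox R :: (int, 'd) vec set)" "ibox r \<subseteq> (ibox R :: (int, 'd) vec set)"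
    using assms by (auto intro!: ibox_mono)
  fix k
  show "k - axis i c \<in> ibox R - {k \<in> ibox R. k + axis i c \<notin> ibox r}" if "k \<in> ibox R - {k \<in> ibox R. k \<notin> ibox r}"
    using that ibox_add_axis(2)[of k r c i] assms * by auto
  show "k + axis i c \<in> ibox R - {k \<in> ibox R. k \<notin> ibox r}" if "k \<in> ibox R - {k \<in> ibox R. k + axis i c \<notin> ibox r}"
    using that * by auto
qed (use assms in \<open>auto simp: sup_in_def\<close>)

text \<open>Summation by parts. In complex terms, \<open>sdiff i\<close> becomes multiplication by
  -i times the real number \<open>symb l i\<close>, which exchanges the cosine and the sine
  transform.\<close>

lemma ctrans_sdiff:
  fixes a :: "(int, 'd::finite) vec \<Rightarrow> 'h::real_vector"
  assumes "sup_in r a" "r + 1 \<le> R"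
  shows "ctrans l (sdiff i a) = symb l i *\<^sub>R strans l a"
    and "strans l (sdiff i a) = - symb l i *\<^sub>R ctrans l a"
proof -
  have m: "k - axis i 1 = k + axis i (- 1)" "k - axis i (-1) = k + axis i 1" for k :: "(int, 'd) vec"
    by (auto simp: vec_eq_iff axis_def)
  note s = sum_ibox_shift[OF assms, of 1] sum_ibox_shift[OF assms, of "-1"]
  have p: "phase L l (axis i (-1)) = - phase L l (axis i 1)"
    using phase_diff[of L l 0 "axis i 1"] m(1)[of 0] phase_add[of L l 0 0] by simp
  show "ctrans l (sdiff i a) = symb l i *\<^sub>R strans l a"
    unfolding ctrans_def strans_def sdiff_def m(1) scaleR_diff_right sum_subtractf s[simplified]
    unfolding sum_subtractf[symmetric] scaleR_diff_left[symmetric] scaleR_sum_right symb_def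
    by (intro sum.cong refl) (simp add: phase_add phase_diff p cos_add cos_diff algebra_simps)
  show "strans l (sdiff i a) = - symb l i *\<^sub>R ctrans l a"
    unfolding ctrans_def strans_def sdiff_def m(1) scaleR_diff_right sum_subtractf s[simplified]
    unfolding sum_subtractf[symmetric] scaleR_diff_left[symmetric] scaleR_sum_right symb_def
    by (intro sum.cong refl) (simp add: phase_add phase_diff p sin_add sin_diff algebra_simps)
qed

lemma trans_sdiffs:
  fixes a :: "(int, 'd::finite) vec \<Rightarrow> 'h::real_vector"
  assumes "sup_in r a" "r + int (size M) \<le> R"
  shows "ctrans l (sdiffs M a) = mpow (symb l) M *\<^sub>R fst (rot (size M) (ctrans l a, strans l a))
    \<and> strans l (sdiffs M a) = mpow (symb l) M *\<^sub>R snd (rot (size M) (ctrans l a, strans l a))"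
  using assms(2)
proof (induction M)
  case (add i M)
  have s: "sup_in (r + int (size M)) (sdiffs M a)"
    using assms(1) by (rule sup_in_sdiffs)
  have r: "r + int (size M) + 1 \<le> R"
    using add.prems by simp
  show ?case
    using add.IH r by (simp add: ctrans_sdiff[OF s r] mpow_def)
qed (simp add: mpow_def)

text \<open>By Parseval the form splits into frequencies. At each of them a difference of order m
  multiplies by a monomial in \<open>symb l\<close> and by the m-th power of -i; the latter is
  common to all multisets of size m and cancels. What remains is \<open>LH\<close> at \<xi> =
  \<open>symb l\<close>, once for the cosine and once for the sine transform.\<close>

lemma form_nonneg_seq:
  fixes a :: "(int, 'd::finite) vec \<Rightarrow> 'h::real_inner"
  assumes lin: "\<And>M N. linear (A M N)"
    and LH: "\<And>\<xi> f. \<delta> * (mpow \<xi> K)\<^sup>2 * (norm f)\<^sup>2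
      \<le> (\<Sum>M\<in>I. \<Sum>N\<in>I. mpow \<xi> M * mpow \<xi> N * inner (A M N f) f)"
    and I: "finite I" "\<And>M. M \<in> I \<Longrightarrow> size M = m" "K \<in> I"
    and a: "sup_in r a" "r + int m \<le> R"
  shows "\<delta> * (\<Sum>k\<in>ibox R. (norm (sdiffs K a k))\<^sup>2)
    \<le> (\<Sum>k\<in>ibox R. \<Sum>M\<in>I. \<Sum>N\<in>I. inner (A M N (sdiffs M a k)) (sdiffs N a k))"
proof -
  define tr :: "('h \<Rightarrow> 'h) \<Rightarrow> ((int, 'd) vec \<Rightarrow> 'h) \<Rightarrow> ((int, 'd) vec \<Rightarrow> 'h) \<Rightarrow> ('d \<Rightarrow> nat) \<Rightarrow> real"
    where "tr = (\<lambda>G a b l. inner (G (ctrans l a)) (ctrans l b) + inner (G (strans l a)) (strans l b))"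
  have tr: "tr G (sdiffs M a) (sdiffs N a) l
      = mpow (symb l) M * mpow (symb l) N * (inner (G (ctrans l a)) (ctrans l a) + inner (G (strans l a)) (strans l a))"
    if "linear G" "M \<in> I" "N \<in> I" for G M N l
  proof -
    have sz: "size M = m" "size N = m" using I that by auto
    show ?thesis
      using trans_sdiffs[OF a(1), of M l] trans_sdiffs[OF a(1), of N l] a(2) sz
        inner_rot[OF that(1), of m "(ctrans l a, strans l a)"]
      by (simp add: tr_def linear_scale[OF that(1)] flip: distrib_left mult.assoc)
  qed
  have L: "0 < real L ^ CARD('d)" using R by (intro zero_less_power) linarith
  have "(\<Sum>k\<in>ibox R. \<Sum>M\<in>I. \<Sum>N\<in>I. inner (A M N (sdiffs M a k)) (sdiffs N a k)) * real L ^ CARD('d)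
    = (\<Sum>M\<in>I. \<Sum>N\<in>I. real L ^ CARD('d) * (\<Sum>k\<in>ibox R. inner (A M N (sdiffs M a k)) (sdiffs N a k)))"
  proof -
    have "(\<Sum>k\<in>ibox R. \<Sum>M\<in>I. \<Sum>N\<in>I. inner (A M N (sdiffs M a k)) (sdiffs N a k))
      = (\<Sum>M\<in>I. \<Sum>N\<in>I. \<Sum>k\<in>ibox R. inner (A M N (sdiffs M a k)) (sdiffs N a k))"
      by (subst sum.swap, intro sum.cong refl, rule sum.swap)
    then show ?thesis
      by (simp only: sum_distrib_left mult.commute)
  qed
  also have "\<dots> = (\<Sum>M\<in>I. \<Sum>N\<in>I. \<Sum>l\<in>freqs L. tr (A M N) (sdiffs M a) (sdiffs N a) l)"
    unfolding tr_def by (simp add: parseval[OF lin])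
  also have "\<dots> = (\<Sum>l\<in>freqs L. \<Sum>M\<in>I. \<Sum>N\<in>I. tr (A M N) (sdiffs M a) (sdiffs N a) l)"
  proof -
    have "(\<Sum>l\<in>freqs L. \<Sum>M\<in>I. \<Sum>N\<in>I. tr (A M N) (sdiffs M a) (sdiffs N a) l)
      = (\<Sum>M\<in>I. \<Sum>N\<in>I. \<Sum>l\<in>freqs L. tr (A M N) (sdiffs M a) (sdiffs N a) l)"
      by (subst sum.swap, intro sum.cong refl, rule sum.swap)
    then show ?thesis ..
  qed
  also have "\<dots> = (\<Sum>l\<in>freqs L. (\<Sum>M\<in>I. \<Sum>N\<in>I. mpow (symb l) M * mpow (symb l) N * inner (A M N (ctrans l a)) (ctrans l a))
     + (\<Sum>M\<in>I. \<Sum>N\<in>I. mpow (symb l) M * mpow (symb l) N * inner (A M N (strans l a)) (strans l a)))"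
    by (intro sum.cong refl) (simp add: tr lin sum.distrib distrib_left)
  also have "\<dots> \<ge> (\<Sum>l\<in>freqs L. \<delta> * (mpow (symb l) K)\<^sup>2 * (norm (ctrans l a))\<^sup>2 + \<delta> * (mpow (symb l) K)\<^sup>2 * (norm (strans l a))\<^sup>2)"
    by (intro sum_mono add_mono LH)
  also have "(\<Sum>l\<in>freqs L. \<delta> * (mpow (symb l) K)\<^sup>2 * (norm (ctrans l a))\<^sup>2 + \<delta> * (mpow (symb l) K)\<^sup>2 * (norm (strans l a))\<^sup>2)
      = \<delta> * (\<Sum>l\<in>freqs L. tr id (sdiffs K a) (sdiffs K a) l)"
    unfolding sum_distrib_left tr[OF linear_id I(3) I(3)] id_apply power2_norm_eq_inner
    by (intro sum.cong refl) (simp add: power2_eq_square algebra_simps)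
  also have "\<dots> = \<delta> * (\<Sum>k\<in>ibox R. (norm (sdiffs K a k))\<^sup>2) * real L ^ CARD('d)"
    unfolding tr_def parseval[OF linear_id] by (simp add: power2_norm_eq_inner)
  finally show ?thesis
    using L by (simp add: mult_le_cancel_right)
qed

end

section \<open>Coercivity along an isometric action of R^d\<close>

section \<open>Difference quotients along a group of isometries\<close>

text \<open>The spatial translations of L2 seen abstractly, as an isometric representation of R^d;
  differentiability is a property of individual vectors.\<close>

locale shift_action =
  fixes sh :: "(real, 'd::finite) vec \<Rightarrow> 'h::real_inner \<Rightarrow> 'h"
  assumes sh_linear: "linear (sh v)"
    and sh_plus: "sh (v + w) f = sh v (sh w f)"
    and sh_0 [simp]: "sh 0 f = f"
    and sh_inner [simp]: "inner (sh v f) (sh v g) = inner f g"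
begin

lemmas sh_simps [simp] = linear_add[OF sh_linear] linear_diff[OF sh_linear] linear_scale[OF sh_linear]
  linear_neg[OF sh_linear] linear_0[OF sh_linear] linear_sum[OF sh_linear]

lemma sh_commute: "sh v (sh w f) = sh w (sh v f)"
  by (metis add.commute sh_plus)

lemma sh_minus [simp]: "sh (- v) (sh v f) = f" "sh v (sh (- v) f) = f"
  by (simp_all flip: sh_plus)

lemma sh_adjoint: "inner (sh v f) g = inner f (sh (- v) g)"
  using sh_inner[of v f "sh (- v) g"] by (simp del: sh_inner)

lemma norm_sh [simp]: "norm (sh v f) = norm f"
  by (simp add: norm_eq_sqrt_inner)

definition cdiff :: "real \<Rightarrow> 'd \<Rightarrow> 'h \<Rightarrow> 'h"
  where "cdiff h i f = (1 / (2 * h)) *\<^sub>R (sh (axis i h) f - sh (axis i (- h)) f)"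

lemma axis_minus: "axis i (- h) = - axis i (h::real)"
  by (simp add: vec_eq_iff axis_def)

lemma axis_0 [simp]: "axis i (0::real) = 0"
  by (simp add: vec_eq_iff axis_def)

lemma axis_plus: "axis i (a + b) = axis i a + axis i (b::real)"
  by (simp add: vec_eq_iff axis_def)

lemma cdiff_sh: "cdiff h i (sh v f) = sh v (cdiff h i f)"
  by (simp add: cdiff_def sh_commute[of v])

lemma cdiff_linear: "linear (cdiff h i)"
  by (rule linearI) (simp_all add: cdiff_def algebra_simps)

lemma cdiff_commute: "cdiff h i (cdiff h' j f) = cdiff h' j (cdiff h i f)"
  unfolding cdiff_def[of h' j]
  by (simp only: linear_scale[OF cdiff_linear] linear_diff[OF cdiff_linear] cdiff_sh)

lemma cdiff_adjoint: "inner (cdiff h i f) g = - inner f (cdiff h i g)"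
  by (simp add: cdiff_def inner_diff_left inner_diff_right sh_adjoint axis_minus algebra_simps)

lemma comp_fun_commute_cdiff: "comp_fun_commute (cdiff h)"
  by standard (rule ext, simp add: cdiff_commute)

definition cdiffs :: "real \<Rightarrow> 'd multiset \<Rightarrow> 'h \<Rightarrow> 'h"
  where "cdiffs h M f = fold_mset (cdiff h) f M"

lemma cdiffs_empty [simp]: "cdiffs h {#} f = f"
  by (simp add: cdiffs_def)

lemma cdiffs_add [simp]: "cdiffs h (add_mset i M) f = cdiff h i (cdiffs h M f)"
  by (simp add: cdiffs_def comp_fun_commute.fold_mset_add_mset[OF comp_fun_commute_cdiff])

lemma cdiffs_linear: "linear (cdiffs h M)"
  by (induction M)
    (auto intro!: linearI simp: linear_add[OF cdiff_linear] linear_scale[OF cdiff_linear] linear_add linear_scale)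

lemma cdiffs_cdiff: "cdiffs h M (cdiff h' i f) = cdiff h' i (cdiffs h M f)"
  by (induction M) (auto simp: cdiff_commute)

lemma cdiffs_adjoint: "inner (cdiffs h M f) g = (- 1) ^ size M * inner f (cdiffs h M g)"
  by (induction M arbitrary: f g) (auto simp: cdiff_adjoint cdiffs_cdiff)

text \<open>The orbit of f sampled on a lattice of mesh h and cut off outside a box. The cut-off
  makes it finitely supported, as \<open>form_nonneg_seq\<close> demands.\<close>

definition lseq :: "real \<Rightarrow> int \<Rightarrow> 'h \<Rightarrow> (int, 'd) vec \<Rightarrow> 'h"
  where "lseq h r f k = (if k \<in> ibox r then sh (\<chi> i. h * of_int (k $ i)) f else 0)"

lemma sup_in_lseq: "sup_in r (lseq h r f)"
  by (simp add: sup_in_def lseq_def)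

text \<open>At points \<open>size M\<close> steps inside the box the cut-off is not felt, and the
  difference of the orbit is the orbit of the difference; the power of 2h undoes the division in
  \<open>cdiff\<close>.\<close>

lemma sdiffs_lseq:
  assumes "h \<noteq> 0" "k \<in> ibox (r - int (size M))"
  shows "sdiffs M (lseq h r f) k = (2 * h) ^ size M *\<^sub>R sh (\<chi> i. h * of_int (k $ i)) (cdiffs h M f)"
  using assms(2)
proof (induction M arbitrary: k)
  case (add j M)
  let ?c = "\<lambda>k::(int, 'd) vec. (\<chi> i. h * of_int (k $ i))"
  have k: "k \<in> ibox (r - int (size M) - 1)"
    using add.prems by (simp add: algebra_simps)
  have c: "?c (k + axis j 1) = ?c k + axis j h" "?c (k - axis j 1) = ?c k + axis j (- h)"
    by (auto simp: vec_eq_iff axis_def algebra_simps)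
  have kk: "k + axis j 1 \<in> ibox (r - int (size M))" "k - axis j 1 \<in> ibox (r - int (size M))"
    using ibox_add_axis[OF k, of 1 j] by simp_all
  show ?case
    unfolding sdiffs_add sdiff_def add.IH[OF kk(1)] add.IH[OF kk(2)] c sh_plus
    by (simp add: cdiff_def assms(1) algebra_simps del: sh_simps(2))
      (simp add: algebra_simps)
qed (simp add: lseq_def)

lemma norm_sdiffs_lseq: "norm (sdiffs M (lseq h r f) k) \<le> 2 ^ size M * norm f"
proof (induction M arbitrary: k)
  case (add j M)
  show ?case
    using norm_triangle_ineq4[of "sdiffs M (lseq h r f) (k + axis j 1)" "sdiffs M (lseq h r f) (k - axis j 1)"]
      add.IH[of "k + axis j 1"] add.IH[of "k - axis j 1"]
    by (simp add: sdiff_def algebra_simps)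
qed (simp add: lseq_def)

text \<open>Transference from the lattice. For the sampled orbit of f, all interior points of the
  box contribute the same amount, since \<open>A\<close> commutes with the isometries, while each
  point of the boundary layer contributes a bounded amount. The layer has a vanishing share of the
  volume as the box grows, so the interior amount is nonnegative.\<close>

lemma form_nonneg_cdiffs:
  fixes A :: "'d multiset \<Rightarrow> 'd multiset \<Rightarrow> 'h \<Rightarrow> 'h"
  assumes lin: "\<And>M N. linear (A M N)"
    and A_sh: "\<And>M N v f. A M N (sh v f) = sh v (A M N f)"
    and A_bound: "\<And>M N f. M \<in> I \<Longrightarrow> N \<in> I \<Longrightarrow> norm (A M N f) \<le> c * norm f"
    and LH: "\<And>\<xi> f. \<delta> * (mpow \<xi> K)\<^sup>2 * (norm f)\<^sup>2
      \<le> (\<Sum>M\<in>I. \<Sum>N\<in>I. mpow \<xi> M * mpow \<xi> N * inner (A M N f) f)"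
    and I: "finite I" "\<And>M. M \<in> I \<Longrightarrow> size M = m" "K \<in> I"
    and h: "h \<noteq> 0" and "0 \<le> \<delta>"
  shows "\<delta> * (norm (cdiffs h K f))\<^sup>2 \<le> (\<Sum>M\<in>I. \<Sum>N\<in>I. inner (A M N (cdiffs h M f)) (cdiffs h N f))"
proof -
  define F where "F = (\<lambda>a k. (\<Sum>M\<in>I. \<Sum>N\<in>I. inner (A M N (sdiffs M a k)) (sdiffs N a k))
    - \<delta> * (norm (sdiffs K a k :: 'h))\<^sup>2)"
  define Phi where "Phi = (\<Sum>M\<in>I. \<Sum>N\<in>I. inner (A M N (cdiffs h M f)) (cdiffs h N f)) - \<delta> * (norm (cdiffs h K f))\<^sup>2"
  define C where "C = (\<Sum>M\<in>I. \<Sum>N\<in>I. \<bar>c\<bar> * (2 ^ m * norm f) * (2 ^ m * norm f))"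
  define d where "d = CARD('d)"
  have C: "0 \<le> C" unfolding C_def by (intro sum_nonneg mult_nonneg_nonneg) auto
  have F_in: "F (lseq h r f) k = (4 * h\<^sup>2) ^ m * Phi" if "k \<in> ibox (r - int m)" for r k
  proof -
    have s: "sdiffs M (lseq h r f) k = (2 * h) ^ m *\<^sub>R sh (\<chi> i. h * of_int (k $ i)) (cdiffs h M f)" if "M \<in> I" for M
      using sdiffs_lseq[OF h, of k r M f] I(2)[OF that] \<open>k \<in> _\<close> by simp
    have p: "(2 * h) ^ m * (2 * h) ^ m = (4 * h\<^sup>2) ^ m"
      unfolding power_mult_distrib[symmetric] by (simp add: power2_eq_square)
    have e: "inner (A M N (b *\<^sub>R sh v x)) (b *\<^sub>R sh v y) = (b * b) * inner (A M N x) y" for b M N v x y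
      by (simp add: linear_scale[OF lin] A_sh)
    have "(\<Sum>M\<in>I. \<Sum>N\<in>I. inner (A M N (sdiffs M (lseq h r f) k)) (sdiffs N (lseq h r f) k))
       = (\<Sum>M\<in>I. \<Sum>N\<in>I. (4 * h\<^sup>2) ^ m * inner (A M N (cdiffs h M f)) (cdiffs h N f))"
      by (intro sum.cong refl) (simp only: s e p)
    moreover have "(norm (sdiffs K (lseq h r f) k))\<^sup>2 = (4 * h\<^sup>2) ^ m * (norm (cdiffs h K f))\<^sup>2"
      unfolding s[OF I(3)] p[symmetric] by (simp add: power_mult_distrib power2_eq_square mult_ac)
    ultimately show ?thesis
      by (simp add: F_def Phi_def sum_distrib_left algebra_simps)
  qed
  have F_le: "F (lseq h r f) k \<le> C" for r k
  proof -
    have "inner (A M N (sdiffs M (lseq h r f) k)) (sdiffs N (lseq h r f) k) \<le> \<bar>c\<bar> * (2 ^ m * norm f) * (2 ^ m * norm f)"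
      if "M \<in> I" "N \<in> I" for M N
    proof -
      have "norm (A M N (sdiffs M (lseq h r f) k)) \<le> \<bar>c\<bar> * (2 ^ m * norm f)"
        using norm_sdiffs_lseq[of M h r f k] A_bound[OF that, of "sdiffs M (lseq h r f) k"] I(2)[OF that(1)]
        by (meson abs_ge_self abs_ge_zero dual_order.trans mult_mono norm_ge_zero)
      moreover have "norm (sdiffs N (lseq h r f) k) \<le> 2 ^ m * norm f"
        using norm_sdiffs_lseq[of N h r f k] I(2)[OF that(2)] by simp
      ultimately show ?thesis
        by (intro order_trans[OF norm_cauchy_schwarz] mult_mono) auto
    qed
    then have "(\<Sum>M\<in>I. \<Sum>N\<in>I. inner (A M N (sdiffs M (lseq h r f) k)) (sdiffs N (lseq h r f) k)) \<le> C"
      unfolding C_def by (intro sum_mono)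
    moreover have "0 \<le> \<delta> * (norm (sdiffs K (lseq h r f) k))\<^sup>2"
      using assms by simp
    ultimately show ?thesis by (simp add: F_def)
  qed
  define q where "q = (4 * h\<^sup>2) ^ m"
  have q: "0 < q" using h by (simp add: q_def)
  have key: "0 \<le> (2 * real n + 1) ^ d * (q * Phi) + ((2 * real n + 1 + 4 * real m) ^ d - (2 * real n + 1) ^ d) * C" for n
  proof -
    \<comment> \<open>Sampling up to radius n + m makes the box of radius n interior; differences of
      order m then live in radius n + 2m.\<close>
    define r where "r = int n + int m"
    define R where "R = r + int m"
    define L where "L = nat (2 * R + 1)"
    have RL: "0 \<le> R" "int L = 2 * R + 1" by (auto simp: R_def r_def L_def)
    have "\<delta> * (\<Sum>k\<in>ibox R. (norm (sdiffs K (lseq h r f) k))\<^sup>2)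
      \<le> (\<Sum>k\<in>ibox R. \<Sum>M\<in>I. \<Sum>N\<in>I. inner (A M N (sdiffs M (lseq h r f) k)) (sdiffs N (lseq h r f) k))"
      by (rule form_nonneg_seq[OF RL lin LH I sup_in_lseq[of r]]) (auto simp: R_def)
    then have "0 \<le> (\<Sum>k\<in>ibox R. F (lseq h r f) k)"
      by (simp add: F_def sum_subtractf sum_distrib_left)
    also have "\<dots> = (\<Sum>k\<in>ibox (int n). F (lseq h r f) k) + (\<Sum>k\<in>ibox R - ibox (int n). F (lseq h r f) k)"
      by (subst add.commute, intro sum.subset_diff ibox_mono) (auto simp: R_def r_def)
    also have "\<dots> \<le> (\<Sum>k\<in>(ibox (int n) :: (int, 'd) vec set). q * Phi) + (\<Sum>k\<in>(ibox R - ibox (int n) :: (int, 'd) vec set). C)"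
      unfolding q_def
      by (intro add_mono sum_mono F_le) (simp_all add: F_in r_def)
    also have "\<dots> = real (card (ibox (int n) :: (int, 'd) vec set)) * (q * Phi)
        + (real (card (ibox R :: (int, 'd) vec set)) - real (card (ibox (int n) :: (int, 'd) vec set))) * C"
      by (simp add: card_Diff_subset ibox_mono R_def r_def of_nat_diff card_mono)
    also have "real (card (ibox (int n) :: (int, 'd) vec set)) = (2 * real n + 1) ^ d"
      by (simp add: card_ibox d_def nat_add_distrib nat_mult_distrib add.commute)
    also have "real (card (ibox R :: (int, 'd) vec set)) = (2 * real n + 1 + 4 * real m) ^ d"
      by (simp add: card_ibox d_def nat_add_distrib nat_mult_distrib R_def r_def algebra_simps)
    finally show ?thesis .
  qed
  have le: "0 \<le> q * Phi + ((1 + 4 * real m * (1 / (2 * real n + 1))) ^ d - 1) * C" for n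
  proof -
    have p: "0 < (2 * real n + 1) ^ d" by (intro zero_less_power) linarith
    have "(2 * real n + 1) * (1 + 4 * real m * (1 / (2 * real n + 1))) = 2 * real n + 1 + 4 * real m"
      by (simp add: field_simps)
    then have "(2 * real n + 1 + 4 * real m) ^ d = (2 * real n + 1) ^ d * (1 + 4 * real m * (1 / (2 * real n + 1))) ^ d"
      by (simp only: power_mult_distrib[symmetric])
    then have "0 \<le> (2 * real n + 1) ^ d * (q * Phi + ((1 + 4 * real m * (1 / (2 * real n + 1))) ^ d - 1) * C)"
      using key[of n] by (simp add: algebra_simps)
    then show ?thesis using p by (simp add: zero_le_mult_iff)
  qed
  \<comment> \<open>After division by the volume of the inner box, the share of the boundary layer
    is governed by this quantity.\<close>
  have "(\<lambda>n. 1 / (2 * real n + 1)) \<longlonglongrightarrow> 0"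
    by real_asymp
  then have "(\<lambda>n. q * Phi + ((1 + 4 * real m * (1 / (2 * real n + 1))) ^ d - 1) * C) \<longlonglongrightarrow> q * Phi + ((1 + 4 * real m * 0) ^ d - 1) * C"
    by (intro tendsto_intros)
  then have "0 \<le> q * Phi + ((1 + 4 * real m * 0) ^ d - 1) * C"
    by (rule LIMSEQ_le_const) (use le in auto)
  then have "0 \<le> Phi" using q by (simp add: zero_le_mult_iff)
  then show ?thesis by (simp add: Phi_def)
qed

text \<open>Differentiability in norm on the whole space and from both sides. For zero extensions
  and the normal direction, this is the form in which vanishing traces enter.\<close>

definition D2 :: "'d \<Rightarrow> 'h \<Rightarrow> 'h \<Rightarrow> bool"
  where "D2 i f g \<longleftrightarrow> ((\<lambda>h. (1 / h) *\<^sub>R (sh (axis i h) f - f)) \<longlongrightarrow> g) (at 0)"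

lemma D2_bounded_linear:
  assumes "D2 i f g" "bounded_linear B" "\<And>h f. B (sh (axis i h) f) = sh (axis i h) (B f)"
  shows "D2 i (B f) (B g)"
proof -
  interpret B: bounded_linear B by fact
  show ?thesis
    using B.tendsto[OF assms(1)[unfolded D2_def]] by (simp add: D2_def B.scaleR B.diff assms(3))
qed

lemma D2_diff: "D2 i f g \<Longrightarrow> D2 i f' g' \<Longrightarrow> D2 i (f - f') (g - g')"
  unfolding D2_def by (drule (1) tendsto_diff) (simp add: algebra_simps)

lemma bounded_linear_sh: "bounded_linear (sh v)"
  by (rule bounded_linear_intro[where K = 1]) auto

lemma bounded_linear_cdiff: "bounded_linear (cdiff h i)"
  unfolding cdiff_def[abs_def]
  by (intro bounded_linear_const_scaleR bounded_linear_sub bounded_linear_sh)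

lemma bounded_linear_cdiffs: "bounded_linear (cdiffs h M)"
proof (induction M)
  case empty
  have "cdiffs h {#} = (\<lambda>f. f)"
    by (rule ext) simp
  then show ?case by (simp add: bounded_linear_ident)
next
  case (add i M)
  have "cdiffs h (add_mset i M) = (\<lambda>f. cdiff h i (cdiffs h M f))"
    by (rule ext) simp
  then show ?case using bounded_linear_compose[OF bounded_linear_cdiff add] by simp
qed

lemma cdiffs_sh: "cdiffs h M (sh v f) = sh v (cdiffs h M f)"
  by (induction M) (auto simp: cdiff_sh)

lemma D2_sh: "D2 i f g \<Longrightarrow> D2 i (sh v f) (sh v g)"
  by (erule D2_bounded_linear[OF _ bounded_linear_sh]) (simp add: sh_commute)

lemma D2_cdiff: "D2 i f g \<Longrightarrow> D2 i (cdiff h j f) (cdiff h j g)"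
  by (erule D2_bounded_linear[OF _ bounded_linear_cdiff]) (simp add: cdiff_sh)

lemma D2_cdiffs: "D2 i f g \<Longrightarrow> D2 i (cdiffs h M f) (cdiffs h M g)"
  by (erule D2_bounded_linear[OF _ bounded_linear_cdiffs]) (simp add: cdiffs_sh)

text \<open>The increment over h is a sum of n translates of the increment over h / n, so its norm
  is at most n times as large as theirs; as n grows this tends to |h| times the norm of the
  derivative.\<close>

lemma sh_diff_le:
  assumes "D2 i f g"
  shows "norm (sh (axis i h) f - f) \<le> \<bar>h\<bar> * norm g"
proof (cases "h = 0")
  case False
  have tel: "norm (sh (axis i (real n * s)) f - f) \<le> real n * norm (sh (axis i s) f - f)" for n s
  proof (induction n)
    case (Suc n)
    have "sh (axis i (real (Suc n) * s)) f - f
        = sh (axis i (real n * s)) (sh (axis i s) f - f) + (sh (axis i (real n * s)) f - f)"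
    proof -
      have "axis i (real (Suc n) * s) = axis i (real n * s) + axis i s"
        by (simp add: vec_eq_iff axis_def algebra_simps)
      then show ?thesis by (simp add: sh_plus)
    qed
    then have "norm (sh (axis i (real (Suc n) * s)) f - f)
        \<le> norm (sh (axis i s) f - f) + norm (sh (axis i (real n * s)) f - f)"
      by (metis norm_sh norm_triangle_ineq)
    with Suc show ?case by (simp add: algebra_simps)
  qed simp
  have "filterlim (\<lambda>n. h / real (Suc n)) (at 0) sequentially"
    unfolding filterlim_at using False
    by (auto intro!: eventually_sequentiallyI) real_asymp
  then have "(\<lambda>n. \<bar>h\<bar> * norm ((1 / (h / real (Suc n))) *\<^sub>R (sh (axis i (h / real (Suc n))) f - f))) \<longlonglongrightarrow> \<bar>h\<bar> * norm g"
    using filterlim_compose[OF assms[unfolded D2_def]] by (intro tendsto_intros)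
  then show ?thesis
  proof (rule LIMSEQ_le_const, intro exI allI impI)
    fix n
    have "norm (sh (axis i h) f - f) \<le> real (Suc n) * norm (sh (axis i (h / real (Suc n))) f - f)"
      using tel[of "Suc n" "h / real (Suc n)"] by simp
    also have "\<dots> = \<bar>h\<bar> * norm ((1 / (h / real (Suc n))) *\<^sub>R (sh (axis i (h / real (Suc n))) f - f))"
      using False by (simp add: abs_mult)
    finally show "norm (sh (axis i h) f - f) \<le> \<bar>h\<bar> * norm ((1 / (h / real (Suc n))) *\<^sub>R (sh (axis i (h / real (Suc n))) f - f))" .
  qed
qed simp

lemma cdiff_eq: "h \<noteq> 0 \<Longrightarrow> cdiff h i f
  = (1/2) *\<^sub>R ((1 / h) *\<^sub>R (sh (axis i h) f - f)) + (1/2) *\<^sub>R ((1 / (- h)) *\<^sub>R (sh (axis i (- h)) f - f))"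
  by (simp add: cdiff_def algebra_simps)

lemma norm_cdiff_le:
  assumes "D2 i f g" "h \<noteq> 0"
  shows "norm (cdiff h i f) \<le> norm g"
proof -
  have "norm (cdiff h i f) = (1 / \<bar>h\<bar>) * norm ((sh (axis i h) f - f) - (sh (axis i (- h)) f - f)) / 2"
    by (simp add: cdiff_def abs_mult)
  also have "\<dots> \<le> (1 / \<bar>h\<bar>) * (norm (sh (axis i h) f - f) + norm (sh (axis i (- h)) f - f)) / 2"
    by (intro divide_right_mono mult_left_mono norm_triangle_ineq4) auto
  also have "\<dots> \<le> (1 / \<bar>h\<bar>) * (\<bar>h\<bar> * norm g + \<bar>h\<bar> * norm g) / 2"
    using sh_diff_le[OF assms(1), of h] sh_diff_le[OF assms(1), of "- h"]
    by (intro divide_right_mono mult_left_mono add_mono) auto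
  finally show ?thesis using assms by simp
qed

lemma tendsto_cdiff:
  assumes "D2 i f g"
  shows "((\<lambda>h. cdiff h i f) \<longlongrightarrow> g) (at 0)"
proof -
  let ?q = "\<lambda>h. (1 / h) *\<^sub>R (sh (axis i h) f - f)"
  have "filterlim uminus (at (0::real)) (at 0)"
    by (auto simp: filterlim_at eventually_at_filter intro!: tendsto_eq_intros)
  then have "((\<lambda>h. ?q (- h)) \<longlongrightarrow> g) (at 0)"
    using filterlim_compose[OF assms[unfolded D2_def]] by blast
  then have "((\<lambda>h. (1/2) *\<^sub>R ?q h + (1/2) *\<^sub>R ?q (- h)) \<longlongrightarrow> (1/2) *\<^sub>R g + (1/2) *\<^sub>R g) (at 0)"
    using assms[unfolded D2_def] by (intro tendsto_intros)
  moreover have "\<forall>\<^sub>F h in at 0. (1/2) *\<^sub>R ?q h + (1/2) *\<^sub>R ?q (- h) = cdiff h i f"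
    by (auto simp: eventually_at_filter cdiff_eq)
  ultimately show ?thesis
    by (simp add: tendsto_cong flip: scaleR_left_distrib)
qed

lemma norm_cdiffs_le:
  assumes "\<And>M i. add_mset i M \<subseteq># S \<Longrightarrow> D2 i (V M) (V (add_mset i M))" "h \<noteq> 0"
  shows "norm (cdiffs h S (V {#})) \<le> norm (V S)"
  using assms(1)
proof (induction S arbitrary: V)
  case (add i S)
  have sub: "M \<subseteq># add_mset i S" if "M \<subseteq># S" for M
    using that by (auto simp: subseteq_mset_def intro: le_SucI)
  have "norm (cdiffs h (add_mset i S) (V {#})) = norm (cdiffs h S (cdiff h i (V {#})))"
    by (simp add: cdiffs_cdiff)
  also have "\<dots> \<le> norm (cdiff h i (V S))"
    by (rule add.IH[of "\<lambda>M. cdiff h i (V M)"])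
      (intro D2_cdiff add.prems sub)
  also have "\<dots> \<le> norm (V (add_mset i S))"
    by (rule norm_cdiff_le[OF add.prems assms(2)]) simp
  finally show ?case .
qed simp

text \<open>Induction on S. The error \<open>?W\<close> made by replacing the first quotient by a
  derivative stays small under the remaining quotients, because by \<open>norm_cdiffs_le\<close>
  these are dominated by derivatives, uniformly in the step.\<close>

lemma tendsto_cdiffs:
  assumes "\<And>M i. add_mset i M \<subseteq># S \<Longrightarrow> D2 i (V M) (V (add_mset i M))"
  shows "((\<lambda>h. cdiffs h S (V {#})) \<longlongrightarrow> V S) (at 0)"
  using assms
proof (induction S arbitrary: V)
  case (add i S)
  have sub: "M \<subseteq># add_mset i S" if "M \<subseteq># S" for M
    using that by (auto simp: subseteq_mset_def intro: le_SucI)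
  have sub': "add_mset j (add_mset i M) \<subseteq># add_mset i S" if "add_mset j M \<subseteq># S" for M j
    using that by (simp add: add_mset_commute[of j i])
  let ?W = "\<lambda>h M. cdiff h i (V M) - V (add_mset i M)"
  have le: "norm (cdiffs h S (?W h {#})) \<le> norm (?W h S)" if "h \<noteq> 0" for h
    by (rule norm_cdiffs_le[OF _ that, of S "?W h"])
      (subst add_mset_commute, auto intro!: D2_cdiff D2_diff add.prems sub sub')
  have "((\<lambda>h. ?W h S) \<longlongrightarrow> 0) (at 0)"
    using tendsto_cdiff[OF add.prems[of i S]] by (simp add: LIM_zero)
  then have "((\<lambda>h. cdiffs h S (?W h {#})) \<longlongrightarrow> 0) (at 0)"
    by (rule Lim_null_comparison[OF _ tendsto_norm_zero, rotated])
      (auto simp: eventually_at_filter le)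
  moreover have "((\<lambda>h. cdiffs h S (V (add_mset i {#}))) \<longlongrightarrow> V (add_mset i S)) (at 0)"
    by (rule add.IH[of "\<lambda>M. V (add_mset i M)"])
      (use add.prems in \<open>auto simp: add_mset_commute[of i]\<close>)
  ultimately have "((\<lambda>h. cdiffs h S (?W h {#}) + cdiffs h S (V (add_mset i {#}))) \<longlongrightarrow> 0 + V (add_mset i S)) (at 0)"
    by (rule tendsto_add)
  then show ?case
    by (simp add: linear_diff[OF cdiffs_linear] cdiffs_cdiff)
qed simp

text \<open>Garding's inequality for coefficients that commute with translations: the limit of
  \<open>form_nonneg_cdiffs\<close> as the step tends to 0. \<open>V\<close> lists the two-sided
  derivatives of \<open>V {#}\<close> up to order m.\<close>

theorem coercivity:
  fixes A :: "'d multiset \<Rightarrow> 'd multiset \<Rightarrow> 'h \<Rightarrow> 'h"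
  assumes bl: "\<And>M N. bounded_linear (A M N)"
    and A_sh: "\<And>M N v f. A M N (sh v f) = sh v (A M N f)"
    and A_bound: "\<And>M N f. M \<in> I \<Longrightarrow> N \<in> I \<Longrightarrow> norm (A M N f) \<le> c * norm f"
    and LH: "\<And>\<xi> f. \<delta> * (mpow \<xi> K)\<^sup>2 * (norm f)\<^sup>2
      \<le> (\<Sum>M\<in>I. \<Sum>N\<in>I. mpow \<xi> M * mpow \<xi> N * inner (A M N f) f)"
    and I: "finite I" "\<And>M. M \<in> I \<Longrightarrow> size M = m" "K \<in> I" and "0 \<le> \<delta>"
    and V: "\<And>M i. size M < m \<Longrightarrow> D2 i (V M) (V (add_mset i M))"
  shows "\<delta> * (norm (V K))\<^sup>2 \<le> (\<Sum>M\<in>I. \<Sum>N\<in>I. inner (A M N (V M)) (V N))"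
proof -
  have lim: "((\<lambda>h. cdiffs h M (V {#})) \<longlongrightarrow> V M) (at 0)" if "M \<in> I" for M
    by (rule tendsto_cdiffs) (use V I(2)[OF that] in \<open>auto dest: size_mset_mono\<close>)
  show ?thesis
  proof (rule tendsto_le[OF trivial_limit_at])
    show "((\<lambda>h. \<delta> * (norm (cdiffs h K (V {#})))\<^sup>2) \<longlongrightarrow> \<delta> * (norm (V K))\<^sup>2) (at 0)"
      by (intro tendsto_intros lim I)
    show "((\<lambda>h. \<Sum>M\<in>I. \<Sum>N\<in>I. inner (A M N (cdiffs h M (V {#}))) (cdiffs h N (V {#})))
        \<longlongrightarrow> (\<Sum>M\<in>I. \<Sum>N\<in>I. inner (A M N (V M)) (V N))) (at 0)"
      by (intro tendsto_intros lim bounded_linear.tendsto[OF bl])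
    show "\<forall>\<^sub>F h in at 0. \<delta> * (norm (cdiffs h K (V {#})))\<^sup>2
        \<le> (\<Sum>M\<in>I. \<Sum>N\<in>I. inner (A M N (cdiffs h M (V {#}))) (cdiffs h N (V {#})))"
      unfolding eventually_at_filter
      by (intro always_eventually allI impI form_nonneg_cdiffs[OF bounded_linear.linear[OF bl] A_sh A_bound LH I])
        (use \<open>0 \<le> \<delta>\<close> in auto)
  qed
qed

end

section \<open>Integration by parts and energy estimates in an abstract half-space\<close>

section \<open>The estimate in an abstract half-space\<close>

text \<open>\<open>E\<close> stands for the restriction to the half-cylinder, an orthogonal
  projection; translations along the boundary preserve the half-cylinder, translations along
  \<open>e1\<close> do not.\<close>

locale half_shift_action = shift_action sh
  for sh :: "(real, 'd::finite) vec \<Rightarrow> 'h::real_inner \<Rightarrow> 'h" +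
  fixes E :: "'h \<Rightarrow> 'h" and e1 :: 'd
  assumes E_bl: "bounded_linear E"
    and E_adj: "inner (E f) g = inner f (E g)"
    and E_idem: "E (E f) = E f"
    and E_sh: "i \<noteq> e1 \<Longrightarrow> E (sh (axis i h) f) = sh (axis i h) (E f)"
begin

text \<open>With h > 0 the quotient at a point of the half-space uses only values from the
  half-space, and \<open>E\<close> discards all other points. Hence no condition at the boundary is
  implied.\<close>

definition DH :: "'d \<Rightarrow> 'h \<Rightarrow> 'h \<Rightarrow> bool"
  where "DH i f g \<longleftrightarrow> ((\<lambda>h. E ((1 / h) *\<^sub>R (sh (axis i h) f - f))) \<longlongrightarrow> g) (at_right 0)"

sublocale E: bounded_linear E by (rule E_bl)

lemma DH_bounded_linear:
  assumes "DH i f g" "bounded_linear B" "\<And>h f. B (sh (axis i h) f) = sh (axis i h) (B f)" "\<And>f. B (E f) = E (B f)"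
  shows "DH i (B f) (B g)"
proof -
  interpret B: bounded_linear B by fact
  show ?thesis
    using B.tendsto[OF assms(1)[unfolded DH_def]]
    by (simp add: DH_def B.scaleR B.diff assms(3,4))
qed

lemma DH_diff: "DH i f g \<Longrightarrow> DH i f' g' \<Longrightarrow> DH i (f - f') (g - g')"
  unfolding DH_def by (drule (1) tendsto_diff) (simp add: E.diff E.add E.scaleR algebra_simps)

lemma DH_scaleR: "DH i f g \<Longrightarrow> DH i (c *\<^sub>R f) (c *\<^sub>R g)"
  unfolding DH_def by (drule tendsto_scaleR[OF tendsto_const, of _ _ _ c]) (simp add: E.diff E.scaleR algebra_simps)

text \<open>The adjoint of a forward quotient is minus a backward one. It falls on f, which is
  differentiable from both sides, and the \<open>E\<close> in front of the quotient of g is absorbed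
  by \<open>E f = f\<close>; this is why no boundary term appears.\<close>

lemma integration_by_parts:
  assumes "D2 i f f'" "E f = f" "DH i g g'"
    and B: "bounded_linear B" "\<And>v f. B (sh v f) = sh v (B f)" "\<And>f. B (E f) = E (B f)"
  shows "inner f (B g') = - inner f' (B g)"
proof -
  interpret B: bounded_linear B by fact
  let ?q = "\<lambda>h. (1 / h) *\<^sub>R (sh (axis i h) f - f)"
  have "filterlim uminus (at (0::real)) (at_right 0)"
    by (auto simp: filterlim_at eventually_at_filter intro!: tendsto_eq_intros)
  then have "((\<lambda>h. ?q (- h)) \<longlongrightarrow> f') (at_right 0)"
    using filterlim_compose[OF assms(1)[unfolded D2_def]] by blast
  then have lim1: "((\<lambda>h. - inner (?q (- h)) (B g)) \<longlongrightarrow> - inner f' (B g)) (at_right 0)"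
    by (intro tendsto_intros)
  have lim2: "((\<lambda>h. inner f (B (E ((1 / h) *\<^sub>R (sh (axis i h) g - g))))) \<longlongrightarrow> inner f (B g')) (at_right 0)"
    using assms(3)[unfolded DH_def] by (intro tendsto_intros B.tendsto)
  have eq: "inner f (B (E ((1 / h) *\<^sub>R (sh (axis i h) g - g)))) = - inner (?q (- h)) (B g)" for h
  proof -
    have "inner f (B (E ((1 / h) *\<^sub>R (sh (axis i h) g - g)))) = inner f (B ((1 / h) *\<^sub>R (sh (axis i h) g - g)))"
      by (metis B(3) E_adj assms(2))
    also have "\<dots> = - inner (?q (- h)) (B g)"
      by (simp add: B.scaleR B.diff B(2) inner_diff_left inner_diff_right sh_adjoint axis_minus algebra_simps)
    finally show ?thesis .
  qed
  show ?thesis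
    by (rule tendsto_unique[OF _ lim2]) (use lim1 in \<open>simp_all add: eq\<close>)
qed

text \<open>\<open>V\<close> is the factor with boundary conditions and can take up at most m normal
  derivatives in total, whence the bound on \<open>count\<close>; \<open>W\<close> gives them
  away.\<close>

lemma integration_by_parts_multi:
  assumes V: "\<And>M. size M \<le> 2 * m \<Longrightarrow> E (V M) = V M"
      "\<And>M i. size M < 2 * m \<Longrightarrow> (i = e1 \<longrightarrow> count M e1 < m) \<Longrightarrow> D2 i (V M) (V (add_mset i M))"
    and W: "\<And>M i. size M < 2 * m \<Longrightarrow> DH i (W M) (W (add_mset i M))"
    and B: "bounded_linear B" "\<And>v f. B (sh v f) = sh v (B f)" "\<And>f. B (E f) = E (B f)"
    and "size M + size S \<le> 2 * m" "size K + size S \<le> 2 * m" "count M e1 + count S e1 \<le> m"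
  shows "inner (V M) (B (W (K + S))) = (- 1) ^ size S * inner (V (M + S)) (B (W K))"
  using assms(7-)
proof (induction S arbitrary: M)
  case (add i S)
  have "inner (V M) (B (W (K + add_mset i S))) = - inner (V (add_mset i M)) (B (W (K + S)))"
    using add.prems
    by (simp, intro integration_by_parts[OF V(2) V(1) W B]) (auto split: if_splits)
  also have "\<dots> = - ((- 1) ^ size S * inner (V (add_mset i M + S)) (B (W K)))"
    using add.prems by (subst add.IH) (auto split: if_splits)
  finally show ?case by simp
qed simp

lemma DH_cdiff:
  assumes "DH i f g" "j \<noteq> e1"
  shows "DH i (cdiff h j f) (cdiff h j g)"
  by (rule DH_bounded_linear[OF assms(1) bounded_linear_cdiff])
    (simp_all add: cdiff_sh, simp add: cdiff_def E.scaleR E.diff E_sh assms(2))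

lemma E_cdiffs: "e1 \<notin># S \<Longrightarrow> E (cdiffs h S f) = cdiffs h S (E f)"
  by (induction S) (auto simp: cdiff_def E.scaleR E.diff E_sh)

lemma DH_cdiffs:
  assumes "DH i f g" "e1 \<notin># S"
  shows "DH i (cdiffs h S f) (cdiffs h S g)"
  by (rule DH_bounded_linear[OF assms(1) bounded_linear_cdiffs]) (simp_all add: cdiffs_sh E_cdiffs assms(2))

end

lemma finite_size_multisets [simp]: "finite {M :: 'd::finite multiset. size M = m}"
proof -
  have "{M :: 'd multiset. size M = m} = mset ` {xs. set xs \<subseteq> UNIV \<and> length xs = m}"
    by (auto simp: image_iff) (metis ex_mset size_mset)
  then show ?thesis
    using finite_lists_length_eq[of "UNIV :: 'd set" m] by simp
qed

text \<open>\<open>P\<close> is the restriction to times before T, \<open>st h\<close> the delay by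
  h, and \<open>R\<close> the dilation f(t, 2 x_1, x'), with \<open>R_norm\<close> its Jacobian.
  \<open>E_st\<close> holds because a delayed function of the half-cylinder still vanishes for x_1
  \<le> 0, so only the time cut matters. \<open>R_D2\<close> expresses that f - R f vanishes on the
  boundary whatever the trace of f is.\<close>

locale half_space = half_shift_action sh E e1
  for sh :: "(real, 'd::finite) vec \<Rightarrow> 'h::real_inner \<Rightarrow> 'h" and E e1 +
  fixes P :: "'h \<Rightarrow> 'h" and st :: "real \<Rightarrow> 'h \<Rightarrow> 'h" and R :: "'h \<Rightarrow> 'h"
    and A :: "'d multiset \<Rightarrow> 'd multiset \<Rightarrow> 'h \<Rightarrow> 'h" and m :: nat and \<delta> :: real
  assumes P_bl: "bounded_linear P"
    and P_adj: "inner (P f) g = inner f (P g)"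
    and P_E: "P (E f) = E f"
    and P_sh: "P (sh v f) = sh v (P f)"
    and st_bl: "bounded_linear (st h)"
    and norm_st: "norm (st h f) = norm f"
    and st_sh: "st h (sh v f) = sh v (st h f)"
    and E_st: "0 < h \<Longrightarrow> E f = f \<Longrightarrow> E (st h f) = P (st h f)"
    and R_bl: "bounded_linear R"
    and R_norm: "2 * (norm (R f))\<^sup>2 = (norm f)\<^sup>2"
    and R_E: "R (E f) = E (R f)"
    and R_sh1: "R (sh (axis e1 h) f) = sh (axis e1 (h / 2)) (R f)"
    and R_sh: "i \<noteq> e1 \<Longrightarrow> R (sh (axis i h) f) = sh (axis i h) (R f)"
    and R_D2: "E f = f \<Longrightarrow> E g = g \<Longrightarrow> DH e1 f g \<Longrightarrow> D2 e1 (f - R f) (g - 2 *\<^sub>R R g)"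
    and A_bl: "bounded_linear (A M N)"
    and A_sh: "A M N (sh v f) = sh v (A M N f)"
    and A_E: "A M N (E f) = E (A M N f)"
    and A_bound: "size M = m \<Longrightarrow> size N = m \<Longrightarrow> norm (A M N f) \<le> inverse \<delta> * norm f"
    and A_LH: "size K = m \<Longrightarrow> \<delta> * (mpow \<xi> K)\<^sup>2 * (norm f)\<^sup>2
      \<le> (\<Sum>M | size M = m. \<Sum>N | size N = m. mpow \<xi> M * mpow \<xi> N * inner (A M N f) f)"
    and \<delta>_pos: "0 < \<delta>"
begin

sublocale P: bounded_linear P by (rule P_bl)
sublocale R: bounded_linear R by (rule R_bl)

text \<open>The quotient is taken backward in time, so that near the final time T it uses only
  values before T.\<close>

definition DT :: "'h \<Rightarrow> 'h \<Rightarrow> bool"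
  where "DT f g \<longleftrightarrow> ((\<lambda>h. (1 / h) *\<^sub>R E (f - st h f)) \<longlongrightarrow> g) (at_right 0)"

text \<open>The derivatives up to order 2m of a function with zero Dirichlet data of order m. Such
  data make the first m normal derivatives two-sided, at any number of tangential ones.\<close>

definition fam :: "('d multiset \<Rightarrow> 'h) \<Rightarrow> bool"
  where "fam U \<longleftrightarrow>
    (\<forall>M. size M \<le> 2 * m \<longrightarrow> E (U M) = U M) \<and>
    (\<forall>M i. size M < 2 * m \<longrightarrow> (i = e1 \<longrightarrow> count M e1 < m) \<longrightarrow> D2 i (U M) (U (add_mset i M))) \<and>
    (\<forall>M i. size M < 2 * m \<longrightarrow> DH i (U M) (U (add_mset i M)))"

lemma famD:
  assumes "fam U"
  shows "size M \<le> 2 * m \<Longrightarrow> E (U M) = U M"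
    and "size M < 2 * m \<Longrightarrow> (i = e1 \<longrightarrow> count M e1 < m) \<Longrightarrow> D2 i (U M) (U (add_mset i M))"
    and "size M < 2 * m \<Longrightarrow> DH i (U M) (U (add_mset i M))"
  using assms by (auto simp: fam_def)

text \<open>The backward time increment of u satisfies the same boundary conditions as u, so \<beta>
  derivatives can be moved onto it. With v = D^\<beta> u there remains |v|^2 minus the inner product
  of v with its delay, which has the same norm.\<close>

lemma time_nonneg:
  assumes U: "fam U" and t: "DT (U {#}) Ut" and \<beta>: "size \<beta> \<le> m"
  shows "0 \<le> (- 1) ^ size \<beta> * inner Ut (U (\<beta> + \<beta>))"
proof (rule tendsto_lowerbound)
  show "((\<lambda>h. (- 1) ^ size \<beta> * inner ((1 / h) *\<^sub>R E (U {#} - st h (U {#}))) (U (\<beta> + \<beta>)))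
     \<longlongrightarrow> (- 1) ^ size \<beta> * inner Ut (U (\<beta> + \<beta>))) (at_right 0)"
    using t unfolding DT_def by (intro tendsto_intros)
  show "\<forall>\<^sub>F h in at_right 0. 0 \<le> (- 1) ^ size \<beta> * inner ((1 / h) *\<^sub>R E (U {#} - st h (U {#}))) (U (\<beta> + \<beta>))"
    unfolding eventually_at_filter
  proof (intro always_eventually allI impI)
    fix h :: real assume h: "h \<in> {0<..}"
    interpret st: bounded_linear "st h" by (rule st_bl)
    \<comment> \<open>\<open>P\<close> commutes with every spatial translation, so it keeps the
      increment two-sided differentiable; by \<open>E_st\<close> it agrees here with
      \<open>E\<close>.\<close>
    let ?B = "\<lambda>f. P (f - st h f)"
    let ?V = "\<lambda>M. ?B (U M)"
    have PU: "P (U M) = U M" if "size M \<le> 2 * m" for M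
      by (metis P_E famD(1)[OF U that])
    have V: "?V M = E (U M - st h (U M))" if "size M \<le> 2 * m" for M
      using E_st[of h "U M"] h famD(1)[OF U that] PU[OF that] by (simp add: E.diff P.diff)
    have "inner (?V {#}) (id (U (\<beta> + \<beta>))) = (- 1) ^ size \<beta> * inner (?V ({#} + \<beta>)) (id (U \<beta>))"
    proof (rule integration_by_parts_multi[where V = ?V and W = U and B = id and m = m])
      show "E (?V M) = ?V M" if "size M \<le> 2 * m" for M
        by (simp only: V[OF that] E_idem)
      show "D2 i (?V M) (?V (add_mset i M))" if "size M < 2 * m" "i = e1 \<longrightarrow> count M e1 < m" for M i
      proof (rule D2_bounded_linear[of i _ _ ?B])
        show "D2 i (U M) (U (add_mset i M))" by (rule famD(2)[OF U that])
        show "bounded_linear ?B"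
          by (intro bounded_linear_compose[OF P_bl] bounded_linear_sub bounded_linear_ident st_bl)
      qed (simp add: st_sh P_sh flip: sh_simps)
      show "count {#} e1 + count \<beta> e1 \<le> m"
        using \<beta> count_le_size[of \<beta> e1] by simp
    qed (use U \<beta> in \<open>auto intro: famD bounded_linear_ident[folded id_def]\<close>)
    then have "(- 1) ^ size \<beta> * inner ((1 / h) *\<^sub>R E (U {#} - st h (U {#}))) (U (\<beta> + \<beta>))
        = (1 / h) * inner (?V \<beta>) (U \<beta>)"
      using V[of "{#}"] by (simp flip: power_add mult_2 mult.assoc)
    also have "inner (?V \<beta>) (U \<beta>) = (norm (U \<beta>))\<^sup>2 - inner (st h (U \<beta>)) (U \<beta>)"
      using PU[of \<beta>] \<beta> by (simp add: P_adj inner_diff_left power2_norm_eq_inner)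
    also have "(1 / h) * \<dots> \<ge> 0"
      using norm_cauchy_schwarz[of "st h (U \<beta>)" "U \<beta>"] h by (simp add: norm_st power2_eq_square)
    finally show "0 \<le> (- 1) ^ size \<beta> * inner ((1 / h) *\<^sub>R E (U {#} - st h (U {#}))) (U (\<beta> + \<beta>))" .
  qed
qed simp

definition Lop :: "('d multiset \<Rightarrow> 'h) \<Rightarrow> 'h"
  where "Lop U = (\<Sum>M | size M = m. \<Sum>N | size N = m. A M N (U (M + N)))"

text \<open>The derivatives N are moved from \<open>V (M + N)\<close> onto \<open>V {#}\<close>,
  which can take up m normal ones; the result is the form of \<open>coercivity\<close>.\<close>

lemma energy:
  assumes "fam V" "size K = m"
  shows "\<delta> * (norm (V K))\<^sup>2 \<le> (- 1) ^ m * inner (Lop V) (V {#})"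
proof -
  have "inner (A M N (V (M + N))) (V {#}) = (- 1) ^ m * inner (A M N (V M)) (V N)"
    if "size M = m" "size N = m" for M N
  proof -
    have "inner (V {#}) (A M N (V (M + N))) = (- 1) ^ size N * inner (V ({#} + N)) (A M N (V M))"
      by (rule integration_by_parts_multi[where m = m, OF famD[OF assms(1)] A_bl A_sh A_E])
        (use that count_le_size[of N e1] in auto)
    then show ?thesis using that by (simp add: inner_commute)
  qed
  then have "(- 1) ^ m * inner (Lop V) (V {#})
      = (\<Sum>M | size M = m. \<Sum>N | size N = m. inner (A M N (V M)) (V N))"
    by (simp add: Lop_def inner_sum_left sum_distrib_left flip: power_add mult_2 mult.assoc)
  also have "\<dots> \<ge> \<delta> * (norm (V K))\<^sup>2"
  proof (rule coercivity[OF A_bl A_sh A_bound A_LH])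
    show "D2 i (V M) (V (add_mset i M))" if "size M < m" for M i
      using that count_le_size[of M e1] by (intro famD(2)[OF assms(1)]) auto
  qed (use assms \<delta>_pos in auto)
  finally show ?thesis by simp
qed

lemma fam_cdiffs:
  assumes "fam U" "e1 \<notin># S"
  shows "fam (\<lambda>M. cdiffs h S (U M))"
  unfolding fam_def
  by (auto simp: E_cdiffs assms(2) famD(1)[OF assms(1)] intro!: D2_cdiffs DH_cdiffs famD(2,3)[OF assms(1)] assms(2))

lemma st_cdiffs: "st h' (cdiffs h S f) = cdiffs h S (st h' f)"
proof -
  interpret st: bounded_linear "st h'" by (rule st_bl)
  show ?thesis by (induction S) (auto simp: cdiff_def st.scaleR st.diff st_sh)
qed

lemma DT_cdiffs:
  assumes "DT f g" "e1 \<notin># S"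
  shows "DT (cdiffs h S f) (cdiffs h S g)"
  using bounded_linear.tendsto[OF bounded_linear_cdiffs assms(1)[unfolded DT_def], of h S]
  by (simp add: DT_def st_cdiffs E_cdiffs[OF assms(2)] linear_scale[OF cdiffs_linear] E.diff linear_diff[OF cdiffs_linear])

lemma cdiffs_union: "cdiffs h (S + S') f = cdiffs h S (cdiffs h S' f)"
  by (induction S) auto

context
  fixes U :: "'d multiset \<Rightarrow> 'h" and Ut F :: 'h and lam :: real
  assumes U: "fam U" and Ut: "DT (U {#}) Ut" and lam: "0 \<le> lam"
    and F: "F = Ut + (- 1) ^ m *\<^sub>R Lop U + lam *\<^sub>R U {#}"
begin

text \<open>Tangential quotients of u keep the boundary conditions and solve the same equation with
  quotients of F. In the energy inequality for them the u_t and lam terms are dropped by sign, and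
  the quotients of F are moved to the other factor, which then carries 2m tangential quotients of
  u.\<close>

lemma tangential_cdiffs:
  assumes "size K = m" "size S = m" "e1 \<notin># S" "h \<noteq> 0"
  shows "\<delta> * (norm (cdiffs h S (U K)))\<^sup>2 \<le> norm F * norm (U (S + S))"
proof -
  let ?V = "\<lambda>M. cdiffs h S (U M)"
  have V: "fam ?V" by (rule fam_cdiffs[OF U assms(3)])
  have VA: "cdiffs h S (A M N f) = A M N (cdiffs h S f)" for M N f
  proof -
    interpret A: bounded_linear "A M N" by (rule A_bl)
    show ?thesis by (induction S) (auto simp: cdiff_def A.scaleR A.diff A_sh)
  qed
  have "\<delta> * (norm (?V K))\<^sup>2 \<le> (- 1) ^ m * inner (Lop ?V) (?V {#})"
    by (rule energy[OF V assms(1)])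
  also have "Lop ?V = cdiffs h S (Lop U)"
    by (simp add: Lop_def linear_sum[OF cdiffs_linear] VA)
  also have "(- 1) ^ m * inner (cdiffs h S (Lop U)) (?V {#}) \<le> inner (cdiffs h S F) (?V {#})"
    using time_nonneg[OF V DT_cdiffs[OF Ut assms(3)], of "{#}"] lam
    by (simp add: F linear_add[OF cdiffs_linear] linear_scale[OF cdiffs_linear] inner_add_left)
  also have "\<dots> = (- 1) ^ m * inner F (cdiffs h (S + S) (U {#}))"
    by (simp add: cdiffs_adjoint cdiffs_union assms)
  also have "\<dots> \<le> \<bar>(- 1) ^ m * inner F (cdiffs h (S + S) (U {#}))\<bar>"
    by (rule abs_ge_self)
  also have "\<dots> \<le> norm F * norm (cdiffs h (S + S) (U {#}))"
    using Cauchy_Schwarz_ineq2 by (simp add: abs_mult power_abs)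
  also have "norm (cdiffs h (S + S) (U {#})) \<le> norm (U (S + S))"
  proof (rule norm_cdiffs_le[OF _ assms(4)])
    fix M i assume M: "add_mset i M \<subseteq># S + S"
    then have "i \<noteq> e1" using assms(3) by (metis mset_subset_eqD union_iff union_single_eq_member add_mset_add_single)
    moreover have "size M < 2 * m" using size_mset_mono[OF M] assms by simp
    ultimately show "D2 i (U M) (U (add_mset i M))" by (intro famD(2)[OF U]) auto
  qed
  finally show ?thesis by (simp add: mult_left_mono)
qed

lemma tangential_aux:
  assumes "size K = m" "size S = m" "e1 \<notin># S"
  shows "\<delta> * (norm (U (K + S)))\<^sup>2 \<le> norm F * norm (U (S + S))"
proof (rule tendsto_upperbound)
  have "((\<lambda>h. cdiffs h S (U (K + {#}))) \<longlongrightarrow> U (K + S)) (at 0)"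
  proof (rule tendsto_cdiffs)
    fix M i assume M: "add_mset i M \<subseteq># S"
    then have "i \<noteq> e1" using assms(3) by (metis mset_subset_eqD union_single_eq_member add_mset_add_single)
    moreover have "size M < m" using size_mset_mono[OF M] assms by simp
    ultimately show "D2 i (U (K + M)) (U (K + add_mset i M))"
      using famD(2)[OF U, of "K + M" i] assms by simp
  qed
  then show "((\<lambda>h. \<delta> * (norm (cdiffs h S (U K)))\<^sup>2) \<longlongrightarrow> \<delta> * (norm (U (K + S)))\<^sup>2) (at 0)"
    by (intro tendsto_intros) simp
  show "\<forall>\<^sub>F h in at 0. \<delta> * (norm (cdiffs h S (U K)))\<^sup>2 \<le> norm F * norm (U (S + S))"
    unfolding eventually_at_filter
    by (intro always_eventually allI impI tangential_cdiffs assms)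
qed simp

text \<open>For K = S the preceding inequality has |D^(2S) u| on both sides and one factor cancels;
  the resulting bound settles general K.\<close>

lemma tangential:
  assumes "size K = m" "size S = m" "e1 \<notin># S"
  shows "\<delta> * norm (U (K + S)) \<le> norm F"
proof -
  have "norm (U (S + S)) * (\<delta> * norm (U (S + S))) \<le> norm (U (S + S)) * norm F"
    using tangential_aux[OF assms(2,2,3)] by (simp add: power2_eq_square mult_ac)
  then have S: "\<delta> * norm (U (S + S)) \<le> norm F"
    by (cases "U (S + S) = 0") (simp_all add: mult_le_cancel_left)
  have "(\<delta> * norm (U (K + S)))\<^sup>2 \<le> \<delta> * (norm F * norm (U (S + S)))"
    using mult_left_mono[OF tangential_aux[OF assms], of \<delta>] \<delta>_pos by (simp add: power2_eq_square mult_ac)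
  also have "\<dots> \<le> (norm F)\<^sup>2"
    using mult_left_mono[OF S, of "norm F"] by (simp add: power2_eq_square mult_ac)
  finally show ?thesis by (rule power2_le_imp_le) simp
qed

text \<open>Pair the equation with D_1^(2m) u. The u_t and lam terms have a good sign after
  integration by parts, since J consists of exactly m normal directions. In \<open>Lop\<close> the
  pair (J, J) acts on D_1^(2m) u itself and is coercive; every other pair is moved to the right by
  Cauchy-Schwarz.\<close>

lemma normal:
  defines "J \<equiv> replicate_mset m e1"
  shows "\<delta> * norm (U (J + J)) \<le> norm F
    + inverse \<delta> * (\<Sum>(M, N)\<in>{M. size M = m} \<times> {N. size N = m} - {(J, J)}. norm (U (M + N)))"
proof -
  let ?I = "{M :: 'd multiset. size M = m}"
  have J: "size J = m" by (simp add: J_def)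
  let ?u = "U (J + J)"
  have "inner (U {#}) (id (U (J + J))) = (- 1) ^ size J * inner (U ({#} + J)) (id (U J))"
    by (rule integration_by_parts_multi[where m = m, OF famD[OF U]])
      (auto simp: J_def intro: bounded_linear_ident[folded id_def])
  then have l: "(- 1) ^ m * inner (U {#}) ?u = (norm (U J))\<^sup>2"
    by (simp add: J power2_norm_eq_inner flip: power_add mult_2 mult.assoc)
  have "inner (Lop U) ?u = (- 1) ^ m * inner F ?u - (- 1) ^ m * inner Ut ?u - lam * ((- 1) ^ m * inner (U {#}) ?u)"
    by (simp add: F inner_add_left algebra_simps flip: power_add mult_2)
  also have "\<dots> \<le> (- 1) ^ m * inner F ?u"
  proof -
    have "0 \<le> lam * (norm (U J))\<^sup>2" using lam by simp
    then show ?thesis using time_nonneg[OF U Ut, of J] by (simp add: J l)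
  qed
  also have "\<dots> \<le> \<bar>(- 1) ^ m * inner F ?u\<bar>"
    by (rule abs_ge_self)
  also have "\<dots> \<le> norm F * norm ?u"
    using Cauchy_Schwarz_ineq2 by (simp add: abs_mult power_abs)
  finally have up: "inner (Lop U) ?u \<le> norm F * norm ?u" .
  \<comment> \<open>The unit vector normal to the boundary: among the monomials of degree m only the
    one of J is nonzero there.\<close>
  define \<xi> :: "'d \<Rightarrow> real" where "\<xi> i = (if i = e1 then 1 else 0)" for i
  have xi: "mpow \<xi> M = (if M = J then 1 else 0)" if "size M = m" for M
  proof -
    have "mpow \<xi> M = (if M = replicate_mset (size M) e1 then 1 else 0)"
    proof (induction M)
      case (add i M)
      have "add_mset i M \<noteq> add_mset e1 (replicate_mset (size M) e1)" if "i \<noteq> e1"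
        using that in_replicate_mset[of i "Suc (size M)" e1] by (metis replicate_mset_Suc union_single_eq_member add_mset_add_single)
      with add show ?case
        by (cases "i = e1") (auto simp: mpow_def \<xi>_def)
    qed (simp add: mpow_def)
    with that show ?thesis by (simp add: J_def)
  qed
  have "\<delta> * (norm ?u)\<^sup>2 = \<delta> * (mpow \<xi> J)\<^sup>2 * (norm ?u)\<^sup>2"
    by (simp add: xi J)
  also have "\<dots> \<le> (\<Sum>M\<in>?I. \<Sum>N\<in>?I. mpow \<xi> M * mpow \<xi> N * inner (A M N ?u) ?u)"
    by (rule A_LH[OF J])
  also have "\<dots> = (\<Sum>M\<in>?I. \<Sum>N\<in>?I. (if M = J then if N = J then inner (A M N ?u) ?u else 0 else 0))"
    by (intro sum.cong refl) (auto simp: xi)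
  also have "\<dots> = inner (A J J ?u) ?u"
  proof -
    have "(\<Sum>N\<in>?I. (if M = J then if N = J then inner (A M N ?u) ?u else 0 else 0))
      = (if M = J then inner (A M J ?u) ?u else 0)" for M
      by (auto simp: J)
    then show ?thesis by (simp add: J)
  qed
  finally have low: "\<delta> * (norm ?u)\<^sup>2 \<le> inner (A J J ?u) ?u" .
  have "inner (Lop U) ?u = (\<Sum>(M, N)\<in>?I \<times> ?I. inner (A M N (U (M + N))) ?u)"
    by (simp add: Lop_def inner_sum_left sum.cartesian_product case_prod_unfold)
  also have "\<dots> = inner (A J J ?u) ?u + (\<Sum>(M, N)\<in>?I \<times> ?I - {(J, J)}. inner (A M N (U (M + N))) ?u)"
    by (subst sum.remove[where x = "(J, J)"]) (auto simp: J)
  finally have "\<delta> * (norm ?u)\<^sup>2 \<le> norm F * norm ?u + (\<Sum>(M, N)\<in>?I \<times> ?I - {(J, J)}. - inner (A M N (U (M + N))) ?u)"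
    using up low by (simp add: sum_negf case_prod_unfold)
  also have "(\<Sum>(M, N)\<in>?I \<times> ?I - {(J, J)}. - inner (A M N (U (M + N))) ?u)
      \<le> (\<Sum>(M, N)\<in>?I \<times> ?I - {(J, J)}. inverse \<delta> * norm (U (M + N)) * norm ?u)"
  proof (rule sum_mono)
    fix p :: "'d multiset \<times> 'd multiset" assume "p \<in> ?I \<times> ?I - {(J, J)}"
    then obtain M N where p: "p = (M, N)" "size M = m" "size N = m" by auto
    then have "norm (A M N (U (M + N))) * norm ?u \<le> inverse \<delta> * norm (U (M + N)) * norm ?u"
      by (intro mult_right_mono A_bound) auto
    then have "- inner (A M N (U (M + N))) ?u \<le> inverse \<delta> * norm (U (M + N)) * norm ?u"
      using Cauchy_Schwarz_ineq2[of "A M N (U (M + N))" ?u] by linarith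
    then show "(case p of (M, N) \<Rightarrow> - inner (A M N (U (M + N))) ?u)
        \<le> (case p of (M, N) \<Rightarrow> inverse \<delta> * norm (U (M + N)) * norm ?u)"
      by (simp add: p)
  qed
  finally have "norm ?u * (\<delta> * norm ?u) \<le> norm ?u * (norm F
    + inverse \<delta> * (\<Sum>(M, N)\<in>?I \<times> ?I - {(J, J)}. norm (U (M + N))))"
    by (simp add: power2_eq_square sum_distrib_left sum_distrib_right case_prod_unfold algebra_simps)
  then show ?thesis
    using \<delta>_pos
    by (cases "?u = 0") (auto simp: mult_le_cancel_left intro!: add_nonneg_nonneg mult_nonneg_nonneg sum_nonneg)
qed

text \<open>The equation bounds u_t + lam u. The inner product of u_t and u is nonnegative, so
  neither summand is longer than the sum.\<close>

lemma time_and_zero_order: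
  defines "S \<equiv> norm F + inverse \<delta> * (\<Sum>(M, N)\<in>{M. size M = m} \<times> {N. size N = m}. norm (U (M + N)))"
  shows "norm Ut \<le> S" "lam * norm (U {#}) \<le> S"
proof -
  let ?w = "Ut + lam *\<^sub>R U {#}"
  have "norm (Lop U) \<le> (\<Sum>M | size M = m. \<Sum>N | size N = m. inverse \<delta> * norm (U (M + N)))"
    unfolding Lop_def by (intro order_trans[OF norm_sum] sum_mono A_bound) auto
  moreover have "norm ?w \<le> norm F + norm ((- 1) ^ m *\<^sub>R Lop U)"
    using norm_triangle_ineq4[of F "(- 1) ^ m *\<^sub>R Lop U"] by (simp add: F algebra_simps)
  ultimately have w: "norm ?w \<le> S"
    by (simp add: S_def sum.cartesian_product sum_distrib_left case_prod_unfold)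
  have "0 \<le> lam * inner Ut (U {#})"
    using time_nonneg[OF U Ut, of "{#}"] lam by simp
  moreover have "(norm ?w)\<^sup>2 = (norm Ut)\<^sup>2 + 2 * (lam * inner Ut (U {#})) + (lam * norm (U {#}))\<^sup>2"
    by (simp add: power2_norm_eq_inner inner_add_left inner_add_right inner_commute power_mult_distrib)
      (simp add: power2_eq_square)
  ultimately have "(norm Ut)\<^sup>2 \<le> (norm ?w)\<^sup>2" "(lam * norm (U {#}))\<^sup>2 \<le> (norm ?w)\<^sup>2"
    by simp_all
  then have "norm Ut \<le> norm ?w" "lam * norm (U {#}) \<le> norm ?w"
    by (auto intro: power2_le_imp_le)
  with w show "norm Ut \<le> S" "lam * norm (U {#}) \<le> S" by linarith+
qed

end

lemma norm_R: "norm (R f) = norm f / sqrt 2"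
proof -
  have "(sqrt 2 * norm (R f))\<^sup>2 = (norm f)\<^sup>2"
    using R_norm[of f] by (simp add: power_mult_distrib)
  then have "sqrt 2 * norm (R f) = norm f"
    by (rule power2_eq_imp_eq) simp_all
  then show ?thesis by (simp add: field_simps)
qed

lemma sqrt2_bounds: "7 / 5 \<le> sqrt 2" "sqrt 2 \<le> 17 / 12"
  by (rule real_le_rsqrt, simp add: power2_eq_square) (rule real_le_lsqrt, simp_all add: power2_eq_square)

text \<open>\<open>2 R\<close> multiplies norms by sqrt 2, which is larger than 1; so 1 - 2R is
  bounded below by sqrt 2 - 1, and 2/5 is a rational number below it.\<close>

lemma norm_sub_2R: "2 / 5 * norm f \<le> norm (f - 2 *\<^sub>R R f)"
proof -
  have "norm (2 *\<^sub>R R f) = sqrt 2 * norm f"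
    using real_div_sqrt[of 2] by (simp add: norm_R field_simps)
  moreover have "7 / 5 * norm f \<le> sqrt 2 * norm f"
    using sqrt2_bounds by (intro mult_right_mono) auto
  moreover have "norm (2 *\<^sub>R R f) \<le> norm f + norm (f - 2 *\<^sub>R R f)"
    using norm_triangle_ineq4[of f "f - 2 *\<^sub>R R f"] by simp
  ultimately show ?thesis by linarith
qed

lemma norm_sub_R: "norm (f - R f) \<le> 9 / 5 * norm f"
proof -
  have "norm f / sqrt 2 \<le> norm f / (5 / 4)"
    using sqrt2_bounds(1) by (intro divide_left_mono) auto
  then have "norm (R f) \<le> 4 / 5 * norm f"
    by (simp add: norm_R)
  then show ?thesis using norm_triangle_ineq4[of f "R f"] by linarith
qed

lemma norm_sub_4R: "norm (f - 4 *\<^sub>R R f) \<le> 4 * norm f"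
proof -
  have "norm (4 *\<^sub>R R f) = 2 * (sqrt 2 * norm f)"
    using real_div_sqrt[of 2] by (simp add: norm_R field_simps)
  also have "\<dots> \<le> 3 * norm f"
    using mult_right_mono[OF sqrt2_bounds(2), of "norm f"] norm_ge_zero[of f] by linarith
  finally show ?thesis using norm_triangle_ineq4[of f "4 *\<^sub>R R f"] by linarith
qed

text \<open>Chain rule: D_1 (R f) = 2 R (D_1 f). Thus the factors in front of R are 1, 2, 4 for a
  function and its first two normal derivatives.\<close>

lemma DH_R:
  assumes "DH e1 f g"
  shows "DH e1 (f - 2 *\<^sub>R R f) (g - 4 *\<^sub>R R g)"
proof -
  let ?q = "\<lambda>h. E ((1 / h) *\<^sub>R (sh (axis e1 h) f - f))"
  have "filterlim (\<lambda>h::real. 2 * h) (at_right 0) (at_right 0)"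
    by (auto simp: filterlim_at eventually_at_filter intro!: tendsto_eq_intros)
  then have "((\<lambda>h. 2 *\<^sub>R R (?q (2 * h))) \<longlongrightarrow> 2 *\<^sub>R R g) (at_right 0)"
    using filterlim_compose[OF assms[unfolded DH_def]] by (intro tendsto_intros R.tendsto) blast
  moreover have "2 *\<^sub>R R (?q (2 * h)) = E ((1 / h) *\<^sub>R (sh (axis e1 h) (R f) - R f))" for h
    by (simp add: R_E R.scaleR R.diff R_sh1 E.scaleR)
  ultimately have "DH e1 (R f) (2 *\<^sub>R R g)"
    by (simp add: DH_def)
  from DH_diff[OF assms DH_scaleR[OF this, of 2]] show ?thesis by simp
qed

lemma R_commute_D2: "i \<noteq> e1 \<Longrightarrow> D2 i f g \<Longrightarrow> D2 i (f - c *\<^sub>R R f) (g - c *\<^sub>R R g)"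
  by (rule D2_bounded_linear[where B = "\<lambda>f. f - c *\<^sub>R R f"])
    (auto intro!: bounded_linear_sub bounded_linear_ident bounded_linear_const_scaleR R_bl simp: R_sh)

text \<open>\<open>U K\<close> need not vanish on the boundary, but \<open>?k0\<close> does, and for
  it integration by parts bounds |D_1 D_j|^2 by |D_1^2| |D_j^2|. Going from \<open>U K\<close> to
  \<open>?k0\<close> and back costs constants only, by the bounds for 1 - R, 1 - 2R and 1 - 4R.
  Difference quotients in direction j take the place of D_j, because D_1^2 D_j \<open>?k0\<close>
  can exceed the available order.\<close>

lemma mixed_interpolation:
  assumes U: "fam U" and K: "size K + 2 \<le> 2 * m" and j: "j \<noteq> e1"
  shows "(norm (U (add_mset e1 (add_mset j K))))\<^sup>2
    \<le> 49 * norm (U (add_mset e1 (add_mset e1 K))) * norm (U (add_mset j (add_mset j K)))"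
proof -
  let ?G = "U K" and ?G1 = "U (add_mset e1 K)" and ?Gj = "U (add_mset j K)"
    and ?G11 = "U (add_mset e1 (add_mset e1 K))" and ?G1j = "U (add_mset e1 (add_mset j K))"
    and ?Gjj = "U (add_mset j (add_mset j K))"
  let ?k0 = "?G - R ?G" and ?k1 = "?G1 - 2 *\<^sub>R R ?G1" and ?k11 = "?G11 - 4 *\<^sub>R R ?G11"
    and ?kj = "?Gj - R ?Gj" and ?kjj = "?Gjj - R ?Gjj" and ?k1j = "?G1j - 2 *\<^sub>R R ?G1j"
  have D1: "D2 e1 ?k0 ?k1"
    using K by (intro R_D2 famD[OF U]) auto
  have D11: "DH e1 ?k1 ?k11"
    using K by (intro DH_R famD[OF U]) auto
  have Dj: "D2 j ?k0 ?kj" "D2 j ?kj ?kjj"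
    using K j R_commute_D2[OF j famD(2)[OF U], of _ 1] by auto
  have D1j: "D2 j ?k1 ?k1j"
    using K j R_commute_D2[OF j famD(2)[OF U], of "add_mset e1 K" 2] by (auto simp: add_mset_commute[of j])
  have E0: "E ?k0 = ?k0"
    using famD(1)[OF U, of K] K by (simp add: E.diff flip: R_E)
  have Ecd: "E (cdiff h j f) = cdiff h j (E f)" for h f
    using E_cdiffs[of "{#j#}" h f] j by simp
  have le: "(norm (cdiff h j ?k1))\<^sup>2 \<le> norm ?kjj * norm ?k11" if "h \<noteq> 0" for h
  proof -
    have "inner (cdiff h j ?k0) (id (cdiff h j ?k11)) = - inner (cdiff h j ?k1) (id (cdiff h j ?k1))"
      by (rule integration_by_parts[OF D2_cdiff[OF D1] _ DH_cdiff[OF D11 j]])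
        (auto simp: Ecd E0 intro: bounded_linear_ident[folded id_def])
    then have "(norm (cdiff h j ?k1))\<^sup>2 = inner (cdiff h j (cdiff h j ?k0)) ?k11"
      by (simp add: power2_norm_eq_inner cdiff_adjoint)
    also have "\<dots> \<le> norm (cdiff h j (cdiff h j ?k0)) * norm ?k11"
      by (rule norm_cauchy_schwarz)
    also have "norm (cdiff h j (cdiff h j ?k0)) \<le> norm (cdiff h j ?kj)"
      by (rule norm_cdiff_le[OF D2_cdiff[OF Dj(1)] that])
    also have "norm (cdiff h j ?kj) \<le> norm ?kjj"
      by (rule norm_cdiff_le[OF Dj(2) that])
    finally show ?thesis by (simp add: mult_right_mono)
  qed
  have "(norm ?k1j)\<^sup>2 \<le> norm ?kjj * norm ?k11"
  proof (rule tendsto_upperbound)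
    show "((\<lambda>h. (norm (cdiff h j ?k1))\<^sup>2) \<longlongrightarrow> (norm ?k1j)\<^sup>2) (at 0)"
      by (intro tendsto_intros tendsto_cdiff D1j)
    show "\<forall>\<^sub>F h in at 0. (norm (cdiff h j ?k1))\<^sup>2 \<le> norm ?kjj * norm ?k11"
      unfolding eventually_at_filter by (intro always_eventually allI impI le)
  qed simp
  also have "\<dots> \<le> (9 / 5 * norm ?Gjj) * (4 * norm ?G11)"
    by (intro mult_mono norm_sub_R norm_sub_4R) auto
  finally have "(norm ?k1j)\<^sup>2 \<le> 36 / 5 * (norm ?G11 * norm ?Gjj)" by (simp add: mult_ac)
  moreover have "(2 / 5 * norm ?G1j)\<^sup>2 \<le> (norm ?k1j)\<^sup>2"
    by (intro power_mono norm_sub_2R) auto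
  ultimately have "4 / 25 * (norm ?G1j)\<^sup>2 \<le> 36 / 5 * (norm ?G11 * norm ?Gjj)"
    by (simp add: power_mult_distrib power_divide)
  moreover have "0 \<le> norm ?G11 * norm ?Gjj" by simp
  \<comment> \<open>The constant is 36/5 times 25/4, that is 45; it is rounded up to 7^2 so that
    powers of 7 can absorb it in \<open>interpolation_max\<close>.\<close>
  ultimately have "(norm ?G1j)\<^sup>2 \<le> 49 * (norm ?G11 * norm ?Gjj)" by linarith
  then show ?thesis by (simp add: mult.assoc)
qed

text \<open>For tangential i, \<open>U K\<close> is two-sided differentiable and one integration by
  parts suffices. For the normal direction the dilate is subtracted first, as in
  \<open>mixed_interpolation\<close>.\<close>

lemma pure_interpolation:
  assumes U: "fam U" and K: "size K + 2 \<le> 2 * m"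
  shows "(norm (U (add_mset i K)))\<^sup>2 \<le> 49 * norm (U K) * norm (U (add_mset i (add_mset i K)))"
proof (cases "i = e1")
  case False
  have "inner (U K) (id (U (add_mset i (add_mset i K)))) = - inner (U (add_mset i K)) (id (U (add_mset i K)))"
    by (rule integration_by_parts[where i = i])
      (use K False in \<open>auto intro: famD[OF U] bounded_linear_ident[folded id_def]\<close>)
  then have "(norm (U (add_mset i K)))\<^sup>2 = \<bar>inner (U K) (U (add_mset i (add_mset i K)))\<bar>"
    by (simp add: power2_norm_eq_inner)
  also have "\<dots> \<le> norm (U K) * norm (U (add_mset i (add_mset i K)))"
    by (rule Cauchy_Schwarz_ineq2)
  also have "\<dots> \<le> 49 * (norm (U K) * norm (U (add_mset i (add_mset i K))))"
    using mult_nonneg_nonneg[OF norm_ge_zero norm_ge_zero, of "U K" "U (add_mset i (add_mset i K))"] by linarith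
  finally show ?thesis by (simp add: mult.assoc)
next
  case True
  let ?G = "U K" and ?G1 = "U (add_mset e1 K)" and ?G11 = "U (add_mset e1 (add_mset e1 K))"
  let ?k0 = "?G - R ?G" and ?k1 = "?G1 - 2 *\<^sub>R R ?G1" and ?k11 = "?G11 - 4 *\<^sub>R R ?G11"
  have D1: "D2 e1 ?k0 ?k1"
    using K by (intro R_D2 famD[OF U]) auto
  have D11: "DH e1 ?k1 ?k11"
    using K by (intro DH_R famD[OF U]) auto
  have E0: "E ?k0 = ?k0"
    using famD(1)[OF U, of K] K by (simp add: E.diff flip: R_E)
  have "inner ?k0 (id ?k11) = - inner ?k1 (id ?k1)"
    by (rule integration_by_parts[OF D1 E0 D11]) (auto intro: bounded_linear_ident[folded id_def])
  then have "(norm ?k1)\<^sup>2 = \<bar>inner ?k0 ?k11\<bar>"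
    by (simp add: power2_norm_eq_inner)
  also have "\<dots> \<le> norm ?k0 * norm ?k11"
    by (rule Cauchy_Schwarz_ineq2)
  also have "\<dots> \<le> (9 / 5 * norm ?G) * (4 * norm ?G11)"
    by (intro mult_mono norm_sub_R norm_sub_4R) auto
  finally have "(norm ?k1)\<^sup>2 \<le> 36 / 5 * (norm ?G * norm ?G11)" by simp
  moreover have "(2 / 5 * norm ?G1)\<^sup>2 \<le> (norm ?k1)\<^sup>2"
    by (intro power_mono norm_sub_2R) auto
  ultimately have "4 / 25 * (norm ?G1)\<^sup>2 \<le> 36 / 5 * (norm ?G * norm ?G11)"
    by (simp add: power_mult_distrib power_divide)
  moreover have "0 \<le> norm ?G * norm ?G11" by simp
  ultimately have "(norm ?G1)\<^sup>2 \<le> 49 * (norm ?G * norm ?G11)" by linarith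
  then show ?thesis using True by (simp add: mult.assoc)
qed

end

section \<open>Log-convex sequences and absorption of the top normal derivative\<close>

section \<open>Interpolation of norms\<close>

text \<open>A log-convex sequence is largest at an end. At the first interior maximum the left
  neighbour would be strictly smaller, and the product of the neighbours would fall below the
  square.\<close>

lemma discrete_max_principle:
  fixes d :: "nat \<Rightarrow> real"
  assumes "p \<le> k" "k \<le> q" "\<And>k. p \<le> k \<Longrightarrow> k \<le> q \<Longrightarrow> 0 \<le> d k"
    and "\<And>k. p < k \<Longrightarrow> k < q \<Longrightarrow> (d k)\<^sup>2 \<le> d (k - 1) * d (k + 1)"
  shows "d k \<le> max (d p) (d q)"
proof (rule ccontr)
  assume "\<not> ?thesis"
  then have k: "max (d p) (d q) < d k" by (simp only: not_le)
  define B where "B = Max (d ` {p..q})"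
  have fin: "finite (d ` {p..q})" "d ` {p..q} \<noteq> {}" using assms by auto
  have le: "d j \<le> B" if "p \<le> j" "j \<le> q" for j
    unfolding B_def using that by (intro Max_ge) auto
  obtain j0 where "p \<le> j0" "j0 \<le> q" "d j0 = B"
    using Max_in[OF fin] by (auto simp: B_def)
  then have ex: "\<exists>j. p \<le> j \<and> j \<le> q \<and> d j = B" by blast
  define j where "j = (LEAST j. p \<le> j \<and> j \<le> q \<and> d j = B)"
  have j: "p \<le> j" "j \<le> q" "d j = B"
    using LeastI_ex[OF ex] by (auto simp: j_def)
  have "d k \<le> B" using le assms by simp
  then have "j \<noteq> p" "j \<noteq> q" "0 < B"
    using j k assms(3)[of p] assms(1,2) by (auto simp: max_def split: if_splits)
  with j have j': "p < j" "j < q" by auto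
  have "d (j - 1) \<noteq> B"
    using not_less_Least[of "j - 1" "\<lambda>j. p \<le> j \<and> j \<le> q \<and> d j = B"] j' by (auto simp: j_def[symmetric])
  moreover have "d (j - 1) \<le> B"
    by (rule le) (use j' in linarith)+
  ultimately have lt: "d (j - 1) < B" by simp
  have "d (j - 1) * d (j + 1) \<le> d (j - 1) * B"
    using j' by (intro mult_left_mono le assms(3)) linarith+
  also have "\<dots> < B * B"
    using lt \<open>0 < B\<close> by (rule mult_strict_right_mono)
  finally have "d (j - 1) * d (j + 1) < B * B" .
  with assms(4)[OF j'] j(3) show False by (simp add: power2_eq_square)
qed

text \<open>Dividing by 7 to the power (k - p)(q - k) removes the factor 49: the second difference
  of this exponent is -2, and it vanishes at both ends.\<close>

lemma interpolation_max:
  fixes c :: "nat \<Rightarrow> real"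
  assumes "p \<le> k" "k \<le> q" "\<And>k. p \<le> k \<Longrightarrow> k \<le> q \<Longrightarrow> 0 \<le> c k"
    and "\<And>k. p < k \<Longrightarrow> k < q \<Longrightarrow> (c k)\<^sup>2 \<le> 49 * c (k - 1) * c (k + 1)"
  shows "c k \<le> 7 ^ ((q - p) * (q - p)) * max (c p) (c q)"
proof -
  define e where "e k = (k - p) * (q - k)" for k
  define d where "d k = c k / 7 ^ e k" for k
  have "d k \<le> max (d p) (d q)"
  proof (rule discrete_max_principle[OF assms(1,2)])
    show "0 \<le> d k" if "p \<le> k" "k \<le> q" for k using assms(3) that by (simp add: d_def)
    fix k assume k: "p < k" "k < q"
    obtain a b where ab: "k = p + a + 1" "q = k + b + 1"
      using k that[of "k - p - 1" "q - k - 1"] by simp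
    have e: "e k + e k = e (k - 1) + e (k + 1) + 2"
      by (simp add: e_def ab algebra_simps)
    have "(d k)\<^sup>2 = (c k)\<^sup>2 / 7 ^ (e (k - 1) + e (k + 1) + 2)"
      unfolding d_def e[symmetric] by (simp add: power_divide power2_eq_square power_add)
    also have "\<dots> \<le> (49 * c (k - 1) * c (k + 1)) / 7 ^ (e (k - 1) + e (k + 1) + 2)"
      by (intro divide_right_mono assms(4) k) auto
    also have "\<dots> = d (k - 1) * d (k + 1)"
      by (simp add: d_def power_add)
    finally show "(d k)\<^sup>2 \<le> d (k - 1) * d (k + 1)" .
  qed
  also have "max (d p) (d q) = max (c p) (c q)" by (simp add: d_def e_def)
  finally have "c k \<le> 7 ^ e k * max (c p) (c q)"
    by (simp add: d_def field_simps)
  also have "\<dots> \<le> 7 ^ ((q - p) * (q - p)) * max (c p) (c q)"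
  proof (intro mult_right_mono power_increasing)
    show "e k \<le> (q - p) * (q - p)" unfolding e_def by (intro mult_le_mono) (use assms in auto)
    show "0 \<le> max (c p) (c q)" using assms(3)[of p] assms(1,2) by (auto simp: max_def)
  qed auto
  finally show ?thesis .
qed

lemma size_filter_neq: "size (filter_mset (\<lambda>i. i \<noteq> a) M) + count M a = size M"
  by (induction M) auto

lemma ex_submultiset_size: "n \<le> size T \<Longrightarrow> \<exists>S. S \<subseteq># T \<and> size S = n"
proof -
  assume n: "n \<le> size T"
  obtain xs where xs: "mset xs = T" using ex_mset by blast
  have "mset (take n xs @ drop n xs) = mset (take n xs) + mset (drop n xs)"
    by (rule mset_append)
  then have "mset (take n xs) \<subseteq># T"
    using xs by simp
  moreover have "size (mset (take n xs)) = n"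
    using n by (simp add: xs[symmetric] min_absorb2)
  ultimately show ?thesis by blast
qed

context
  fixes m :: nat and \<delta> :: real and e1 :: "'d::finite"
  assumes m: "1 \<le> m" and \<delta>: "0 < \<delta>"
begin

text \<open>Stated for arbitrary numbers \<open>u M\<close> in place of norms, so that C depends
  only on m, \<delta> and the set of directions. Let \<open>a k\<close> be the largest entry of
  order 2m with k normal directions and x the entry with 2m of them. For k \<le> m the tangential
  bound applies. Interpolation between m and 2m with weights s^k bounds the others below 2m by
  \<open>G * f + Q * s * x\<close>, and the normal inequality then bounds x, once s is small
  enough.\<close>

lemma top_order_bound:
  "\<exists>C. \<forall>(u :: 'd multiset \<Rightarrow> real) f. (\<forall>M. 0 \<le> u M) \<longrightarrow> 0 \<le> f \<longrightarrow>
     (\<forall>K S. size K = m \<longrightarrow> size S = m \<longrightarrow> e1 \<notin># S \<longrightarrow> \<delta> * u (K + S) \<le> f) \<longrightarrow>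
     \<delta> * u (replicate_mset m e1 + replicate_mset m e1) \<le> f + inverse \<delta> *
       (\<Sum>(M, N)\<in>{M. size M = m} \<times> {N. size N = m} - {(replicate_mset m e1, replicate_mset m e1)}. u (M + N)) \<longrightarrow>
     (\<forall>K j. size K + 2 \<le> 2 * m \<longrightarrow> j \<noteq> e1 \<longrightarrow>
        (u (add_mset e1 (add_mset j K)))\<^sup>2 \<le> 49 * u (add_mset e1 (add_mset e1 K)) * u (add_mset j (add_mset j K))) \<longrightarrow>
     (\<forall>M. size M = 2 * m \<longrightarrow> u M \<le> C * f)"
proof -
  define J where "J = replicate_mset m e1"
  define Q :: real where "Q = 7 ^ (m * m)"
  have Q: "1 \<le> Q" by (simp add: Q_def)
  let ?I = "{M :: 'd multiset. size M = m}"
  define n where "n = real (card (?I \<times> ?I))"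
  have n: "0 \<le> n" by (simp add: n_def)
  \<comment> \<open>So small that the terms with x on the right of the normal inequality, at most n
    in number, amount to no more than half of \<delta> x.\<close>
  define s where "s = min 1 (\<delta>\<^sup>2 / (2 * (n + 1) * Q))"
  have s: "0 < s" "s \<le> 1" "s \<le> \<delta>\<^sup>2 / (2 * (n + 1) * Q)"
    using \<delta> Q n by (auto simp: s_def intro!: divide_pos_pos mult_pos_pos)
  define G where "G = Q * inverse (s ^ m) * inverse \<delta>"
  have G: "inverse \<delta> \<le> G" "0 < G"
  proof -
    have "s ^ m \<le> 1" "0 < s ^ m" using s by (simp_all add: power_le_one)
    then have "1 \<le> inverse (s ^ m)" by (simp add: one_le_inverse)
    then have "1 * 1 \<le> Q * inverse (s ^ m)" using Q by (intro mult_mono) auto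
    then show "inverse \<delta> \<le> G" "0 < G"
      using \<delta> Q s mult_right_mono[of 1 "Q * inverse (s ^ m)" "inverse \<delta>"] by (auto simp: G_def)
  qed
  define B where "B = (1 + inverse \<delta> * n * G) * (2 * inverse \<delta>)"
  have B: "0 \<le> B" using \<delta> n G by (simp add: B_def)
  define C where "C = G + Q * B"
  show ?thesis
  proof (intro exI[of _ C] allI impI)
    fix u :: "'d multiset \<Rightarrow> real" and f :: real and M0 :: "'d multiset"
    assume u: "\<forall>M. 0 \<le> u M" and f: "0 \<le> f"
      and tan: "\<forall>K S. size K = m \<longrightarrow> size S = m \<longrightarrow> e1 \<notin># S \<longrightarrow> \<delta> * u (K + S) \<le> f"
      and nor: "\<delta> * u (replicate_mset m e1 + replicate_mset m e1) \<le> f + inverse \<delta> *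
       (\<Sum>(M, N)\<in>{M. size M = m} \<times> {N. size N = m} - {(replicate_mset m e1, replicate_mset m e1)}. u (M + N))"
      and mix: "\<forall>K j. size K + 2 \<le> 2 * m \<longrightarrow> j \<noteq> e1 \<longrightarrow>
        (u (add_mset e1 (add_mset j K)))\<^sup>2 \<le> 49 * u (add_mset e1 (add_mset e1 K)) * u (add_mset j (add_mset j K))"
      and M0: "size M0 = 2 * m"
    define a where "a k = Max (insert 0 (u ` {M. size M = 2 * m \<and> count M e1 = k}))" for k
    have fin: "finite (insert 0 (u ` {M. size M = 2 * m \<and> count M e1 = k}))" for k
      by (auto intro: finite_subset[OF _ finite_size_multisets[of "2 * m"]])
    have a_ge: "u M \<le> a k" if "size M = 2 * m" "count M e1 = k" for M k
      unfolding a_def using that by (intro Max_ge fin) auto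
    have a0: "0 \<le> a k" for k unfolding a_def by (intro Max_ge fin) auto
    have a_cases: "a k = 0 \<or> (\<exists>M. size M = 2 * m \<and> count M e1 = k \<and> a k = u M)" for k
      using Max_in[OF fin[of k]] by (auto simp: a_def)
    have low: "a k \<le> inverse \<delta> * f" if k: "k \<le> m" for k
    proof (cases "a k = 0")
      case True then show ?thesis using f \<delta> by simp
    next
      case False
      then obtain M where M: "size M = 2 * m" "count M e1 = k" "a k = u M" using a_cases by blast
      \<comment> \<open>M contains at least m tangential directions; m of them form S and the rest
        of M forms K.\<close>
      define T where "T = filter_mset (\<lambda>i. i \<noteq> e1) M"
      have "m \<le> size T"
        using size_filter_neq[of e1 M] M k by (simp add: T_def)
      then obtain S where S: "S \<subseteq># T" "size S = m"
        using ex_submultiset_size by blast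
      have "S \<subseteq># M" using S(1) unfolding T_def by (rule subset_mset.order_trans) simp
      moreover have "e1 \<notin># S"
        using mset_subset_eqD[OF S(1), of e1] by (auto simp: T_def)
      moreover have "size (M - S) = m"
        using \<open>S \<subseteq># M\<close> S(2) M(1) by (simp add: size_Diff_submset)
      ultimately have "\<delta> * u ((M - S) + S) \<le> f"
        using tan S(2) by blast
      then have "\<delta> * u M \<le> f"
        using \<open>S \<subseteq># M\<close> by (simp only: subset_mset.diff_add)
      then show ?thesis
        using \<delta> M(3) by (simp add: field_simps)
    qed
    define x where "x = u (J + J)"
    have a2m: "a (2 * m) \<le> x"
    proof (cases "a (2 * m) = 0")
      case True then show ?thesis using u by (simp add: x_def)
    next
      case False
      then obtain M where M: "size M = 2 * m" "count M e1 = 2 * m" "a (2 * m) = u M" using a_cases by blast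
      have "filter_mset (\<lambda>i. i \<noteq> e1) M = {#}"
        using size_filter_neq[of e1 M] M by (metis add_cancel_left_left size_eq_0_iff_empty)
      then have "M = J + J"
        using M(2) by (intro multiset_eqI) (auto simp: J_def filter_mset_eq_mempty_iff count_eq_zero_iff)
      with M show ?thesis by (simp add: x_def)
    qed
    have conv: "(a k)\<^sup>2 \<le> 49 * a (k - 1) * a (k + 1)" if k: "m < k" "k < 2 * m" for k
    proof (cases "a k = 0")
      case True then show ?thesis using a0 by simp
    next
      case False
      then obtain M where M: "size M = 2 * m" "count M e1 = k" "a k = u M" using a_cases by blast
      obtain M' where M': "M = add_mset e1 M'"
        using M k by (metis count_greater_zero_iff less_nat_zero_code mset_add neq0_conv)
      have "filter_mset (\<lambda>i. i \<noteq> e1) M \<noteq> {#}"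
      proof
        assume "filter_mset (\<lambda>i. i \<noteq> e1) M = {#}"
        then have "size (filter_mset (\<lambda>i. i \<noteq> e1) M) = 0" by (simp only: size_empty)
        then show False using size_filter_neq[of e1 M] M k by linarith
      qed
      then obtain j where j: "j \<in># M" "j \<noteq> e1"
        by (auto simp: filter_mset_eq_mempty_iff)
      then obtain K where K: "M' = add_mset j K"
        using M' by (metis insert_noteq_member multi_member_split)
      have "(u (add_mset e1 (add_mset j K)))\<^sup>2 \<le> 49 * u (add_mset e1 (add_mset e1 K)) * u (add_mset j (add_mset j K))"
        using mix M M' K j by auto
      also have "\<dots> \<le> 49 * a (k + 1) * a (k - 1)"
        using M M' K j u a0 by (intro mult_mono mult_left_mono a_ge) auto
      finally show ?thesis using M M' K by (simp add: mult_ac)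
    qed
    have a_le: "a k \<le> G * f + Q * s * x" if k: "k < 2 * m" for k
    proof (cases "k \<le> m")
      case True
      have "inverse \<delta> * f \<le> G * f" using G f by (intro mult_right_mono) auto
      moreover have "0 \<le> Q * s * x" using Q s u by (simp add: x_def)
      ultimately show ?thesis using low[OF True] by linarith
    next
      case False
      \<comment> \<open>Geometric weights preserve log-convexity, and with s < 1 they shift the cost
        from the end 2m to the end m.\<close>
      have "s ^ k * a k \<le> 7 ^ ((2 * m - m) * (2 * m - m)) * max (s ^ m * a m) (s ^ (2 * m) * a (2 * m))"
      proof (rule interpolation_max)
        fix k assume k: "m < k" "k < 2 * m"
        then obtain l where l: "k = Suc l" by (cases k) auto
        have "(s ^ k * a k)\<^sup>2 = (s ^ (k - 1) * s ^ (k + 1)) * (a k)\<^sup>2"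
          by (simp add: l power_mult_distrib power2_eq_square)
        also have "\<dots> \<le> (s ^ (k - 1) * s ^ (k + 1)) * (49 * a (k - 1) * a (k + 1))"
          using s by (intro mult_left_mono conv k) auto
        finally show "(s ^ k * a k)\<^sup>2 \<le> 49 * (s ^ (k - 1) * a (k - 1)) * (s ^ (k + 1) * a (k + 1))"
          by (simp add: mult_ac)
      qed (use False k s a0 in auto)
      also have "\<dots> \<le> Q * (s ^ m * (inverse \<delta> * f) + s ^ (2 * m) * x)"
      proof -
        have "s ^ m * a m \<le> s ^ m * (inverse \<delta> * f)" "s ^ (2 * m) * a (2 * m) \<le> s ^ (2 * m) * x"
          using s low[of m] a2m by (auto intro!: mult_left_mono)
        moreover have "0 \<le> s ^ m * a m" "0 \<le> s ^ (2 * m) * a (2 * m)" using s a0 by auto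
        ultimately have "max (s ^ m * a m) (s ^ (2 * m) * a (2 * m)) \<le> s ^ m * (inverse \<delta> * f) + s ^ (2 * m) * x"
          by linarith
        then show ?thesis using Q by (simp add: Q_def mult_left_mono)
      qed
      finally have 1: "s ^ k * a k \<le> Q * (s ^ m * (inverse \<delta> * f) + s ^ (2 * m) * x)" .
      have 2: "s ^ m \<le> s ^ k * inverse (s ^ m)"
      proof -
        have "s ^ (2 * m) \<le> s ^ k" using s k by (intro power_decreasing) auto
        then have "s ^ m * s ^ m \<le> s ^ k" by (simp add: mult_2 power_add)
        then show ?thesis using s by (simp add: field_simps)
      qed
      have 3: "s ^ (2 * m) \<le> s ^ k * s"
        using s k power_decreasing[of "Suc k" "2 * m" s] by (simp add: mult.commute)
      have "s ^ k * a k \<le> Q * ((s ^ k * inverse (s ^ m)) * (inverse \<delta> * f) + (s ^ k * s) * x)"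
        using 1 2 3 Q f \<delta> u by (elim order_trans, intro mult_left_mono add_mono mult_right_mono) (auto simp: x_def)
      also have "\<dots> = s ^ k * (G * f + Q * s * x)"
        by (simp add: G_def algebra_simps)
      finally show ?thesis using s by (simp add: mult_le_cancel_left)
    qed
    have x_le: "x \<le> B * f"
    proof -
      have "(\<Sum>(M, N)\<in>?I \<times> ?I - {(J, J)}. u (M + N)) \<le> (\<Sum>(M, N)\<in>?I \<times> ?I - {(J, J)}. G * f + Q * s * x)"
      proof (rule sum_mono)
        fix p assume "p \<in> ?I \<times> ?I - {(J, J)}"
        then obtain M N where p: "p = (M, N)" "size M = m" "size N = m" "\<not> (M = J \<and> N = J)" by auto
        have cnt: "M = J" if "size M = m" "count M e1 = m" for M :: "'d multiset"
        proof -
          have "filter_mset (\<lambda>i. i \<noteq> e1) M = {#}"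
            using size_filter_neq[of e1 M] that by (metis add_cancel_left_left size_eq_0_iff_empty)
          then show ?thesis
            using that by (intro multiset_eqI) (auto simp: J_def filter_mset_eq_mempty_iff count_eq_zero_iff)
        qed
        have "count M e1 + count N e1 < 2 * m"
          using p cnt[of M] cnt[of N] count_le_size[of M e1] count_le_size[of N e1] by linarith
        then have "u (M + N) \<le> G * f + Q * s * x"
          using a_ge[of "M + N"] a_le[of "count (M + N) e1"] p by fastforce
        then show "(case p of (M, N) \<Rightarrow> u (M + N)) \<le> (case p of (M, N) \<Rightarrow> G * f + Q * s * x)"
          by (simp add: p)
      qed
      also have "\<dots> = real (card (?I \<times> ?I - {(J, J)})) * (G * f + Q * s * x)"
        by (simp add: case_prod_unfold)
      also have "\<dots> \<le> n * (G * f + Q * s * x)"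
        unfolding n_def using G Q s f u
        by (intro mult_right_mono of_nat_mono card_mono) (auto simp: x_def intro!: add_nonneg_nonneg mult_nonneg_nonneg)
      finally have "\<delta> * x \<le> f + inverse \<delta> * (n * (G * f + Q * s * x))"
        using nor \<delta> unfolding x_def[symmetric] J_def[symmetric]
        by (elim order_trans) (simp add: mult_left_mono)
      moreover have "inverse \<delta> * (n * (Q * s * x)) \<le> \<delta> / 2 * x"
      proof -
        have "n * (Q * s) \<le> (n + 1) * (Q * (\<delta>\<^sup>2 / (2 * (n + 1) * Q)))"
          using n Q s by (intro mult_mono) auto
        also have "\<dots> = \<delta>\<^sup>2 / 2"
        proof -
          have gen: "a * (Q * (\<delta>\<^sup>2 / (2 * a * Q))) = \<delta>\<^sup>2 / 2" if "a \<noteq> 0" for a :: real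
            using that Q by (simp add: field_simps)
          show ?thesis by (rule gen) (use n in linarith)
        qed
        finally have "inverse \<delta> * (n * (Q * s)) \<le> \<delta> / 2"
          using \<delta> by (simp add: field_simps power2_eq_square)
        from mult_right_mono[OF this, of x] show ?thesis using u by (simp add: x_def mult_ac)
      qed
      ultimately have "\<delta> / 2 * x \<le> (1 + inverse \<delta> * n * G) * f"
        by (simp add: algebra_simps)
      then have "(2 * inverse \<delta>) * (\<delta> / 2 * x) \<le> (2 * inverse \<delta>) * ((1 + inverse \<delta> * n * G) * f)"
        using \<delta> by (intro mult_left_mono) auto
      moreover have "(2 * inverse \<delta>) * (\<delta> / 2 * x) = x"
        using \<delta> by (simp add: field_simps)
      ultimately show ?thesis by (simp only: B_def mult_ac)
    qed
    have x0: "0 \<le> x" using u by (simp add: x_def)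
    show "u M0 \<le> C * f"
    proof (cases "count M0 e1 < 2 * m")
      case True
      have "u M0 \<le> G * f + Q * s * x" using a_ge[OF M0 refl] a_le[OF True] by linarith
      also have "\<dots> \<le> G * f + Q * 1 * (B * f)"
        using s Q x_le x0 by (intro add_left_mono mult_mono mult_left_mono) auto
      finally show ?thesis by (simp add: C_def algebra_simps)
    next
      case False
      then have "count M0 e1 = 2 * m" using count_le_size[of M0 e1] M0 by linarith
      then have "u M0 \<le> B * f" using a_ge[OF M0] a2m x_le by fastforce
      also have "\<dots> \<le> Q * (B * f)" using mult_right_mono[OF Q, of "B * f"] B f by simp
      also have "\<dots> \<le> C * f" using G f by (simp add: C_def algebra_simps)
      finally show ?thesis .
    qed
  qed
qed

text \<open>Again a statement about numbers only, so that N is fixed before T, the coefficients, lam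
  and the function. Weighted with powers of lam, the largest entries of each order remain log-convex
  up to the factor 49, as the weights are geometric in the order. The end 0 is bounded by the
  zero-order hypothesis and the end 2m by \<open>top_order_bound\<close>.\<close>

lemma all_orders_bound:
  "\<exists>N. \<forall>(u :: 'd multiset \<Rightarrow> real) f ut lam. (\<forall>M. 0 \<le> u M) \<longrightarrow> 0 \<le> f \<longrightarrow> 0 \<le> lam \<longrightarrow>
     (\<forall>K S. size K = m \<longrightarrow> size S = m \<longrightarrow> e1 \<notin># S \<longrightarrow> \<delta> * u (K + S) \<le> f) \<longrightarrow>
     \<delta> * u (replicate_mset m e1 + replicate_mset m e1) \<le> f + inverse \<delta> *
       (\<Sum>(M, N)\<in>{M. size M = m} \<times> {N. size N = m} - {(replicate_mset m e1, replicate_mset m e1)}. u (M + N)) \<longrightarrow>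
     (\<forall>K j. size K + 2 \<le> 2 * m \<longrightarrow> j \<noteq> e1 \<longrightarrow>
        (u (add_mset e1 (add_mset j K)))\<^sup>2 \<le> 49 * u (add_mset e1 (add_mset e1 K)) * u (add_mset j (add_mset j K))) \<longrightarrow>
     (\<forall>K i. size K + 2 \<le> 2 * m \<longrightarrow>
        (u (add_mset i K))\<^sup>2 \<le> 49 * u K * u (add_mset i (add_mset i K))) \<longrightarrow>
     ut \<le> f + inverse \<delta> * (\<Sum>(M, N)\<in>{M. size M = m} \<times> {N. size N = m}. u (M + N)) \<longrightarrow>
     lam * u {#} \<le> f + inverse \<delta> * (\<Sum>(M, N)\<in>{M. size M = m} \<times> {N. size N = m}. u (M + N)) \<longrightarrow>
     ut + (\<Sum>M | size M \<le> 2 * m. rpow lam (1 - real (size M) / real (2 * m)) * u M) \<le> N * f"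
proof -
  obtain C where C: "\<And>(u :: 'd multiset \<Rightarrow> real) f M. \<lbrakk>\<forall>M. 0 \<le> u M; 0 \<le> f;
     \<forall>K S. size K = m \<longrightarrow> size S = m \<longrightarrow> e1 \<notin># S \<longrightarrow> \<delta> * u (K + S) \<le> f;
     \<delta> * u (replicate_mset m e1 + replicate_mset m e1) \<le> f + inverse \<delta> *
       (\<Sum>(M, N)\<in>{M. size M = m} \<times> {N. size N = m} - {(replicate_mset m e1, replicate_mset m e1)}. u (M + N));
     \<forall>K j. size K + 2 \<le> 2 * m \<longrightarrow> j \<noteq> e1 \<longrightarrow>
        (u (add_mset e1 (add_mset j K)))\<^sup>2 \<le> 49 * u (add_mset e1 (add_mset e1 K)) * u (add_mset j (add_mset j K));
     size M = 2 * m\<rbrakk> \<Longrightarrow> u M \<le> C * f"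
    using top_order_bound by (elim exE) blast
  let ?I = "{M :: 'd multiset. size M = m}"
  let ?J = "{M :: 'd multiset. size M \<le> 2 * m}"
  define D where "D = 1 + inverse \<delta> * (real (card (?I \<times> ?I)) * \<bar>C\<bar>)"
  define Q :: real where "Q = 7 ^ (2 * m * (2 * m))"
  have D: "1 \<le> D" using \<delta> by (simp add: D_def)
  define H where "H = Q * max D \<bar>C\<bar>"
  have H: "0 \<le> H" "\<bar>C\<bar> \<le> H"
    using D mult_mono[of 1 Q "\<bar>C\<bar>" "max D \<bar>C\<bar>"] by (auto simp: H_def Q_def)
  have finJ: "finite ?J"
    using finite_UN_I[of "{..2 * m}" "\<lambda>n. {M :: 'd multiset. size M = n}"] by (simp add: UNION_eq)
  show ?thesis
  proof (intro exI[of _ "D + real (card ?J) * H"] allI impI)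
    fix u :: "'d multiset \<Rightarrow> real" and f ut lam :: real
    assume u: "\<forall>M. 0 \<le> u M" and f: "0 \<le> f" and lam: "0 \<le> lam"
      and tan: "\<forall>K S. size K = m \<longrightarrow> size S = m \<longrightarrow> e1 \<notin># S \<longrightarrow> \<delta> * u (K + S) \<le> f"
      and nor: "\<delta> * u (replicate_mset m e1 + replicate_mset m e1) \<le> f + inverse \<delta> *
       (\<Sum>(M, N)\<in>{M. size M = m} \<times> {N. size N = m} - {(replicate_mset m e1, replicate_mset m e1)}. u (M + N))"
      and mix: "\<forall>K j. size K + 2 \<le> 2 * m \<longrightarrow> j \<noteq> e1 \<longrightarrow>
        (u (add_mset e1 (add_mset j K)))\<^sup>2 \<le> 49 * u (add_mset e1 (add_mset e1 K)) * u (add_mset j (add_mset j K))"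
      and pure: "\<forall>K i. size K + 2 \<le> 2 * m \<longrightarrow> (u (add_mset i K))\<^sup>2 \<le> 49 * u K * u (add_mset i (add_mset i K))"
      and ut: "ut \<le> f + inverse \<delta> * (\<Sum>(M, N)\<in>{M. size M = m} \<times> {N. size N = m}. u (M + N))"
      and u0: "lam * u {#} \<le> f + inverse \<delta> * (\<Sum>(M, N)\<in>{M. size M = m} \<times> {N. size N = m}. u (M + N))"
    have top: "u M \<le> \<bar>C\<bar> * f" if "size M = 2 * m" for M
      using C[OF u f tan nor mix that] f mult_right_mono[of C "\<bar>C\<bar>" f] by linarith
    have "(\<Sum>(M, N)\<in>?I \<times> ?I. u (M + N)) \<le> (\<Sum>(M, N)\<in>?I \<times> ?I. \<bar>C\<bar> * f)"
      by (intro sum_mono) (auto intro!: top)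
    then have "inverse \<delta> * (\<Sum>(M, N)\<in>?I \<times> ?I. u (M + N)) \<le> inverse \<delta> * (real (card (?I \<times> ?I)) * (\<bar>C\<bar> * f))"
      using \<delta> by (intro mult_left_mono) (auto simp: case_prod_unfold)
    then have D': "ut \<le> D * f" "lam * u {#} \<le> D * f"
      using ut u0 by (auto simp: D_def algebra_simps)
    have each: "rpow lam (1 - real (size M) / real (2 * m)) * u M \<le> H * f" if M: "size M \<le> 2 * m" for M
    proof (cases "size M = 2 * m")
      case True
      have "u M \<le> H * f" using top[OF True] H f mult_right_mono[of "\<bar>C\<bar>" H f] by linarith
      then show ?thesis using m True by (simp add: rpow_def)
    next
      case False
      then have ne: "1 - real (size M) / real (2 * m) \<noteq> 0" using m by (simp add: field_simps)
      show ?thesis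
      \<comment> \<open>For lam = 0 the weight vanishes at all orders below 2m, which are the ones
        left here; order 2m has weight 1 by the convention 0^0 = 1.\<close>
      proof (cases "lam = 0")
        case True
        then have "rpow lam (1 - real (size M) / real (2 * m)) = 0"
          using ne by (simp only: rpow_def if_False powr_zero_eq_one powr_0)
        then show ?thesis using H f by simp
      next
        case False
        with lam have lam: "0 < lam" by simp
        define b where "b k = Max (insert 0 (u ` {M. size M = k}))" for k
        have fin: "finite (insert 0 (u ` {M. size M = k}))" for k by simp
        have b_ge: "u M \<le> b (size M)" for M
          unfolding b_def by (intro Max_ge fin) auto
        have b0: "0 \<le> b k" for k unfolding b_def by (intro Max_ge fin) auto
        have b_cases: "b k = 0 \<or> (\<exists>M. size M = k \<and> b k = u M)" for k
          using Max_in[OF fin[of k]] by (auto simp: b_def)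
        define c where "c k = lam powr (1 - real k / real (2 * m)) * b k" for k
        have cM: "c (size M) \<le> 7 ^ ((2 * m - 0) * (2 * m - 0)) * max (c 0) (c (2 * m))"
        proof (rule interpolation_max)
          show "0 \<le> c k" for k using b0 by (simp add: c_def)
          fix k assume k: "0 < k" "k < 2 * m"
          have b: "(b k)\<^sup>2 \<le> 49 * b (k - 1) * b (k + 1)"
          proof (cases "b k = 0")
            case True then show ?thesis using b0 by simp
          next
            case False
            then obtain M where M: "size M = k" "b k = u M" using b_cases by blast
            obtain i K where K: "M = add_mset i K" using M k by (cases M) auto
            have "(u M)\<^sup>2 \<le> 49 * u K * u (add_mset i (add_mset i K))"
              using pure K M k by auto
            also have "\<dots> \<le> 49 * b (k - 1) * b (k + 1)"
              using b_ge[of K] b_ge[of "add_mset i (add_mset i K)"] K M u b0 by (intro mult_mono mult_left_mono) auto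
            finally show ?thesis using M by simp
          qed
          have p: "(lam powr (1 - real k / real (2 * m)))\<^sup>2
            = lam powr (1 - real (k - 1) / real (2 * m)) * lam powr (1 - real (k + 1) / real (2 * m))"
          proof -
            have "(1 - real k / real (2 * m)) + (1 - real k / real (2 * m))
              = (1 - real (k - 1) / real (2 * m)) + (1 - real (k + 1) / real (2 * m))"
              using k m by (simp add: of_nat_diff field_simps)
            then show ?thesis by (simp only: power2_eq_square powr_add[symmetric])
          qed
          have "(c k)\<^sup>2 \<le> (lam powr (1 - real (k - 1) / real (2 * m)) * lam powr (1 - real (k + 1) / real (2 * m)))
              * (49 * b (k - 1) * b (k + 1))"
            unfolding c_def power_mult_distrib p by (intro mult_left_mono b) auto
          then show "(c k)\<^sup>2 \<le> 49 * c (k - 1) * c (k + 1)"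
            by (simp add: c_def mult_ac)
        qed (use M in auto)
        have c0: "c 0 \<le> max D \<bar>C\<bar> * f"
        proof -
          have "b 0 = u {#}" using b_cases[of 0] b_ge[of "{#}"] u by (auto intro: antisym)
          then have "c 0 \<le> D * f" using D'(2) lam by (simp add: c_def)
          also have "\<dots> \<le> max D \<bar>C\<bar> * f" using f by (intro mult_right_mono) auto
          finally show ?thesis .
        qed
        have c2m: "c (2 * m) \<le> max D \<bar>C\<bar> * f"
        proof -
          have "b (2 * m) \<le> \<bar>C\<bar> * f" using b_cases[of "2 * m"] top f by auto
          then have "c (2 * m) \<le> \<bar>C\<bar> * f" using lam m by (simp add: c_def)
          also have "\<dots> \<le> max D \<bar>C\<bar> * f" using f by (intro mult_right_mono) auto
          finally show ?thesis .
        qed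
        have "max (c 0) (c (2 * m)) \<le> max D \<bar>C\<bar> * f"
          using c0 c2m by (rule max.boundedI)
        then have "Q * max (c 0) (c (2 * m)) \<le> Q * (max D \<bar>C\<bar> * f)"
          by (intro mult_left_mono) (auto simp: Q_def)
        moreover have "c (size M) \<le> Q * max (c 0) (c (2 * m))"
          using cM by (simp add: Q_def)
        ultimately have "c (size M) \<le> H * f"
          unfolding H_def by (simp only: mult.assoc)
        moreover have "rpow lam (1 - real (size M) / real (2 * m)) * u M \<le> c (size M)"
          unfolding rpow_def c_def if_not_P[OF ne] by (intro mult_left_mono b_ge) simp
        ultimately show ?thesis by linarith
      qed
    qed
    have "(\<Sum>M\<in>?J. rpow lam (1 - real (size M) / real (2 * m)) * u M) \<le> (\<Sum>M\<in>?J. H * f)"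
      by (intro sum_mono each) auto
    then show "ut + (\<Sum>M | size M \<le> 2 * m. rpow lam (1 - real (size M) / real (2 * m)) * u M) \<le> (D + real (card ?J) * H) * f"
      using D'(1) by (simp add: algebra_simps)
  qed
qed

end

section \<open>Square integrable functions as an inner product space, and operators on it\<close>

section \<open>The Hilbert space of square integrable functions\<close>

lemma in_L2_integrable_inner:
  assumes "in_L2 M f" "in_L2 M g"
  shows "integrable M (\<lambda>z. inner (f z) (g z))"
proof (rule Bochner_Integration.integrable_bound)
  show "integrable M (\<lambda>z. (norm (f z))\<^sup>2 + (norm (g z))\<^sup>2)"
    using assms by (auto simp: in_L2_def)
  have [measurable]: "f \<in> borel_measurable M" "g \<in> borel_measurable M"
    using assms by (auto simp: in_L2_def)
  show "(\<lambda>z. inner (f z) (g z)) \<in> borel_measurable M"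
    by measurable
  show "AE z in M. norm (inner (f z) (g z)) \<le> norm ((norm (f z))\<^sup>2 + (norm (g z))\<^sup>2)"
  proof (intro AE_I2)
    fix z
    have "\<bar>inner (f z) (g z)\<bar> \<le> norm (f z) * norm (g z)"
      by (rule Cauchy_Schwarz_ineq2)
    also have "2 * (norm (f z) * norm (g z)) \<le> (norm (f z))\<^sup>2 + (norm (g z))\<^sup>2"
      using sum_squares_bound[of "norm (f z)" "norm (g z)"] by (simp add: mult.assoc)
    then have "norm (f z) * norm (g z) \<le> (norm (f z))\<^sup>2 + (norm (g z))\<^sup>2"
      using mult_nonneg_nonneg[OF norm_ge_zero norm_ge_zero, of "f z" "g z"] by linarith
    finally show "norm (inner (f z) (g z)) \<le> norm ((norm (f z))\<^sup>2 + (norm (g z))\<^sup>2)"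
      by simp
  qed
qed

lemma in_L2_bound:
  assumes "in_L2 M f" "g \<in> borel_measurable M" "AE z in M. norm (g z) \<le> C * norm (f z)"
  shows "in_L2 M g"
  unfolding in_L2_def
proof (intro conjI)
  have f: "f \<in> borel_measurable M" "integrable M (\<lambda>z. (norm (f z))\<^sup>2)"
    using assms(1) by (auto simp: in_L2_def)
  show "integrable M (\<lambda>z. (norm (g z))\<^sup>2)"
  proof (rule Bochner_Integration.integrable_bound)
    show "integrable M (\<lambda>z. C\<^sup>2 * (norm (f z))\<^sup>2)"
      using f(2) by simp
    show "(\<lambda>z. (norm (g z))\<^sup>2) \<in> borel_measurable M"
      using assms(2) by measurable
    show "AE z in M. norm ((norm (g z))\<^sup>2) \<le> norm (C\<^sup>2 * (norm (f z))\<^sup>2)"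
      using assms(3)
    proof eventually_elim
      case (elim z)
      then show ?case using power_mono[OF elim, of 2] by (simp add: power_mult_distrib)
    qed
  qed
qed (rule assms(2))

lemma in_L2_add:
  assumes "in_L2 M f" "in_L2 M g"
  shows "in_L2 M (\<lambda>z. f z + g z)"
  unfolding in_L2_def
proof
  have [measurable]: "f \<in> borel_measurable M" "g \<in> borel_measurable M"
    using assms by (auto simp: in_L2_def)
  show "(\<lambda>z. f z + g z) \<in> borel_measurable M" by measurable
  have "(\<lambda>z. (norm (f z + g z))\<^sup>2) = (\<lambda>z. (norm (f z))\<^sup>2 + (norm (g z))\<^sup>2 + 2 * inner (f z) (g z))"
    by (simp add: power2_norm_eq_inner inner_add_left inner_add_right inner_commute[of "g _" "f _"] add.commute)
  then show "integrable M (\<lambda>z. (norm (f z + g z))\<^sup>2)"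
    using assms in_L2_integrable_inner[OF assms] by (auto simp: in_L2_def)
qed

lemma in_L2_scaleR: "in_L2 M f \<Longrightarrow> in_L2 M (\<lambda>z. c *\<^sub>R f z)"
  by (auto simp: in_L2_def power_mult_distrib)

lemma in_L2_minus: "in_L2 M f \<Longrightarrow> in_L2 M (\<lambda>z. - f z)"
  by (auto simp: in_L2_def)

lemma in_L2_diff: "in_L2 M f \<Longrightarrow> in_L2 M g \<Longrightarrow> in_L2 M (\<lambda>z. f z - g z)"
  using in_L2_add[OF _ in_L2_minus, of M f g] by simp

lemma in_L2_zero: "in_L2 M (\<lambda>z. 0)"
  by (simp add: in_L2_def)

lemma in_L2_cong_AE:
  assumes "in_L2 M f" "AE z in M. f z = g z" "g \<in> borel_measurable M"
  shows "in_L2 M g"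
  by (rule in_L2_bound[OF assms(1,3), of 1]) (use assms(2) in auto)

lemma in_L2_restrict_iff:
  assumes "S \<in> sets lebesgue"
  shows "in_L2 (lebesgue_on S) f \<longleftrightarrow> in_L2 lebesgue (\<lambda>z. indicator S z *\<^sub>R f z)"
proof -
  have "(\<lambda>z. indicator S z *\<^sub>R (norm (f z))\<^sup>2) = (\<lambda>z. (norm (indicator S z *\<^sub>R f z))\<^sup>2 :: real)"
    by (auto simp: indicator_def)
  then show ?thesis
    using assms by (simp add: in_L2_def borel_measurable_restrict_space_iff integrable_restrict_space)
qed

lemma L2_norm_restrict:
  assumes "S \<in> sets lebesgue"
  shows "L2_norm (lebesgue_on S) f = L2_norm lebesgue (\<lambda>z. indicator S z *\<^sub>R f z)"
proof -
  have "(\<lambda>z. indicator S z *\<^sub>R (norm (f z))\<^sup>2) = (\<lambda>z. (norm (indicator S z *\<^sub>R f z))\<^sup>2 :: real)"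
    by (auto simp: indicator_def)
  then show ?thesis
    using assms by (simp add: L2_norm_def integral_restrict_space)
qed

\<comment> \<open>A type of classes is formed because the abstract estimates are about a type of
  class \<open>real_inner\<close>. The relation is partial, so \<open>mk f\<close> has a meaning
  only for square integrable f, and \<open>in_L2\<close> accompanies every computation with
  \<open>mk\<close>.\<close>
quotient_type (overloaded) ('a, 'b) l2 = "'a::euclidean_space \<Rightarrow> 'b::euclidean_space"
  / partial: "\<lambda>f g. in_L2 lebesgue f \<and> in_L2 lebesgue g \<and> (AE z in lebesgue. f z = g z)"
  morphisms fn mk
proof (rule part_equivpI)
  show "\<exists>f::'a \<Rightarrow> 'b. in_L2 lebesgue f \<and> in_L2 lebesgue f \<and> (AE z in lebesgue. f z = f z)"
    by (rule exI[of _ "\<lambda>_. 0"]) (simp add: in_L2_zero)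
next
  have sym: "AE z in lebesgue. g z = f z" if "AE z in lebesgue. f z = g z" for f g :: "'a \<Rightarrow> 'b"
    using that by eventually_elim simp
  show "symp (\<lambda>f g :: 'a \<Rightarrow> 'b. in_L2 lebesgue f \<and> in_L2 lebesgue g \<and> (AE z in lebesgue. f z = g z))"
    by (rule sympI) (blast intro: sym)
  have trans: "AE z in lebesgue. f z = h z"
    if "AE z in lebesgue. f z = g z" "AE z in lebesgue. g z = h z" for f g h :: "'a \<Rightarrow> 'b"
    using that by eventually_elim simp
  show "transp (\<lambda>f g :: 'a \<Rightarrow> 'b. in_L2 lebesgue f \<and> in_L2 lebesgue g \<and> (AE z in lebesgue. f z = g z))"
    by (rule transpI) (blast intro: trans)
qed

lemma mk_eq_iff: "in_L2 lebesgue f \<Longrightarrow> in_L2 lebesgue g \<Longrightarrow> mk f = mk g \<longleftrightarrow> (AE z in lebesgue. f z = g z)"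
  using Quotient_rel[OF Quotient_l2, of f g] by auto

lemma mk_induct [case_names mk]:
  assumes "\<And>f. in_L2 lebesgue f \<Longrightarrow> Q (mk f)"
  shows "Q x"
  using Quotient_abs_rep[OF Quotient_l2, of x] Quotient_rep_reflp[OF Quotient_l2, of x] assms[of "fn x"] by simp

instantiation l2 :: (euclidean_space, euclidean_space) real_vector
begin

lift_definition zero_l2 :: "('a, 'b) l2" is "\<lambda>z. 0"
  by (simp add: in_L2_zero)

lift_definition plus_l2 :: "('a, 'b) l2 \<Rightarrow> ('a, 'b) l2 \<Rightarrow> ('a, 'b) l2" is "\<lambda>f g z. f z + g z"
  by (auto intro: in_L2_add)

lift_definition minus_l2 :: "('a, 'b) l2 \<Rightarrow> ('a, 'b) l2 \<Rightarrow> ('a, 'b) l2" is "\<lambda>f g z. f z - g z"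
  by (auto intro: in_L2_diff)

lift_definition uminus_l2 :: "('a, 'b) l2 \<Rightarrow> ('a, 'b) l2" is "\<lambda>f z. - f z"
  by (auto intro: in_L2_minus)

lift_definition scaleR_l2 :: "real \<Rightarrow> ('a, 'b) l2 \<Rightarrow> ('a, 'b) l2" is "\<lambda>c f z. c *\<^sub>R f z"
  by (auto intro: in_L2_scaleR)

instance
proof
  fix x y w :: "('a, 'b) l2" and a b :: real
  show "x + y + w = x + (y + w)"
    by transfer (auto simp: algebra_simps intro: in_L2_add)
  show "x + y = y + x"
    by transfer (auto simp: algebra_simps intro: in_L2_add)
  show "0 + x = x"
    by transfer auto
  show "- x + x = 0"
    by transfer (auto intro: in_L2_zero)
  show "x - y = x + - y"
    by transfer (auto intro: in_L2_diff)
  show "a *\<^sub>R (x + y) = a *\<^sub>R x + a *\<^sub>R y"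
    by transfer (auto simp: algebra_simps intro!: in_L2_add in_L2_scaleR simp flip: scaleR_right_distrib)
  show "(a + b) *\<^sub>R x = a *\<^sub>R x + b *\<^sub>R x"
    by transfer (auto simp: algebra_simps intro!: in_L2_add in_L2_scaleR)
  show "a *\<^sub>R b *\<^sub>R x = (a * b) *\<^sub>R x"
    by transfer (auto intro!: in_L2_scaleR)
  show "1 *\<^sub>R x = x"
    by transfer auto
qed

end

instantiation l2 :: (euclidean_space, euclidean_space) real_inner
begin

lift_definition inner_l2 :: "('a, 'b) l2 \<Rightarrow> ('a, 'b) l2 \<Rightarrow> real" is "\<lambda>f g. LINT z|lebesgue. inner (f z) (g z)"
proof -
  fix f f' g g' :: "'a \<Rightarrow> 'b"
  assume f: "in_L2 lebesgue f \<and> in_L2 lebesgue f' \<and> (AE z in lebesgue. f z = f' z)"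
    and g: "in_L2 lebesgue g \<and> in_L2 lebesgue g' \<and> (AE z in lebesgue. g z = g' z)"
  have "AE z in lebesgue. inner (f z) (g z) = inner (f' z) (g' z)"
    using conjunct2[OF conjunct2[OF f]] conjunct2[OF conjunct2[OF g]] by eventually_elim simp
  then show "(LINT z|lebesgue. inner (f z) (g z)) = (LINT z|lebesgue. inner (f' z) (g' z))"
    using f g by (intro integral_cong_AE borel_measurable_inner) (auto simp: in_L2_def)
qed

definition "norm_l2 (x :: ('a, 'b) l2) = sqrt (inner x x)"
definition "sgn_l2 (x :: ('a, 'b) l2) = x /\<^sub>R norm x"
definition "dist_l2 (x :: ('a, 'b) l2) y = norm (x - y)"
definition "uniformity_l2 = (INF e\<in>{0<..}. principal {(x :: ('a, 'b) l2, y). dist x y < e})"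
definition "open_l2 (U :: ('a, 'b) l2 set) = (\<forall>x\<in>U. eventually (\<lambda>(x', y). x' = x \<longrightarrow> y \<in> U) uniformity)"

instance
proof
  fix x y w :: "('a, 'b) l2" and r :: real
  show "inner x y = inner y x"
    by transfer (simp add: inner_commute)
  show "inner (x + y) w = inner x w + inner y w"
    by transfer (auto simp: inner_add_left in_L2_integrable_inner)
  show "inner (r *\<^sub>R x) y = r * inner x y"
    by transfer simp
  show "0 \<le> inner x x"
    by transfer (simp add: integral_nonneg_AE)
  show "inner x x = 0 \<longleftrightarrow> x = 0"
    by transfer (subst integral_nonneg_eq_0_iff_AE, auto intro!: in_L2_integrable_inner in_L2_zero)
qed (simp_all add: norm_l2_def sgn_l2_def dist_l2_def uniformity_l2_def open_l2_def)

end

lemma mk_simps: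
  assumes "in_L2 lebesgue f" "in_L2 lebesgue g"
  shows mk_plus: "mk f + mk g = mk (\<lambda>z. f z + g z)"
    and mk_diff: "mk f - mk g = mk (\<lambda>z. f z - g z)"
    and mk_inner: "inner (mk f) (mk g) = (LINT z|lebesgue. inner (f z) (g z))"
  using assms by (auto simp: plus_l2.abs_eq minus_l2.abs_eq inner_l2.abs_eq)

lemma mk_scaleR: "in_L2 lebesgue f \<Longrightarrow> c *\<^sub>R mk f = mk (\<lambda>z. c *\<^sub>R f z)"
  by (simp add: scaleR_l2.abs_eq)

lemma mk_zero: "0 = mk (\<lambda>z. 0)"
  by (simp add: zero_l2.abs_eq)

lemma norm_mk: "in_L2 lebesgue f \<Longrightarrow> norm (mk f) = L2_norm lebesgue f"
  by (simp add: norm_eq_sqrt_inner mk_inner L2_norm_def power2_norm_eq_inner)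

lemma mk_sum:
  assumes "\<And>i. i \<in> I \<Longrightarrow> in_L2 lebesgue (f i)"
  shows "in_L2 lebesgue (\<lambda>z. \<Sum>i\<in>I. f i z) \<and> (\<Sum>i\<in>I. mk (f i)) = mk (\<lambda>z. \<Sum>i\<in>I. f i z)"
  using assms
  by (induction I rule: infinite_finite_induct) (auto simp: in_L2_zero mk_zero mk_plus in_L2_add)

subsection \<open>Affine changes of variables\<close>

text \<open>Diagonal maps cover both changes of variables in use: after adding a vector, factors 1
  give translations, and one factor different from 1 gives the normal dilation.\<close>

definition diag :: "('a \<Rightarrow> real) \<Rightarrow> 'a::euclidean_space \<Rightarrow> 'a"
  where "diag c z = (\<Sum>b\<in>Basis. (c b * (z \<bullet> b)) *\<^sub>R b)"

lemma diag_one [simp]: "diag (\<lambda>_. 1) z = z"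
  by (simp add: diag_def euclidean_representation)

context
  fixes c :: "'a::euclidean_space \<Rightarrow> real" and v :: 'a
  assumes c: "\<And>b. b \<in> Basis \<Longrightarrow> c b \<noteq> 0"
begin

lemma affine_measurable: "(\<lambda>z. v + diag c z) \<in> lebesgue \<rightarrow>\<^sub>M lebesgue"
  unfolding diag_def by (rule lebesgue_affine_measurable[OF c])

lemma affine_density:
  "lebesgue = density (distr lebesgue lebesgue (\<lambda>z. v + diag c z)) (\<lambda>_. ennreal (\<Prod>b\<in>Basis. \<bar>c b\<bar>))"
  using lebesgue_affine_euclidean[OF c, where t = v] unfolding diag_def
  by (simp add: prod_ennreal)

lemma prod_c: "0 < (\<Prod>b\<in>Basis. \<bar>c b\<bar>)"
  using c by (intro prod_pos) auto

lemma affine_AE: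
  assumes "AE z in lebesgue. Q z"
  shows "AE z in lebesgue. Q (v + diag c z)"
proof -
  have "AE z in distr lebesgue lebesgue (\<lambda>z. v + diag c z). Q z"
    using assms prod_c by (subst (asm) affine_density) (simp add: AE_density)
  then show ?thesis
    by (rule AE_distrD[OF affine_measurable])
qed

lemma affine_borel_measurable:
  "f \<in> borel_measurable lebesgue \<Longrightarrow> (\<lambda>z. f (v + diag c z)) \<in> borel_measurable lebesgue"
  by (rule measurable_compose[OF affine_measurable])

lemma affine_integral:
  fixes f :: "'a \<Rightarrow> 'b::euclidean_space"
  assumes "integrable lebesgue f"
  shows "integrable lebesgue (\<lambda>z. f (v + diag c z))"
    and "(LINT z|lebesgue. f z) = (\<Prod>b\<in>Basis. \<bar>c b\<bar>) *\<^sub>R (LINT z|lebesgue. f (v + diag c z))"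
proof -
  let ?D = "distr lebesgue lebesgue (\<lambda>z. v + diag c z)"
  have f[measurable]: "f \<in> borel_measurable lebesgue" using assms by auto
  have fD: "f \<in> borel_measurable ?D" by simp
  have "integrable (density ?D (\<lambda>_. ennreal (\<Prod>b\<in>Basis. \<bar>c b\<bar>))) f"
    using assms affine_density by simp
  then have "integrable ?D (\<lambda>z. (\<Prod>b\<in>Basis. \<bar>c b\<bar>) *\<^sub>R f z)"
    using prod_c by (subst (asm) integrable_density) (auto simp: less_imp_le)
  then have "integrable ?D (\<lambda>z. inverse (\<Prod>b\<in>Basis. \<bar>c b\<bar>) *\<^sub>R (\<Prod>b\<in>Basis. \<bar>c b\<bar>) *\<^sub>R f z)"
    by - (rule integrable_scaleR_right)
  moreover have "inverse (\<Prod>b\<in>Basis. \<bar>c b\<bar>) * (\<Prod>b\<in>Basis. \<bar>c b\<bar>) = 1"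
    by (rule left_inverse[OF less_imp_neq[OF prod_c, symmetric]])
  ultimately have "integrable ?D f"
    by (simp only: scaleR_scaleR scaleR_one)
  then show "integrable lebesgue (\<lambda>z. f (v + diag c z))"
    by (subst (asm) integrable_distr_eq[OF affine_measurable f])
  have "(LINT z|lebesgue. f z) = (LINT z|density ?D (\<lambda>_. ennreal (\<Prod>b\<in>Basis. \<bar>c b\<bar>)). f z)"
    using affine_density by simp
  also have "\<dots> = (LINT z|?D. (\<Prod>b\<in>Basis. \<bar>c b\<bar>) *\<^sub>R f z)"
    using prod_c by (intro integral_density) (auto simp: less_imp_le)
  also have "\<dots> = (\<Prod>b\<in>Basis. \<bar>c b\<bar>) *\<^sub>R (LINT z|lebesgue. f (v + diag c z))"
    by (simp add: integral_distr[OF affine_measurable f])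
  finally show "(LINT z|lebesgue. f z) = (\<Prod>b\<in>Basis. \<bar>c b\<bar>) *\<^sub>R (LINT z|lebesgue. f (v + diag c z))" .
qed

lemma affine_in_L2: "in_L2 lebesgue f \<Longrightarrow> in_L2 lebesgue (\<lambda>z. f (v + diag c z))"
  unfolding in_L2_def using affine_borel_measurable affine_integral(1) by blast

end

lemmas translate_AE = affine_AE[where c = "\<lambda>_. 1", simplified]
lemmas translate_borel_measurable = affine_borel_measurable[where c = "\<lambda>_. 1", simplified]
lemmas translate_integrable = affine_integral(1)[where c = "\<lambda>_. 1", simplified]
lemmas translate_integral = affine_integral(2)[where c = "\<lambda>_. 1", simplified]
lemmas translate_in_L2 = affine_in_L2[where c = "\<lambda>_. 1", simplified]

subsection \<open>Operators\<close>

lift_definition sft :: "'a::euclidean_space \<Rightarrow> ('a, 'b::euclidean_space) l2 \<Rightarrow> ('a, 'b) l2"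
  is "\<lambda>v f z. f (v + z)"
proof -
  fix v :: 'a and f g :: "'a \<Rightarrow> 'b"
  assume "in_L2 lebesgue f \<and> in_L2 lebesgue g \<and> (AE z in lebesgue. f z = g z)"
  then show "in_L2 lebesgue (\<lambda>z. f (v + z)) \<and> in_L2 lebesgue (\<lambda>z. g (v + z)) \<and>
      (AE z in lebesgue. f (v + z) = g (v + z))"
    using translate_AE[of "\<lambda>z. f z = g z" v] by (auto intro: translate_in_L2)
qed

lemma sft_mk: "in_L2 lebesgue f \<Longrightarrow> sft v (mk f) = mk (\<lambda>z. f (v + z))"
  by (simp add: sft.abs_eq)

lemma sft_plus: "sft (v + w) x = sft v (sft w x)"
  by transfer (auto simp: add_ac intro: translate_in_L2)

lemma sft_0: "sft 0 x = x"
  by transfer auto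

lemma sft_linear: "linear (sft v)"
proof (rule linearI)
  show "sft v (x + y) = sft v x + sft v y" for x y :: "('a, 'b) l2"
    by transfer (auto intro!: in_L2_add translate_in_L2)
  show "sft v (r *\<^sub>R x) = r *\<^sub>R sft v x" for r and x :: "('a, 'b) l2"
    by transfer (auto intro!: in_L2_scaleR translate_in_L2)
qed

lemma sft_inner: "inner (sft v x) (sft v y) = inner x y"
proof transfer
  fix v :: 'a and x y :: "'a \<Rightarrow> 'b"
  assume "in_L2 lebesgue x \<and> in_L2 lebesgue x \<and> (AE z in lebesgue. x z = x z)"
    "in_L2 lebesgue y \<and> in_L2 lebesgue y \<and> (AE z in lebesgue. y z = y z)"
  then show "(LINT z|lebesgue. x (v + z) \<bullet> y (v + z)) = (LINT z|lebesgue. x z \<bullet> y z)"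
    using translate_integral[OF in_L2_integrable_inner[of lebesgue x y], of v] by simp
qed

lemma sft_norm: "norm (sft v x) = norm x"
  by (simp add: norm_eq_sqrt_inner sft_inner)

lemma sft_adjoint: "inner (sft v x) y = inner x (sft (- v) y)"
  using sft_inner[of v x "sft (- v) y"] by (simp add: sft_0 flip: sft_plus)

text \<open>Covers indicators and coefficient matrices alike. Linearity in the fibre reduces
  measurability of the product to that of the field applied to constant vectors.\<close>

definition bdd_field :: "('a::euclidean_space \<Rightarrow> 'b::euclidean_space \<Rightarrow> 'b) \<Rightarrow> bool"
  where "bdd_field G \<longleftrightarrow> (\<forall>z. linear (G z)) \<and> (\<exists>C. \<forall>z x. norm (G z x) \<le> C * norm x) \<and>
    (\<forall>x. (\<lambda>z. G z x) \<in> borel_measurable lebesgue)"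

lemma bdd_field_measurable:
  assumes "bdd_field G" "f \<in> borel_measurable lebesgue"
  shows "(\<lambda>z. G z (f z)) \<in> borel_measurable lebesgue"
proof -
  have "G z (f z) = (\<Sum>b\<in>Basis. (f z \<bullet> b) *\<^sub>R G z b)" for z
  proof -
    interpret linear "G z" using assms by (simp add: bdd_field_def)
    have "G z (\<Sum>b\<in>Basis. (f z \<bullet> b) *\<^sub>R b) = (\<Sum>b\<in>Basis. (f z \<bullet> b) *\<^sub>R G z b)"
      by (simp add: sum scaleR)
    then show ?thesis by (simp add: euclidean_representation)
  qed
  then show ?thesis
    using assms by (auto simp: bdd_field_def intro!: borel_measurable_sum borel_measurable_scaleR borel_measurable_inner)
qed

lemma bdd_field_in_L2:
  assumes "bdd_field G" "in_L2 lebesgue f"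
  shows "in_L2 lebesgue (\<lambda>z. G z (f z))"
proof -
  obtain C where "\<And>z x. norm (G z x) \<le> C * norm x"
    using assms by (auto simp: bdd_field_def)
  then show ?thesis
    using assms bdd_field_measurable[OF assms(1), of f]
    by (intro in_L2_bound[OF assms(2), of _ C]) (auto simp: in_L2_def)
qed

text \<open>The value 0 off bounded fields makes the operation total and compatible with the
  quotient.\<close>

lift_definition mop :: "('a::euclidean_space \<Rightarrow> 'b::euclidean_space \<Rightarrow> 'b) \<Rightarrow> ('a, 'b) l2 \<Rightarrow> ('a, 'b) l2"
  is "\<lambda>G f z. if bdd_field G then G z (f z) else 0"
  subgoal for G f g by (cases "bdd_field G") (auto intro: bdd_field_in_L2 in_L2_zero)
  done

lemma mop_mk: "bdd_field G \<Longrightarrow> in_L2 lebesgue f \<Longrightarrow> mop G (mk f) = mk (\<lambda>z. G z (f z))"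
  by (simp add: mop.abs_eq)

lemma L2_norm_mono:
  assumes "in_L2 M f" "in_L2 M g" "AE z in M. norm (f z) \<le> C * norm (g z)" "0 \<le> C"
  shows "L2_norm M f \<le> C * L2_norm M g"
proof -
  have "(LINT z|M. (norm (f z))\<^sup>2) \<le> (LINT z|M. C\<^sup>2 * (norm (g z))\<^sup>2)"
    using assms(1,2)
  proof (intro integral_mono_AE)
    show "AE z in M. (norm (f z))\<^sup>2 \<le> C\<^sup>2 * (norm (g z))\<^sup>2"
      using assms(3)
    proof eventually_elim
      case (elim z)
      then show ?case using power_mono[OF elim, of 2] by (simp add: power_mult_distrib)
    qed
  qed (auto simp: in_L2_def)
  then have "L2_norm M f \<le> sqrt (C\<^sup>2 * (LINT z|M. (norm (g z))\<^sup>2))"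
    unfolding L2_norm_def by simp
  also have "\<dots> = C * L2_norm M g"
    using assms(4) by (simp add: real_sqrt_mult L2_norm_def)
  finally show ?thesis .
qed

lemma mop_norm:
  assumes "bdd_field G" "\<And>z x. norm (G z x) \<le> C * norm x" "0 \<le> C"
  shows "norm (mop G x) \<le> C * norm x"
proof (induction x rule: mk_induct)
  case (mk f)
  then show ?case
    using L2_norm_mono[OF bdd_field_in_L2[OF assms(1) mk] mk, of C] assms
    by (simp add: mop_mk norm_mk bdd_field_in_L2)
qed

lemma mop_bounded_linear:
  fixes G :: "'a::euclidean_space \<Rightarrow> 'b::euclidean_space \<Rightarrow> 'b"
  assumes "bdd_field G"
  shows "bounded_linear (mop G)"
proof -
  obtain C where C: "\<And>z x. norm (G z x) \<le> C * norm x"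
    using assms by (auto simp: bdd_field_def)
  have C': "norm (G z x) \<le> \<bar>C\<bar> * norm x" for z x
    by (rule order_trans[OF C mult_right_mono]) auto
  have lin: "linear (G z)" for z using assms by (simp add: bdd_field_def)
  show ?thesis
  proof (rule bounded_linear_intro)
    fix r :: real and x y :: "('a, 'b) l2"
    show "mop G (x + y) = mop G x + mop G y"
    proof (induction x rule: mk_induct)
      case (mk f) note f = mk
      show ?case
        by (induction y rule: mk_induct)
          (simp add: f assms mk_plus mop_mk bdd_field_in_L2 in_L2_add linear_add[OF lin])
    qed
    show "mop G (r *\<^sub>R x) = r *\<^sub>R mop G x"
      by (induction x rule: mk_induct)
        (simp add: assms mk_scaleR mop_mk bdd_field_in_L2 in_L2_scaleR linear_scale[OF lin])
    show "norm (mop G x) \<le> norm x * \<bar>C\<bar>"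
      using mop_norm[OF assms C', of x] by (simp add: mult.commute)
  qed
qed

lemma mop_inner_le:
  assumes "bdd_field G" "AE z in lebesgue. \<forall>x. c * (norm x)\<^sup>2 \<le> inner (G z x) x"
  shows "c * (norm x)\<^sup>2 \<le> inner (mop G x) x"
proof (induction x rule: mk_induct)
  case (mk f)
  have "(LINT z|lebesgue. c * (norm (f z))\<^sup>2) \<le> (LINT z|lebesgue. inner (G z (f z)) (f z))"
  proof (rule integral_mono_AE)
    show "integrable lebesgue (\<lambda>z. c * (norm (f z))\<^sup>2)"
      using mk by (simp add: in_L2_def)
    show "integrable lebesgue (\<lambda>z. inner (G z (f z)) (f z))"
      by (rule in_L2_integrable_inner[OF bdd_field_in_L2[OF assms(1) mk] mk])
    show "AE z in lebesgue. c * (norm (f z))\<^sup>2 \<le> inner (G z (f z)) (f z)"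
      using assms(2) by eventually_elim blast
  qed
  also have "(LINT z|lebesgue. c * (norm (f z))\<^sup>2) = c * (norm (mk f))\<^sup>2"
    by (simp add: power2_norm_eq_inner mk_inner[OF mk mk])
  also have "(LINT z|lebesgue. inner (G z (f z)) (f z)) = inner (mop G (mk f)) (mk f)"
    by (simp add: mop_mk[OF assms(1) mk] mk_inner[OF bdd_field_in_L2[OF assms(1) mk] mk])
  finally show ?case .
qed

definition rst :: "'a set \<Rightarrow> ('a::euclidean_space, 'b::euclidean_space) l2 \<Rightarrow> ('a, 'b) l2"
  where "rst S = mop (\<lambda>z x. indicator S z *\<^sub>R x)"

lemma bdd_field_indicator:
  assumes "S \<in> sets lebesgue"
  shows "bdd_field (\<lambda>z x. indicator S z *\<^sub>R (x :: 'b::euclidean_space))"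
  unfolding bdd_field_def
proof (intro conjI allI)
  show "linear ((*\<^sub>R) (indicator S z) :: 'b \<Rightarrow> 'b)" for z :: 'a
    by (rule linearI) (auto simp: algebra_simps)
  show "\<exists>C. \<forall>z x. norm (indicator S z *\<^sub>R (x :: 'b)) \<le> C * norm x"
    by (rule exI[of _ 1]) (auto simp: indicator_def)
  show "(\<lambda>z. indicator S z *\<^sub>R (x :: 'b)) \<in> borel_measurable lebesgue" for x
    using assms by measurable
qed

lemma rst_mk: "S \<in> sets lebesgue \<Longrightarrow> in_L2 lebesgue f \<Longrightarrow> rst S (mk f) = mk (\<lambda>z. indicator S z *\<^sub>R f z)"
  by (simp add: rst_def mop_mk bdd_field_indicator)

lemma in_L2_indicator: "S \<in> sets lebesgue \<Longrightarrow> in_L2 lebesgue f \<Longrightarrow> in_L2 lebesgue (\<lambda>z. indicator S z *\<^sub>R f z)"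
  using bdd_field_in_L2[OF bdd_field_indicator] .

lemma rst_bounded_linear: "S \<in> sets lebesgue \<Longrightarrow> bounded_linear (rst S)"
  unfolding rst_def by (rule mop_bounded_linear[OF bdd_field_indicator])

lemma rst_adjoint:
  assumes "S \<in> sets lebesgue"
  shows "inner (rst S x) y = inner x (rst S y)"
proof (induction x rule: mk_induct)
  case (mk f) note f = mk
  show ?case
    by (induction y rule: mk_induct) (simp add: rst_mk assms f mk_inner in_L2_indicator)
qed

text \<open>Defined through a representative, because composition with a degenerate diagonal map
  does not respect equality almost everywhere; for nonzero factors \<open>dil_mk\<close> removes the
  choice.\<close>

definition dil :: "('a \<Rightarrow> real) \<Rightarrow> ('a::euclidean_space, 'b::euclidean_space) l2 \<Rightarrow> ('a, 'b) l2"
  where "dil c x = mk (\<lambda>z. fn x (diag c z))"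

lemma dil_mk:
  assumes c: "\<And>b. b \<in> Basis \<Longrightarrow> c b \<noteq> 0" and f: "in_L2 lebesgue f"
  shows "dil c (mk f) = mk (\<lambda>z. f (diag c z))"
proof -
  have fn: "in_L2 lebesgue (fn (mk f))" "AE z in lebesgue. fn (mk f) z = f z"
    using Quotient_rep_reflp[OF Quotient_l2, of "mk f"] Quotient_rep_abs[OF Quotient_l2, of f] f by auto
  show ?thesis
    unfolding dil_def
    using affine_in_L2[OF c fn(1), where v = 0] affine_in_L2[OF c f, where v = 0] affine_AE[OF c fn(2), where v = 0]
    by (subst mk_eq_iff) simp_all
qed

lemma dil_in_L2: "(\<And>b. b \<in> Basis \<Longrightarrow> c b \<noteq> 0) \<Longrightarrow> in_L2 lebesgue f \<Longrightarrow> in_L2 lebesgue (\<lambda>z. f (diag c z))"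
  using affine_in_L2[where c = c and f = f and v = 0] by simp

lemma dil_norm:
  assumes "\<And>b. b \<in> Basis \<Longrightarrow> c b \<noteq> 0"
  shows "(\<Prod>b\<in>Basis. \<bar>c b\<bar>) * (norm (dil c x))\<^sup>2 = (norm x)\<^sup>2"
proof (induction x rule: mk_induct)
  case (mk f)
  then have "integrable lebesgue (\<lambda>z. inner (f z) (f z))"
    by (intro in_L2_integrable_inner)
  from affine_integral(2)[OF assms this, where v = 0] mk assms show ?case
    by (simp add: dil_mk mk_inner dil_in_L2 power2_norm_eq_inner)
qed

lemma dil_bounded_linear:
  fixes c :: "'a::euclidean_space \<Rightarrow> real"
  assumes "\<And>b. b \<in> Basis \<Longrightarrow> c b \<noteq> 0"
  shows "bounded_linear (dil c :: ('a, 'b::euclidean_space) l2 \<Rightarrow> _)"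
proof (rule bounded_linear_intro)
  fix r :: real and x y :: "('a, 'b) l2"
  show "dil c (x + y) = dil c x + dil c y"
  proof (induction x rule: mk_induct)
    case (mk f) note f = mk
    show ?case
      by (induction y rule: mk_induct) (simp add: f assms mk_plus dil_mk dil_in_L2 in_L2_add)
  qed
  show "dil c (r *\<^sub>R x) = r *\<^sub>R dil c x"
    by (induction x rule: mk_induct) (simp add: assms mk_scaleR dil_mk dil_in_L2 in_L2_scaleR)
  define p where "p = (\<Prod>b\<in>Basis. \<bar>c b\<bar>)"
  have p: "0 < p" unfolding p_def by (rule prod_c[OF assms])
  have "p * (norm (dil c x))\<^sup>2 = (norm x)\<^sup>2"
    unfolding p_def by (rule dil_norm) (rule assms)
  then have "(norm (dil c x))\<^sup>2 = (norm x)\<^sup>2 * (1 / p)"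
    using p by (simp add: field_simps)
  then have "(norm (dil c x))\<^sup>2 \<le> (norm x * sqrt (1 / p))\<^sup>2"
    using p by (simp add: power_mult_distrib)
  moreover have "0 \<le> norm x * sqrt (1 / p)"
    using p by simp
  ultimately show "norm (dil c x) \<le> norm x * sqrt (1 / p)"
    by (rule power2_le_imp_le)
qed

section \<open>Smooth functions, test functions and cut-offs\<close>

section \<open>Smooth functions\<close>

lemma pdiff_eq: "(f has_derivative D) (at z) \<Longrightarrow> pdiff v f z = D v"
  unfolding pdiff_def using frechet_derivative_at by metis

lemma differentiable_derivative:
  "f differentiable (at z) \<Longrightarrow> (f has_derivative (\<lambda>v. pdiff v f z)) (at z)"
  unfolding pdiff_def using frechet_derivative_works by blast

lemma C_k_Suc_imp: "C_k (Suc k) f \<Longrightarrow> C_k k f"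
proof (induction k arbitrary: f)
  case 0
  then show ?case
    by (auto intro!: differentiable_imp_continuous_on differentiable_at_imp_differentiable_on)
next
  case (Suc k)
  then show ?case by (metis C_k.simps(2))
qed

lemma C_k_imp_continuous: "C_k k f \<Longrightarrow> continuous_on UNIV f"
  by (induction k) (use C_k_Suc_imp in auto)

lemma smooth_imp_continuous: "smooth f \<Longrightarrow> continuous_on UNIV f"
  unfolding smooth_def using C_k.simps(1) by blast

lemma smooth_imp_differentiable: "smooth f \<Longrightarrow> f differentiable (at z)"
  unfolding smooth_def using C_k.simps(2) by blast

lemma smooth_pdiff: "smooth f \<Longrightarrow> b \<in> Basis \<Longrightarrow> smooth (pdiff b f)"
  unfolding smooth_def using C_k.simps(2) by blast

lemma pdiff_const [simp]: "pdiff v (\<lambda>_. c) = (\<lambda>_. 0)"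
  by (rule ext) (simp add: pdiff_eq[OF has_derivative_const])

lemma C_k_const: "C_k k (\<lambda>_. c)"
  by (induction k arbitrary: c) auto

lemma C_k_add: "C_k k f \<Longrightarrow> C_k k g \<Longrightarrow> C_k k (\<lambda>z. f z + g z)"
proof (induction k arbitrary: f g)
  case (Suc k)
  then have d: "f differentiable (at z)" "g differentiable (at z)" for z by auto
  have "pdiff b (\<lambda>z. f z + g z) = (\<lambda>z. pdiff b f z + pdiff b g z)" for b
    by (rule ext, rule pdiff_eq) (intro derivative_intros differentiable_derivative d)
  with Suc d show ?case by auto
qed (auto intro: continuous_intros)

lemma C_k_scaleR:
  fixes f :: "'a::euclidean_space \<Rightarrow> real"
  shows "C_k k f \<Longrightarrow> C_k k g \<Longrightarrow> C_k k (\<lambda>z. f z *\<^sub>R g z)"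
proof (induction k arbitrary: f g)
  case (Suc k)
  then have d: "f differentiable (at z)" "g differentiable (at z)" for z by auto
  have p: "pdiff b (\<lambda>z. f z *\<^sub>R g z) = (\<lambda>z. f z *\<^sub>R pdiff b g z + pdiff b f z *\<^sub>R g z)" for b
    by (rule ext, rule pdiff_eq) (intro derivative_intros differentiable_derivative d)
  have "C_k k f" "C_k k g" using Suc.prems by (auto intro: C_k_Suc_imp)
  with Suc d show ?case by (auto simp: p intro!: C_k_add)
qed (auto intro: continuous_intros)

lemma pdiff_scaleR:
  fixes f :: "'a::euclidean_space \<Rightarrow> real"
  assumes "f differentiable (at z)" "g differentiable (at z)"
  shows "pdiff b (\<lambda>z. f z *\<^sub>R g z) z = f z *\<^sub>R pdiff b g z + pdiff b f z *\<^sub>R g z"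
  by (rule pdiff_eq) (intro derivative_intros differentiable_derivative assms)

lemma C_k_affine:
  "C_k k f \<Longrightarrow> C_k k (\<lambda>z. f (v + diag c z))"
proof (induction k arbitrary: f)
  case 0
  then show ?case
    by (auto simp: diag_def intro!: continuous_on_compose2[of UNIV f] continuous_intros)
next
  case (Suc k)
  have T: "((\<lambda>z. v + diag c z) has_derivative diag c) (at z)" for z
  proof -
    have "((\<lambda>z. v + diag c z) has_derivative (\<lambda>w. 0 + diag c w)) (at z)"
      unfolding diag_def by (auto intro!: derivative_eq_intros simp: algebra_simps)
    then show ?thesis by simp
  qed
  have d: "((\<lambda>z. f (v + diag c z)) has_derivative (\<lambda>w. pdiff (diag c w) f (v + diag c z))) (at z)" for z
  proof -
    have "f differentiable (at (v + diag c z))" using Suc.prems by simp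
    from has_derivative_compose[OF T differentiable_derivative[OF this]] show ?thesis .
  qed
  have dg: "diag c b = c b *\<^sub>R b" if "b \<in> Basis" for b
    using that by (simp add: diag_def inner_Basis if_distrib[where f = "\<lambda>x. _ * x"] if_distrib[where f = "\<lambda>x. x *\<^sub>R _"] cong: if_cong)
  have p: "pdiff b (\<lambda>z. f (v + diag c z)) = (\<lambda>z. c b *\<^sub>R pdiff b f (v + diag c z))" if "b \<in> Basis" for b
  proof
    fix z
    have lin: "linear (\<lambda>w. pdiff w f (v + diag c z))"
      using Suc.prems has_derivative_linear[OF differentiable_derivative] by auto
    show "pdiff b (\<lambda>z. f (v + diag c z)) z = c b *\<^sub>R pdiff b f (v + diag c z)"
      by (simp only: pdiff_eq[OF d] dg[OF that] linear_scale[OF lin])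
  qed
  have "C_k k (\<lambda>z. c b *\<^sub>R pdiff b f (v + diag c z))" if "b \<in> Basis" for b
    using Suc.prems that by (intro C_k_scaleR C_k_const Suc.IH) auto
  then show ?case
    using d by (auto simp: p differentiable_def)
qed

lemma pdiff_affine:
  assumes "f differentiable (at (v + diag c z))" "b \<in> Basis"
  shows "pdiff b (\<lambda>z. f (v + diag c z)) z = c b *\<^sub>R pdiff b f (v + diag c z)"
proof -
  have T: "((\<lambda>z. v + diag c z) has_derivative diag c) (at z)"
  proof -
    have "((\<lambda>z. v + diag c z) has_derivative (\<lambda>w. 0 + diag c w)) (at z)"
      unfolding diag_def by (auto intro!: derivative_eq_intros simp: algebra_simps)
    then show ?thesis by simp
  qed
  have dg: "diag c b = c b *\<^sub>R b"
    using assms(2) by (simp add: diag_def inner_Basis if_distrib[where f = "\<lambda>x. _ * x"] if_distrib[where f = "\<lambda>x. x *\<^sub>R _"] cong: if_cong)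
  show ?thesis
    using pdiff_eq[OF has_derivative_compose[OF T differentiable_derivative[OF assms(1)]]] dg
      linear_scale[OF has_derivative_linear[OF differentiable_derivative[OF assms(1)]]] by simp
qed

lemma C_k_coordinate:
  fixes g :: "real \<Rightarrow> real"
  assumes "b \<in> Basis"
  shows "C_k k g \<Longrightarrow> C_k k (\<lambda>z. g (z \<bullet> b))"
proof (induction k arbitrary: g)
  case 0
  then show ?case
    by (auto intro!: continuous_on_compose2[of UNIV g] continuous_intros)
next
  case (Suc k)
  have d: "((\<lambda>z. g (z \<bullet> b)) has_derivative (\<lambda>w. pdiff (w \<bullet> b) g (z \<bullet> b))) (at z)" for z
  proof -
    have 1: "((\<lambda>z. z \<bullet> b) has_derivative (\<lambda>w. w \<bullet> b)) (at z)"
      by (auto intro!: derivative_eq_intros)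
    have "g differentiable (at (z \<bullet> b))" using Suc.prems by simp
    from has_derivative_compose[OF 1 differentiable_derivative[OF this]] show ?thesis .
  qed
  have p: "pdiff b' (\<lambda>z. g (z \<bullet> b)) = (\<lambda>z. (b' \<bullet> b) *\<^sub>R pdiff 1 g (z \<bullet> b))" for b'
  proof
    fix z
    have "linear (\<lambda>w. pdiff w g (z \<bullet> b))"
      using Suc.prems has_derivative_linear[OF differentiable_derivative] by auto
    from linear_scale[OF this, of "b' \<bullet> b" 1]
    show "pdiff b' (\<lambda>z. g (z \<bullet> b)) z = (b' \<bullet> b) *\<^sub>R pdiff 1 g (z \<bullet> b)"
      using pdiff_eq[OF d] by simp
  qed
  have "C_k k (\<lambda>z. (b' \<bullet> b) *\<^sub>R pdiff 1 g (z \<bullet> b))" for b'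
    using Suc.prems by (intro C_k_scaleR C_k_const Suc.IH) auto
  then show ?case
    using d unfolding C_k.simps p differentiable_def by blast
qed

lemma pdiff_coordinate:
  fixes g :: "real \<Rightarrow> real"
  assumes "(g has_real_derivative g') (at (z \<bullet> b))"
  shows "pdiff v (\<lambda>z. g (z \<bullet> b)) z = g' * (v \<bullet> b)"
proof (rule pdiff_eq)
  have "((\<lambda>z. z \<bullet> b) has_derivative (\<lambda>w. w \<bullet> b)) (at z)"
    by (auto intro!: derivative_eq_intros)
  from has_derivative_compose[OF this assms[unfolded has_field_derivative_def]]
  show "((\<lambda>z. g (z \<bullet> b)) has_derivative (\<lambda>v. g' * (v \<bullet> b))) (at z)" .
qed

lemmas smooth_const = C_k_const[THEN allI[of "\<lambda>k. C_k k _"], folded smooth_def]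

lemma smooth_add: "smooth f \<Longrightarrow> smooth g \<Longrightarrow> smooth (\<lambda>z. f z + g z)"
  by (simp add: smooth_def C_k_add)

lemma smooth_scaleR:
  fixes f :: "'a::euclidean_space \<Rightarrow> real"
  shows "smooth f \<Longrightarrow> smooth g \<Longrightarrow> smooth (\<lambda>z. f z *\<^sub>R g z)"
  by (simp add: smooth_def C_k_scaleR)

lemma smooth_mult:
  fixes f g :: "'a::euclidean_space \<Rightarrow> real"
  shows "smooth f \<Longrightarrow> smooth g \<Longrightarrow> smooth (\<lambda>z. f z * g z)"
  using smooth_scaleR[of f g] by simp

lemma smooth_diff:
  fixes f g :: "'a::euclidean_space \<Rightarrow> 'b::real_normed_vector"
  assumes "smooth f" "smooth g"
  shows "smooth (\<lambda>z. f z - g z)"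
  using smooth_add[OF assms(1) smooth_scaleR[OF smooth_const[of "-1"] assms(2)]] by simp

lemma smooth_prod:
  fixes f :: "'i \<Rightarrow> 'a::euclidean_space \<Rightarrow> real"
  shows "(\<And>i. i \<in> I \<Longrightarrow> smooth (f i)) \<Longrightarrow> smooth (\<lambda>z. \<Prod>i\<in>I. f i z)"
  by (induction I rule: infinite_finite_induct) (auto intro: smooth_mult smooth_const)

lemma smooth_power:
  fixes f :: "'a::euclidean_space \<Rightarrow> real"
  shows "smooth f \<Longrightarrow> smooth (\<lambda>z. f z ^ n)"
  by (induction n) (auto intro: smooth_mult smooth_const)

lemma smooth_affine: "smooth f \<Longrightarrow> smooth (\<lambda>z. f (v + diag c z))"
  by (simp add: smooth_def C_k_affine)

lemma smooth_coordinate: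
  fixes g :: "real \<Rightarrow> real"
  shows "smooth g \<Longrightarrow> b \<in> Basis \<Longrightarrow> smooth (\<lambda>z. g (z \<bullet> b))"
  by (simp add: smooth_def C_k_coordinate)

text \<open>Two applications of the mean value theorem to the second-order difference
  \<open>f (z + s a + t b) - f (z + s a) - f (z + t b) + f z\<close>, in either order.\<close>

lemma second_difference:
  fixes f :: "'a::euclidean_space \<Rightarrow> real"
  assumes f: "\<And>z. f differentiable (at z)" "\<And>z. pdiff a f differentiable (at z)" and "0 < h"
  shows "\<exists>s t. 0 < s \<and> s < h \<and> 0 < t \<and> t < h \<and>
    f (z + h *\<^sub>R a + h *\<^sub>R b) - f (z + h *\<^sub>R a) - (f (z + h *\<^sub>R b) - f z)
      = h * (h * pdiff b (pdiff a f) (z + s *\<^sub>R a + t *\<^sub>R b))"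
proof -
  have along: "((\<lambda>s. g (w + s *\<^sub>R v)) has_real_derivative pdiff v g (w + s *\<^sub>R v)) (at s)"
    if "\<And>z. g differentiable (at z)" for g :: "'a \<Rightarrow> real" and w v s
  proof -
    have 1: "((\<lambda>s. w + s *\<^sub>R v) has_derivative (\<lambda>x. x *\<^sub>R v)) (at s)"
      by (auto intro!: derivative_eq_intros)
    have "linear (\<lambda>u. pdiff u g (w + s *\<^sub>R v))"
      using has_derivative_linear[OF differentiable_derivative[OF that]] .
    from linear_scale[OF this] show ?thesis
      using has_derivative_compose[OF 1 differentiable_derivative[OF that]]
      by (simp add: has_field_derivative_def mult_commute_abs)
  qed
  let ?g = "\<lambda>s. f (z + h *\<^sub>R b + s *\<^sub>R a) - f (z + s *\<^sub>R a)"
  have "\<exists>s. 0 < s \<and> s < h \<and> ?g h - ?g 0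
      = (h - 0) * (pdiff a f (z + h *\<^sub>R b + s *\<^sub>R a) - pdiff a f (z + s *\<^sub>R a))"
    by (rule MVT2[OF \<open>0 < h\<close>]) (intro derivative_intros along f)
  then obtain s where s: "0 < s" "s < h"
    "?g h - ?g 0 = h * (pdiff a f (z + h *\<^sub>R b + s *\<^sub>R a) - pdiff a f (z + s *\<^sub>R a))"
    by auto
  have "\<exists>t. 0 < t \<and> t < h \<and> pdiff a f (z + s *\<^sub>R a + h *\<^sub>R b) - pdiff a f (z + s *\<^sub>R a + 0 *\<^sub>R b)
      = (h - 0) * pdiff b (pdiff a f) (z + s *\<^sub>R a + t *\<^sub>R b)"
    by (rule MVT2[OF \<open>0 < h\<close>]) (intro along f)
  then obtain t where "0 < t" "t < h"
    "pdiff a f (z + s *\<^sub>R a + h *\<^sub>R b) - pdiff a f (z + s *\<^sub>R a) = h * pdiff b (pdiff a f) (z + s *\<^sub>R a + t *\<^sub>R b)"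
    by auto
  with s show ?thesis
    by (intro exI[of _ s] exI[of _ t]) (simp add: algebra_simps)
qed

text \<open>Schwarz's theorem. The mixed second difference is symmetric in the two directions and
  equals h^2 times either iterated derivative at suitable points whose distance from z tends to 0
  with h; continuity finishes the argument.\<close>

lemma pdiff_commute:
  fixes f :: "'a::euclidean_space \<Rightarrow> real"
  assumes f: "smooth f" and ab: "a \<in> Basis" "b \<in> Basis"
  shows "pdiff a (pdiff b f) = pdiff b (pdiff a f)"
proof
  fix z
  have d: "f differentiable (at z)" "pdiff a f differentiable (at z)" "pdiff b f differentiable (at z)" for z
    using f ab by (auto intro: smooth_imp_differentiable smooth_pdiff)
  have c: "continuous_on UNIV (pdiff a (pdiff b f))" "continuous_on UNIV (pdiff b (pdiff a f))"
    using f ab by (auto intro: smooth_imp_continuous smooth_pdiff)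
  define h where "h n = 1 / real (Suc n)" for n
  have h: "0 < h n" for n by (simp add: h_def)
  have "\<forall>n. \<exists>s t s' t'. \<bar>s\<bar> \<le> h n \<and> \<bar>t\<bar> \<le> h n \<and> \<bar>s'\<bar> \<le> h n \<and> \<bar>t'\<bar> \<le> h n \<and>
     pdiff b (pdiff a f) (z + s *\<^sub>R a + t *\<^sub>R b) = pdiff a (pdiff b f) (z + s' *\<^sub>R b + t' *\<^sub>R a)"
  proof
    fix n
    obtain s t where st: "0 < s" "s < h n" "0 < t" "t < h n"
      "f (z + h n *\<^sub>R a + h n *\<^sub>R b) - f (z + h n *\<^sub>R a) - (f (z + h n *\<^sub>R b) - f z)
        = h n * (h n * pdiff b (pdiff a f) (z + s *\<^sub>R a + t *\<^sub>R b))"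
      using second_difference[OF d(1,2) h[of n], where z = z and b = b] by blast
    obtain s' t' where st': "0 < s'" "s' < h n" "0 < t'" "t' < h n"
      "f (z + h n *\<^sub>R b + h n *\<^sub>R a) - f (z + h n *\<^sub>R b) - (f (z + h n *\<^sub>R a) - f z)
        = h n * (h n * pdiff a (pdiff b f) (z + s' *\<^sub>R b + t' *\<^sub>R a))"
      using second_difference[OF d(1,3) h[of n], where z = z and b = a] by blast
    have "h n * (h n * pdiff b (pdiff a f) (z + s *\<^sub>R a + t *\<^sub>R b)) = h n * (h n * pdiff a (pdiff b f) (z + s' *\<^sub>R b + t' *\<^sub>R a))"
      unfolding st(5)[symmetric] st'(5)[symmetric] by (simp add: algebra_simps)
    then have "pdiff b (pdiff a f) (z + s *\<^sub>R a + t *\<^sub>R b) = pdiff a (pdiff b f) (z + s' *\<^sub>R b + t' *\<^sub>R a)"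
      using h[of n] by simp
    with st st' show "\<exists>s t s' t'. \<bar>s\<bar> \<le> h n \<and> \<bar>t\<bar> \<le> h n \<and> \<bar>s'\<bar> \<le> h n \<and> \<bar>t'\<bar> \<le> h n \<and>
     pdiff b (pdiff a f) (z + s *\<^sub>R a + t *\<^sub>R b) = pdiff a (pdiff b f) (z + s' *\<^sub>R b + t' *\<^sub>R a)"
      by (intro exI[of _ s] exI[of _ t] exI[of _ s'] exI[of _ t']) auto
  qed
  then obtain s t s' t' where st: "\<And>n. \<bar>s n\<bar> \<le> h n" "\<And>n. \<bar>t n\<bar> \<le> h n" "\<And>n. \<bar>s' n\<bar> \<le> h n" "\<And>n. \<bar>t' n\<bar> \<le> h n"
    "\<And>n. pdiff b (pdiff a f) (z + s n *\<^sub>R a + t n *\<^sub>R b) = pdiff a (pdiff b f) (z + s' n *\<^sub>R b + t' n *\<^sub>R a)"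
    by metis
  have h0: "h \<longlonglongrightarrow> 0" unfolding h_def by real_asymp
  have z0: "q \<longlonglongrightarrow> 0" if "\<And>n. \<bar>q n\<bar> \<le> h n" for q
    by (rule Lim_null_comparison[OF _ h0]) (use that in auto)
  have "(\<lambda>n. z + s n *\<^sub>R a + t n *\<^sub>R b) \<longlonglongrightarrow> z + 0 *\<^sub>R a + 0 *\<^sub>R b"
    by (intro tendsto_intros z0 st)
  then have 1: "(\<lambda>n. pdiff b (pdiff a f) (z + s n *\<^sub>R a + t n *\<^sub>R b)) \<longlonglongrightarrow> pdiff b (pdiff a f) z"
    using c(2) by (intro continuous_on_tendsto_compose[OF c(2)]) auto
  have "(\<lambda>n. z + s' n *\<^sub>R b + t' n *\<^sub>R a) \<longlonglongrightarrow> z + 0 *\<^sub>R b + 0 *\<^sub>R a"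
    by (intro tendsto_intros z0 st)
  then have 2: "(\<lambda>n. pdiff a (pdiff b f) (z + s' n *\<^sub>R b + t' n *\<^sub>R a)) \<longlonglongrightarrow> pdiff a (pdiff b f) z"
    by (intro continuous_on_tendsto_compose[OF c(1)]) auto
  show "pdiff a (pdiff b f) z = pdiff b (pdiff a f) z"
    using LIMSEQ_unique[OF 2 1[unfolded st(5)]] .
qed

subsection \<open>Supports\<close>

lemma supp_subset:
  assumes "closed K" "\<And>z. z \<notin> K \<Longrightarrow> f z = 0"
  shows "supp f \<subseteq> K"
  unfolding supp_def
proof (rule closure_minimal)
  show "{z. f z \<noteq> 0} \<subseteq> K" using assms(2) by blast
qed (rule assms(1))

lemma not_in_supp: "z \<notin> supp f \<Longrightarrow> f z = 0"
  unfolding supp_def using closure_subset[of "{z. f z \<noteq> 0}"] by blast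

lemma closed_supp: "closed (supp f)"
  by (simp add: supp_def)

lemma smooth_cptI:
  assumes "smooth f" "compact K" "K \<subseteq> S" "\<And>z. z \<notin> K \<Longrightarrow> f z = 0"
  shows "f \<in> smooth_cpt S"
proof -
  have sub: "supp f \<subseteq> K"
    using compact_imp_closed[OF assms(2)] assms(4) by (rule supp_subset)
  then have "compact (supp f)"
    using compact_Int_closed[OF assms(2) closed_supp[of f]] by (simp only: Int_absorb1)
  with assms(1,3) sub show ?thesis
    unfolding smooth_cpt_def by blast
qed

lemma smooth_cptD:
  assumes "f \<in> smooth_cpt S"
  shows "smooth f" "compact (supp f)" "supp f \<subseteq> S" "z \<notin> S \<Longrightarrow> f z = 0"
proof -
  show *: "smooth f" "compact (supp f)" "supp f \<subseteq> S"
    using assms by (auto simp: smooth_cpt_def)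
  show "z \<notin> S \<Longrightarrow> f z = 0"
    using *(3) by (intro not_in_supp) blast
qed

lemma smooth_cpt_mono: "f \<in> smooth_cpt S \<Longrightarrow> S \<subseteq> S' \<Longrightarrow> f \<in> smooth_cpt S'"
  by (auto simp: smooth_cpt_def)

lemma pdiff_outside_supp:
  assumes "z \<notin> supp f"
  shows "pdiff v f z = 0"
proof -
  have "(f has_derivative (\<lambda>_. 0)) (at z)"
  proof (rule has_derivative_transform_within_open[of "\<lambda>_. 0"])
    show "((\<lambda>_. 0) has_derivative (\<lambda>_. 0)) (at z within UNIV)" by simp
    show "open (- supp f)" by (simp add: open_Compl closed_supp)
  qed (use assms in \<open>auto simp: not_in_supp\<close>)
  then show ?thesis by (rule pdiff_eq)
qed

lemma smooth_cpt_pdiff: "f \<in> smooth_cpt S \<Longrightarrow> b \<in> Basis \<Longrightarrow> pdiff b f \<in> smooth_cpt S"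
  by (rule smooth_cptI[where K = "supp f"]) (auto dest: smooth_cptD intro: smooth_pdiff pdiff_outside_supp)

lemma pdiff_sum_Basis:
  assumes "f differentiable (at z)"
  shows "pdiff v f z = (\<Sum>b\<in>Basis. (v \<bullet> b) *\<^sub>R pdiff b f z)"
proof -
  have lin: "linear (\<lambda>w. pdiff w f z)"
    using has_derivative_linear[OF differentiable_derivative[OF assms]] .
  have "pdiff (\<Sum>b\<in>Basis. (v \<bullet> b) *\<^sub>R b) f z = (\<Sum>b\<in>Basis. (v \<bullet> b) *\<^sub>R pdiff b f z)"
    by (simp only: linear_sum[OF lin] linear_scale[OF lin])
  then show ?thesis by (simp add: euclidean_representation)
qed

lemma smooth_sum:
  "(\<And>i. i \<in> I \<Longrightarrow> smooth (f i)) \<Longrightarrow> smooth (\<lambda>z. \<Sum>i\<in>I. f i z)"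
  by (induction I rule: infinite_finite_induct) (auto intro: smooth_add smooth_const)

lemma smooth_cpt_pdiff_dir:
  assumes "f \<in> smooth_cpt S"
  shows "pdiff v f \<in> smooth_cpt S"
proof (rule smooth_cptI[where K = "supp f"])
  have "pdiff v f = (\<lambda>z. \<Sum>b\<in>Basis. (v \<bullet> b) *\<^sub>R pdiff b f z)"
    by (rule ext, rule pdiff_sum_Basis) (intro smooth_imp_differentiable smooth_cptD(1)[OF assms])
  then show "smooth (pdiff v f)"
    by (simp only:) (intro smooth_sum smooth_scaleR smooth_const smooth_pdiff smooth_cptD(1)[OF assms])
qed (auto intro: pdiff_outside_supp smooth_cptD[OF assms] dest: set_mp[OF smooth_cptD(3)[OF assms]])

lemma smooth_cpt_foldr_pdiff:
  "f \<in> smooth_cpt S \<Longrightarrow> set vs \<subseteq> Basis \<Longrightarrow> foldr pdiff vs f \<in> smooth_cpt S"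
  by (induction vs) (auto intro: smooth_cpt_pdiff)

lemma smooth_cpt_scaleR:
  fixes f :: "'a::euclidean_space \<Rightarrow> real"
  shows "f \<in> smooth_cpt S \<Longrightarrow> smooth g \<Longrightarrow> (\<lambda>z. f z *\<^sub>R g z) \<in> smooth_cpt S"
  by (rule smooth_cptI[where K = "supp f"]) (auto dest: smooth_cptD intro: smooth_scaleR simp: not_in_supp)

lemma smooth_cpt_affine:
  fixes f :: "'a::euclidean_space \<Rightarrow> 'b::real_normed_vector"
  assumes f: "f \<in> smooth_cpt S" and c: "\<And>b. b \<in> Basis \<Longrightarrow> c b \<noteq> 0"
    and S: "\<And>z. v + diag c z \<in> S \<Longrightarrow> z \<in> S'"
  shows "(\<lambda>z. f (v + diag c z)) \<in> smooth_cpt S'"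
proof (rule smooth_cptI[where K = "(\<lambda>w. diag (\<lambda>b. inverse (c b)) (w - v)) ` supp f"])
  have inv: "diag (\<lambda>b. inverse (c b)) (diag c z) = z" "diag c (diag (\<lambda>b. inverse (c b)) z) = z" for z
    by (rule euclidean_eqI, use c in \<open>simp add: diag_def\<close>)+
  show "compact ((\<lambda>w. diag (\<lambda>b. inverse (c b)) (w - v)) ` supp f)"
    using smooth_cptD(2)[OF f] by (intro compact_continuous_image) (auto simp: diag_def intro!: continuous_intros)
  show "(\<lambda>w. diag (\<lambda>b. inverse (c b)) (w - v)) ` supp f \<subseteq> S'"
    using smooth_cptD(3)[OF f] S by (auto simp: inv)
  show "f (v + diag c z) = 0" if "z \<notin> (\<lambda>w. diag (\<lambda>b. inverse (c b)) (w - v)) ` supp f" for z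
  proof (rule not_in_supp[where f = f], rule)
    assume "v + diag c z \<in> supp f"
    then have "diag (\<lambda>b. inverse (c b)) (v + diag c z - v) \<in> (\<lambda>w. diag (\<lambda>b. inverse (c b)) (w - v)) ` supp f"
      by (rule imageI)
    with that show False by (simp add: inv)
  qed
qed (use smooth_cptD(1)[OF f] in \<open>rule smooth_affine\<close>)

lemmas smooth_cpt_translate = smooth_cpt_affine[where c = "\<lambda>_. 1", simplified]

lemma smooth_cpt_bounded:
  fixes f :: "'a::euclidean_space \<Rightarrow> 'b::real_normed_vector"
  assumes "f \<in> smooth_cpt S"
  shows "\<exists>B. \<forall>z. norm (f z) \<le> B"
proof -
  have "compact (f ` supp f)"
    using smooth_cptD[OF assms] by (intro compact_continuous_image continuous_on_subset[OF smooth_imp_continuous]) auto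
  then obtain B where B: "\<And>z. z \<in> supp f \<Longrightarrow> norm (f z) \<le> B"
    by (metis bounded_iff compact_imp_bounded imageI)
  show ?thesis
  proof (intro exI[of _ "max B 0"] allI)
    show "norm (f z) \<le> max B 0" for z
      using B[of z] not_in_supp[of z f] by (cases "z \<in> supp f") auto
  qed
qed

lemma smooth_cpt_in_L2:
  fixes f :: "'a::euclidean_space \<Rightarrow> 'b::euclidean_space"
  assumes "f \<in> smooth_cpt S"
  shows "in_L2 lebesgue f"
proof -
  obtain B where B: "\<And>z. norm (f z) \<le> B" using smooth_cpt_bounded[OF assms] by blast
  have K: "supp f \<in> lmeasurable" using smooth_cptD(2)[OF assms] by (rule lmeasurable_compact)
  have "in_L2 lebesgue (indicator (supp f) :: 'a \<Rightarrow> real)"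
  proof -
    have "(\<lambda>z. (norm (indicator (supp f) z :: real))\<^sup>2) = (indicator (supp f) :: 'a \<Rightarrow> real)"
      by (auto simp: indicator_def)
    then show ?thesis
      using K by (auto simp: in_L2_def fmeasurable_def intro!: integrable_real_indicator)
  qed
  then show ?thesis
  proof (rule in_L2_bound)
    have "f \<in> borel_measurable borel"
      using smooth_imp_continuous[OF smooth_cptD(1)[OF assms]] by (rule borel_measurable_continuous_onI)
    then show "f \<in> borel_measurable lebesgue"
      by (simp add: measurable_completion)
    show "AE z in lebesgue. norm (f z) \<le> B * norm (indicator (supp f) z :: real)"
      using B not_in_supp[of _ f] by (intro AE_I2) (auto simp: indicator_def)
  qed
qed

subsection \<open>Bump functions\<close>

text \<open>The classical x^(-n) exp(-1/x), extended by 0. The whole family in n is needed because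
  differentiation leads from one member to a combination of the next two.\<close>

definition flat_exp :: "nat \<Rightarrow> real \<Rightarrow> real"
  where "flat_exp n x = (if 0 < x then inverse x ^ n * exp (- inverse x) else 0)"

lemma flat_exp_tendsto_0: "(flat_exp n \<longlongrightarrow> 0) (at 0)"
proof -
  have "((\<lambda>y. y ^ n / exp y) \<longlongrightarrow> (0::real)) at_top"
    by (rule tendsto_power_div_exp_0)
  then have "((\<lambda>x. inverse x ^ n / exp (inverse x)) \<longlongrightarrow> (0::real)) (at_right 0)"
    by (rule filterlim_compose[OF _ filterlim_inverse_at_top_right])
  then have "(flat_exp n \<longlongrightarrow> 0) (at_right 0)"
    by (rule Lim_transform_eventually) (auto simp: flat_exp_def exp_minus divide_inverse eventually_at_filter)
  moreover have "(flat_exp n \<longlongrightarrow> 0) (at_left 0)"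
    by (rule Lim_transform_eventually[OF tendsto_const]) (auto simp: flat_exp_def eventually_at_filter)
  ultimately show ?thesis by (simp add: filterlim_split_at)
qed

lemma flat_exp_deriv:
  "(flat_exp n has_real_derivative (flat_exp (n + 2) x - real n * flat_exp (n + 1) x)) (at x)"
proof -
  consider "x < 0" | "x = 0" | "0 < x" by linarith
  then show ?thesis
  proof cases
    case 1
    have "((\<lambda>_. 0) has_real_derivative 0) (at x)" by simp
    then have "(flat_exp n has_real_derivative 0) (at x)"
      by (rule has_field_derivative_transform_within_open[where S = "{..<0}"]) (use 1 in \<open>auto simp: flat_exp_def\<close>)
    then show ?thesis using 1 by (simp add: flat_exp_def)
  next
    case 2
    have "((\<lambda>h. (flat_exp n (0 + h) - flat_exp n 0) / h) \<longlongrightarrow> 0) (at 0)"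
      by (rule Lim_transform_eventually[OF flat_exp_tendsto_0[of "Suc n"]])
        (auto simp: flat_exp_def eventually_at_filter field_simps)
    then show ?thesis using 2 by (simp add: DERIV_def flat_exp_def)
  next
    case 3
    have inv: "((\<lambda>x. inverse x) has_real_derivative - (inverse x ^ 2)) (at x)"
      using 3 DERIV_inverse[of x UNIV] by (simp add: numeral_2_eq_2)
    have pow: "real n * (y ^ (n - 1) * - (y ^ 2)) * e + e * (y ^ 2) * y ^ n
        = y ^ (n + 2) * e - real n * (y ^ (n + 1) * e)" for y e :: real
      by (cases n) (simp_all add: power2_eq_square algebra_simps)
    have "((\<lambda>x. inverse x ^ n * exp (- inverse x)) has_real_derivative
      (real n * (inverse x ^ (n - 1) * - (inverse x ^ 2)) * exp (- inverse x)
        + exp (- inverse x) * (inverse x ^ 2) * inverse x ^ n)) (at x)"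
      by (rule DERIV_mult[OF DERIV_power[OF inv, simplified One_nat_def[symmetric]] DERIV_chain2[OF DERIV_exp DERIV_minus[OF inv]], THEN DERIV_cong])
        (simp add: algebra_simps)
    then have "((\<lambda>x. inverse x ^ n * exp (- inverse x)) has_real_derivative
      (inverse x ^ (n + 2) * exp (- inverse x) - real n * (inverse x ^ (n + 1) * exp (- inverse x)))) (at x)"
      by (simp only: pow)
    then have "(flat_exp n has_real_derivative
      (inverse x ^ (n + 2) * exp (- inverse x) - real n * (inverse x ^ (n + 1) * exp (- inverse x)))) (at x)"
      by (rule has_field_derivative_transform_within_open[where S = "{0<..}"]) (use 3 in \<open>auto simp: flat_exp_def\<close>)
    then show ?thesis using 3 by (simp add: flat_exp_def)
  qed
qed

lemma C_k_flat_exp: "C_k k (flat_exp n)"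
proof (induction k arbitrary: n)
  case 0
  show ?case
    using flat_exp_deriv[THEN DERIV_isCont] by (simp add: continuous_at_imp_continuous_on)
next
  case (Suc k)
  have d: "(flat_exp n has_derivative (\<lambda>v. (flat_exp (n + 2) x - real n * flat_exp (n + 1) x) * v)) (at x)" for x
    using flat_exp_deriv[of n x] by (simp add: has_field_derivative_def)
  have "pdiff 1 (flat_exp n) = (\<lambda>x. flat_exp (n + 2) x + (- real n) *\<^sub>R flat_exp (n + 1) x)"
    by (rule ext) (simp add: pdiff_eq[OF d])
  then have "C_k k (pdiff 1 (flat_exp n))"
    using Suc by (simp only:) (intro C_k_add C_k_scaleR C_k_const)
  then show ?case using d by (auto simp: differentiable_def)
qed

lemma smooth_flat_exp: "smooth (flat_exp n)"
  by (simp add: smooth_def C_k_flat_exp)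

lemma flat_exp_bounds: "0 \<le> flat_exp 0 x" "flat_exp 0 x \<le> 1" "flat_exp 0 x > 0 \<longleftrightarrow> 0 < x" "x \<le> 0 \<Longrightarrow> flat_exp n x = 0"
  by (auto simp: flat_exp_def)

definition bump :: "'a::euclidean_space \<Rightarrow> 'a \<Rightarrow> 'a \<Rightarrow> real"
  where "bump l u z = (\<Prod>b\<in>Basis. flat_exp 0 (z \<bullet> b - l \<bullet> b) * flat_exp 0 (u \<bullet> b - z \<bullet> b))"

lemma bump_bounds: "0 \<le> bump l u z" "bump l u z \<le> 1"
  unfolding bump_def
  by (auto intro!: prod_nonneg prod_le_1 mult_nonneg_nonneg mult_le_one flat_exp_bounds)

lemma bump_pos: "z \<in> box l u \<Longrightarrow> 0 < bump l u z"
  unfolding bump_def by (intro prod_pos) (auto simp: mem_box flat_exp_bounds)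

lemma bump_zero: "z \<notin> box l u \<Longrightarrow> bump l u z = 0"
proof -
  assume "z \<notin> box l u"
  then obtain b where b: "b \<in> Basis" "z \<bullet> b \<le> l \<bullet> b \<or> u \<bullet> b \<le> z \<bullet> b"
    by (auto simp: mem_box not_less)
  then have "flat_exp 0 (z \<bullet> b - l \<bullet> b) * flat_exp 0 (u \<bullet> b - z \<bullet> b) = 0"
    using flat_exp_bounds(4)[of "z \<bullet> b - l \<bullet> b" 0] flat_exp_bounds(4)[of "u \<bullet> b - z \<bullet> b" 0] by auto
  with b(1) show ?thesis
    unfolding bump_def by (intro prod_zero) auto
qed

lemma smooth_bump: "smooth (bump l u)"
proof -
  have s: "smooth (\<lambda>x::real. flat_exp 0 (a + c * x))" for a c
    using smooth_affine[OF smooth_flat_exp[of 0], of a "\<lambda>_. c"] by (simp add: diag_def)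
  have "smooth (\<lambda>z. flat_exp 0 (z \<bullet> b - l \<bullet> b))" "smooth (\<lambda>z. flat_exp 0 (u \<bullet> b - z \<bullet> b))" if "b \<in> Basis" for b :: 'a
    using smooth_coordinate[OF s[of "- (l \<bullet> b)" 1] that] smooth_coordinate[OF s[of "u \<bullet> b" "-1"] that] by simp_all
  then show ?thesis
    unfolding bump_def[abs_def] by (intro smooth_prod smooth_mult) auto
qed

text \<open>By Lindelof, S is covered by countably many open boxes whose closed boxes lie in S. The
  product of the first n factors 1 - bump stays below a number less than 1 at each point of S from
  some n on; its n-th power tends to 0 there, and is 1 outside S.\<close>

lemma smooth_exhaustion:
  fixes S :: "'a::euclidean_space set"
  assumes "open S"
  obtains f :: "nat \<Rightarrow> 'a \<Rightarrow> real" where "\<And>n. f n \<in> smooth_cpt S" "\<And>n z. 0 \<le> f n z \<and> f n z \<le> 1"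
    "\<And>z. (\<lambda>n. f n z) \<longlonglongrightarrow> indicator S z"
proof -
  let ?F = "{box l u | l u :: 'a. cbox l u \<subseteq> S}"
  have "\<Union>?F = S"
  proof (intro equalityI subsetI)
    fix z assume z: "z \<in> S"
    obtain a b where ab: "cbox a b \<subseteq> S" "z \<in> box a b"
      by (rule open_contains_cbox[OF assms z])
    show "z \<in> \<Union>?F"
      by (rule UnionI[of "box a b"]) (use ab in auto)
  next
    fix z assume "z \<in> \<Union>?F"
    then obtain l u where "z \<in> box l u" "cbox l u \<subseteq> S" by auto
    then show "z \<in> S" using box_subset_cbox[of l u] by auto
  qed
  have op: "open B" if "B \<in> ?F" for B
    using that by (auto simp: open_box)
  obtain F' where "F' \<subseteq> ?F" "countable F'" "\<Union>F' = \<Union>?F"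
    by (rule Lindelof[OF op])
  then have F': "F' \<subseteq> ?F" "countable F'" "\<Union>F' = S"
    by (simp_all only: \<open>\<Union>?F = S\<close>)
  \<comment> \<open>The additional empty box makes the family nonempty, so that
    \<open>from_nat_into\<close> enumerates members of it in every case.\<close>
  let ?F'' = "insert {} F'"
  have "\<forall>n. \<exists>l u. from_nat_into ?F'' n = box l u \<and> cbox l u \<subseteq> S"
  proof
    fix n
    have "from_nat_into ?F'' n \<in> ?F''" by (rule from_nat_into) simp
    moreover have "\<exists>l u :: 'a. {} = box l u \<and> cbox l u \<subseteq> S"
    proof -
      obtain b :: 'a where b: "b \<in> Basis" using nonempty_Basis by blast
      have "cbox (One :: 'a) 0 = {}" unfolding box_eq_empty using b by (intro bexI[of _ b]) (auto simp: inner_sum_left inner_Basis if_distrib)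
      then show ?thesis
        using box_subset_cbox[of "One :: 'a" 0] by (intro exI[of _ One] exI[of _ 0]) auto
    qed
    moreover have "\<exists>l u. B = box l u \<and> cbox l u \<subseteq> S" if "B \<in> F'" for B
      using F'(1) that by blast
    ultimately show "\<exists>l u. from_nat_into ?F'' n = box l u \<and> cbox l u \<subseteq> S"
      by (metis insertE)
  qed
  then obtain l u where lu: "\<And>n. from_nat_into ?F'' n = box (l n) (u n)" "\<And>n. cbox (l n) (u n) \<subseteq> S"
    by metis
  define f where "f n z = 1 - (\<Prod>i<n. 1 - bump (l i) (u i) z) ^ n" for n z
  have p: "0 \<le> (\<Prod>i<n. 1 - bump (l i) (u i) z)" "(\<Prod>i<n. 1 - bump (l i) (u i) z) \<le> 1" for n z
    using bump_bounds by (auto intro!: prod_nonneg prod_le_1)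
  show ?thesis
  proof
    show "f n \<in> smooth_cpt S" for n
    proof (rule smooth_cptI[where K = "\<Union>i<n. cbox (l i) (u i)"])
      show "smooth (f n)"
        unfolding f_def by (intro smooth_diff smooth_const smooth_power smooth_prod smooth_bump)
      show "compact (\<Union>i<n. cbox (l i) (u i))" by (intro compact_UN) auto
      show "(\<Union>i<n. cbox (l i) (u i)) \<subseteq> S" using lu(2) by blast
      show "f n z = 0" if "z \<notin> (\<Union>i<n. cbox (l i) (u i))" for z
      proof -
        have "bump (l i) (u i) z = 0" if "i < n" for i
          using that \<open>z \<notin> _\<close> box_subset_cbox by (intro bump_zero) blast
        then show ?thesis by (simp add: f_def)
      qed
    qed
    show "0 \<le> f n z \<and> f n z \<le> 1" for n z
      using p[where n = n and z = z] by (simp add: f_def power_le_one)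
    show "(\<lambda>n. f n z) \<longlonglongrightarrow> indicator S z" for z
    proof (cases "z \<in> S")
      case True
      then obtain B where B: "B \<in> F'" "z \<in> B" using F' by blast
      have "countable ?F''" using F'(2) by simp
      then obtain j where j: "from_nat_into ?F'' j = B"
        using from_nat_into_surj[of ?F'' B] B by blast
      define r where "r = 1 - bump (l j) (u j) z"
      have r: "0 \<le> r" "r < 1"
        using bump_pos[where z = z and l = "l j" and u = "u j"] bump_bounds[where l = "l j" and u = "u j" and z = z] j B lu(1)[of j] by (auto simp: r_def)
      have "(\<lambda>n. (\<Prod>i<n. 1 - bump (l i) (u i) z) ^ n) \<longlonglongrightarrow> 0"
      proof (rule tendsto_sandwich[OF _ _ tendsto_const LIMSEQ_realpow_zero[OF r]])
        show "\<forall>\<^sub>F n in sequentially. 0 \<le> (\<Prod>i<n. 1 - bump (l i) (u i) z) ^ n"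
          using p by (auto intro!: always_eventually)
        show "\<forall>\<^sub>F n in sequentially. (\<Prod>i<n. 1 - bump (l i) (u i) z) ^ n \<le> r ^ n"
        proof (rule eventually_sequentiallyI[of "Suc j"])
          fix n assume "Suc j \<le> n"
          then have "(\<Prod>i<n. 1 - bump (l i) (u i) z) = r * (\<Prod>i\<in>{..<n} - {j}. 1 - bump (l i) (u i) z)"
            by (subst prod.remove[of _ j]) (auto simp: r_def)
          also have "\<dots> \<le> r * 1"
            using r bump_bounds by (intro mult_left_mono prod_le_1) auto
          finally show "(\<Prod>i<n. 1 - bump (l i) (u i) z) ^ n \<le> r ^ n"
            using p by (intro power_mono) auto
        qed
      qed
      then have "(\<lambda>n. f n z) \<longlonglongrightarrow> 1 - 0"
        unfolding f_def by (intro tendsto_intros)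
      then show ?thesis using True by simp
    next
      case False
      then have "bump (l i) (u i) z = 0" for i
        using lu(2)[of i] box_subset_cbox by (intro bump_zero) blast
      then show ?thesis using False by (simp add: f_def)
    qed
  qed
qed

section \<open>Density of test functions in L2 of an open set\<close>

section \<open>Density of test functions\<close>

lemma in_L2_indicator_set:
  assumes "B \<in> lmeasurable"
  shows "in_L2 lebesgue (indicator B :: 'a::euclidean_space \<Rightarrow> real)"
proof -
  have "(\<lambda>z. (norm (indicator B z :: real))\<^sup>2) = (indicator B :: 'a \<Rightarrow> real)"
    by (auto simp: indicator_def)
  then show ?thesis
    using assms by (auto simp: in_L2_def fmeasurable_def intro!: integrable_real_indicator)
qed

lemma norm_mk_sq: "in_L2 lebesgue f \<Longrightarrow> (norm (mk f))\<^sup>2 = (LINT z|lebesgue. (norm (f z))\<^sup>2)"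
  by (simp add: norm_mk L2_norm_def integral_nonneg_AE)

definition tests :: "'a::euclidean_space set \<Rightarrow> ('a, real) l2 set"
  where "tests S = mk ` smooth_cpt S"

lemma smooth_cpt_add:
  assumes "f \<in> smooth_cpt S" "g \<in> smooth_cpt S"
  shows "(\<lambda>z. f z + g z) \<in> smooth_cpt S"
proof (rule smooth_cptI[where K = "supp f \<union> supp g"])
  show "smooth (\<lambda>z. f z + g z)" by (intro smooth_add smooth_cptD(1)[OF assms(1)] smooth_cptD(1)[OF assms(2)])
  show "compact (supp f \<union> supp g)" by (intro compact_Un smooth_cptD(2)[OF assms(1)] smooth_cptD(2)[OF assms(2)])
  show "supp f \<union> supp g \<subseteq> S" by (intro Un_least smooth_cptD(3)[OF assms(1)] smooth_cptD(3)[OF assms(2)])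
qed (simp add: not_in_supp)

lemma subspace_tests: "subspace (tests S)"
  unfolding subspace_def
proof (intro conjI ballI allI)
  have "(\<lambda>z. 0 :: real) \<in> smooth_cpt S"
    by (rule smooth_cptI[where K = "{}"]) (auto intro: smooth_const)
  then show "0 \<in> tests S" by (auto simp: tests_def mk_zero)
  fix x y :: "('a, real) l2" and c :: real
  assume "x \<in> tests S"
  then obtain f where f: "x = mk f" "f \<in> smooth_cpt S" by (auto simp: tests_def)
  then show "c *\<^sub>R x \<in> tests S"
    using smooth_cpt_scaleR[OF f(2) smooth_const[of c]] by (auto simp: tests_def mk_scaleR smooth_cpt_in_L2[OF f(2)] mult.commute)
  assume "y \<in> tests S"
  then obtain g where g: "y = mk g" "g \<in> smooth_cpt S" by (auto simp: tests_def)
  show "x + y \<in> tests S"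
    using smooth_cpt_add[OF f(2) g(2)] by (auto simp: tests_def f g mk_plus smooth_cpt_in_L2[OF f(2)] smooth_cpt_in_L2[OF g(2)])
qed

lemma smooth_exhaustion_ex:
  fixes S :: "'a::euclidean_space set"
  assumes "open S"
  shows "\<exists>f :: nat \<Rightarrow> 'a \<Rightarrow> real. (\<forall>n. f n \<in> smooth_cpt S) \<and> (\<forall>n z. 0 \<le> f n z \<and> f n z \<le> 1) \<and>
    (\<forall>z. (\<lambda>n. f n z) \<longlonglongrightarrow> indicator S z)"
  by (rule smooth_exhaustion[OF assms]) blast

lemma subspace_closure:
  fixes T :: "'v::real_normed_vector set"
  assumes "subspace T"
  shows "subspace (closure T)"
  unfolding subspace_def
proof (intro conjI ballI allI)
  show "0 \<in> closure T" using subspace_0[OF assms] closure_subset by blast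
  fix x y :: 'v and c :: real
  assume "x \<in> closure T"
  then obtain f where f: "\<And>n. f n \<in> T" "f \<longlonglongrightarrow> x" by (auto simp: closure_sequential)
  have "(\<lambda>n. c *\<^sub>R f n) \<longlonglongrightarrow> c *\<^sub>R x" by (rule tendsto_scaleR[OF tendsto_const f(2)])
  then show "c *\<^sub>R x \<in> closure T"
    unfolding closure_sequential
    by (intro exI[of _ "\<lambda>n. c *\<^sub>R f n"] conjI allI subspace_scale[OF assms] f(1))
  assume "y \<in> closure T"
  then obtain g where g: "\<And>n. g n \<in> T" "g \<longlonglongrightarrow> y" by (auto simp: closure_sequential)
  have "(\<lambda>n. f n + g n) \<longlonglongrightarrow> x + y" by (rule tendsto_add[OF f(2) g(2)])
  then show "x + y \<in> closure T"
    unfolding closure_sequential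
    by (intro exI[of _ "\<lambda>n. f n + g n"] conjI allI subspace_add[OF assms] f(1) g(1))
qed

lemma L2_dominated_convergence:
  fixes f :: "nat \<Rightarrow> 'a::euclidean_space \<Rightarrow> 'b::euclidean_space"
  assumes "\<And>n. in_L2 lebesgue (f n)" "in_L2 lebesgue g" "in_L2 lebesgue w"
    and "AE z in lebesgue. (\<lambda>n. f n z) \<longlonglongrightarrow> g z"
    and "\<And>n. AE z in lebesgue. norm (f n z - g z) \<le> norm (w z)"
  shows "(\<lambda>n. mk (f n)) \<longlonglongrightarrow> mk g"
proof -
  have "(\<lambda>n. LINT z|lebesgue. (norm (f n z - g z))\<^sup>2) \<longlonglongrightarrow> (LINT z|(lebesgue :: 'a measure). 0)"
  proof (rule integral_dominated_convergence[where w = "\<lambda>z. (norm (w z))\<^sup>2"])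
    show "(\<lambda>z. (norm (f n z - g z))\<^sup>2) \<in> borel_measurable lebesgue" for n
      using in_L2_diff[OF assms(1,2)] by (auto simp: in_L2_def)
    show "integrable lebesgue (\<lambda>z. (norm (w z))\<^sup>2)"
      using assms(3) by (simp add: in_L2_def)
    show "AE z in lebesgue. (\<lambda>n. (norm (f n z - g z))\<^sup>2) \<longlonglongrightarrow> 0"
      using assms(4)
    proof eventually_elim
      case (elim z)
      then have "(\<lambda>n. (norm (f n z - g z))\<^sup>2) \<longlonglongrightarrow> (norm (g z - g z))\<^sup>2"
        by (intro tendsto_intros)
      then show ?case by simp
    qed
    show "AE z in lebesgue. norm ((norm (f n z - g z))\<^sup>2) \<le> (norm (w z))\<^sup>2" for n
      using assms(5)[of n] by eventually_elim (simp add: power_mono)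
  qed simp
  then have "(\<lambda>n. (norm (mk (f n) - mk g))\<^sup>2) \<longlonglongrightarrow> 0"
    by (simp add: mk_diff assms norm_mk_sq in_L2_diff)
  then have "(\<lambda>n. sqrt ((norm (mk (f n) - mk g))\<^sup>2)) \<longlonglongrightarrow> sqrt 0"
    by (rule tendsto_real_sqrt)
  then show ?thesis
    by (simp add: LIM_zero_iff tendsto_norm_zero_iff)
qed

text \<open>Outer regularity yields an open U with B inside U, U inside S and U - B of small
  measure; the test functions exhausting U converge to its indicator in L2.\<close>

lemma indicator_in_closure_tests:
  assumes S: "open S" and B: "B \<in> lmeasurable" "B \<subseteq> S"
  shows "mk (indicator B) \<in> closure (tests S)"
  unfolding closure_approachable
proof (intro allI impI)
  fix e :: real assume e: "0 < e"
  have e2: "0 < (e / 2)\<^sup>2" using e by simp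
  have BL: "B \<in> sets lebesgue" using B(1) by (rule fmeasurableD)
  obtain T where T: "open T" "B \<subseteq> T" "T - B \<in> lmeasurable" "emeasure lebesgue (T - B) < ennreal ((e / 2)\<^sup>2)"
    by (rule sets_lebesgue_outer_open[OF BL e2])
  define U where "U = T \<inter> S"
  have U: "open U" "B \<subseteq> U" "U \<subseteq> S" using T S B by (auto simp: U_def)
  have UB: "U - B \<in> lmeasurable"
  proof (rule fmeasurableI2[OF T(3)])
    show "U - B \<in> sets lebesgue"
      using U(1) BL by (intro sets.Diff) auto
  qed (auto simp: U_def)
  have UL: "U \<in> lmeasurable"
    using fmeasurable.Un[OF UB B(1)] U(2) by (simp add: Un_absorb2)
  obtain f where f: "\<And>n. f n \<in> smooth_cpt U" "\<And>n z. 0 \<le> f n z \<and> f n z \<le> (1::real)" "\<And>z. (\<lambda>n. f n z) \<longlonglongrightarrow> indicator U z"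
    using smooth_exhaustion_ex[OF U(1)] by blast
  have lim: "(\<lambda>n. mk (f n)) \<longlonglongrightarrow> mk (indicator U)"
  proof (rule L2_dominated_convergence[where w = "indicator U :: _ \<Rightarrow> real"])
    show "AE z in lebesgue. norm (f n z - indicator U z) \<le> norm (indicator U z :: real)" for n
      using f(2)[of n] smooth_cptD(4)[OF f(1)[of n]] by (intro AE_I2) (auto simp: indicator_def abs_le_iff)
  qed (use f UL in \<open>auto intro: smooth_cpt_in_L2 in_L2_indicator_set\<close>)
  then have "\<forall>\<^sub>F n in sequentially. dist (mk (f n)) (mk (indicator U)) < e / 2"
    by (rule tendstoD) (use e in simp)
  then obtain n where n: "dist (mk (f n)) (mk (indicator U)) < e / 2"
    unfolding eventually_sequentially by blast
  have ind: "(\<lambda>z. (norm (indicator U z - indicator B z :: real))\<^sup>2) = indicator (U - B)"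
    by (rule ext) (use U(2) in \<open>auto split: split_indicator\<close>)
  have norm: "(norm (mk (indicator U) - mk (indicator B) :: ('a, real) l2))\<^sup>2 = measure lebesgue (U - B)"
    using UL B ind by (simp add: mk_diff in_L2_indicator_set norm_mk_sq in_L2_diff)
  have "measure lebesgue (U - B) \<le> measure lebesgue (T - B)"
    using T(3) UB by (intro measure_mono_fmeasurable) (auto simp: U_def dest: fmeasurableD)
  moreover have "measure lebesgue (T - B) < (e / 2)\<^sup>2"
    using T(4) unfolding emeasure_eq_measure2[OF T(3)] by (simp add: ennreal_less_iff)
  ultimately have "(norm (mk (indicator U) - mk (indicator B) :: ('a, real) l2))\<^sup>2 < (e / 2)\<^sup>2"
    unfolding norm by linarith
  then have "norm (mk (indicator U) - mk (indicator B) :: ('a, real) l2) < e / 2"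
    by (rule power2_less_imp_less) (use e in simp)
  then have "dist (mk (f n)) (mk (indicator B)) < e"
    using n dist_triangle[of "mk (f n)" "mk (indicator B)" "mk (indicator U)"] by (simp add: dist_norm[of "mk (indicator U)"])
  then show "\<exists>y\<in>tests S. dist y (mk (indicator B)) < e"
    using smooth_cpt_mono[OF f(1) U(3)] by (auto simp: tests_def)
qed

text \<open>Simple functions with modulus at most twice that of f converge to f in L2 by domination.
  Their level sets for nonzero values have finite measure, which reduces the claim to
  indicators.\<close>

lemma in_closure_tests:
  fixes x :: "('a::euclidean_space, real) l2"
  assumes S: "open S" and x: "rst S x = x"
  shows "x \<in> closure (tests S)"
proof -
  have SL: "S \<in> sets lebesgue" using S by auto
  have sub: "subspace (closure (tests S))"
    by (rule subspace_closure[OF subspace_tests])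
  have "rst S x \<in> closure (tests S)"
  proof (induction x rule: mk_induct)
    case (mk f)
    then have fm: "f \<in> borel_measurable lebesgue" by (simp add: in_L2_def)
    obtain F where F: "\<And>i. simple_function lebesgue (F i)" "\<And>z. (\<lambda>i. F i z) \<longlonglongrightarrow> f z"
      "\<And>i z. dist (F i z) 0 \<le> 2 * dist (f z) 0"
      using borel_measurable_implies_sequence_metric[OF fm, of 0] by auto
    have F2: "in_L2 lebesgue (F i)" for i
    proof (rule in_L2_bound[OF mk])
      show "F i \<in> borel_measurable lebesgue" by (rule borel_measurable_simple_function[OF F(1)])
      show "AE z in lebesgue. norm (F i z) \<le> 2 * norm (f z)"
        using F(3)[of i] by (intro AE_I2) simp
    qed
    have "mk (\<lambda>z. indicator S z *\<^sub>R F i z) \<in> closure (tests S)" for i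
    proof -
      let ?B = "\<lambda>y. {z. F i z = y} \<inter> S"
      let ?Y = "F i ` UNIV - {0}"
      have fin: "finite ?Y" using simple_functionD(1)[OF F(1)] by simp
      have B: "?B y \<in> lmeasurable" if y: "y \<noteq> 0" for y
      proof -
        have m: "?B y \<in> sets lebesgue"
          using simple_functionD(2)[OF F(1)[of i], of "{y}"] SL by (auto simp: vimage_def)
        have "integrable lebesgue (indicator (?B y) :: 'a \<Rightarrow> real)"
        proof (rule Bochner_Integration.integrable_bound)
          show "integrable lebesgue (\<lambda>z. inverse (y\<^sup>2) * (norm (F i z))\<^sup>2)"
            using F2[of i] by (simp add: in_L2_def)
          show "AE z in lebesgue. norm (indicator (?B y) z :: real) \<le> norm (inverse (y\<^sup>2) * (norm (F i z))\<^sup>2)"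
            using y by (intro AE_I2) (auto simp: indicator_def)
        qed (use m in simp)
        then show ?thesis using m by (simp add: fmeasurable_def integrable_indicator_iff)
      qed
      have e: "indicator S z *\<^sub>R F i z = (\<Sum>y\<in>?Y. y * indicator (?B y) z)" for z
      proof (cases "z \<in> S \<and> F i z \<noteq> 0")
        case True
        then have "(\<Sum>y\<in>?Y. y * indicator (?B y) z) = (\<Sum>y\<in>?Y. if y = F i z then y else 0)"
          by (intro sum.cong refl) (auto simp: indicator_def)
        then show ?thesis using True fin by simp
      next
        case False
        then have "(\<Sum>y\<in>?Y. y * indicator (?B y) z) = 0"
          by (intro sum.neutral) (auto simp: indicator_def)
        then show ?thesis using False by (auto simp: indicator_def)
      qed
      have sc: "(\<lambda>z. y * indicator (?B y) z) = (\<lambda>z. y *\<^sub>R indicator (?B y) z)" for y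
        by simp
      have i2: "in_L2 lebesgue (\<lambda>z. y * indicator (?B y) z)" if "y \<in> ?Y" for y
        unfolding sc using that B by (intro in_L2_scaleR in_L2_indicator_set) auto
      have "mk (\<lambda>z. indicator S z *\<^sub>R F i z) = (\<Sum>y\<in>?Y. mk (\<lambda>z. y * indicator (?B y) z))"
        unfolding e using mk_sum[of ?Y "\<lambda>y z. y * indicator (?B y) z"] i2 by auto
      also have "\<dots> = (\<Sum>y\<in>?Y. y *\<^sub>R mk (indicator (?B y)))"
        unfolding sc by (intro sum.cong refl mk_scaleR[symmetric] in_L2_indicator_set B) auto
      also have "\<dots> \<in> closure (tests S)"
        using B by (intro subspace_sum[OF sub] subspace_scale[OF sub] indicator_in_closure_tests[OF S]) auto
      finally show ?thesis .
    qed
    moreover have "(\<lambda>i. mk (\<lambda>z. indicator S z *\<^sub>R F i z)) \<longlonglongrightarrow> mk (\<lambda>z. indicator S z *\<^sub>R f z)"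
    proof (rule L2_dominated_convergence[where w = "\<lambda>z. 3 *\<^sub>R f z"])
      show "AE z in lebesgue. norm (indicator S z *\<^sub>R F n z - indicator S z *\<^sub>R f z) \<le> norm (3 *\<^sub>R f z)" for n
      proof (intro AE_I2)
        fix z
        have "norm (F n z - f z) \<le> 3 * norm (f z)"
          using F(3)[of n z] norm_triangle_ineq4[of "F n z" "f z"] by simp
        then show "norm (indicator S z *\<^sub>R F n z - indicator S z *\<^sub>R f z) \<le> norm (3 *\<^sub>R f z)"
          by (auto simp: indicator_def)
      qed
      show "AE z in lebesgue. (\<lambda>n. indicator S z *\<^sub>R F n z) \<longlonglongrightarrow> indicator S z *\<^sub>R f z"
        by (intro AE_I2 tendsto_intros F(2))
    qed (use F2 mk SL in \<open>auto intro!: in_L2_indicator in_L2_scaleR simp del: real_scaleR_def\<close>)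
    ultimately show ?case
      unfolding rst_mk[OF SL mk] by (rule closed_sequentially[OF closed_closure])
  qed
  then show ?thesis by (simp add: x)
qed

section \<open>The lemma of du Bois-Reymond\<close>

subsection \<open>Uniqueness of weak derivatives\<close>

text \<open>The set where h is positive is, up to a null set, the intersection of a decreasing
  sequence of open sets; hence the integral of h over it is a limit of zeros.\<close>

lemma AE_zero_of_open_integrals:
  fixes h :: "'a::euclidean_space \<Rightarrow> real"
  assumes h: "integrable lebesgue h" and zero: "\<And>U. open U \<Longrightarrow> (LINT z|lebesgue. indicator U z * h z) = 0"
  shows "AE z in lebesgue. h z \<le> 0"
proof -
  have hm[measurable]: "h \<in> borel_measurable lebesgue" using h by auto
  define B where "B = {z. 0 < h z}"
  have Bm[measurable]: "B \<in> sets lebesgue"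
    unfolding B_def using borel_measurable_less[of "\<lambda>_. 0" lebesgue h] by simp
  have "\<forall>n. \<exists>T. open T \<and> B \<subseteq> T \<and> T - B \<in> lmeasurable \<and> emeasure lebesgue (T - B) < ennreal (1 / real (Suc n))"
  proof
    fix n
    show "\<exists>T. open T \<and> B \<subseteq> T \<and> T - B \<in> lmeasurable \<and> emeasure lebesgue (T - B) < ennreal (1 / real (Suc n))"
      using sets_lebesgue_outer_open[OF Bm, of "1 / real (Suc n)"] by (metis of_nat_0_less_iff zero_less_Suc zero_less_divide_1_iff)
  qed
  then obtain T where T: "\<And>n. open (T n)" "\<And>n. B \<subseteq> T n" "\<And>n. T n - B \<in> lmeasurable"
    "\<And>n. emeasure lebesgue (T n - B) < ennreal (1 / real (Suc n))"
    by metis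
  define U where "U n = (\<Inter>i\<le>n. T i)" for n
  have U: "open (U n)" "B \<subseteq> U n" for n using T by (auto simp: U_def)
  define Z where "Z = (\<Inter>n. U n) - B"
  have Zm: "Z \<in> sets lebesgue"
    unfolding Z_def using U(1) by (intro sets.Diff sets.countable_INT) auto
  have "Z \<in> null_sets lebesgue"
  proof (rule null_setsI[OF _ Zm])
    have "emeasure lebesgue Z \<le> ennreal (1 / real (Suc n))" for n
    proof -
      have "emeasure lebesgue Z \<le> emeasure lebesgue (T n - B)"
        using T(3)[of n] by (intro emeasure_mono) (auto simp: Z_def U_def dest: fmeasurableD)
      then show ?thesis using T(4)[of n] by simp
    qed
    moreover have "(\<lambda>n. ennreal (1 / real (Suc n))) \<longlonglongrightarrow> ennreal 0"
      by (intro tendsto_ennrealI) real_asymp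
    ultimately have "emeasure lebesgue Z \<le> ennreal 0"
      by (intro LIMSEQ_le_const[of _ "ennreal 0"]) auto
    then show "emeasure lebesgue Z = 0" by simp
  qed
  then have Z: "AE z in lebesgue. z \<notin> Z" by (rule AE_not_in)
  have "(\<lambda>n. LINT z|lebesgue. indicator (U n) z * h z) \<longlonglongrightarrow> (LINT z|lebesgue. indicator B z * h z)"
  proof (rule integral_dominated_convergence[where w = "\<lambda>z. norm (h z)"])
    show "AE z in lebesgue. (\<lambda>n. indicator (U n) z * h z) \<longlonglongrightarrow> indicator B z * h z"
      using Z
    proof eventually_elim
      case (elim z)
      show ?case
      proof (cases "z \<in> B")
        case True
        then show ?thesis using U(2) by (simp add: subset_iff)
      next
        case False
        with elim obtain n where n: "z \<notin> U n" by (auto simp: Z_def)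
        have "z \<notin> U k" if "n \<le> k" for k using n that by (auto simp: U_def)
        then have "\<forall>\<^sub>F k in sequentially. indicator (U k) z * h z = indicator B z * h z"
          using False by (intro eventually_sequentiallyI[of n]) simp
        then show ?thesis by (rule tendsto_eventually)
      qed
    qed
    show "(\<lambda>z. indicator (U n) z * h z) \<in> borel_measurable lebesgue" for n
      using U(1)[of n] by (intro borel_measurable_times borel_measurable_indicator) auto
    show "AE z in lebesgue. norm (indicator (U n) z * h z) \<le> norm (h z)" for n
      by (intro AE_I2) (auto simp: indicator_def)
  qed (use h in \<open>auto intro: borel_measurable_times borel_measurable_indicator Bm\<close>)
  then have "(LINT z|lebesgue. indicator B z * h z) = 0"
    using zero[OF U(1)] by (simp add: LIMSEQ_const_iff)
  moreover have "integrable lebesgue (\<lambda>z. indicator B z * h z)"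
    by (rule Bochner_Integration.integrable_bound[OF h]) (auto simp: indicator_def)
  ultimately have "AE z in lebesgue. indicator B z * h z = 0"
    by (subst (asm) integral_nonneg_eq_0_iff_AE) (auto simp: B_def indicator_def)
  then show ?thesis
    by eventually_elim (auto simp: B_def indicator_def split: if_splits)
qed

text \<open>On a box whose closed box lies in S, g is integrable, and test functions converge
  boundedly to the indicator of any open part; so \<open>AE_zero_of_open_integrals\<close> applies
  to g and to -g there. Countably many such boxes cover S.\<close>

lemma du_Bois_Reymond_real:
  fixes g :: "'a::euclidean_space \<Rightarrow> real"
  assumes S: "open S" and g: "loc_integrable S g"
    and zero: "\<And>\<phi>. \<phi> \<in> smooth_cpt S \<Longrightarrow> (LINT z|lebesgue_on S. \<phi> z * g z) = 0"
  shows "AE z in lebesgue. z \<in> S \<longrightarrow> g z = 0"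
proof -
  have box: "AE z in lebesgue. z \<in> box a b \<longrightarrow> g z = 0" if ab: "cbox a b \<subseteq> S" for a b
  proof -
    define h where "h z = indicator (box a b) z * g z" for z
    have gi: "integrable lebesgue (\<lambda>z. indicator (cbox a b) z * g z)"
      using g ab by (auto simp: loc_integrable_def absolutely_integrable_on_def set_integrable_def)
    have h: "integrable lebesgue h"
    proof -
      have "integrable lebesgue (\<lambda>z. indicator (box a b) z *\<^sub>R (indicator (cbox a b) z * g z))"
        by (rule integrable_mult_indicator[OF _ gi]) auto
      moreover have "(\<lambda>z. indicator (box a b) z *\<^sub>R (indicator (cbox a b) z * g z)) = h"
        using box_subset_cbox[of a b] by (auto simp: h_def indicator_def fun_eq_iff)
      ultimately show ?thesis by simp
    qed
    have U0: "(LINT z|lebesgue. indicator U z * h z) = 0" if U: "open U" for U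
    proof -
      have op: "open (U \<inter> box a b)" using U by auto
      obtain f where f: "\<And>n. f n \<in> smooth_cpt (U \<inter> box a b)" "\<And>n z. 0 \<le> f n z \<and> f n z \<le> (1::real)"
        "\<And>z. (\<lambda>n. f n z) \<longlonglongrightarrow> indicator (U \<inter> box a b) z"
        using smooth_exhaustion_ex[OF op] by blast
      have fS: "f n \<in> smooth_cpt S" for n
        by (rule smooth_cpt_mono[OF f(1)]) (use ab box_subset_cbox[of a b] in blast)
      have "(\<lambda>n. LINT z|lebesgue. f n z * h z) \<longlonglongrightarrow> (LINT z|lebesgue. indicator (U \<inter> box a b) z * h z)"
      proof (rule integral_dominated_convergence[where w = "\<lambda>z. norm (h z)"])
        show "(\<lambda>z. f n z * h z) \<in> borel_measurable lebesgue" for n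
          using h smooth_cpt_in_L2[OF fS[of n]] by (auto simp: in_L2_def)
        show "AE z in lebesgue. norm (f n z * h z) \<le> norm (h z)" for n
          using f(2)[of n] by (intro AE_I2) (simp add: abs_mult mult_left_le_one_le)
        show "AE z in lebesgue. (\<lambda>n. f n z * h z) \<longlonglongrightarrow> indicator (U \<inter> box a b) z * h z"
          by (intro AE_I2 tendsto_intros f(3))
      qed (use h op in \<open>auto intro!: borel_measurable_times borel_measurable_indicator\<close>)
      moreover have "(LINT z|lebesgue. f n z * h z) = 0" for n
      proof -
        have "(LINT z|lebesgue_on S. f n z * g z) = (LINT z|lebesgue. indicator S z *\<^sub>R (f n z * g z))"
          using S by (intro integral_restrict_space) auto
        also have "\<dots> = (LINT z|lebesgue. f n z * h z)"
          using smooth_cptD(4)[OF f(1)[of n]] smooth_cptD(4)[OF fS[of n]]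
          by (intro Bochner_Integration.integral_cong refl) (auto simp: h_def indicator_def)
        finally show ?thesis using zero[OF fS] by simp
      qed
      ultimately have "(LINT z|lebesgue. indicator (U \<inter> box a b) z * h z) = 0"
        by (simp add: LIMSEQ_const_iff)
      moreover have "indicator (U \<inter> box a b) z * h z = indicator U z * h z" for z
        by (auto simp: h_def indicator_def)
      ultimately show ?thesis by simp
    qed
    have "AE z in lebesgue. h z \<le> 0"
      by (rule AE_zero_of_open_integrals[OF h U0])
    moreover have "AE z in lebesgue. - h z \<le> 0"
    proof (rule AE_zero_of_open_integrals)
      show "integrable lebesgue (\<lambda>z. - h z)" using h by simp
      show "(LINT z|lebesgue. indicator U z * - h z) = 0" if "open U" for U
        using U0[OF that] by simp
    qed
    ultimately show ?thesis
      by eventually_elim (auto simp: h_def indicator_def split: if_splits)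
  qed
  let ?F = "{box l u | l u :: 'a. cbox l u \<subseteq> S}"
  have op: "open B" if "B \<in> ?F" for B
    using that by (auto simp: open_box)
  obtain F' where F': "F' \<subseteq> ?F" "countable F'" "\<Union>F' = \<Union>?F"
    by (rule Lindelof[OF op])
  have "AE z in lebesgue. \<forall>B\<in>F'. z \<in> B \<longrightarrow> g z = 0"
    unfolding AE_ball_countable[OF F'(2)] using F'(1) box by blast
  then show ?thesis
  proof eventually_elim
    case (elim z)
    show ?case
    proof
      assume z: "z \<in> S"
      obtain a b where ab: "cbox a b \<subseteq> S" "z \<in> box a b"
        by (rule open_contains_cbox[OF S z])
      then have "z \<in> \<Union>F'" unfolding F'(3) by blast
      with elim show "g z = 0" by blast
    qed
  qed
qed

lemma loc_integrable_mult_test: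
  fixes g :: "'a::euclidean_space \<Rightarrow> 'b::euclidean_space"
  assumes "loc_integrable S g" "\<phi> \<in> smooth_cpt S" "S \<in> sets lebesgue"
  shows "integrable (lebesgue_on S) (\<lambda>z. \<phi> z *\<^sub>R g z)"
proof -
  obtain B where B: "\<And>z. norm (\<phi> z) \<le> B" using smooth_cpt_bounded[OF assms(2)] by blast
  have m: "\<phi> \<in> borel_measurable lebesgue" using smooth_cpt_in_L2[OF assms(2)] by (simp add: in_L2_def)
  have gi: "integrable lebesgue (\<lambda>z. indicator (supp \<phi>) z *\<^sub>R g z)"
    using assms(1) smooth_cptD(2,3)[OF assms(2)]
    by (auto simp: loc_integrable_def absolutely_integrable_on_def set_integrable_def)
  have "integrable lebesgue (\<lambda>z. \<phi> z *\<^sub>R (indicator (supp \<phi>) z *\<^sub>R g z))"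
  proof (rule Bochner_Integration.integrable_bound)
    show "integrable lebesgue (\<lambda>z. B *\<^sub>R norm (indicator (supp \<phi>) z *\<^sub>R g z))"
      using gi by (intro integrable_scaleR_right integrable_norm)
    show "(\<lambda>z. \<phi> z *\<^sub>R (indicator (supp \<phi>) z *\<^sub>R g z)) \<in> borel_measurable lebesgue"
      using m borel_measurable_integrable[OF gi] by (rule borel_measurable_scaleR)
    show "AE z in lebesgue. norm (\<phi> z *\<^sub>R (indicator (supp \<phi>) z *\<^sub>R g z)) \<le> norm (B *\<^sub>R norm (indicator (supp \<phi>) z *\<^sub>R g z))"
    proof (intro AE_I2)
      fix z
      have "norm (\<phi> z) * norm (indicator (supp \<phi>) z *\<^sub>R g z) \<le> \<bar>B\<bar> * norm (indicator (supp \<phi>) z *\<^sub>R g z)"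
        using B[of z] by (intro mult_right_mono) auto
      then show "norm (\<phi> z *\<^sub>R (indicator (supp \<phi>) z *\<^sub>R g z)) \<le> norm (B *\<^sub>R norm (indicator (supp \<phi>) z *\<^sub>R g z))"
        by (simp add: abs_mult)
    qed
  qed
  moreover have "(\<lambda>z. \<phi> z *\<^sub>R (indicator (supp \<phi>) z *\<^sub>R g z)) = (\<lambda>z. indicator S z *\<^sub>R (\<phi> z *\<^sub>R g z))"
    using not_in_supp[of _ \<phi>] smooth_cptD(3)[OF assms(2)] by (auto simp: indicator_def fun_eq_iff)
  ultimately show ?thesis
    using assms(3) by (simp add: integrable_restrict_space)
qed

lemma weak_deriv_unique:
  fixes f :: "'a::euclidean_space \<Rightarrow> 'b::euclidean_space"
  assumes S: "open S" and g: "has_weak_deriv S vs f g" and g': "has_weak_deriv S vs f g'"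
  shows "AE z in lebesgue. z \<in> S \<longrightarrow> g z = g' z"
proof -
  have SL: "S \<in> sets lebesgue" using S by auto
  have loc: "loc_integrable S g" "loc_integrable S g'" using g g' by (auto simp: has_weak_deriv_def)
  have comp: "AE z in lebesgue. z \<in> S \<longrightarrow> (g z - g' z) \<bullet> b = 0" for b
  proof (rule du_Bois_Reymond_real[OF S])
    show "loc_integrable S (\<lambda>z. (g z - g' z) \<bullet> b)"
      unfolding loc_integrable_def
    proof (intro allI impI)
      fix K assume K: "compact K \<and> K \<subseteq> S"
      then have "(\<lambda>z. g z - g' z) absolutely_integrable_on K"
        using loc by (intro set_integral_diff) (auto simp: loc_integrable_def)
      then show "(\<lambda>z. (g z - g' z) \<bullet> b) absolutely_integrable_on K"
        using absolutely_integrable_linear[OF _ bounded_linear_inner_left[of b]] by (simp add: comp_def)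
    qed
    fix \<phi> :: "'a \<Rightarrow> real" assume \<phi>: "\<phi> \<in> smooth_cpt S"
    have i: "integrable (lebesgue_on S) (\<lambda>z. \<phi> z *\<^sub>R g z)" "integrable (lebesgue_on S) (\<lambda>z. \<phi> z *\<^sub>R g' z)"
      by (intro loc_integrable_mult_test loc \<phi> SL)+
    have "(-1::real) ^ length vs *\<^sub>R (LINT z|lebesgue_on S. \<phi> z *\<^sub>R g z) = (-1) ^ length vs *\<^sub>R (LINT z|lebesgue_on S. \<phi> z *\<^sub>R g' z)"
      using g g' \<phi> by (simp add: has_weak_deriv_def)
    then have "(LINT z|lebesgue_on S. \<phi> z *\<^sub>R g z) = (LINT z|lebesgue_on S. \<phi> z *\<^sub>R g' z)"
      by simp
    then have "(LINT z|lebesgue_on S. \<phi> z *\<^sub>R g z - \<phi> z *\<^sub>R g' z) \<bullet> b = 0"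
      using i by simp
    also have "(LINT z|lebesgue_on S. \<phi> z *\<^sub>R g z - \<phi> z *\<^sub>R g' z) \<bullet> b = (LINT z|lebesgue_on S. (\<phi> z *\<^sub>R g z - \<phi> z *\<^sub>R g' z) \<bullet> b)"
      using i by (intro integral_inner_left[symmetric]) auto
    also have "\<dots> = (LINT z|lebesgue_on S. \<phi> z * ((g z - g' z) \<bullet> b))"
      by (simp add: inner_diff_left algebra_simps)
    finally show "(LINT z|lebesgue_on S. \<phi> z * ((g z - g' z) \<bullet> b)) = 0" .
  qed
  have all: "\<forall>b\<in>(Basis :: 'b set). AE z in lebesgue. z \<in> S \<longrightarrow> (g z - g' z) \<bullet> b = 0"
    by (rule ballI) (rule comp)
  have eq: "g z = g' z" if "\<forall>b\<in>Basis. z \<in> S \<longrightarrow> (g z - g' z) \<bullet> b = 0" "z \<in> S" for z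
  proof (rule euclidean_eqI)
    fix b :: 'b assume "b \<in> Basis"
    with that have "(g z - g' z) \<bullet> b = 0" by blast
    then show "g z \<bullet> b = g' z \<bullet> b" by (simp add: inner_diff_left)
  qed
  show ?thesis
    by (rule eventually_mono[OF eventually_ball_finite[OF finite_Basis all]]) (use eq in blast)
qed

section \<open>Weak derivatives are limits of difference quotients in L2\<close>

section \<open>Weak derivatives as limits of difference quotients\<close>

lemma real_along_line:
  fixes f :: "'a::euclidean_space \<Rightarrow> real"
  assumes "\<And>z. f differentiable (at z)"
  shows "((\<lambda>s. f (w + s *\<^sub>R v)) has_real_derivative pdiff v f (w + s *\<^sub>R v)) (at s)"
proof -
  have 1: "((\<lambda>s. w + s *\<^sub>R v) has_derivative (\<lambda>x. x *\<^sub>R v)) (at s)"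
    by (auto intro!: derivative_eq_intros)
  have "linear (\<lambda>u. pdiff u f (w + s *\<^sub>R v))"
    using has_derivative_linear[OF differentiable_derivative[OF assms]] .
  from linear_scale[OF this] show ?thesis
    using has_derivative_compose[OF 1 differentiable_derivative[OF assms]]
    by (simp add: has_field_derivative_def mult_commute_abs)
qed

lemma mean_value_line:
  fixes f :: "'a::euclidean_space \<Rightarrow> real"
  assumes "\<And>z. f differentiable (at z)" "h \<noteq> 0"
  shows "\<exists>s. \<bar>s\<bar> \<le> \<bar>h\<bar> \<and> (f (h *\<^sub>R v + z) - f z) / h = pdiff v f (s *\<^sub>R v + z)"
proof (cases "0 < h")
  case True
  have "\<exists>s. 0 < s \<and> s < h \<and> f (z + h *\<^sub>R v) - f (z + 0 *\<^sub>R v) = (h - 0) * pdiff v f (z + s *\<^sub>R v)"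
    by (rule MVT2[OF True]) (rule real_along_line[OF assms(1)])
  then obtain s where "0 < s" "s < h" "f (z + h *\<^sub>R v) - f z = h * pdiff v f (z + s *\<^sub>R v)" by auto
  then show ?thesis using True by (intro exI[of _ s]) (simp add: add.commute)
next
  case False
  then have h: "h < 0" using assms(2) by simp
  have "\<exists>s. h < s \<and> s < 0 \<and> f (z + 0 *\<^sub>R v) - f (z + h *\<^sub>R v) = (0 - h) * pdiff v f (z + s *\<^sub>R v)"
    by (rule MVT2[OF h]) (rule real_along_line[OF assms(1)])
  then obtain s where s: "h < s" "s < 0" "f z - f (z + h *\<^sub>R v) = (- h) * pdiff v f (z + s *\<^sub>R v)" by auto
  have "f (z + h *\<^sub>R v) - f z = h * pdiff v f (z + s *\<^sub>R v)" using s(3) by simp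
  then have "(f (z + h *\<^sub>R v) - f z) / h = pdiff v f (z + s *\<^sub>R v)" using h by simp
  then show ?thesis using s(1,2) h by (intro exI[of _ s]) (auto simp: add.commute)
qed

text \<open>Dominated convergence. By the mean value theorem the quotient is a value of the
  derivative at a shifted point, so it is bounded, and it is carried by the compact set
  \<open>K\<close> which the shifted supports sweep out.\<close>

lemma test_difference_quotient:
  fixes \<phi> :: "'a::euclidean_space \<Rightarrow> real"
  assumes \<phi>: "\<phi> \<in> smooth_cpt S"
  shows "((\<lambda>h. (1 / h) *\<^sub>R (sft (h *\<^sub>R v) (mk \<phi>) - mk \<phi>)) \<longlongrightarrow> mk (pdiff v \<phi>)) (at 0)"
  unfolding tendsto_at_iff_sequentially comp_def
proof (intro allI impI)
  fix X :: "nat \<Rightarrow> real" assume X: "\<forall>i. X i \<in> UNIV - {0}" "X \<longlonglongrightarrow> 0"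
  have d: "\<phi> differentiable (at z)" for z
    by (rule smooth_imp_differentiable[OF smooth_cptD(1)[OF \<phi>]])
  obtain M where M: "\<And>n. \<bar>X n\<bar> \<le> M"
    using convergent_imp_Bseq[OF convergentI[OF X(2)]] unfolding Bseq_def by auto
  have v: "pdiff v \<phi> \<in> smooth_cpt S" by (rule smooth_cpt_pdiff_dir[OF \<phi>])
  obtain B where B: "\<And>z. norm (pdiff v \<phi> z) \<le> B" using smooth_cpt_bounded[OF v] by blast
  have B0: "0 \<le> B" by (rule order_trans[OF norm_ge_zero B])
  have L[simp]: "in_L2 lebesgue \<phi>" "in_L2 lebesgue (\<lambda>z. \<phi> (w + z))" for w
    using smooth_cpt_in_L2[OF \<phi>] by (auto intro: translate_in_L2)
  define K where "K = (\<lambda>(z, s). z - s *\<^sub>R v) ` (supp \<phi> \<times> {-M..M})"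
  have K: "compact K"
    unfolding K_def using smooth_cptD(2)[OF \<phi>]
    by (intro compact_continuous_image compact_Times) (auto simp: case_prod_unfold intro!: continuous_intros)
  have outside: "pdiff v \<phi> (s *\<^sub>R v + z) = 0" if "z \<notin> K" "\<bar>s\<bar> \<le> M" for z s
  proof (rule pdiff_outside_supp)
    show "s *\<^sub>R v + z \<notin> supp \<phi>"
    proof
      assume "s *\<^sub>R v + z \<in> supp \<phi>"
      then have "(\<lambda>(z, s). z - s *\<^sub>R v) (s *\<^sub>R v + z, s) \<in> K"
        unfolding K_def using that(2) by (intro imageI) auto
      with that(1) show False by simp
    qed
  qed
  have "(\<lambda>n. mk (\<lambda>z. (1 / X n) *\<^sub>R (\<phi> (X n *\<^sub>R v + z) - \<phi> z))) \<longlonglongrightarrow> mk (pdiff v \<phi>)"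
  proof (rule L2_dominated_convergence[where w = "\<lambda>z. (2 * B) *\<^sub>R indicator K z"])
    show "in_L2 lebesgue (\<lambda>z. (1 / X n) *\<^sub>R (\<phi> (X n *\<^sub>R v + z) - \<phi> z))" for n
      by (intro in_L2_scaleR in_L2_diff L)
    show "in_L2 lebesgue (pdiff v \<phi>)" by (rule smooth_cpt_in_L2[OF v])
    show "in_L2 lebesgue (\<lambda>z. (2 * B) *\<^sub>R indicator K z :: real)"
      by (intro in_L2_scaleR in_L2_indicator_set lmeasurable_compact K)
    show "AE z in lebesgue. (\<lambda>n. (1 / X n) *\<^sub>R (\<phi> (X n *\<^sub>R v + z) - \<phi> z)) \<longlonglongrightarrow> pdiff v \<phi> z"
    proof (intro AE_I2)
      fix z
      have "((\<lambda>s. \<phi> (z + s *\<^sub>R v)) has_real_derivative pdiff v \<phi> (z + 0 *\<^sub>R v)) (at 0)"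
        by (rule real_along_line[OF d])
      then have "((\<lambda>h. (\<phi> (z + h *\<^sub>R v) - \<phi> z) / h) \<longlongrightarrow> pdiff v \<phi> z) (at 0)"
        by (simp add: DERIV_def)
      then have "(\<lambda>n. (\<phi> (z + X n *\<^sub>R v) - \<phi> z) / X n) \<longlonglongrightarrow> pdiff v \<phi> z"
        using X unfolding tendsto_at_iff_sequentially comp_def by blast
      then show "(\<lambda>n. (1 / X n) *\<^sub>R (\<phi> (X n *\<^sub>R v + z) - \<phi> z)) \<longlonglongrightarrow> pdiff v \<phi> z"
        by (simp add: add.commute)
    qed
    show "AE z in lebesgue. norm ((1 / X n) *\<^sub>R (\<phi> (X n *\<^sub>R v + z) - \<phi> z) - pdiff v \<phi> z) \<le> norm ((2 * B) *\<^sub>R indicator K z :: real)" for n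
    proof (intro AE_I2)
      fix z
      obtain s where s: "\<bar>s\<bar> \<le> \<bar>X n\<bar>" "(\<phi> (X n *\<^sub>R v + z) - \<phi> z) / X n = pdiff v \<phi> (s *\<^sub>R v + z)"
        using mean_value_line[OF d, of "X n" v z] X(1) by auto
      have e: "(1 / X n) *\<^sub>R (\<phi> (X n *\<^sub>R v + z) - \<phi> z) - pdiff v \<phi> z = pdiff v \<phi> (s *\<^sub>R v + z) - pdiff v \<phi> z"
        using s(2) by simp
      have sM: "\<bar>s\<bar> \<le> M" "0 \<le> M" using s(1) M[of n] by auto
      show "norm ((1 / X n) *\<^sub>R (\<phi> (X n *\<^sub>R v + z) - \<phi> z) - pdiff v \<phi> z) \<le> norm ((2 * B) *\<^sub>R indicator K z :: real)"
      proof (cases "z \<in> K")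
        case True
        then show ?thesis
          unfolding e using norm_triangle_ineq4[of "pdiff v \<phi> (s *\<^sub>R v + z)" "pdiff v \<phi> z"] B[of "s *\<^sub>R v + z"] B[of z] B0 by simp
      next
        case False
        then show ?thesis
          unfolding e using outside[OF False sM(1)] outside[OF False, of 0] sM by simp
      qed
    qed
  qed
  then show "(\<lambda>n. (1 / X n) *\<^sub>R (sft (X n *\<^sub>R v) (mk \<phi>) - mk \<phi>)) \<longlonglongrightarrow> mk (pdiff v \<phi>)"
    by (simp add: sft_mk mk_diff mk_scaleR in_L2_diff del: real_scaleR_def)
qed

lemma sft_telescope:
  "x - sft (- (real n * h) *\<^sub>R v) x = (\<Sum>j<n. sft (- (real j * h) *\<^sub>R v) (x - sft (- h *\<^sub>R v) x))"
proof (induction n)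
  case (Suc n)
  have "sft (- (real n * h) *\<^sub>R v) (sft (- h *\<^sub>R v) x) = sft (- (real (Suc n) * h) *\<^sub>R v) x"
    by (simp add: algebra_simps flip: sft_plus)
  then show ?case
    using Suc by (simp add: linear_diff[OF sft_linear] algebra_simps)
qed (simp add: sft_0)

definition bquot :: "'a::euclidean_space \<Rightarrow> ('a, real) l2 \<Rightarrow> real \<Rightarrow> ('a, real) l2"
  where "bquot v F h = (1 / h) *\<^sub>R (F - sft (- h *\<^sub>R v) F)"

text \<open>The error of the difference quotient of a test function. It tends to 0 with h, and its
  norm does not change when the test function is translated; this makes the estimates below
  uniform.\<close>

definition tquot :: "'a::euclidean_space \<Rightarrow> real \<Rightarrow> ('a \<Rightarrow> real) \<Rightarrow> ('a, real) l2"
  where "tquot v h \<phi> = (1 / h) *\<^sub>R (sft (h *\<^sub>R v) (mk \<phi>) - mk \<phi>) - mk (pdiff v \<phi>)"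

text \<open>S is stable under motion against v. Therefore the translate of a test function by
  \<open>s *\<^sub>R v\<close> with s \<ge> 0, whose support moves by - s v, is again a test
  function on S.\<close>

context
  fixes S :: "'a::euclidean_space set" and v :: 'a and F G :: "('a, real) l2"
  assumes S: "open S" and inv: "\<And>z s. z \<in> S \<Longrightarrow> 0 \<le> s \<Longrightarrow> z - s *\<^sub>R v \<in> S"
    and F: "rst S F = F" and G: "rst S G = G"
    and weak: "\<And>\<phi>. \<phi> \<in> smooth_cpt S \<Longrightarrow> inner (mk (pdiff v \<phi>)) F = - inner (mk \<phi>) G"
begin

lemma SL: "S \<in> sets lebesgue"
  using S by auto

lemma tquot_tendsto: "\<phi> \<in> smooth_cpt S \<Longrightarrow> ((\<lambda>h. norm (tquot v h \<phi>)) \<longlongrightarrow> 0) (at 0)"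
  using test_difference_quotient[of \<phi> S v] unfolding tquot_def
  by (intro tendsto_norm_zero LIM_zero)

lemma translate_test:
  assumes "\<phi> \<in> smooth_cpt S" "0 \<le> s"
  shows "(\<lambda>z. \<phi> (s *\<^sub>R v + z)) \<in> smooth_cpt S"
proof (rule smooth_cpt_translate[OF assms(1)])
  fix z assume "s *\<^sub>R v + z \<in> S"
  from inv[OF this assms(2)] show "z \<in> S" by simp
qed

lemma tquot_translate:
  assumes \<phi>: "\<phi> \<in> smooth_cpt S"
  shows "tquot v h (\<lambda>z. \<phi> (s *\<^sub>R v + z)) = sft (s *\<^sub>R v) (tquot v h \<phi>)"
proof -
  have L: "in_L2 lebesgue \<phi>" "in_L2 lebesgue (pdiff v \<phi>)"
    using smooth_cpt_in_L2[OF \<phi>] smooth_cpt_in_L2[OF smooth_cpt_pdiff_dir[OF \<phi>]] by auto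
  have "pdiff v (\<lambda>z. \<phi> (s *\<^sub>R v + z)) z = pdiff v \<phi> (s *\<^sub>R v + z)" for z
  proof -
    have d: "\<phi> differentiable (at w)" for w
      by (rule smooth_imp_differentiable[OF smooth_cptD(1)[OF \<phi>]])
    have 1: "((\<lambda>z. s *\<^sub>R v + z) has_derivative (\<lambda>w. w)) (at z)"
      by (auto intro!: derivative_eq_intros)
    show ?thesis
      using pdiff_eq[OF has_derivative_compose[OF 1 differentiable_derivative[OF d]]] .
  qed
  then have "pdiff v (\<lambda>z. \<phi> (s *\<^sub>R v + z)) = (\<lambda>z. pdiff v \<phi> (s *\<^sub>R v + z))"
    by (rule ext)
  then have "mk (pdiff v (\<lambda>z. \<phi> (s *\<^sub>R v + z))) = sft (s *\<^sub>R v) (mk (pdiff v \<phi>))"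
    by (simp only: sft_mk[OF L(2)])
  moreover have "sft (h *\<^sub>R v) (sft (s *\<^sub>R v) (mk \<phi>)) = sft (s *\<^sub>R v) (sft (h *\<^sub>R v) (mk \<phi>))"
    by (simp add: add.commute flip: sft_plus)
  ultimately show ?thesis
    by (simp add: tquot_def linear_diff[OF sft_linear] linear_scale[OF sft_linear] flip: sft_mk[OF L(1)])
qed

text \<open>The backward quotient of F becomes minus the forward quotient of the test function, and
  G becomes minus its derivative; the difference of the two is \<open>tquot\<close>.\<close>

lemma weak_estimate:
  assumes \<phi>: "\<phi> \<in> smooth_cpt S" and "0 \<le> s"
  shows "\<bar>inner (sft (s *\<^sub>R v) (mk \<phi>)) (bquot v F h - G)\<bar> \<le> norm F * norm (tquot v h \<phi>)"
proof -
  define \<psi> where "\<psi> = (\<lambda>z. \<phi> (s *\<^sub>R v + z))"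
  have \<psi>: "\<psi> \<in> smooth_cpt S" unfolding \<psi>_def by (rule translate_test[OF assms])
  have "inner (mk \<psi>) (bquot v F h - G) = - inner (tquot v h \<psi>) F"
    using weak[OF \<psi>] by (simp add: bquot_def tquot_def inner_diff_left inner_diff_right sft_adjoint[of "h *\<^sub>R v"] algebra_simps)
  also have "\<bar>\<dots>\<bar> \<le> norm (tquot v h \<psi>) * norm F"
    using Cauchy_Schwarz_ineq2 by simp
  also have "norm (tquot v h \<psi>) = norm (tquot v h \<phi>)"
    unfolding \<psi>_def tquot_translate[OF \<phi>] by (rule sft_norm)
  finally show ?thesis
    unfolding \<psi>_def by (simp add: sft_mk smooth_cpt_in_L2[OF \<phi>] mult.commute)
qed

text \<open>A quotient with step h is the mean of N translates of the quotient with step h / N. Each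
  of those pairs with \<phi> as G does, up to the error at step h / N, and N tends to infinity. The
  bound obtained no longer depends on h.\<close>

lemma inner_bquot_le:
  assumes \<phi>: "\<phi> \<in> smooth_cpt S" and h: "0 < h"
  shows "\<bar>inner (mk \<phi>) (bquot v F h)\<bar> \<le> norm (mk \<phi>) * norm G"
proof (rule tendsto_lowerbound)
  have "filterlim (\<lambda>n. h / real (Suc n)) (at 0) sequentially"
    unfolding filterlim_at using h
    by (auto intro!: eventually_sequentiallyI) real_asymp
  then have "(\<lambda>n. norm (tquot v (h / real (Suc n)) \<phi>)) \<longlonglongrightarrow> 0"
    using filterlim_compose[OF tquot_tendsto[OF \<phi>]] by blast
  then have "(\<lambda>n. norm (mk \<phi>) * norm G + norm F * norm (tquot v (h / real (Suc n)) \<phi>)) \<longlonglongrightarrow> norm (mk \<phi>) * norm G + norm F * 0"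
    by (intro tendsto_add tendsto_mult tendsto_const)
  then show "(\<lambda>n. norm (mk \<phi>) * norm G + norm F * norm (tquot v (h / real (Suc n)) \<phi>)) \<longlonglongrightarrow> norm (mk \<phi>) * norm G"
    by simp
  show "\<forall>\<^sub>F n in sequentially. \<bar>inner (mk \<phi>) (bquot v F h)\<bar> \<le> norm (mk \<phi>) * norm G + norm F * norm (tquot v (h / real (Suc n)) \<phi>)"
  proof (intro always_eventually allI)
    fix n
    define N where "N = Suc n"
    define e where "e = h / real N"
    have e: "0 < e" "real N * e = h" using h by (auto simp: e_def N_def)
    have "F - sft (- h *\<^sub>R v) F = (\<Sum>j<N. sft (- (real j * e) *\<^sub>R v) (F - sft (- e *\<^sub>R v) F))"
      using sft_telescope[of F N e v] e by simp
    also have "\<dots> = (\<Sum>j<N. e *\<^sub>R sft (- (real j * e) *\<^sub>R v) (bquot v F e))"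
      using e by (simp add: bquot_def linear_scale[OF sft_linear])
    finally have "bquot v F h = (e / h) *\<^sub>R (\<Sum>j<N. sft (- (real j * e) *\<^sub>R v) (bquot v F e))"
      by (simp add: bquot_def scaleR_sum_right[symmetric])
    then have "inner (mk \<phi>) (bquot v F h) = (e / h) * (\<Sum>j<N. inner (sft ((real j * e) *\<^sub>R v) (mk \<phi>)) (bquot v F e))"
      by (simp add: inner_sum_right sft_adjoint[of "(_ * e) *\<^sub>R v"])
    also have "\<bar>\<dots>\<bar> \<le> (e / h) * (\<Sum>j<N. norm (mk \<phi>) * norm G + norm F * norm (tquot v e \<phi>))"
    proof -
      have "\<bar>inner (sft ((real j * e) *\<^sub>R v) (mk \<phi>)) (bquot v F e)\<bar> \<le> norm (mk \<phi>) * norm G + norm F * norm (tquot v e \<phi>)" for j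
      proof -
        have "\<bar>inner (sft ((real j * e) *\<^sub>R v) (mk \<phi>)) (bquot v F e - G)\<bar> \<le> norm F * norm (tquot v e \<phi>)"
          using e by (intro weak_estimate \<phi>) simp
        moreover have "\<bar>inner (sft ((real j * e) *\<^sub>R v) (mk \<phi>)) G\<bar> \<le> norm (mk \<phi>) * norm G"
          using Cauchy_Schwarz_ineq2[of "sft ((real j * e) *\<^sub>R v) (mk \<phi>)" G] by (simp add: sft_norm)
        ultimately show ?thesis by (simp add: inner_diff_right)
      qed
      then have "\<bar>\<Sum>j<N. inner (sft ((real j * e) *\<^sub>R v) (mk \<phi>)) (bquot v F e)\<bar> \<le> (\<Sum>j<N. norm (mk \<phi>) * norm G + norm F * norm (tquot v e \<phi>))"
        by (intro order_trans[OF sum_abs] sum_mono)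
      then show ?thesis using e h by (simp add: abs_mult divide_right_mono mult_left_mono)
    qed
    also have "\<dots> = (real N * e / h) * (norm (mk \<phi>) * norm G + norm F * norm (tquot v e \<phi>))"
      by simp
    also have "\<dots> = norm (mk \<phi>) * norm G + norm F * norm (tquot v e \<phi>)"
      using e h by simp
    finally show "\<bar>inner (mk \<phi>) (bquot v F h)\<bar> \<le> norm (mk \<phi>) * norm G + norm F * norm (tquot v (h / real (Suc n)) \<phi>)"
      by (simp add: e_def N_def)
  qed
qed simp

lemma rst_test: "\<phi> \<in> smooth_cpt S \<Longrightarrow> rst S (mk \<phi>) = mk \<phi>"
proof -
  assume \<phi>: "\<phi> \<in> smooth_cpt S"
  have "(\<lambda>z. indicator S z *\<^sub>R \<phi> z) = \<phi>"
    using smooth_cptD(4)[OF \<phi>] by (auto simp: indicator_def fun_eq_iff)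
  then show ?thesis by (simp add: rst_mk[OF SL smooth_cpt_in_L2[OF \<phi>]])
qed

lemma rst_idem: "rst S (rst S x) = rst S x"
proof (induction x rule: mk_induct)
  case (mk f)
  have "(\<lambda>z. indicator S z *\<^sub>R indicator S z *\<^sub>R f z) = (\<lambda>z. indicator S z *\<^sub>R f z)"
    by (auto simp: indicator_def)
  then show ?case by (simp add: rst_mk SL mk in_L2_indicator del: real_scaleR_def)
qed

lemma norm_bquot_le:
  assumes "0 < h"
  shows "norm (rst S (bquot v F h)) \<le> norm G"
proof -
  let ?X = "rst S (bquot v F h)"
  have "?X \<in> closure (tests S)" by (rule in_closure_tests[OF S rst_idem])
  then obtain f where f: "\<And>n. f n \<in> tests S" "f \<longlonglongrightarrow> ?X" by (auto simp: closure_sequential)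
  have "inner (f n) ?X \<le> norm (f n) * norm G" for n
  proof -
    obtain \<phi> where \<phi>: "f n = mk \<phi>" "\<phi> \<in> smooth_cpt S" using f(1)[of n] by (auto simp: tests_def)
    have "inner (mk \<phi>) ?X = inner (mk \<phi>) (bquot v F h)"
      using rst_adjoint[OF SL, of "mk \<phi>" "bquot v F h"] rst_test[OF \<phi>(2)] by simp
    then show ?thesis using inner_bquot_le[OF \<phi>(2) assms] \<phi>(1) by simp
  qed
  then have "inner ?X ?X \<le> norm ?X * norm G"
    by (intro LIMSEQ_le[OF tendsto_inner[OF f(2) tendsto_const] tendsto_mult[OF tendsto_norm[OF f(2)] tendsto_const]]) auto
  then have "norm ?X * norm ?X \<le> norm ?X * norm G"
    by (simp add: norm_eq_sqrt_inner)
  then show ?thesis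
    by (cases "?X = 0") (simp_all add: mult_le_cancel_left)
qed

text \<open>The quotients converge weakly against the dense set of test functions, and by
  \<open>norm_bquot_le\<close> their norms do not exceed that of G. In an inner product space this
  forces convergence in norm.\<close>

lemma bquot_tendsto: "((\<lambda>h. rst S (bquot v F h)) \<longlongrightarrow> G) (at_right 0)"
proof (rule tendstoI)
  fix e :: real assume e: "0 < e"
  have "G \<in> closure (tests S)" by (rule in_closure_tests[OF S G])
  moreover define d where "d = e\<^sup>2 / (8 * (norm G + 1))"
  have d: "0 < d" unfolding d_def using e by (intro divide_pos_pos) (auto intro: add_nonneg_pos)
  ultimately obtain \<phi> where \<phi>: "\<phi> \<in> smooth_cpt S" "dist (mk \<phi>) G < d"
    by (auto simp: closure_approachable tests_def)
  have "((\<lambda>h. norm F * norm (tquot v h \<phi>)) \<longlongrightarrow> norm F * 0) (at 0)"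
    by (rule tendsto_mult[OF tendsto_const tquot_tendsto[OF \<phi>(1)]])
  then have "((\<lambda>h. norm F * norm (tquot v h \<phi>)) \<longlongrightarrow> 0) (at_right 0)"
    by (simp add: filterlim_at_split)
  then have "\<forall>\<^sub>F h in at_right 0. norm F * norm (tquot v h \<phi>) < e\<^sup>2 / 4"
    by (rule order_tendstoD) (use e in simp)
  moreover have "\<forall>\<^sub>F h in at_right (0::real). 0 < h"
    by (simp add: eventually_at_filter)
  ultimately show "\<forall>\<^sub>F h in at_right 0. dist (rst S (bquot v F h)) G < e"
  proof eventually_elim
    case (elim h)
    let ?X = "rst S (bquot v F h)"
    have X: "norm ?X \<le> norm G" by (rule norm_bquot_le[OF elim(2)])
    have "\<bar>inner (mk \<phi>) (?X - G)\<bar> \<le> norm F * norm (tquot v h \<phi>)"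
      using weak_estimate[OF \<phi>(1), of 0 h] rst_adjoint[OF SL, of "mk \<phi>" "bquot v F h"] rst_test[OF \<phi>(1)]
      by (simp add: sft_0 inner_diff_right)
    with elim(1) have 1: "\<bar>inner (mk \<phi>) (?X - G)\<bar> < e\<^sup>2 / 4" by linarith
    have "\<bar>inner (G - mk \<phi>) (?X - G)\<bar> \<le> norm (G - mk \<phi>) * norm (?X - G)"
      by (rule Cauchy_Schwarz_ineq2)
    also have "\<dots> \<le> d * (norm G + norm G)"
      using \<phi>(2) X norm_triangle_ineq4[of ?X G] d
      by (intro mult_mono) (auto simp: dist_norm norm_minus_commute)
    also have "\<dots> \<le> 2 * (d * (norm G + 1))"
      using d by (simp add: algebra_simps)
    also have "d * (norm G + 1) = e\<^sup>2 / 8"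
    proof -
      have "norm G + 1 \<noteq> 0" using norm_ge_zero[of G] by linarith
      moreover have "r / (8 * a) * a = r / 8" if "a \<noteq> 0" for r a :: real
        using that by simp
      ultimately show ?thesis unfolding d_def by blast
    qed
    finally have 2: "\<bar>inner (G - mk \<phi>) (?X - G)\<bar> \<le> e\<^sup>2 / 4" by simp
    \<comment> \<open>Since |X| is at most |G|, smallness of the inner product of G and X - G is all
      that is needed.\<close>
    have "(norm (?X - G))\<^sup>2 = (norm ?X)\<^sup>2 - (norm G)\<^sup>2 - 2 * inner G (?X - G)"
      by (simp add: power2_norm_eq_inner inner_diff_left inner_diff_right inner_commute)
    moreover have "(norm ?X)\<^sup>2 \<le> (norm G)\<^sup>2" using X by (intro power_mono) auto
    moreover have "inner G (?X - G) = inner (G - mk \<phi>) (?X - G) + inner (mk \<phi>) (?X - G)"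
      by (simp add: inner_diff_left)
    ultimately have "(norm (?X - G))\<^sup>2 < e\<^sup>2" using 1 2 by linarith
    then have "norm (?X - G) < e" by (rule power2_less_imp_less) (use e in simp)
    then show ?case by (simp add: dist_norm)
  qed
qed

end

text \<open>Scalar components, because test functions and their density are treated for real
  values.\<close>

definition cmp :: "'b::euclidean_space \<Rightarrow> ('a::euclidean_space, 'b) l2 \<Rightarrow> ('a, real) l2"
  where "cmp b x = mk (\<lambda>z. fn x z \<bullet> b)"

lemma in_L2_inner_const: "in_L2 M f \<Longrightarrow> in_L2 M (\<lambda>z. f z \<bullet> b)"
proof -
  assume f: "in_L2 M f"
  then have "f \<in> borel_measurable M" by (simp add: in_L2_def)
  then show ?thesis
    by (intro in_L2_bound[OF f, of _ "norm b"] AE_I2)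
      (auto simp: mult.commute[of "norm b"] Cauchy_Schwarz_ineq2)
qed

lemma cmp_mk:
  assumes f: "in_L2 lebesgue f"
  shows "cmp b (mk f) = mk (\<lambda>z. f z \<bullet> b)"
proof -
  have fn: "in_L2 lebesgue (fn (mk f))" "AE z in lebesgue. fn (mk f) z = f z"
    using Quotient_rep_reflp[OF Quotient_l2, of "mk f"] Quotient_rep_abs[OF Quotient_l2, of f] f by auto
  have "AE z in lebesgue. fn (mk f) z \<bullet> b = f z \<bullet> b"
    using fn(2) by eventually_elim simp
  then show ?thesis
    unfolding cmp_def by (subst mk_eq_iff) (auto intro: in_L2_inner_const fn f)
qed

lemma cmp_linear: "linear (cmp b)"
proof (rule linearI)
  fix x y :: "('a, 'b) l2" and r :: real
  show "cmp b (x + y) = cmp b x + cmp b y"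
  proof (induction x rule: mk_induct)
    case (mk f) note f = mk
    show ?case
      by (induction y rule: mk_induct)
        (simp add: f mk_plus cmp_mk in_L2_add in_L2_inner_const inner_add_left)
  qed
  show "cmp b (r *\<^sub>R x) = r *\<^sub>R cmp b x"
    by (induction x rule: mk_induct) (simp add: mk_scaleR cmp_mk in_L2_scaleR in_L2_inner_const)
qed

lemma cmp_sft: "cmp b (sft v x) = sft v (cmp b x)"
  by (induction x rule: mk_induct) (simp add: sft_mk cmp_mk translate_in_L2 in_L2_inner_const)

lemma cmp_rst: "S \<in> sets lebesgue \<Longrightarrow> cmp b (rst S x) = rst S (cmp b x)"
  by (induction x rule: mk_induct) (simp add: rst_mk cmp_mk in_L2_indicator in_L2_inner_const del: real_scaleR_def, simp)

lemma norm_cmp_sum: "(norm x)\<^sup>2 = (\<Sum>b\<in>Basis. (norm (cmp b x))\<^sup>2)"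
proof (induction x rule: mk_induct)
  case (mk f)
  have i: "integrable lebesgue (\<lambda>z. (f z \<bullet> b)\<^sup>2)" for b
    using in_L2_inner_const[OF mk, of b] by (simp add: in_L2_def)
  have "(norm (mk f))\<^sup>2 = (LINT z|lebesgue. (\<Sum>b\<in>Basis. (f z \<bullet> b)\<^sup>2))"
  proof -
    have "(norm (f z))\<^sup>2 = (\<Sum>b\<in>Basis. (f z \<bullet> b)\<^sup>2)" for z
      unfolding power2_norm_eq_inner by (subst euclidean_inner) (simp add: power2_eq_square)
    then show ?thesis unfolding norm_mk_sq[OF mk] by simp
  qed
  also have "\<dots> = (\<Sum>b\<in>Basis. (LINT z|lebesgue. (f z \<bullet> b)\<^sup>2))"
    by (rule Bochner_Integration.integral_sum) (rule i)
  also have "\<dots> = (\<Sum>b\<in>Basis. (norm (cmp b (mk f)))\<^sup>2)"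
    by (simp add: cmp_mk mk norm_mk_sq in_L2_inner_const)
  finally show "(norm (mk f))\<^sup>2 = (\<Sum>b\<in>Basis. (norm (cmp b (mk f)))\<^sup>2)" .
qed

lemma tendsto_cmp:
  fixes x :: "('a::euclidean_space, 'b::euclidean_space) l2"
  assumes "\<And>b. b \<in> Basis \<Longrightarrow> ((\<lambda>h. cmp b (X h)) \<longlongrightarrow> cmp b x) A"
  shows "(X \<longlongrightarrow> x) A"
proof -
  have "((\<lambda>h. \<Sum>b\<in>Basis. (norm (cmp b (X h) - cmp b x))\<^sup>2) \<longlongrightarrow> (\<Sum>b\<in>(Basis::'b set). (norm (cmp b x - cmp b x))\<^sup>2)) A"
    by (rule tendsto_sum, rule tendsto_power, rule tendsto_norm, rule tendsto_diff[OF assms tendsto_const])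
  moreover have "(norm (X h - x))\<^sup>2 = (\<Sum>b\<in>Basis. (norm (cmp b (X h) - cmp b x))\<^sup>2)" for h
    by (subst norm_cmp_sum) (simp only: linear_diff[OF cmp_linear])
  ultimately have "((\<lambda>h. (norm (X h - x))\<^sup>2) \<longlongrightarrow> 0) A"
    by simp
  then have "((\<lambda>h. sqrt ((norm (X h - x))\<^sup>2)) \<longlongrightarrow> sqrt 0) A"
    by (rule tendsto_real_sqrt)
  then have "((\<lambda>h. norm (X h - x)) \<longlongrightarrow> 0) A" by simp
  then show ?thesis using LIM_zero_iff tendsto_norm_zero_iff by blast
qed

text \<open>The bridge from weak derivatives to the abstract notions, reduced to the scalar case by
  components. With v = - \<open>x_dir i\<close> it leads to \<open>DH\<close>, with v =
  \<open>t_dir\<close> to \<open>DT\<close>; the half-cylinder is stable under motion against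
  both.\<close>

theorem weak_derivative_difference_quotient:
  fixes F G :: "('a::euclidean_space, 'b::euclidean_space) l2"
  assumes S: "open S" "\<And>z s. z \<in> S \<Longrightarrow> 0 \<le> s \<Longrightarrow> z - s *\<^sub>R v \<in> S"
    and F: "rst S F = F" and G: "rst S G = G"
    and weak: "\<And>\<phi> b. \<phi> \<in> smooth_cpt S \<Longrightarrow> b \<in> Basis \<Longrightarrow> inner (mk (pdiff v \<phi>)) (cmp b F) = - inner (mk \<phi>) (cmp b G)"
  shows "((\<lambda>h. (1 / h) *\<^sub>R rst S (F - sft (- h *\<^sub>R v) F)) \<longlongrightarrow> G) (at_right 0)"
proof (rule tendsto_cmp)
  fix b :: 'b assume b: "b \<in> Basis"
  have SL: "S \<in> sets lebesgue" using S by auto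
  have r: "rst S (cmp b F) = cmp b F" "rst S (cmp b G) = cmp b G"
    using cmp_rst[OF SL, of b F] cmp_rst[OF SL, of b G] F G by simp_all
  have "((\<lambda>h. rst S ((1 / h) *\<^sub>R (cmp b F - sft (- h *\<^sub>R v) (cmp b F)))) \<longlongrightarrow> cmp b G) (at_right 0)"
    using bquot_tendsto[OF S(1) S(2) r(1) r(2) weak[OF _ b]] unfolding bquot_def by simp
  then show "((\<lambda>h. cmp b ((1 / h) *\<^sub>R rst S (F - sft (- h *\<^sub>R v) F))) \<longlongrightarrow> cmp b G) (at_right 0)"
    by (simp add: linear_scale[OF cmp_linear] linear_diff[OF cmp_linear] cmp_rst[OF SL] cmp_sft
        linear_scale[OF bounded_linear.linear[OF rst_bounded_linear[OF SL]]])
qed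

section \<open>The half-cylinder and the translations that preserve it\<close>

section \<open>Geometry of the half-cylinder\<close>

definition past :: "ereal \<Rightarrow> 'd::finite spacetime set"
  where "past T = {(t, x). ereal t < T}"

lemma open_past: "open (past T :: 'd::finite spacetime set)"
proof -
  have "open (ereal -` {..<T})" by (rule open_ereal_vimage) simp
  then have "open ((ereal -` {..<T}) \<times> (UNIV :: (real, 'd) vec set))"
    by (rule open_Times) simp
  moreover have "(ereal -` {..<T}) \<times> (UNIV :: (real, 'd) vec set) = past T"
    by (auto simp: past_def)
  ultimately show ?thesis by simp
qed

lemma half_cyl_eq: "half_cyl T = past T \<inter> {z. 0 < snd z $ first_coord}"
  by (auto simp: half_cyl_def past_def)

lemma open_half_cyl: "open (half_cyl T :: 'd::{finite,linorder} spacetime set)"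
  unfolding half_cyl_eq
  by (intro open_Int open_past open_Collect_less continuous_intros)

lemma sets_half_cyl [simp]: "(half_cyl T :: 'd::{finite,linorder} spacetime set) \<in> sets lebesgue"
  using open_half_cyl[of T, where ?'d = 'd] by auto

lemma sets_past [simp]: "(past T :: 'd::finite spacetime set) \<in> sets lebesgue"
  using open_past[of T, where ?'d = 'd] by auto

lemma x_dir_Basis [simp]: "x_dir i \<in> Basis"
  by (auto simp: x_dir_def Basis_prod_def axis_in_Basis_iff)

lemma t_dir_Basis [simp]: "t_dir \<in> Basis"
  by (auto simp: t_dir_def Basis_prod_def)

lemma x_dir_inject [simp]: "x_dir i = x_dir j \<longleftrightarrow> i = j"
  by (auto simp: x_dir_def axis_eq_axis)

lemma axis_x_dir: "(0, axis i h) = h *\<^sub>R x_dir i"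
  by (auto simp: x_dir_def vec_eq_iff axis_def)

lemma inner_x_dir: "z \<bullet> x_dir i = snd z $ i"
  by (simp add: x_dir_def inner_prod_def inner_axis)

lemma in_half_cyl_shift: "i \<noteq> first_coord \<Longrightarrow> s *\<^sub>R x_dir i + z \<in> half_cyl T \<longleftrightarrow> z \<in> half_cyl T"
  by (cases z) (auto simp: half_cyl_def x_dir_def axis_def)

lemma in_past_shift: "(0, v) + z \<in> past T \<longleftrightarrow> z \<in> past T"
  by (cases z) (auto simp: past_def)

lemma rst_mk_cong:
  assumes "S \<in> sets lebesgue" "S' \<in> sets lebesgue" "in_L2 lebesgue f" "in_L2 lebesgue g"
    "\<And>z. indicator S z *\<^sub>R f z = indicator S' z *\<^sub>R g z"
  shows "rst S (mk f) = rst S' (mk g)"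
  using assms by (simp add: rst_mk)

lemma rst_sft_commute:
  assumes S: "S \<in> sets lebesgue" and inv: "\<And>z. v + z \<in> S \<longleftrightarrow> z \<in> S"
  shows "rst S (sft v x) = sft v (rst S x)"
proof (induction x rule: mk_induct)
  case (mk f)
  have "(\<lambda>z. indicator S z *\<^sub>R f (v + z)) = (\<lambda>z. indicator S (v + z) *\<^sub>R f (v + z))"
    by (auto simp: indicator_def inv)
  then show ?case
    by (simp add: sft_mk rst_mk S mk translate_in_L2 in_L2_indicator)
qed

lemma rst_rst:
  assumes "S \<in> sets lebesgue" "S' \<in> sets lebesgue" "S \<subseteq> S'"
  shows "rst S' (rst S x) = rst S x"
proof (induction x rule: mk_induct)
  case (mk f)
  have "(\<lambda>z. indicator S' z *\<^sub>R indicator S z *\<^sub>R f z) = (\<lambda>z. indicator S z *\<^sub>R f z)"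
    using assms(3) by (auto simp: fun_eq_iff split: split_indicator)
  then show ?case using mk assms(1,2) by (simp add: rst_mk in_L2_indicator del: scaleR_scaleR)
qed

section \<open>Translations, restriction and quotients on the half-cylinder\<close>

section \<open>The operators on the half-cylinder\<close>

definition shx :: "(real, 'd::finite) vec \<Rightarrow> ('d spacetime, 'b::euclidean_space) l2 \<Rightarrow> ('d spacetime, 'b) l2"
  where "shx v = sft (0, v)"

definition rstE :: "ereal \<Rightarrow> ('d::{finite,linorder} spacetime, 'b::euclidean_space) l2 \<Rightarrow> ('d spacetime, 'b) l2"
  where "rstE T = rst (half_cyl T)"

lemma shx_axis: "shx (axis i h) = sft (h *\<^sub>R x_dir i)"
  by (simp add: shx_def axis_x_dir)

lemma half_shift_action:
  "half_shift_action (shx :: (real, 'd) vec \<Rightarrow> ('d spacetime, 'b) l2 \<Rightarrow> ('d spacetime, 'b::euclidean_space) l2)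
    (rstE T) (first_coord :: 'd::{finite,linorder})"
proof (intro half_shift_action.intro shift_action.intro half_shift_action_axioms.intro)
  fix f g :: "('d spacetime, 'b) l2" and v w :: "(real, 'd) vec" and i :: 'd and h :: real
  show "linear (shx v)" unfolding shx_def by (rule sft_linear)
  show "shx (v + w) f = shx v (shx w f)"
    by (simp add: shx_def flip: sft_plus)
  show "shx 0 f = f"
    using sft_0[of f] by (simp add: shx_def zero_prod_def)
  show "inner (shx v f) (shx v g) = inner f g"
    by (simp add: shx_def sft_inner)
  show "bounded_linear (rstE T)" unfolding rstE_def by (rule rst_bounded_linear) simp
  show "inner (rstE T f) g = inner f (rstE T g)" unfolding rstE_def by (rule rst_adjoint) simp
  show "rstE T (rstE T f) = rstE T f" unfolding rstE_def by (rule rst_rst) simp_all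
  show "rstE T (shx (axis i h) f) = shx (axis i h) (rstE T f)" if "i \<noteq> first_coord"
    unfolding rstE_def shx_axis by (rule rst_sft_commute) (simp_all add: in_half_cyl_shift that)
qed

text \<open>S is invariant in both directions, so the one-sided theorem for v and for -v gives the
  limits from the two sides, and the restriction to S has no effect. It serves the half-cylinder
  with tangential v and \<open>past T\<close> with the normal v.\<close>

lemma weak_imp_two_sided:
  fixes F G :: "('d::finite spacetime, 'b::euclidean_space) l2"
  assumes S: "open S" and inv: "\<And>z s. z \<in> S \<Longrightarrow> z + s *\<^sub>R v \<in> S"
    and F: "rst S F = F" "rst S G = G"
    and weak: "\<And>\<phi> b. \<phi> \<in> smooth_cpt S \<Longrightarrow> b \<in> Basis \<Longrightarrow> inner (mk (pdiff v \<phi>)) (cmp b F) = - inner (mk \<phi>) (cmp b G)"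
  shows "((\<lambda>h. (1 / h) *\<^sub>R (sft (h *\<^sub>R v) F - F)) \<longlongrightarrow> G) (at 0)"
proof -
  have SL: "S \<in> sets lebesgue" using S by auto
  have iff: "s *\<^sub>R v + z \<in> S \<longleftrightarrow> z \<in> S" for s z
    using inv[of z s] inv[of "s *\<^sub>R v + z" "- s"] by (auto simp: algebra_simps)
  have r: "rst S (F - sft (s *\<^sub>R v) F) = F - sft (s *\<^sub>R v) F" for s
    using rst_sft_commute[OF SL iff, of s F] F(1)
    by (simp add: linear_diff[OF bounded_linear.linear[OF rst_bounded_linear[OF SL]]])
  let ?q = "\<lambda>h. (1 / h) *\<^sub>R (sft (h *\<^sub>R v) F - F)"
  have 1: "((\<lambda>h. (1 / h) *\<^sub>R rst S (F - sft (- h *\<^sub>R v) F)) \<longlongrightarrow> G) (at_right 0)"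
  proof (rule weak_derivative_difference_quotient[OF S _ F weak])
    show "z - s *\<^sub>R v \<in> S" if "z \<in> S" for z s using inv[OF that, of "- s"] by simp
  qed
  have flip: "(1 / h) *\<^sub>R (F - sft (- h *\<^sub>R v) F) = ?q (- h)" for h
    by (simp add: scaleR_diff_right)
  have "((\<lambda>h. ?q (- h)) \<longlongrightarrow> G) (at_right 0)"
    using 1 unfolding r flip .
  then have l: "(?q \<longlongrightarrow> G) (at_left 0)"
    using filterlim_at_left_to_right[of ?q "nhds G" 0] by simp
  have mG: "rst S (- G) = - G"
    using F(2) by (simp add: linear_neg[OF bounded_linear.linear[OF rst_bounded_linear[OF SL]]])
  have weak': "inner (mk (pdiff (- v) \<phi>)) (cmp b F) = - inner (mk \<phi>) (cmp b (- G))"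
    if \<phi>: "\<phi> \<in> smooth_cpt S" and b: "b \<in> Basis" for \<phi> b
  proof -
    have lin: "linear (\<lambda>u. pdiff u \<phi> z)" for z
      by (rule has_derivative_linear[OF differentiable_derivative[OF smooth_imp_differentiable[OF smooth_cptD(1)[OF \<phi>]]]])
    have "pdiff (- v) \<phi> = (\<lambda>z. (- 1) *\<^sub>R pdiff v \<phi> z)"
      by (rule ext) (simp add: linear_neg[OF lin])
    then have "mk (pdiff (- v) \<phi>) = (- 1) *\<^sub>R mk (pdiff v \<phi>)"
      by (simp only: mk_scaleR[OF smooth_cpt_in_L2[OF smooth_cpt_pdiff_dir[OF \<phi>]]])
    then show ?thesis using weak[OF \<phi> b] by (simp add: linear_neg[OF cmp_linear])
  qed
  have "((\<lambda>h. (1 / h) *\<^sub>R rst S (F - sft (- h *\<^sub>R (- v)) F)) \<longlongrightarrow> - G) (at_right 0)"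
  proof (rule weak_derivative_difference_quotient[OF S _ F(1) mG weak'])
    show "z - s *\<^sub>R (- v) \<in> S" if "z \<in> S" for z s using inv[OF that, of s] by simp
  qed
  then have "((\<lambda>h. - ((1 / h) *\<^sub>R (F - sft (h *\<^sub>R v) F))) \<longlongrightarrow> - (- G)) (at_right 0)"
    by (intro tendsto_minus) (simp add: r)
  then have "(?q \<longlongrightarrow> G) (at_right 0)"
    by (simp add: scaleR_diff_right)
  with l show ?thesis by (simp add: filterlim_split_at)
qed

lemma test_rst:
  assumes "S \<in> sets lebesgue" "\<phi> \<in> smooth_cpt S"
  shows "rst S (mk \<phi>) = mk \<phi>"
proof -
  have "(\<lambda>z. indicator S z *\<^sub>R \<phi> z) = \<phi>"
    using smooth_cptD(4)[OF assms(2)] by (auto simp: indicator_def fun_eq_iff)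
  then show ?thesis by (simp add: rst_mk[OF assms(1) smooth_cpt_in_L2[OF assms(2)]])
qed

lemma cmp_bounded_linear: "bounded_linear (cmp b :: ('a::euclidean_space, 'b::euclidean_space) l2 \<Rightarrow> ('a, real) l2)"
proof (rule bounded_linear_intro[where K = "norm b"])
  fix x y :: "('a, 'b) l2" and r :: real
  show "cmp b (x + y) = cmp b x + cmp b y" "cmp b (r *\<^sub>R x) = r *\<^sub>R cmp b x"
    by (simp_all add: linear_add[OF cmp_linear] linear_scale[OF cmp_linear])
  show "norm (cmp b x) \<le> norm x * norm b"
  proof (induction x rule: mk_induct)
    case (mk f)
    have "L2_norm lebesgue (\<lambda>z. f z \<bullet> b) \<le> norm b * L2_norm lebesgue f"
      using mk by (intro L2_norm_mono in_L2_inner_const AE_I2) (auto simp: Cauchy_Schwarz_ineq2 mult.commute[of "norm b"])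
    then show ?case using mk by (simp add: cmp_mk norm_mk in_L2_inner_const mult.commute)
  qed
qed

text \<open>The way back: the quotient is moved onto the test function. It is needed for
  \<open>R_D2\<close>, which starts from a one-sided quotient and is proved weakly.\<close>

lemma quotient_imp_weak:
  fixes f g :: "('a::euclidean_space, 'b::euclidean_space) l2"
  assumes S: "S \<in> sets lebesgue"
    and lim: "((\<lambda>h. rst S ((1 / h) *\<^sub>R (sft (h *\<^sub>R v) f - f))) \<longlongrightarrow> g) (at_right 0)"
    and \<phi>: "\<phi> \<in> smooth_cpt S"
  shows "inner (mk (pdiff v \<phi>)) (cmp b f) = - inner (mk \<phi>) (cmp b g)"
proof -
  have "((\<lambda>h. inner (mk \<phi>) (cmp b (rst S ((1 / h) *\<^sub>R (sft (h *\<^sub>R v) f - f))))) \<longlongrightarrow> inner (mk \<phi>) (cmp b g)) (at_right 0)"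
    by (rule tendsto_inner[OF tendsto_const bounded_linear.tendsto[OF cmp_bounded_linear lim]])
  moreover have "inner (mk \<phi>) (cmp b (rst S ((1 / h) *\<^sub>R (sft (h *\<^sub>R v) f - f))))
      = - inner ((1 / (- h)) *\<^sub>R (sft ((- h) *\<^sub>R v) (mk \<phi>) - mk \<phi>)) (cmp b f)" for h
    using rst_adjoint[OF S, of "mk \<phi>"] test_rst[OF S \<phi>]
    by (simp add: cmp_rst[OF S] linear_scale[OF cmp_linear] linear_diff[OF cmp_linear] cmp_sft inner_diff_right
        inner_diff_left sft_adjoint[of "- (h *\<^sub>R v)"] algebra_simps flip: rst_adjoint[OF S])
  moreover have "((\<lambda>h. - inner ((1 / (- h)) *\<^sub>R (sft ((- h) *\<^sub>R v) (mk \<phi>) - mk \<phi>)) (cmp b f)) \<longlongrightarrow> - inner (mk (pdiff v \<phi>)) (cmp b f)) (at_right 0)"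
  proof -
    have "filterlim uminus (at (0::real)) (at_right 0)"
      by (auto simp: filterlim_at eventually_at_filter intro!: tendsto_eq_intros)
    from filterlim_compose[OF test_difference_quotient[OF \<phi>] this]
    have "((\<lambda>h. (1 / (- h)) *\<^sub>R (sft ((- h) *\<^sub>R v) (mk \<phi>) - mk \<phi>)) \<longlongrightarrow> mk (pdiff v \<phi>)) (at_right 0)" .
    from tendsto_minus[OF tendsto_inner[OF this tendsto_const]] show ?thesis .
  qed
  ultimately have "inner (mk \<phi>) (cmp b g) = - inner (mk (pdiff v \<phi>)) (cmp b f)"
    using tendsto_unique[OF trivial_limit_at_right_real] by simp
  then show ?thesis by simp
qed

section \<open>Weak derivatives tested with functions that vanish at x_1 = 0\<close>

subsection \<open>Test functions vanishing on the lateral boundary\<close>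

text \<open>With t = 1 / y the claim is t + t^2 \<le> 2 exp t, which follows from the quadratic
  Taylor polynomial. It dominates the error caused by the cut-off near the boundary.\<close>

lemma flat_exp_2_bound: "0 \<le> y \<Longrightarrow> (y + 1) * flat_exp 2 y \<le> 2"
proof -
  assume "0 \<le> y"
  show ?thesis
  proof (cases "y = 0")
    case False
    with \<open>0 \<le> y\<close> have y: "0 < y" by simp
    define t where "t = inverse y"
    have t: "0 < t" "y = inverse t" using y by (auto simp: t_def)
    have "1 + t + t\<^sup>2 / 2 \<le> exp t" using exp_lower_Taylor_quadratic[of t] t by simp
    then have "t + t\<^sup>2 \<le> 2 * exp t" using t by simp
    then have "(t + t\<^sup>2) * exp (- t) \<le> 2" by (simp add: exp_minus field_simps)
    moreover have "(y + 1) * flat_exp 2 y = (t + t\<^sup>2) * exp (- t)"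
    proof -
      have "(y + 1) * flat_exp 2 y = (inverse t + 1) * (t\<^sup>2 * exp (- t))"
        using y by (simp add: flat_exp_def t(2))
      also have "\<dots> = (t + t\<^sup>2) * exp (- t)"
        using t(1) by (simp add: power2_eq_square field_simps)
      finally show ?thesis .
    qed
    ultimately show ?thesis by simp
  qed (simp add: flat_exp_def)
qed

text \<open>Multiply \<psi> by a cut-off \<eta> n that vanishes where (n + 1) x_1 \<le> 1, and let n
  grow. The dangerous term \<psi> D_1 \<eta> n is harmless: |\<psi>| \<le> B x_1 because \<psi>
  vanishes at x_1 = 0, so with y = (n + 1) x_1 - 1 the term is at most
  \<open>B * ((y + 1) * flat_exp 2 y)\<close>, which is bounded and tends to 0. No condition on the
  trace of f enters.\<close>

lemma weak_with_vanishing_test: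
  fixes f g :: "('d::{finite,linorder} spacetime, real) l2" and \<psi> :: "'d spacetime \<Rightarrow> real"
  assumes f: "rst (half_cyl T) f = f" and g: "rst (half_cyl T) g = g"
    and weak: "\<And>\<phi>. \<phi> \<in> smooth_cpt (half_cyl T) \<Longrightarrow> inner (mk (pdiff (x_dir first_coord) \<phi>)) f = - inner (mk \<phi>) g"
    and \<psi>: "\<psi> \<in> smooth_cpt (past T)" and zero: "\<And>z. snd z $ first_coord = 0 \<Longrightarrow> \<psi> z = 0"
  shows "inner (mk (pdiff (x_dir first_coord) \<psi>)) f = - inner (mk \<psi>) g"
proof -
  let ?e = "x_dir first_coord :: 'd spacetime" and ?O = "half_cyl T"
  define x1 where "x1 z = snd z $ first_coord" for z :: "'d spacetime"
  have x1: "x1 z = z \<bullet> ?e" for z by (simp add: x1_def inner_x_dir)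
  define \<eta> where "\<eta> n z = flat_exp 0 (real (Suc n) * (x1 z) - 1)" for n z
  have d\<psi>: "\<psi> differentiable (at z)" for z
    by (rule smooth_imp_differentiable[OF smooth_cptD(1)[OF \<psi>]])
  have \<eta>s: "smooth (\<eta> n)" for n
  proof -
    have "smooth (\<lambda>x::real. flat_exp 0 (- 1 + real (Suc n) * x))"
      using smooth_affine[OF smooth_flat_exp[of 0], of "- 1" "\<lambda>_. real (Suc n)"] by (simp add: diag_def)
    from smooth_coordinate[OF this x_dir_Basis[of first_coord]] show ?thesis
      unfolding \<eta>_def[abs_def] x1 by (simp only: diff_conv_add_uminus add.commute[of _ "- 1"])
  qed
  have p\<eta>: "pdiff ?e (\<eta> n) z = real (Suc n) * flat_exp 2 (real (Suc n) * (x1 z) - 1)" for n z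
  proof -
    have "((\<lambda>x. flat_exp 0 (real (Suc n) * x - 1)) has_real_derivative
       (flat_exp (0 + 2) (real (Suc n) * (z \<bullet> ?e) - 1) - real 0 * flat_exp (0 + 1) (real (Suc n) * (z \<bullet> ?e) - 1)) * real (Suc n)) (at (z \<bullet> ?e))"
      by (rule DERIV_chain2[OF flat_exp_deriv]) (auto intro!: derivative_eq_intros)
    from pdiff_coordinate[OF this, of ?e] show ?thesis
      unfolding \<eta>_def[abs_def] x1 by (simp add: mult.commute inner_Basis numeral_2_eq_2)
  qed
  have test: "(\<lambda>z. \<psi> z *\<^sub>R \<eta> n z) \<in> smooth_cpt ?O" for n
  proof (rule smooth_cptI[where K = "supp \<psi> \<inter> {z. 1 / real (Suc n) \<le> x1 z}"])
    show "smooth (\<lambda>z. \<psi> z *\<^sub>R \<eta> n z)" by (intro smooth_scaleR \<eta>s smooth_cptD(1)[OF \<psi>])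
    have "closed {z. 1 / real (Suc n) \<le> x1 z}"
      unfolding x1 by (intro closed_Collect_le continuous_intros)
    then show "compact (supp \<psi> \<inter> {z. 1 / real (Suc n) \<le> x1 z})"
      by (rule compact_Int_closed[OF smooth_cptD(2)[OF \<psi>]])
    have "0 < x1 z" if "1 / real (Suc n) \<le> x1 z" for z
      using that by (rule less_le_trans[rotated]) simp
    then show "supp \<psi> \<inter> {z. 1 / real (Suc n) \<le> x1 z} \<subseteq> ?O"
      using smooth_cptD(3)[OF \<psi>] unfolding half_cyl_eq x1_def by blast
    show "\<psi> z *\<^sub>R \<eta> n z = 0" if z: "z \<notin> supp \<psi> \<inter> {z. 1 / real (Suc n) \<le> x1 z}" for z
    proof (cases "z \<in> supp \<psi>")
      case True
      then have "x1 z < 1 / real (Suc n)" using z by simp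
      then have "real (Suc n) * x1 z - 1 \<le> 0" by (simp add: field_simps)
      then show ?thesis by (simp add: \<eta>_def flat_exp_bounds(4))
    qed (simp add: not_in_supp)
  qed
  obtain B where B: "\<And>z. norm (pdiff ?e \<psi> z) \<le> B"
    using smooth_cpt_bounded[OF smooth_cpt_pdiff_dir[OF \<psi>]] by blast
  have B0: "0 \<le> B" by (rule order_trans[OF norm_ge_zero B])
  have \<psi>_le: "\<bar>\<psi> z\<bar> \<le> B * x1 z" if z: "0 < x1 z" for z
  proof -
    obtain s where s: "(\<psi> ((- x1 z) *\<^sub>R ?e + z) - \<psi> z) / (- x1 z) = pdiff ?e \<psi> (s *\<^sub>R ?e + z)"
      using mean_value_line[OF d\<psi>, of "- x1 z" ?e z] z by auto
    have "\<psi> ((- x1 z) *\<^sub>R ?e + z) = 0"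
      by (rule zero) (simp add: x1_def x_dir_def)
    then have "\<psi> z = x1 z * pdiff ?e \<psi> (s *\<^sub>R ?e + z)"
      using s z by (simp add: field_simps)
    then show ?thesis using B[of "s *\<^sub>R ?e + z"] z by (simp add: abs_mult mult.commute mult_left_mono)
  qed
  have large: "filterlim (\<lambda>n. real (Suc n) * x1 z - 1) at_top sequentially" if "0 < x1 z" for z
    using that by real_asymp
  have K: "supp \<psi> \<in> lmeasurable" by (rule lmeasurable_compact[OF smooth_cptD(2)[OF \<psi>]])
  have \<psi>2: "in_L2 lebesgue \<psi>" "in_L2 lebesgue (pdiff ?e \<psi>)"
    by (intro smooth_cpt_in_L2[OF \<psi>] smooth_cpt_in_L2[OF smooth_cpt_pdiff_dir[OF \<psi>]])+
  have t1: "(\<lambda>n. mk (\<lambda>z. \<psi> z *\<^sub>R \<eta> n z)) \<longlonglongrightarrow> mk (\<lambda>z. indicator ?O z *\<^sub>R \<psi> z)"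
  proof (rule L2_dominated_convergence[where w = "\<lambda>z. 2 *\<^sub>R \<psi> z"])
    show "in_L2 lebesgue (\<lambda>z. \<psi> z *\<^sub>R \<eta> n z)" for n by (rule smooth_cpt_in_L2[OF test])
    show "in_L2 lebesgue (\<lambda>z. indicator ?O z *\<^sub>R \<psi> z)" by (rule in_L2_indicator[OF sets_half_cyl \<psi>2(1)])
    show "in_L2 lebesgue (\<lambda>z. 2 *\<^sub>R \<psi> z)" by (rule in_L2_scaleR[OF \<psi>2(1)])
    show "AE z in lebesgue. (\<lambda>n. \<psi> z *\<^sub>R \<eta> n z) \<longlonglongrightarrow> indicator ?O z *\<^sub>R \<psi> z"
    proof (intro AE_I2)
      fix z
      show "(\<lambda>n. \<psi> z *\<^sub>R \<eta> n z) \<longlonglongrightarrow> indicator ?O z *\<^sub>R \<psi> z"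
      proof (cases "z \<in> ?O")
        case True
        then have z: "0 < x1 z" by (simp add: half_cyl_eq x1_def)
        have "((\<lambda>y. flat_exp 0 y) \<longlongrightarrow> 1) at_top"
        proof (rule Lim_transform_eventually)
          show "((\<lambda>y::real. exp (- inverse y)) \<longlongrightarrow> 1) at_top" by real_asymp
          show "\<forall>\<^sub>F y in at_top. exp (- inverse y) = flat_exp 0 y"
            using eventually_gt_at_top[of "0::real"] by eventually_elim (simp add: flat_exp_def)
        qed
        from filterlim_compose[OF this large[OF z]] have "(\<lambda>n. \<eta> n z) \<longlonglongrightarrow> 1"
          by (simp add: \<eta>_def)
        from tendsto_mult[OF tendsto_const this, of "\<psi> z"] True show ?thesis by simp
      next
        case False
        have "(\<lambda>n. \<psi> z *\<^sub>R \<eta> n z) = (\<lambda>n. 0)"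
          by (rule ext) (rule smooth_cptD(4)[OF test False])
        then show ?thesis using False by (simp only:) simp
      qed
    qed
    show "AE z in lebesgue. norm (\<psi> z *\<^sub>R \<eta> n z - indicator ?O z *\<^sub>R \<psi> z) \<le> norm (2 *\<^sub>R \<psi> z)" for n
    proof (intro AE_I2)
      fix z
      have "\<psi> z *\<^sub>R \<eta> n z - indicator ?O z *\<^sub>R \<psi> z = \<psi> z * (\<eta> n z - indicator ?O z)"
        by (simp add: algebra_simps)
      moreover have "\<bar>\<eta> n z - indicator ?O z\<bar> \<le> 2"
        using flat_exp_bounds(1,2)[of "real (Suc n) * (x1 z) - 1"] by (auto simp: \<eta>_def indicator_def)
      ultimately show "norm (\<psi> z *\<^sub>R \<eta> n z - indicator ?O z *\<^sub>R \<psi> z) \<le> norm (2 *\<^sub>R \<psi> z)"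
        using mult_left_mono[of "\<bar>\<eta> n z - indicator ?O z\<bar>" 2 "\<bar>\<psi> z\<bar>"] by (simp add: abs_mult mult.commute)
    qed
  qed
  have pd: "pdiff ?e (\<lambda>z. \<psi> z *\<^sub>R \<eta> n z) z
      = \<psi> z * (real (Suc n) * flat_exp 2 (real (Suc n) * (x1 z) - 1)) + pdiff ?e \<psi> z * \<eta> n z" for n z
    using pdiff_scaleR[OF d\<psi> smooth_imp_differentiable[OF \<eta>s], of ?e n z] by (simp add: p\<eta>)
  have small: "\<bar>\<psi> z * (real (Suc n) * flat_exp 2 (real (Suc n) * (x1 z) - 1))\<bar>
      \<le> B * ((y + 1) * flat_exp 2 y)" if y: "y = real (Suc n) * x1 z - 1" and z: "0 < x1 z" for n z y
  proof -
    have "\<bar>\<psi> z * (real (Suc n) * flat_exp 2 y)\<bar> = \<bar>\<psi> z\<bar> * (real (Suc n) * flat_exp 2 y)"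
      by (simp add: abs_mult flat_exp_def)
    also have "\<dots> \<le> (B * x1 z) * (real (Suc n) * flat_exp 2 y)"
      by (intro mult_right_mono \<psi>_le z) (simp add: flat_exp_def)
    also have "\<dots> = B * ((y + 1) * flat_exp 2 y)" by (simp add: y)
    finally show ?thesis by (simp add: y)
  qed
  have t2: "(\<lambda>n. mk (pdiff ?e (\<lambda>z. \<psi> z *\<^sub>R \<eta> n z))) \<longlonglongrightarrow> mk (\<lambda>z. indicator ?O z *\<^sub>R pdiff ?e \<psi> z)"
  proof (rule L2_dominated_convergence[where w = "\<lambda>z. (4 * B) *\<^sub>R indicator (supp \<psi>) z"])
    show "in_L2 lebesgue (pdiff ?e (\<lambda>z. \<psi> z *\<^sub>R \<eta> n z))" for n
      by (rule smooth_cpt_in_L2[OF smooth_cpt_pdiff_dir[OF test]])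
    show "in_L2 lebesgue (\<lambda>z. indicator ?O z *\<^sub>R pdiff ?e \<psi> z)" by (rule in_L2_indicator[OF sets_half_cyl \<psi>2(2)])
    show "in_L2 lebesgue (\<lambda>z. (4 * B) *\<^sub>R indicator (supp \<psi>) z :: real)"
      by (rule in_L2_scaleR[OF in_L2_indicator_set[OF K]])
    have off: "pdiff ?e (\<lambda>z. \<psi> z *\<^sub>R \<eta> n z) z = 0" if "z \<notin> ?O" for n z
      by (rule smooth_cptD(4)[OF smooth_cpt_pdiff_dir[OF test] that])
    show "AE z in lebesgue. (\<lambda>n. pdiff ?e (\<lambda>z. \<psi> z *\<^sub>R \<eta> n z) z) \<longlonglongrightarrow> indicator ?O z *\<^sub>R pdiff ?e \<psi> z"
    proof (intro AE_I2)
      fix z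
      show "(\<lambda>n. pdiff ?e (\<lambda>z. \<psi> z *\<^sub>R \<eta> n z) z) \<longlonglongrightarrow> indicator ?O z *\<^sub>R pdiff ?e \<psi> z"
      proof (cases "z \<in> ?O")
        case True
        then have z: "0 < x1 z" by (simp add: half_cyl_eq x1_def)
        have "((\<lambda>y. flat_exp 0 y) \<longlongrightarrow> 1) at_top"
        proof (rule Lim_transform_eventually)
          show "((\<lambda>y::real. exp (- inverse y)) \<longlongrightarrow> 1) at_top" by real_asymp
          show "\<forall>\<^sub>F y in at_top. exp (- inverse y) = flat_exp 0 y"
            using eventually_gt_at_top[of "0::real"] by eventually_elim (simp add: flat_exp_def)
        qed
        from filterlim_compose[OF this large[OF z]] have l1: "(\<lambda>n. \<eta> n z) \<longlonglongrightarrow> 1"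
          by (simp add: \<eta>_def)
        \<comment> \<open>At a fixed point of the half-cylinder y tends to infinity with n, and the
          bound decays like 1 / y.\<close>
        have "((\<lambda>y. B * ((y + 1) * flat_exp 2 y)) \<longlongrightarrow> 0) at_top"
        proof (rule Lim_transform_eventually)
          show "((\<lambda>y::real. B * ((y + 1) * (inverse y ^ 2 * exp (- inverse y)))) \<longlongrightarrow> 0) at_top" by real_asymp
          show "\<forall>\<^sub>F y in at_top. B * ((y + 1) * (inverse y ^ 2 * exp (- inverse y))) = B * ((y + 1) * flat_exp 2 y)"
            using eventually_gt_at_top[of "0::real"] by eventually_elim (simp add: flat_exp_def)
        qed
        from filterlim_compose[OF this large[OF z]]
        have "(\<lambda>n. B * ((real (Suc n) * x1 z - 1 + 1) * flat_exp 2 (real (Suc n) * x1 z - 1))) \<longlonglongrightarrow> 0" .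
        then have "(\<lambda>n. \<psi> z * (real (Suc n) * flat_exp 2 (real (Suc n) * (x1 z) - 1))) \<longlonglongrightarrow> 0"
          by (rule Lim_null_comparison[rotated]) (use small[OF refl z] in auto)
        from tendsto_add[OF this tendsto_mult[OF tendsto_const l1, of "pdiff ?e \<psi> z"]] True
        show ?thesis unfolding pd by simp
      next
        case False
        then show ?thesis using off by simp
      qed
    qed
    show "AE z in lebesgue. norm (pdiff ?e (\<lambda>z. \<psi> z *\<^sub>R \<eta> n z) z - indicator ?O z *\<^sub>R pdiff ?e \<psi> z)
        \<le> norm ((4 * B) *\<^sub>R indicator (supp \<psi>) z :: real)" for n
    proof (intro AE_I2)
      fix z
      show "norm (pdiff ?e (\<lambda>z. \<psi> z *\<^sub>R \<eta> n z) z - indicator ?O z *\<^sub>R pdiff ?e \<psi> z) \<le> norm ((4 * B) *\<^sub>R indicator (supp \<psi>) z :: real)"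
      proof (cases "z \<in> ?O \<and> z \<in> supp \<psi>")
        case True
        then have z: "0 < x1 z" by (simp add: half_cyl_eq x1_def)
        define y where "y = real (Suc n) * x1 z - 1"
        have "(y + 1) * flat_exp 2 y \<le> 2"
          using flat_exp_2_bound[of y] by (cases "0 \<le> y") (auto simp: flat_exp_def)
        then have 1: "\<bar>\<psi> z * (real (Suc n) * flat_exp 2 (real (Suc n) * (x1 z) - 1))\<bar> \<le> B * 2"
          using small[OF y_def z] mult_left_mono[OF _ B0] by (meson order_trans)
        have 2: "\<bar>pdiff ?e \<psi> z * \<eta> n z - pdiff ?e \<psi> z\<bar> \<le> B * 1"
        proof -
          have "pdiff ?e \<psi> z * \<eta> n z - pdiff ?e \<psi> z = pdiff ?e \<psi> z * (\<eta> n z - 1)" by (simp add: algebra_simps)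
          moreover have "\<bar>\<eta> n z - 1\<bar> \<le> 1"
            using flat_exp_bounds(1,2)[of "real (Suc n) * (x1 z) - 1"] by (auto simp: \<eta>_def)
          ultimately show ?thesis
            using B[of z] B0 by (simp only: abs_mult) (intro mult_mono, auto)
        qed
        have "pdiff ?e (\<lambda>z. \<psi> z *\<^sub>R \<eta> n z) z - indicator ?O z *\<^sub>R pdiff ?e \<psi> z
            = \<psi> z * (real (Suc n) * flat_exp 2 (real (Suc n) * (x1 z) - 1)) + (pdiff ?e \<psi> z * \<eta> n z - pdiff ?e \<psi> z)"
          unfolding pd using True by simp
        moreover have "norm ((4 * B) *\<^sub>R indicator (supp \<psi>) z :: real) = 4 * B"
          using True B0 by simp
        ultimately show ?thesis using 1 2 B0 by (simp only: real_norm_def)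
      next
        case False
        have "pdiff ?e (\<lambda>z. \<psi> z *\<^sub>R \<eta> n z) z - indicator ?O z *\<^sub>R pdiff ?e \<psi> z = 0"
        proof (cases "z \<in> ?O")
          case True
          then have "z \<notin> supp \<psi>" using False by simp
          then show ?thesis unfolding pd by (simp add: not_in_supp pdiff_outside_supp)
        next
          case False
          show ?thesis unfolding off[OF False] using False by simp
        qed
        then show ?thesis by simp
      qed
    qed
  qed
  have "inner (mk (pdiff ?e (\<lambda>z. \<psi> z *\<^sub>R \<eta> n z))) f = - inner (mk (\<lambda>z. \<psi> z *\<^sub>R \<eta> n z)) g" for n
    by (rule weak[OF test])
  then have "(\<lambda>n. inner (mk (pdiff ?e (\<lambda>z. \<psi> z *\<^sub>R \<eta> n z))) f) \<longlonglongrightarrow> - inner (mk (\<lambda>z. indicator ?O z *\<^sub>R \<psi> z)) g"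
    using tendsto_minus[OF tendsto_inner[OF t1 tendsto_const, of g]] by simp
  from LIMSEQ_unique[OF tendsto_inner[OF t2 tendsto_const, of f] this]
  have "inner (rst ?O (mk (pdiff ?e \<psi>))) f = - inner (rst ?O (mk \<psi>)) g"
    by (simp only: rst_mk[OF sets_half_cyl \<psi>2(1)] rst_mk[OF sets_half_cyl \<psi>2(2)])
  then show ?thesis
    by (simp only: rst_adjoint[OF sets_half_cyl] f g)
qed

section \<open>The normal dilation\<close>

subsection \<open>Dilation in the normal direction\<close>

definition stretch :: "real \<Rightarrow> 'd::{finite,linorder} spacetime \<Rightarrow> real"
  where "stretch r b = (if b = x_dir first_coord then r else 1)"

lemma stretch_nz: "r \<noteq> 0 \<Longrightarrow> stretch r b \<noteq> 0"
  by (simp add: stretch_def)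

lemma diag_stretch:
  fixes z :: "'d::{finite,linorder} spacetime"
  shows "diag (stretch r) z = z + ((r - 1) * (z \<bullet> x_dir first_coord)) *\<^sub>R x_dir first_coord"
proof -
  have "diag (stretch r) z = (\<Sum>b\<in>Basis. (z \<bullet> b) *\<^sub>R b + (if b = x_dir first_coord then ((r - 1) * (z \<bullet> b)) *\<^sub>R b else 0))"
    unfolding diag_def by (intro sum.cong refl) (simp add: stretch_def algebra_simps)
  also have "\<dots> = z + ((r - 1) * (z \<bullet> x_dir first_coord)) *\<^sub>R x_dir first_coord"
    by (simp add: sum.distrib euclidean_representation)
  finally show ?thesis .
qed

lemma prod_stretch: "(\<Prod>b\<in>(Basis :: 'd::{finite,linorder} spacetime set). \<bar>stretch r b\<bar>) = \<bar>r\<bar>"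
proof -
  have "(\<Prod>b\<in>(Basis :: 'd spacetime set). \<bar>stretch r b\<bar>) = (\<Prod>b\<in>(Basis :: 'd spacetime set). if b = x_dir first_coord then \<bar>r\<bar> else 1)"
    by (intro prod.cong refl) (simp add: stretch_def)
  then show ?thesis by simp
qed

lemma x_dir_inner: "x_dir i \<bullet> x_dir j = (if i = j then 1 else 0)"
  by (simp add: inner_Basis)

lemma diag_stretch_inverse: "diag (stretch (1/2)) (diag (stretch 2) z) = z"
  by (simp add: diag_stretch inner_add_left x_dir_inner algebra_simps flip: scaleR_add_left)

lemma diag_stretch_half_cyl: "0 < r \<Longrightarrow> diag (stretch r) z \<in> half_cyl T \<longleftrightarrow> z \<in> half_cyl T"
proof -
  assume r: "0 < r"
  obtain t x where z: "z = (t, x)" by (cases z)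
  have "x $ first_coord + (r - 1) * x $ first_coord = r * x $ first_coord" by (simp add: algebra_simps)
  moreover have "axis first_coord (1::real) $ first_coord = 1" by simp
  ultimately show ?thesis
    using r by (simp add: z diag_stretch half_cyl_def x_dir_def inner_axis zero_less_mult_iff)
qed

lemma diag_stretch_past: "diag (stretch r) z \<in> past T \<longleftrightarrow> z \<in> past T"
  by (cases z) (simp add: diag_stretch past_def x_dir_def)

definition dl :: "('d::{finite,linorder} spacetime, 'b::euclidean_space) l2 \<Rightarrow> ('d spacetime, 'b) l2"
  where "dl = dil (stretch 2)"

lemma dl_mk: "in_L2 lebesgue f \<Longrightarrow> dl (mk f) = mk (\<lambda>z. f (diag (stretch 2) z))"
  unfolding dl_def by (rule dil_mk) (simp_all add: stretch_nz)

lemma dl_in_L2: "r \<noteq> 0 \<Longrightarrow> in_L2 lebesgue f \<Longrightarrow> in_L2 lebesgue (\<lambda>z. f (diag (stretch r) z))"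
  by (rule dil_in_L2) (simp_all add: stretch_nz)

lemma dl_bounded_linear: "bounded_linear dl"
  unfolding dl_def by (rule dil_bounded_linear) (simp add: stretch_nz)

lemma dl_norm: "2 * (norm (dl f))\<^sup>2 = (norm f)\<^sup>2"
  using dil_norm[of "stretch 2" f] unfolding dl_def prod_stretch by (simp add: stretch_nz)

lemma dl_rst:
  fixes f :: "('d::{finite,linorder} spacetime, 'b::euclidean_space) l2"
  shows "dl (rstE T f) = rstE T (dl f)"
proof (induction f rule: mk_induct)
  case (mk f)
  have "indicator (half_cyl T) (diag (stretch 2) z) = (indicator (half_cyl T) z :: real)" for z :: "'d spacetime"
    by (simp add: indicator_def diag_stretch_half_cyl)
  then show ?case
    by (simp add: rstE_def rst_mk dl_mk mk in_L2_indicator dl_in_L2 del: indicator_simps)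
qed

lemma dl_shift:
  assumes "\<And>z. w + diag (stretch 2) z = diag (stretch 2) (v + z)"
  shows "dl (sft w f) = sft v (dl f)"
  by (induction f rule: mk_induct) (simp add: sft_mk dl_mk translate_in_L2 dl_in_L2 assms)

lemma dl_shift_normal: "dl (shx (axis first_coord h) f) = shx (axis first_coord (h / 2)) (dl f)"
  unfolding shx_axis
  by (rule dl_shift) (simp add: diag_stretch inner_add_left x_dir_inner algebra_simps flip: scaleR_add_left)

lemma dl_shift_tangential: "i \<noteq> first_coord \<Longrightarrow> dl (shx (axis i h) f) = shx (axis i h) (dl f)"
  unfolding shx_axis
  by (rule dl_shift) (simp add: diag_stretch inner_add_left x_dir_inner algebra_simps)

lemma cmp_dl: "cmp b (dl x) = dl (cmp b x)"
  by (induction x rule: mk_induct) (simp add: dl_mk cmp_mk dl_in_L2 in_L2_inner_const)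

text \<open>The adjoint of the dilation by 2 is the dilation by 1/2 times the Jacobian 1/2; it moves
  the dilation onto test functions.\<close>

lemma dl_adjoint:
  fixes x :: "('d::{finite,linorder} spacetime, real) l2"
  assumes a: "in_L2 lebesgue a"
  shows "inner (mk a) (dl x) = 1 / 2 * inner (mk (\<lambda>z. a (diag (stretch (1/2)) z))) x"
proof (induction x rule: mk_induct)
  case (mk f)
  have a': "in_L2 lebesgue (\<lambda>z. a (diag (stretch (1/2)) z))"
    by (rule dl_in_L2[OF _ a]) simp
  have "(LINT z|lebesgue. inner (a (diag (stretch (1/2)) z)) (f z))
      = 2 *\<^sub>R (LINT z|lebesgue. inner (a (diag (stretch (1/2)) (0 + diag (stretch 2) z))) (f (0 + diag (stretch 2) z)))"
    using affine_integral(2)[where c = "stretch 2" and v = 0, OF stretch_nz in_L2_integrable_inner[OF a' mk]] unfolding prod_stretch by simp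
  also have "\<dots> = 2 * inner (mk a) (dl (mk f))"
    by (simp add: dl_mk mk mk_inner a dl_in_L2 diag_stretch_inverse)
  also have "(LINT z|lebesgue. inner (a (diag (stretch (1/2)) z)) (f z)) = inner (mk (\<lambda>z. a (diag (stretch (1/2)) z))) (mk f)"
    by (rule mk_inner[OF a' mk, symmetric])
  finally show "inner (mk a) (dl (mk f)) = 1 / 2 * inner (mk (\<lambda>z. a (diag (stretch (1/2)) z))) (mk f)" by simp
qed

text \<open>\<open>f - dl f\<close> vanishes on the lateral boundary; in the weak formulation the test function
  \<open>\<phi>\<close> is traded for \<open>\<phi>(t, x) - \<phi>(t, x\<^sub>1/2, x')\<close>, which vanishes there.\<close>

lemma dl_difference_quotient:
  fixes f g :: "('d::{finite,linorder} spacetime, 'b::euclidean_space) l2"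
  assumes f: "rstE T f = f" and g: "rstE T g = g"
    and D: "half_shift_action.DH shx (rstE T) first_coord f g"
  shows "shift_action.D2 shx first_coord (f - dl f) (g - 2 *\<^sub>R dl g)"
proof -
  interpret hs: half_shift_action "shx :: (real, 'd) vec \<Rightarrow> ('d spacetime, 'b) l2 \<Rightarrow> _" "rstE T" first_coord
    by (rule half_shift_action)
  let ?e = "x_dir first_coord :: 'd spacetime" and ?h = "stretch (1/2) :: 'd spacetime \<Rightarrow> real"
  have rl: "linear (rst S :: ('d spacetime, 'b) l2 \<Rightarrow> _)" if "S \<in> sets lebesgue" for S
    by (rule bounded_linear.linear[OF rst_bounded_linear[OF that]])
  have sub: "half_cyl T \<subseteq> (past T :: 'd spacetime set)" by (auto simp: half_cyl_eq)
  have past: "rst (past T) x = x" if "rstE T x = x" for x :: "('d spacetime, 'b) l2"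
    using rst_rst[OF sets_half_cyl sets_past sub, of x] that by (simp add: rstE_def)
  have dlE: "rstE T (dl x) = dl x" if "rstE T x = x" for x :: "('d spacetime, 'b) l2"
    using dl_rst[of T x] that by simp
  have lim: "((\<lambda>h. rst (half_cyl T) ((1 / h) *\<^sub>R (sft (h *\<^sub>R ?e) f - f))) \<longlongrightarrow> g) (at_right 0)"
    using D unfolding hs.DH_def unfolding shx_axis rstE_def .
  have weak: "inner (mk (pdiff ?e \<phi>)) (cmp b (f - dl f)) = - inner (mk \<phi>) (cmp b (g - 2 *\<^sub>R dl g))"
    if \<phi>: "\<phi> \<in> smooth_cpt (past T)" for \<phi> b
  proof -
    define \<psi> where "\<psi> z = \<phi> z - \<phi> (diag ?h z)" for z
    have nz: "?h b \<noteq> 0" for b by (simp add: stretch_nz)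
    have half: "(\<lambda>z. \<phi> (0 + diag ?h z)) \<in> smooth_cpt (past T)"
      by (rule smooth_cpt_affine[OF \<phi> nz]) (simp add: diag_stretch_past)
    have \<psi>: "\<psi> \<in> smooth_cpt (past T)"
      using smooth_cpt_add[OF \<phi> smooth_cpt_scaleR[OF half smooth_const[of "-1"]]] by (simp add: \<psi>_def[abs_def])
    have zero: "\<psi> z = 0" if "snd z $ first_coord = 0" for z
      using that by (simp add: \<psi>_def diag_stretch inner_x_dir)
    have d: "\<phi> differentiable (at z)" for z
      by (rule smooth_imp_differentiable[OF smooth_cptD(1)[OF \<phi>]])
    have dh: "(\<lambda>z. \<phi> (0 + diag ?h z)) differentiable (at z)" for z
      by (rule smooth_imp_differentiable[OF smooth_cptD(1)[OF half]])
    have L: "in_L2 lebesgue \<phi>" "in_L2 lebesgue (pdiff ?e \<phi>)"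
      by (rule smooth_cpt_in_L2[OF \<phi>], rule smooth_cpt_in_L2[OF smooth_cpt_pdiff_dir[OF \<phi>]])
    have p: "pdiff ?e \<psi> z = pdiff ?e \<phi> z - (1/2) *\<^sub>R pdiff ?e \<phi> (diag ?h z)" for z
    proof -
      have "pdiff ?e (\<lambda>z. \<phi> z - \<phi> (0 + diag ?h z)) z = pdiff ?e \<phi> z - pdiff ?e (\<lambda>z. \<phi> (0 + diag ?h z)) z"
        by (rule pdiff_eq) (intro has_derivative_diff differentiable_derivative d dh)
      also have "pdiff ?e (\<lambda>z. \<phi> (0 + diag ?h z)) z = ?h ?e *\<^sub>R pdiff ?e \<phi> (0 + diag ?h z)"
        by (rule pdiff_affine[OF d x_dir_Basis])
      also have "?h ?e = 1 / 2" by (simp add: stretch_def)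
      finally show ?thesis by (simp only: \<psi>_def[abs_def] add_0)
    qed
    have h2: "in_L2 lebesgue (\<lambda>z. \<phi> (diag ?h z))" "in_L2 lebesgue (\<lambda>z. pdiff ?e \<phi> (diag ?h z))"
      by (rule dl_in_L2[OF _ L(1)], simp, rule dl_in_L2[OF _ L(2)], simp)
    have "inner (mk (pdiff ?e \<phi>)) (cmp b (f - dl f)) = inner (mk (pdiff ?e \<phi>) - (1/2) *\<^sub>R mk (\<lambda>z. pdiff ?e \<phi> (diag ?h z))) (cmp b f)"
      by (simp add: linear_diff[OF cmp_linear] cmp_dl inner_diff_left inner_diff_right dl_adjoint[OF L(2)])
    also have "mk (pdiff ?e \<phi>) - (1/2) *\<^sub>R mk (\<lambda>z. pdiff ?e \<phi> (diag ?h z)) = mk (pdiff ?e \<psi>)"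
      by (simp only: mk_scaleR[OF h2(2)] mk_diff[OF L(2) in_L2_scaleR[OF h2(2)]] flip: p)
    also have "inner (mk (pdiff ?e \<psi>)) (cmp b f) = - inner (mk \<psi>) (cmp b g)"
    proof (rule weak_with_vanishing_test[OF _ _ quotient_imp_weak[OF sets_half_cyl lim] \<psi> zero])
      show "rst (half_cyl T) (cmp b f) = cmp b f" "rst (half_cyl T) (cmp b g) = cmp b g"
        using f g cmp_rst[OF sets_half_cyl, of b T f] cmp_rst[OF sets_half_cyl, of b T g] by (simp_all add: rstE_def)
    qed
    also have "mk \<psi> = mk \<phi> - mk (\<lambda>z. \<phi> (diag ?h z))"
      by (simp only: mk_diff[OF L(1) h2(1)] \<psi>_def[abs_def])
    also have "inner (mk \<phi> - mk (\<lambda>z. \<phi> (diag ?h z))) (cmp b g) = inner (mk \<phi>) (cmp b (g - 2 *\<^sub>R dl g))"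
      by (simp add: linear_diff[OF cmp_linear] linear_scale[OF cmp_linear] cmp_dl inner_diff_left inner_diff_right dl_adjoint[OF L(1)])
    finally show ?thesis .
  qed
  have "((\<lambda>h. (1 / h) *\<^sub>R (sft (h *\<^sub>R ?e) (f - dl f) - (f - dl f))) \<longlongrightarrow> g - 2 *\<^sub>R dl g) (at 0)"
  proof (rule weak_imp_two_sided[OF open_past _ _ _ weak])
    show "z + s *\<^sub>R ?e \<in> past T" if "z \<in> past T" for z s
      using that by (cases z) (simp add: past_def x_dir_def)
    show "rst (past T) (f - dl f) = f - dl f" "rst (past T) (g - 2 *\<^sub>R dl g) = g - 2 *\<^sub>R dl g"
      using past[OF f] past[OF g] past[OF dlE[OF f]] past[OF dlE[OF g]]
      by (simp_all add: linear_diff[OF rl[OF sets_past]] linear_scale[OF rl[OF sets_past]])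
  qed
  then show ?thesis by (simp add: hs.D2_def shx_axis)
qed

section \<open>Multisets of directions, coefficients, and the instance of the abstract
  half-space\<close>

subsection \<open>Multi-indices as multisets, and the coefficients\<close>

lemma mi_size_count: "mi_size (count M) = size M"
proof -
  have "(\<Sum>i\<in>UNIV. count M i) = (\<Sum>i\<in>set_mset M. count M i)"
    by (rule sum.mono_neutral_right) (auto simp: count_eq_zero_iff)
  then show ?thesis by (simp add: mi_size_def size_multiset_overloaded_eq)
qed

lemma count_surj: "\<exists>M. count M = (\<alpha> :: 'd::finite \<Rightarrow> nat)"
  by (rule exI[of _ "Abs_multiset \<alpha>"]) simp

lemma bij_count_eq: "bij_betw count {M :: 'd::finite multiset. size M = k} (mi_eq k)"
  unfolding bij_betw_def
proof
  show "inj_on count {M :: 'd multiset. size M = k}" by (rule inj_onI) (simp add: count_inject)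
  show "count ` {M :: 'd multiset. size M = k} = mi_eq k"
  proof (intro equalityI subsetI)
    fix \<alpha> :: "'d \<Rightarrow> nat" assume "\<alpha> \<in> mi_eq k"
    then show "\<alpha> \<in> count ` {M. size M = k}"
      using count_surj[of \<alpha>] by (auto simp: mi_eq_def mi_size_count)
  qed (auto simp: mi_eq_def mi_size_count)
qed

lemma bij_count_le: "bij_betw count {M :: 'd::finite multiset. size M \<le> k} (mi_le k)"
  unfolding bij_betw_def
proof
  show "inj_on count {M :: 'd multiset. size M \<le> k}" by (rule inj_onI) (simp add: count_inject)
  show "count ` {M :: 'd multiset. size M \<le> k} = mi_le k"
  proof (intro equalityI subsetI)
    fix \<alpha> :: "'d \<Rightarrow> nat" assume "\<alpha> \<in> mi_le k"
    then show "\<alpha> \<in> count ` {M. size M \<le> k}"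
      using count_surj[of \<alpha>] by (auto simp: mi_le_def mi_size_count)
  qed (auto simp: mi_le_def mi_size_count)
qed

lemma mi_power_count: "mi_power (\<chi> i. \<xi> i) (count M) = mpow \<xi> M"
proof (induction M)
  case (add i M)
  have "mi_power (\<chi> i. \<xi> i) (count (add_mset i M)) = (\<Prod>j\<in>UNIV. \<xi> j ^ count M j * (if j = i then \<xi> j else 1))"
    unfolding mi_power_def by (intro prod.cong refl) simp
  also have "\<dots> = \<xi> i * mi_power (\<chi> i. \<xi> i) (count M)"
    by (simp add: prod.distrib mi_power_def)
  finally have e: "mi_power (\<chi> i. \<xi> i) (count (add_mset i M)) = \<xi> i * mi_power (\<chi> i. \<xi> i) (count M)" .
  show ?case unfolding e add by (simp add: mpow_def)
qed (simp add: mi_power_def mpow_def)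

lemma mpow_le: "\<bar>mpow \<xi> M\<bar> \<le> norm ((\<chi> i. \<xi> i) :: (real, 'd) vec) ^ size (M :: 'd::finite multiset)"
proof (induction M)
  case (add i M)
  have "\<bar>\<xi> i\<bar> \<le> norm ((\<chi> i. \<xi> i) :: (real, 'd) vec)"
    using component_le_norm_cart[of "(\<chi> i. \<xi> i) :: (real, 'd) vec" i] by simp
  with add show ?case by (simp add: mpow_def abs_mult mult_mono)
qed (simp add: mpow_def)

lemma norm_matrix_vector_le:
  fixes a :: "((complex, 'n::finite) vec, 'n) vec"
  shows "norm (a *v x) \<le> norm a * norm x"
proof -
  have row: "norm ((a *v x) $ i) \<le> norm x * norm (a $ i)" for i
  proof -
    have "norm ((a *v x) $ i) \<le> (\<Sum>j\<in>UNIV. \<bar>norm (a $ i $ j)\<bar> * \<bar>norm (x $ j)\<bar>)"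
      unfolding matrix_vector_mult_def by (simp add: norm_mult[symmetric] norm_sum)
    also have "\<dots> \<le> L2_set (\<lambda>j. norm (a $ i $ j)) UNIV * L2_set (\<lambda>j. norm (x $ j)) UNIV"
      by (rule L2_set_mult_ineq)
    finally show ?thesis by (simp add: norm_vec_def mult.commute)
  qed
  have "norm (a *v x) = L2_set (\<lambda>i. norm ((a *v x) $ i)) UNIV" by (simp add: norm_vec_def)
  also have "\<dots> \<le> L2_set (\<lambda>i. norm x * norm (a $ i)) UNIV"
    by (rule L2_set_mono) (simp_all add: row)
  also have "\<dots> = norm x * norm a"
    by (simp add: L2_set_right_distrib[symmetric] norm_vec_def[of a])
  finally show ?thesis by (simp add: mult.commute)
qed

text \<open>Preimages of Borel sets are Borel, and a null set of times multiplied by the whole space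
  is null. The coefficients are only Lebesgue measurable in t, so the second point matters.\<close>

lemma fst_measurable_lebesgue:
  "(fst :: real \<times> 'a::euclidean_space \<Rightarrow> real) \<in> measurable lebesgue lebesgue"
proof (rule measurableI)
  fix A :: "real set" assume "A \<in> sets lebesgue"
  then obtain S N N' where A: "A = S \<union> N" "N \<subseteq> N'" "N' \<in> null_sets lborel" "S \<in> sets lborel"
    by (rule sets_completionE)
  have N': "N' \<in> sets borel" "emeasure lborel N' = 0" using A(3) by auto
  have "emeasure (lborel :: (real \<times> 'a) measure) (N' \<times> UNIV) = emeasure lborel N' * emeasure (lborel :: 'a measure) UNIV"
    unfolding lborel_prod[symmetric] using N'(1) by (intro lborel.emeasure_pair_measure_Times) auto
  then have n: "N' \<times> (UNIV :: 'a set) \<in> null_sets lborel"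
    using N' by (intro null_setsI) (auto simp: borel_Times)
  have "fst -` S = S \<times> (UNIV :: 'a set)" by auto
  then have s: "fst -` S \<in> sets (lborel :: (real \<times> 'a) measure)"
    using A(4) by (simp add: borel_Times)
  show "fst -` A \<inter> space lebesgue \<in> sets (lebesgue :: (real \<times> 'a) measure)"
    by (rule sets_completionI[of _ "fst -` S" "fst -` N" "N' \<times> UNIV"]) (use A n s in auto)
qed simp

lemma continuous_matrix_vector: "continuous_on UNIV (\<lambda>a :: ((complex, 'n::finite) vec, 'n) vec. a *v x)"
  unfolding matrix_vector_mult_def by (intro continuous_intros)

text \<open>The value 0 for other sizes is there because the abstract half-space demands boundedness
  and invariance for all pairs of multisets.\<close>

definition opA :: "nat \<Rightarrow> ('d::{finite,linorder}, 'n::finite) coeffs \<Rightarrow> 'd multiset \<Rightarrow> 'd multiset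
    \<Rightarrow> ('d spacetime, (complex, 'n) vec) l2 \<Rightarrow> ('d spacetime, (complex, 'n) vec) l2"
  where "opA m A M N f = (if size M = m \<and> size N = m then mop (\<lambda>z x. A (count M) (count N) (fst z) *v x) f else 0)"

lemma coeff_bdd_field:
  fixes A :: "('d::{finite,linorder}, 'n::finite) coeffs"
  assumes A: "admissible_coeffs m \<delta> A" and M: "size M = m" "size N = m"
  shows "bdd_field (\<lambda>z x. A (count M) (count N) (fst z) *v x)"
    and "norm (A (count M) (count N) t *v x) \<le> inverse \<delta> * norm x"
proof -
  have in_mi: "count M \<in> mi_eq m" "count N \<in> mi_eq m" using M by (auto simp: mi_eq_def mi_size_count)
  have m: "A (count M) (count N) \<in> borel_measurable lebesgue" "norm (A (count M) (count N) t) \<le> inverse \<delta>" for t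
    using A in_mi by (auto simp: admissible_coeffs_def)
  show b: "norm (A (count M) (count N) t *v x) \<le> inverse \<delta> * norm x" for t x
    by (rule order_trans[OF norm_matrix_vector_le mult_right_mono[OF m(2) norm_ge_zero]])
  show "bdd_field (\<lambda>z x. A (count M) (count N) (fst z) *v x)"
    unfolding bdd_field_def
  proof (intro conjI allI exI)
    show "linear ((*v) (A (count M) (count N) (fst z)))" for z
      by (rule linearI) (simp_all add: vec_eq_iff matrix_vector_mult_def scaleR_sum_right distrib_left sum.distrib)
    show "norm (A (count M) (count N) (fst z) *v x) \<le> inverse \<delta> * norm x" for z x by (rule b)
    show "(\<lambda>z. A (count M) (count N) (fst z) *v x) \<in> borel_measurable lebesgue" for x
    proof (rule measurable_compose[where g = "\<lambda>a. a *v x" and N = borel])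
      show "(\<lambda>z. A (count M) (count N) (fst z)) \<in> borel_measurable lebesgue"
        by (rule measurable_compose[OF fst_measurable_lebesgue m(1)])
      show "(\<lambda>a :: ((complex, 'n) vec, 'n) vec. a *v x) \<in> borel_measurable borel"
        by (rule borel_measurable_continuous_onI[OF continuous_matrix_vector])
    qed
  qed
qed

lemma inner_complex_vec: "inner (x :: (complex, 'n::finite) vec) y = Re (\<Sum>i\<in>UNIV. x $ i * cnj (y $ i))"
  by (simp add: inner_vec_def inner_complex_def)

text \<open>The condition is about \<theta>^tr A conj(\<theta>) and the inner product about (A x)
  with conj(x), so \<theta> is the conjugate of x. On the lower side |\<xi>|^m is replaced by the
  modulus of one monomial of degree m, which it dominates.\<close>

lemma LH_pointwise:
  fixes A :: "('d::{finite,linorder}, 'n::finite) coeffs"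
  assumes A: "admissible_coeffs m \<delta> A" and K: "size K = m" and "0 \<le> \<delta>"
  shows "\<delta> * (mpow \<xi> K)\<^sup>2 * (norm x)\<^sup>2
    \<le> (\<Sum>M | size M = m. \<Sum>N | size N = m. mpow \<xi> M * mpow \<xi> N * inner (A (count M) (count N) t *v x) x)"
proof -
  define \<theta> where "\<theta> = (\<chi> i. cnj (x $ i))"
  have n\<theta>: "norm \<theta> = norm x" by (simp add: norm_vec_def \<theta>_def)
  have e: "Re (\<Sum>i\<in>UNIV. \<Sum>j\<in>UNIV. \<theta> $ i * of_real (r * s) * a $ i $ j * cnj (\<theta> $ j)) = r * s * inner (a *v x) x" for a r s
  proof -
    have "(\<Sum>i\<in>UNIV. \<Sum>j\<in>UNIV. \<theta> $ i * of_real (r * s) * a $ i $ j * cnj (\<theta> $ j))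
      = of_real (r * s) * (\<Sum>i\<in>UNIV. (a *v x) $ i * cnj (x $ i))"
      unfolding sum_distrib_left by (intro sum.cong refl)
        (simp add: \<theta>_def matrix_vector_mult_def sum_distrib_left sum_distrib_right mult_ac)
    then show ?thesis by (simp add: inner_complex_vec)
  qed
  have "(mpow \<xi> K)\<^sup>2 \<le> (norm (\<chi> i. \<xi> i) ^ m)\<^sup>2"
    using mpow_le[of \<xi> K] K by (simp add: abs_le_square_iff[symmetric])
  then have "\<delta> * (mpow \<xi> K)\<^sup>2 * (norm x)\<^sup>2 \<le> \<delta> * norm (\<chi> i. \<xi> i) ^ (2 * m) * (norm \<theta>)\<^sup>2"
    unfolding n\<theta> using assms(3) by (intro mult_right_mono mult_left_mono) (auto simp: power_mult power_mult[of _ m 2] mult.commute[of 2 m])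
  also have "\<dots> \<le> Re (\<Sum>\<alpha>\<in>mi_eq m. \<Sum>\<beta>\<in>mi_eq m. \<Sum>i\<in>UNIV. \<Sum>j\<in>UNIV.
             \<theta> $ i * of_real (mi_power (\<chi> i. \<xi> i) \<alpha> * mi_power (\<chi> i. \<xi> i) \<beta>) * A \<alpha> \<beta> t $ i $ j * cnj (\<theta> $ j))"
    using A unfolding admissible_coeffs_def legendre_hadamard_def by blast
  also have "\<dots> = (\<Sum>\<alpha>\<in>mi_eq m. \<Sum>\<beta>\<in>mi_eq m. mi_power (\<chi> i. \<xi> i) \<alpha> * mi_power (\<chi> i. \<xi> i) \<beta> * inner (A \<alpha> \<beta> t *v x) x)"
    unfolding Re_sum[of _ "mi_eq m"] e ..
  also have "\<dots> = (\<Sum>M | size M = m. \<Sum>N | size N = m. mpow \<xi> M * mpow \<xi> N * inner (A (count M) (count N) t *v x) x)"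
    by (simp add: sum.reindex_bij_betw[OF bij_count_eq, symmetric] mi_power_count)
  finally show ?thesis .
qed

text \<open>The coefficients see only t, so multiplication by them commutes with spatial
  translations; being linear at each point, it commutes with restriction too. The Legendre-Hadamard
  condition is integrated pointwise.\<close>

lemma half_space_cyl:
  fixes A :: "('d::{finite,linorder}, 'n::finite) coeffs"
  assumes A: "admissible_coeffs m \<delta> A" and \<delta>: "0 < \<delta>"
  shows "half_space shx (rstE T) first_coord (rst (past T)) (\<lambda>h. sft (- h, 0)) dl (opA m A) m \<delta>"
proof (intro half_space.intro half_shift_action half_space_axioms.intro)
  fix f g :: "('d spacetime, (complex, 'n) vec) l2" and v :: "(real, 'd) vec" and h :: real and i :: 'd
    and M N K :: "'d multiset" and \<xi> :: "'d \<Rightarrow> real"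
  have sub: "half_cyl T \<subseteq> (past T :: 'd spacetime set)" by (auto simp: half_cyl_eq)
  note bdd = coeff_bdd_field(1)[OF A]
  show "bounded_linear (rst (past T) :: ('d spacetime, (complex, 'n) vec) l2 \<Rightarrow> _)" by (rule rst_bounded_linear) simp
  show "inner (rst (past T) f) g = inner f (rst (past T) g)" by (rule rst_adjoint) simp
  show "rst (past T) (rstE T f) = rstE T f" unfolding rstE_def by (rule rst_rst[OF _ _ sub]) simp_all
  show "rst (past T) (shx v f) = shx v (rst (past T) f)"
    unfolding shx_def by (rule rst_sft_commute) (simp_all add: in_past_shift)
  show "bounded_linear (sft (- h, 0) :: ('d spacetime, (complex, 'n) vec) l2 \<Rightarrow> _)"
    by (rule bounded_linear_intro[where K = 1]) (simp_all add: linear_add[OF sft_linear] linear_scale[OF sft_linear] sft_norm)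
  show "norm (sft (- h, 0) f) = norm f" by (rule sft_norm)
  show "sft (- h, 0) (shx v f) = shx v (sft (- h, 0) f)" by (simp add: shx_def flip: sft_plus)
  show "rstE T (sft (- h, 0) f) = rst (past T) (sft (- h, 0) f)" if h: "0 < h" and f: "rstE T f = f"
  proof -
    have "rstE T (sft (- h, 0) (rstE T f)) = rst (past T) (sft (- h, 0) (rstE T f))"
    proof (induction f rule: mk_induct)
      case (mk f)
      \<comment> \<open>Where the delayed function is nonzero one has x_1 > 0, so such a point
        before time T lies in the half-cylinder.\<close>
      have pt: "indicator (half_cyl T) z *\<^sub>R (indicator (half_cyl T) ((- h, 0) + z) *\<^sub>R f ((- h, 0) + z))
        = indicator (past T) z *\<^sub>R (indicator (half_cyl T) ((- h, 0) + z) *\<^sub>R f ((- h, 0) + z))" for z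
        by (cases z) (auto simp: half_cyl_def past_def split: split_indicator)
      have L: "in_L2 lebesgue (\<lambda>z. indicator (half_cyl T) z *\<^sub>R f z)" by (rule in_L2_indicator[OF sets_half_cyl mk])
      show ?case
        unfolding rstE_def rst_mk[OF sets_half_cyl mk] sft_mk[OF L]
        by (rule rst_mk_cong) (simp_all only: sets_half_cyl sets_past translate_in_L2[OF L] pt)
    qed
    then show ?thesis by (simp only: f)
  qed
  show "bounded_linear (dl :: ('d spacetime, (complex, 'n) vec) l2 \<Rightarrow> _)" by (rule dl_bounded_linear)
  show "2 * (norm (dl f))\<^sup>2 = (norm f)\<^sup>2" by (rule dl_norm)
  show "dl (rstE T f) = rstE T (dl f)" by (rule dl_rst)
  show "dl (shx (axis first_coord h) f) = shx (axis first_coord (h / 2)) (dl f)" by (rule dl_shift_normal)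
  show "dl (shx (axis i h) f) = shx (axis i h) (dl f)" if "i \<noteq> first_coord" by (rule dl_shift_tangential[OF that])
  show "shift_action.D2 shx first_coord (f - dl f) (g - 2 *\<^sub>R dl g)"
    if "rstE T f = f" "rstE T g = g" "half_shift_action.DH shx (rstE T) first_coord f g"
    by (rule dl_difference_quotient[OF that])
  show "bounded_linear (opA m A M N)"
  proof (cases "size M = m \<and> size N = m")
    case True
    then have "opA m A M N = mop (\<lambda>z x. A (count M) (count N) (fst z) *v x)" by (auto simp: opA_def fun_eq_iff)
    then show ?thesis using mop_bounded_linear[OF bdd[OF conjunct1[OF True] conjunct2[OF True]]] by simp
  next
    case False
    then have "opA m A M N = (\<lambda>_. 0)" by (auto simp: opA_def fun_eq_iff)
    then show ?thesis by simp
  qed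
  show "opA m A M N (shx v f) = shx v (opA m A M N f)"
  proof (cases "size M = m \<and> size N = m")
    case True
    note b = bdd[OF conjunct1[OF True] conjunct2[OF True]]
    have "mop (\<lambda>z x. A (count M) (count N) (fst z) *v x) (shx v f) = shx v (mop (\<lambda>z x. A (count M) (count N) (fst z) *v x) f)"
      by (induction f rule: mk_induct) (simp add: shx_def sft_mk mop_mk[OF b] translate_in_L2 bdd_field_in_L2[OF b])
    then show ?thesis using True by (simp add: opA_def)
  qed (auto simp: opA_def shx_def linear_0[OF sft_linear])
  show "opA m A M N (rstE T f) = rstE T (opA m A M N f)"
  proof (cases "size M = m \<and> size N = m")
    case True
    note b = bdd[OF conjunct1[OF True] conjunct2[OF True]]
    have lin: "linear ((*v) (A (count M) (count N) t))" for t
      using b by (auto simp: bdd_field_def)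
    have "mop (\<lambda>z x. A (count M) (count N) (fst z) *v x) (rstE T f) = rstE T (mop (\<lambda>z x. A (count M) (count N) (fst z) *v x) f)"
      by (induction f rule: mk_induct)
        (simp add: rstE_def rst_mk mop_mk[OF b] in_L2_indicator bdd_field_in_L2[OF b] linear_scale[OF lin])
    then show ?thesis using True by (simp add: opA_def)
  next
    case False
    have "rstE T 0 = (0 :: ('d spacetime, (complex, 'n) vec) l2)"
      unfolding rstE_def by (rule linear_0[OF bounded_linear.linear[OF rst_bounded_linear]]) simp
    then show ?thesis using False by (auto simp: opA_def)
  qed
  show "norm (opA m A M N f) \<le> inverse \<delta> * norm f" if "size M = m" "size N = m"
    using mop_norm[OF bdd[OF that] coeff_bdd_field(2)[OF A that], of f] \<delta> that by (simp add: opA_def)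
  show "\<delta> * (mpow \<xi> K)\<^sup>2 * (norm f)\<^sup>2
      \<le> (\<Sum>M | size M = m. \<Sum>N | size N = m. mpow \<xi> M * mpow \<xi> N * inner (opA m A M N f) f)"
    if K: "size K = m"
  proof (induction f rule: mk_induct)
    case (mk f)
    let ?g = "\<lambda>M N z. mpow \<xi> M * mpow \<xi> N * inner (A (count M) (count N) (fst z) *v f z) (f z)"
    have i: "integrable lebesgue (?g M N)" if "size M = m" "size N = m" for M N
      by (intro integrable_mult_right in_L2_integrable_inner bdd_field_in_L2[OF bdd[OF that]] mk)
    have "(LINT z|lebesgue. \<delta> * (mpow \<xi> K)\<^sup>2 * (norm (f z))\<^sup>2)
        \<le> (LINT z|lebesgue. (\<Sum>M | size M = m. \<Sum>N | size N = m. ?g M N z))"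
    proof (rule integral_mono)
      show "integrable lebesgue (\<lambda>z. \<delta> * (mpow \<xi> K)\<^sup>2 * (norm (f z))\<^sup>2)"
        using mk by (simp add: in_L2_def)
      show "integrable lebesgue (\<lambda>z. \<Sum>M | size M = m. \<Sum>N | size N = m. ?g M N z)"
        by (intro Bochner_Integration.integrable_sum i) auto
      show "\<delta> * (mpow \<xi> K)\<^sup>2 * (norm (f z))\<^sup>2 \<le> (\<Sum>M | size M = m. \<Sum>N | size N = m. ?g M N z)" for z
        using \<delta> by (intro LH_pointwise[OF A K]) simp
    qed
    also have "(LINT z|lebesgue. (\<Sum>M | size M = m. \<Sum>N | size N = m. ?g M N z))
      = (\<Sum>M | size M = m. \<Sum>N | size N = m. (LINT z|lebesgue. ?g M N z))"
    proof -
      have "(LINT z|lebesgue. (\<Sum>M | size M = m. \<Sum>N | size N = m. ?g M N z))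
        = (\<Sum>M | size M = m. (LINT z|lebesgue. (\<Sum>N | size N = m. ?g M N z)))"
        by (rule Bochner_Integration.integral_sum) (intro Bochner_Integration.integrable_sum i, auto)
      also have "\<dots> = (\<Sum>M | size M = m. \<Sum>N | size N = m. (LINT z|lebesgue. ?g M N z))"
        by (intro sum.cong refl Bochner_Integration.integral_sum i) auto
      finally show ?thesis .
    qed
    also have "\<dots> = (\<Sum>M | size M = m. \<Sum>N | size N = m. mpow \<xi> M * mpow \<xi> N * inner (opA m A M N (mk f)) (mk f))"
      by (intro sum.cong refl) (simp add: opA_def mop_mk[OF bdd mk] mk_inner[OF bdd_field_in_L2[OF bdd mk] mk])
    also have "(LINT z|lebesgue. \<delta> * (mpow \<xi> K)\<^sup>2 * (norm (f z))\<^sup>2) = \<delta> * (mpow \<xi> K)\<^sup>2 * (norm (mk f))\<^sup>2"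
      by (simp add: norm_mk_sq mk)
    finally show ?case .
  qed
  show "0 < \<delta>" by (rule \<delta>)
qed

section \<open>Gauss formula on the lateral boundary and functions with zero trace\<close>

section \<open>Vanishing traces\<close>

lemma spacetime_Basis: "(Basis :: 'd::finite spacetime set) = insert t_dir (range x_dir)"
  by (auto simp: Basis_prod_def Basis_vec_def x_dir_def t_dir_def image_image)

lemma t_dir_neq_x_dir: "t_dir \<notin> range x_dir"
  by (auto simp: x_dir_def t_dir_def)

lemma inner_t_dir: "z \<bullet> t_dir = fst z"
  by (simp add: t_dir_def inner_prod_def)

text \<open>Coordinates in the order ((t, x'), x_1): Fubini then integrates along the normal lines
  first, and setting x_1 = 0 gives the embedding behind \<open>bdry_measure\<close>.\<close>

definition glue :: "(real \<times> ('d \<Rightarrow> real)) \<times> real \<Rightarrow> 'd::{finite,linorder} spacetime"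
  where "glue p = (fst (fst p), \<chi> i. if i = first_coord then snd p else snd (fst p) i)"

abbreviation tangential_measure :: "(real \<times> ('d::{finite,linorder} \<Rightarrow> real)) measure"
  where "tangential_measure \<equiv> lborel \<Otimes>\<^sub>M (\<Pi>\<^sub>M i\<in>UNIV - {first_coord :: 'd}. lborel)"

lemma glue_measurable: "glue \<in> borel_measurable (tangential_measure \<Otimes>\<^sub>M lborel)"
proof (subst borel_measurable_euclidean_space, safe)
  fix v :: "'d::{finite,linorder} spacetime"
  assume "v \<in> Basis"
  then consider "v = t_dir" | "v = x_dir first_coord" | i where "v = x_dir i" "i \<noteq> first_coord"
    by (auto simp: spacetime_Basis)
  then show "(\<lambda>p. glue p \<bullet> v) \<in> borel_measurable (tangential_measure \<Otimes>\<^sub>M lborel)"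
  proof cases
    case 3
    have "(\<lambda>y. y i) \<in> measurable (\<Pi>\<^sub>M i\<in>UNIV - {first_coord :: 'd}. lborel) lborel"
      by (rule measurable_component_singleton) (use 3 in simp)
    then have "(\<lambda>p. snd (fst p) i) \<in> measurable ((tangential_measure :: (real \<times> ('d \<Rightarrow> real)) measure) \<Otimes>\<^sub>M lborel) lborel"
      by (intro measurable_compose[OF measurable_fst measurable_compose[OF measurable_snd]])
    then show ?thesis using 3 by (simp add: inner_x_dir glue_def)
  qed (simp_all add: inner_t_dir inner_x_dir glue_def)
qed

lemma sigma_finite_tangential:
  "sigma_finite_measure (\<Pi>\<^sub>M i\<in>UNIV - {first_coord :: 'd::{finite,linorder}}. (lborel :: real measure))"
proof -
  interpret product_sigma_finite "\<lambda>_::'d. lborel :: real measure" by standard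
  show ?thesis by (rule sigma_finite) simp
qed

text \<open>Both measures assign the product of the side lengths to every box.\<close>

lemma lborel_eq_glue: "(lborel :: 'd::{finite,linorder} spacetime measure) = distr (tangential_measure \<Otimes>\<^sub>M lborel) borel glue"
proof (rule lborel_eqI)
  let ?I = "UNIV - {first_coord :: 'd}"
  interpret product_sigma_finite "\<lambda>_::'d. lborel :: real measure" by standard
  interpret y: sigma_finite_measure "\<Pi>\<^sub>M i\<in>?I. (lborel :: real measure)" by (rule sigma_finite_tangential)
  fix l u :: "'d spacetime" assume lu: "\<And>b. b \<in> Basis \<Longrightarrow> l \<bullet> b \<le> u \<bullet> b"
  let ?Y = "Pi\<^sub>E ?I (\<lambda>i. {snd l $ i <..< snd u $ i})"
  have pre: "glue -` box l u \<inter> space (tangential_measure \<Otimes>\<^sub>M lborel)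
      = ({fst l <..< fst u} \<times> ?Y) \<times> {snd l $ first_coord <..< snd u $ first_coord}"
  proof (rule set_eqI)
    fix p :: "(real \<times> ('d \<Rightarrow> real)) \<times> real"
    obtain t y s where p: "p = ((t, y), s)" by (metis prod.exhaust)
    have mem: "z \<in> box l u \<longleftrightarrow> fst l < fst z \<and> fst z < fst u \<and> (\<forall>i. snd l $ i < snd z $ i \<and> snd z $ i < snd u $ i)" for z
      unfolding mem_box spacetime_Basis by (simp only: ball_simps inner_t_dir inner_x_dir) simp
    have split: "(\<forall>i. Q i) \<longleftrightarrow> Q first_coord \<and> (\<forall>i\<in>?I. Q i)" for Q :: "'d \<Rightarrow> bool" by blast
    show "p \<in> glue -` box l u \<inter> space (tangential_measure \<Otimes>\<^sub>M lborel) \<longleftrightarrow>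
        p \<in> ({fst l <..< fst u} \<times> ?Y) \<times> {snd l $ first_coord <..< snd u $ first_coord}"
      unfolding p vimage_eq Int_iff mem split[of "\<lambda>i. snd l $ i < snd (glue ((t, y), s)) $ i \<and> snd (glue ((t, y), s)) $ i < snd u $ i"]
      by (simp add: glue_def space_pair_measure space_PiM PiE_iff) blast
  qed
  have Y: "?Y \<in> sets (\<Pi>\<^sub>M i\<in>?I. (lborel :: real measure))" by (rule sets_PiM_I_finite) auto
  have t: "fst l \<le> fst u" using lu[of t_dir] by (simp add: inner_t_dir)
  have x: "snd l $ i \<le> snd u $ i" for i using lu[of "x_dir i"] by (simp add: inner_x_dir)
  have "emeasure (distr (tangential_measure \<Otimes>\<^sub>M lborel) borel glue) (box l u)
      = emeasure ((tangential_measure :: (real \<times> ('d \<Rightarrow> real)) measure) \<Otimes>\<^sub>M lborel)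
          (({fst l <..< fst u} \<times> ?Y) \<times> {snd l $ first_coord <..< snd u $ first_coord})"
    unfolding pre[symmetric] by (rule emeasure_distr[OF glue_measurable]) simp
  also have "\<dots> = emeasure lborel {fst l <..< fst u} * emeasure (\<Pi>\<^sub>M i\<in>?I. lborel) ?Y * emeasure lborel {snd l $ first_coord <..< snd u $ first_coord}"
    using Y by (simp add: lborel.emeasure_pair_measure_Times y.emeasure_pair_measure_Times)
  also have "emeasure (\<Pi>\<^sub>M i\<in>?I. lborel) ?Y = (\<Prod>i\<in>?I. ennreal (snd u $ i - snd l $ i))"
    by (subst emeasure_PiM) (simp_all add: x)
  also have "\<dots> = ennreal (\<Prod>i\<in>?I. snd u $ i - snd l $ i)"
    by (rule prod_ennreal) (simp add: x)
  finally have 1: "emeasure (distr (tangential_measure \<Otimes>\<^sub>M lborel) borel glue) (box l u)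
      = ennreal ((fst u - fst l) * ((\<Prod>i\<in>?I. snd u $ i - snd l $ i) * (snd u $ first_coord - snd l $ first_coord)))"
    using t x prod_nonneg[of ?I "\<lambda>i. snd u $ i - snd l $ i"] by (simp add: ennreal_mult mult.assoc)
  have "(\<Prod>b\<in>Basis. (u - l) \<bullet> b) = (fst u - fst l) * (\<Prod>i\<in>UNIV. snd u $ i - snd l $ i)"
    unfolding spacetime_Basis
    by (subst prod.insert) (simp_all add: t_dir_neq_x_dir prod.reindex inj_def inner_t_dir inner_x_dir)
  also have "(\<Prod>i\<in>UNIV. snd u $ i - snd l $ i) = (\<Prod>i\<in>?I. snd u $ i - snd l $ i) * (snd u $ first_coord - snd l $ first_coord)"
    by (subst prod.remove[of _ first_coord]) (simp_all add: mult.commute)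
  finally show "emeasure (distr (tangential_measure \<Otimes>\<^sub>M lborel) borel glue) (box l u) = (\<Prod>b\<in>Basis. (u - l) \<bullet> b)"
    using 1 by simp
qed simp

lemma half_line_integral:
  fixes F :: "real \<Rightarrow> real"
  assumes F: "\<And>s. (F has_real_derivative f s) (at s)" and f: "continuous_on UNIV f"
    and R: "0 < R" "\<And>s. R \<le> s \<Longrightarrow> F s = 0" "\<And>s. R \<le> s \<Longrightarrow> f s = 0"
  shows "(LINT s|lborel. indicator {0<..} s * f s) = - F 0"
proof -
  have [measurable]: "f \<in> borel_measurable borel" by (rule borel_measurable_continuous_onI[OF f])
  have "AE s in lborel. s \<noteq> (0::real)" by (rule AE_lborel_singleton)
  then have "AE s in lborel. indicator {0<..} s * f s = f s * indicator {0..R} s"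
    by eventually_elim (use R(3) in \<open>auto split: split_indicator\<close>)
  then have "(LINT s|lborel. indicator {0<..} s * f s) = (LINT s|lborel. f s * indicator {0..R} s)"
    by (intro integral_cong_AE) measurable
  also have "\<dots> = F R - F 0"
    by (rule integral_FTC_Icc_real) (use F f R(1) in \<open>auto simp: continuous_on_eq_continuous_at\<close>)
  finally show ?thesis using R(2)[of R] by simp
qed

text \<open>The fundamental theorem of calculus on each normal half-line, integrated over the
  tangential variables. The support is compact in \<open>past T\<close>, so the only boundary
  contribution comes from x_1 = 0.\<close>

lemma lateral_gauss:
  fixes g :: "'d::{finite,linorder} spacetime \<Rightarrow> real"
  assumes g: "g \<in> smooth_cpt (past T)"
  shows "integrable (bdry_measure T) g"
    and "(LINT z|lebesgue. indicator (half_cyl T) z * pdiff (x_dir first_coord) g z) = - (LINT z|bdry_measure T. g z)"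
proof -
  let ?e = "x_dir first_coord :: 'd spacetime"
  let ?h = "\<lambda>z. indicator (half_cyl T) z * pdiff ?e g z"
  let ?P = "tangential_measure :: (real \<times> ('d \<Rightarrow> real)) measure"
  interpret y: sigma_finite_measure "\<Pi>\<^sub>M i\<in>UNIV - {first_coord :: 'd}. (lborel :: real measure)" by (rule sigma_finite_tangential)
  interpret p: pair_sigma_finite lborel "\<Pi>\<^sub>M i\<in>UNIV - {first_coord :: 'd}. (lborel :: real measure)" ..
  interpret ps: pair_sigma_finite ?P lborel ..
  note smooth = smooth_cptD(1)[OF g]
  have cont: "continuous_on UNIV g" "continuous_on UNIV (pdiff ?e g)"
    by (intro smooth_imp_continuous smooth_pdiff smooth x_dir_Basis)+
  have [measurable]: "g \<in> borel_measurable borel" "pdiff ?e g \<in> borel_measurable borel"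
    using cont by (auto intro: borel_measurable_continuous_onI)
  have [measurable]: "half_cyl T \<in> sets (borel :: 'd spacetime measure)" "past T \<in> sets (borel :: 'd spacetime measure)"
    by (intro borel_open open_half_cyl open_past)+
  have hm[measurable]: "?h \<in> borel_measurable borel" by measurable
  note [measurable] = glue_measurable
  obtain r where r: "\<And>z. z \<in> supp g \<Longrightarrow> norm z \<le> r"
    using compact_imp_bounded[OF smooth_cptD(2)[OF g]] by (auto simp: bounded_iff)
  define R where "R = \<bar>r\<bar> + 1"
  have far: "z \<notin> supp g" if "R \<le> snd z $ first_coord" for z
  proof
    assume "z \<in> supp g"
    then have "norm z \<le> r" by (rule r)
    moreover have "\<bar>snd z $ first_coord\<bar> \<le> norm z" using Basis_le_norm[OF x_dir_Basis, of z first_coord] by (simp add: inner_x_dir)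
    ultimately show False using that by (simp add: R_def)
  qed
  have "integrable lborel ?h"
  proof -
    have "integrable lborel (\<lambda>z. indicator (supp g) z *\<^sub>R pdiff ?e g z)"
      by (rule borel_integrable_compact[OF smooth_cptD(2)[OF g] continuous_on_subset[OF cont(2)]]) simp
    moreover have "indicator (supp g) z *\<^sub>R pdiff ?e g z = pdiff ?e g z" for z
      by (auto simp: pdiff_outside_supp split: split_indicator)
    ultimately have "integrable lborel (pdiff ?e g)" by (simp only:)
    then have "integrable lborel (\<lambda>z. indicator (half_cyl T) z *\<^sub>R pdiff ?e g z)"
      by (rule integrable_mult_indicator[rotated]) simp
    then show ?thesis by simp
  qed
  then have "integrable (distr (?P \<Otimes>\<^sub>M lborel) borel glue) ?h" by (simp add: lborel_eq_glue)
  then have int: "integrable (?P \<Otimes>\<^sub>M lborel) (\<lambda>p. ?h (glue p))"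
    by (subst (asm) integrable_distr_eq) measurable
  have glue: "glue (q, s) = glue (q, 0) + s *\<^sub>R ?e" for q s
    by (auto simp: glue_def x_dir_def axis_def vec_eq_iff)
  have line: "(LINT s|lborel. ?h (glue (q, s))) = - g (glue (q, 0))" for q
  proof -
    have "?h (glue (q, s)) = indicator {0<..} s * pdiff ?e g (glue (q, 0) + s *\<^sub>R ?e)" for s
    proof (cases "glue (q, s) \<in> past T")
      case True
      moreover have "snd (glue (q, s)) $ first_coord = s" by (simp add: glue_def)
      ultimately show ?thesis unfolding half_cyl_eq by (simp flip: glue add: indicator_def)
    next
      case False
      then have "pdiff ?e g (glue (q, s)) = 0" by (rule smooth_cptD(4)[OF smooth_cpt_pdiff[OF g x_dir_Basis]])
      then show ?thesis by (simp flip: glue)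
    qed
    then have "(LINT s|lborel. ?h (glue (q, s))) = (LINT s|lborel. indicator {0<..} s * pdiff ?e g (glue (q, 0) + s *\<^sub>R ?e))"
      by simp
    also have "\<dots> = - g (glue (q, 0) + 0 *\<^sub>R ?e)"
    proof (rule half_line_integral[where R = R and F = "\<lambda>s. g (glue (q, 0) + s *\<^sub>R ?e)"])
      show "((\<lambda>s. g (glue (q, 0) + s *\<^sub>R ?e)) has_real_derivative pdiff ?e g (glue (q, 0) + s *\<^sub>R ?e)) (at s)" for s
        by (rule real_along_line) (rule smooth_imp_differentiable[OF smooth])
      show "continuous_on UNIV (\<lambda>s. pdiff ?e g (glue (q, 0) + s *\<^sub>R ?e))"
        by (intro continuous_on_compose2[OF cont(2)] continuous_intros) auto
      show "0 < R" by (simp add: R_def)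
      fix s assume "R \<le> s"
      then have "glue (q, 0) + s *\<^sub>R ?e \<notin> supp g"
        unfolding glue[symmetric] by (intro far) (simp add: glue_def)
      then show "g (glue (q, 0) + s *\<^sub>R ?e) = 0" "pdiff ?e g (glue (q, 0) + s *\<^sub>R ?e) = 0"
        by (simp_all add: not_in_supp pdiff_outside_supp)
    qed
    finally show ?thesis by simp
  qed
  let ?\<iota> = "\<lambda>q. glue (q, 0)"
  have \<iota>[measurable]: "?\<iota> \<in> borel_measurable ?P"
    by (rule measurable_compose[OF _ glue_measurable]) measurable
  have bdry: "bdry_measure T = restrict_space (distr ?P borel ?\<iota>) (past T)"
    unfolding bdry_measure_def past_def by (intro arg_cong2[where f = restrict_space] arg_cong[where f = "distr ?P borel"] refl)
      (auto simp: glue_def fun_eq_iff)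
  have off: "indicator (past T) z *\<^sub>R g z = g z" for z
    using smooth_cptD(4)[OF g, of z] by (cases "z \<in> past T") auto
  have S: "past T \<inter> space (distr ?P borel ?\<iota>) \<in> sets (distr ?P borel ?\<iota>)" by simp
  from ps.integrable_fst'[OF int] have i: "integrable ?P (\<lambda>q. g (glue (q, 0)))"
    unfolding line by simp
  show "integrable (bdry_measure T) g"
    unfolding bdry integrable_restrict_space[OF S] off by (subst integrable_distr_eq) (simp_all add: i)
  have "(LINT z|lebesgue. ?h z) = (LINT z|lborel. ?h z)"
    by (rule integral_completion) simp
  also have "\<dots> = (LINT p|(?P \<Otimes>\<^sub>M lborel). ?h (glue p))"
    unfolding lborel_eq_glue by (rule integral_distr) measurable
  also have "\<dots> = (LINT q|?P. (LINT s|lborel. ?h (glue (q, s))))"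
    by (rule ps.integral_fst'[OF int, symmetric])
  also have "\<dots> = - (LINT q|?P. g (glue (q, 0)))"
    unfolding line by simp
  also have "(LINT q|?P. g (glue (q, 0))) = (LINT z|bdry_measure T. g z)"
    unfolding bdry integral_restrict_space[OF S] off by (rule integral_distr[symmetric]) measurable
  finally show "(LINT z|lebesgue. ?h z) = - (LINT z|bdry_measure T. g z)" .
qed

lemma C_k_inner: "C_k k f \<Longrightarrow> C_k k (\<lambda>z. f z \<bullet> b)"
proof (induction k arbitrary: f)
  case 0
  then show ?case by (auto intro!: continuous_intros)
next
  case (Suc k)
  have "pdiff v (\<lambda>z. f z \<bullet> b) = (\<lambda>z. pdiff v f z \<bullet> b)" for v
    using Suc.prems by (intro ext pdiff_eq has_derivative_inner_left differentiable_derivative) auto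
  with Suc show ?case by (auto intro!: derivative_intros)
qed

lemma pdiff_inner: "f differentiable (at z) \<Longrightarrow> pdiff v (\<lambda>z. f z \<bullet> b) z = pdiff v f z \<bullet> b"
  by (intro pdiff_eq has_derivative_inner_left differentiable_derivative)

lemma smooth_inner: "smooth f \<Longrightarrow> smooth (\<lambda>z. f z \<bullet> b)"
  by (simp add: smooth_def C_k_inner)

lemma L2_tendsto_mk:
  assumes S: "S \<in> sets lebesgue" and lim: "L2_tendsto (lebesgue_on S) F f"
    and F: "\<And>k. in_L2 (lebesgue_on S) (F k)" and f: "in_L2 (lebesgue_on S) f"
  shows "(\<lambda>k. mk (\<lambda>z. indicator S z *\<^sub>R F k z)) \<longlonglongrightarrow> mk (\<lambda>z. indicator S z *\<^sub>R f z)"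
proof -
  have L: "in_L2 lebesgue (\<lambda>z. indicator S z *\<^sub>R F k z)" "in_L2 lebesgue (\<lambda>z. indicator S z *\<^sub>R f z)" for k
    using F f by (simp_all add: in_L2_restrict_iff[OF S])
  have "norm (mk (\<lambda>z. indicator S z *\<^sub>R F k z) - mk (\<lambda>z. indicator S z *\<^sub>R f z)) = L2_norm (lebesgue_on S) (\<lambda>z. F k z - f z)" for k
    by (simp add: mk_diff[OF L] norm_mk[OF in_L2_diff[OF L]] L2_norm_restrict[OF S] scaleR_diff_right)
  then show ?thesis
    using lim by (subst LIM_zero_iff[symmetric], subst tendsto_norm_zero_iff[symmetric]) (simp add: L2_tendsto_def)
qed

text \<open>Young's inequality with a free weight r. If the product is not integrable, its integral
  is 0 by convention and the bound still holds.\<close>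

lemma integral_mult_le:
  fixes f g :: "'a::euclidean_space \<Rightarrow> real"
  assumes "integrable M (\<lambda>z. (f z)\<^sup>2)" "integrable M (\<lambda>z. (g z)\<^sup>2)" "0 < r"
  shows "\<bar>LINT z|M. f z * g z\<bar> \<le> r / 2 * (LINT z|M. (f z)\<^sup>2) + (LINT z|M. (g z)\<^sup>2) / (2 * r)"
proof -
  have pt: "\<bar>a * b\<bar> \<le> r / 2 * a\<^sup>2 + b\<^sup>2 / (2 * r)" for a b :: real
  proof -
    have "0 \<le> (r * \<bar>a\<bar> - \<bar>b\<bar>)\<^sup>2 / (2 * r)" using assms(3) by simp
    also have "(r * \<bar>a\<bar> - \<bar>b\<bar>)\<^sup>2 / (2 * r) = r / 2 * a\<^sup>2 + b\<^sup>2 / (2 * r) - \<bar>a * b\<bar>"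
      using assms(3) by (simp add: power2_diff power_mult_distrib abs_mult field_simps) (simp add: power2_eq_square)
    finally show ?thesis by simp
  qed
  have "\<bar>LINT z|M. f z * g z\<bar> \<le> (LINT z|M. r / 2 * (f z)\<^sup>2 + (g z)\<^sup>2 / (2 * r))"
  proof (cases "integrable M (\<lambda>z. f z * g z)")
    case True
    show ?thesis
      by (rule Bochner_Integration.integral_abs_bound_integral[OF True]) (use assms pt in auto)
  next
    case False
    then have "(LINT z|M. f z * g z) = 0" by (rule not_integrable_integral_eq)
    then show ?thesis using assms(3) by (simp add: integral_nonneg_AE)
  qed
  then show ?thesis using assms by simp
qed

text \<open>For the smooth approximations \<phi> k, \<open>lateral_gauss\<close> gives the identity
  with a boundary term \<open>J k\<close>, which tends to 0 with the boundary norms of \<phi> k. The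
  test function \<psi> may be nonzero at x_1 = 0, so the zero extension of w has the zero extension
  of v as weak normal derivative in all of \<open>past T\<close>.\<close>

lemma zero_trace_weak:
  fixes w v :: "('d::{finite,linorder}, 'n::finite) vfield"
  assumes tr: "has_trace T w (\<lambda>_. 0)"
    and wd: "has_weak_deriv (half_cyl T) [x_dir first_coord] w v"
    and w: "in_L2 (leb_cyl T) w" and v: "in_L2 (leb_cyl T) v"
    and \<psi>: "\<psi> \<in> smooth_cpt (past T)"
  shows "inner (mk (pdiff (x_dir first_coord) \<psi>)) (cmp b (mk (\<lambda>z. indicator (half_cyl T) z *\<^sub>R w z)))
    = - inner (mk \<psi>) (cmp b (mk (\<lambda>z. indicator (half_cyl T) z *\<^sub>R v z)))"
proof -
  let ?e = "x_dir first_coord :: 'd spacetime" and ?O = "half_cyl T :: 'd spacetime set"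
  obtain \<phi> v' where \<phi>: "\<And>k. \<phi> k \<in> smooth_cpt (UNIV :: 'd spacetime set)" and \<phi>w: "L2_tendsto (leb_cyl T) \<phi> w"
    and v': "has_weak_deriv ?O [?e] w v'" and \<phi>v': "L2_tendsto (leb_cyl T) (\<lambda>k. pdiff ?e (\<phi> k)) v'"
    and \<phi>0: "L2_tendsto (bdry_measure T) \<phi> (\<lambda>_. 0)"
    using tr unfolding has_trace_def by blast
  \<comment> \<open>The trace relation supplies a weak derivative of its own, which uniqueness
    identifies with v.\<close>
  have eq: "AE z in lebesgue. z \<in> ?O \<longrightarrow> v' z = v z"
    by (rule weak_deriv_unique[OF open_half_cyl v' wd])
  have L: "in_L2 lebesgue (\<phi> k)" "in_L2 lebesgue (pdiff ?e (\<phi> k))" for k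
    by (rule smooth_cpt_in_L2[OF \<phi>], rule smooth_cpt_in_L2[OF smooth_cpt_pdiff[OF \<phi> x_dir_Basis]])
  have LO: "in_L2 lebesgue (\<lambda>z. indicator ?O z *\<^sub>R \<phi> k z)" "in_L2 lebesgue (\<lambda>z. indicator ?O z *\<^sub>R pdiff ?e (\<phi> k) z)" for k
    by (rule in_L2_indicator[OF sets_half_cyl L(1)], rule in_L2_indicator[OF sets_half_cyl L(2)])
  have vO: "in_L2 lebesgue (\<lambda>z. indicator ?O z *\<^sub>R v z)" using v by (simp add: in_L2_restrict_iff)
  have v'd: "in_L2 lebesgue (\<lambda>z. indicator ?O z *\<^sub>R (pdiff ?e (\<phi> 0) z - v' z))"
    using \<phi>v' by (simp add: L2_tendsto_def in_L2_restrict_iff)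
  have v'O: "in_L2 lebesgue (\<lambda>z. indicator ?O z *\<^sub>R v' z)"
    using in_L2_diff[OF LO(2)[of 0] v'd] by (simp add: scaleR_diff_right)
  have mkv: "mk (\<lambda>z. indicator ?O z *\<^sub>R v' z) = mk (\<lambda>z. indicator ?O z *\<^sub>R v z)"
    unfolding mk_eq_iff[OF v'O vO] using eq by eventually_elim (auto split: split_indicator)
  have l1: "(\<lambda>k. mk (\<lambda>z. indicator ?O z *\<^sub>R \<phi> k z)) \<longlonglongrightarrow> mk (\<lambda>z. indicator ?O z *\<^sub>R w z)"
    by (rule L2_tendsto_mk[OF sets_half_cyl \<phi>w]) (simp_all add: in_L2_restrict_iff LO w)
  have l2: "(\<lambda>k. mk (\<lambda>z. indicator ?O z *\<^sub>R pdiff ?e (\<phi> k) z)) \<longlonglongrightarrow> mk (\<lambda>z. indicator ?O z *\<^sub>R v z)"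
    unfolding mkv[symmetric]
    by (rule L2_tendsto_mk[OF sets_half_cyl \<phi>v']) (simp_all add: in_L2_restrict_iff LO v'O)
  have \<psi>L: "in_L2 lebesgue \<psi>" "in_L2 lebesgue (pdiff ?e \<psi>)"
    by (rule smooth_cpt_in_L2[OF \<psi>], rule smooth_cpt_in_L2[OF smooth_cpt_pdiff[OF \<psi> x_dir_Basis]])
  have d: "\<psi> differentiable (at z)" "\<phi> k differentiable (at z)" for k z
    by (rule smooth_imp_differentiable[OF smooth_cptD(1)[OF \<psi>]], rule smooth_imp_differentiable[OF smooth_cptD(1)[OF \<phi>]])
  define f where "f k z = \<phi> k z \<bullet> b" for k z
  have fs: "smooth (f k)" for k unfolding f_def[abs_def] by (rule smooth_inner[OF smooth_cptD(1)[OF \<phi>]])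
  have \<psi>f: "(\<lambda>z. \<psi> z *\<^sub>R f k z) \<in> smooth_cpt (past T)" for k
    by (rule smooth_cpt_scaleR[OF \<psi> fs])
  define J where "J k = (LINT z|bdry_measure T. \<psi> z * f k z)" for k
  let ?a = "\<lambda>k. inner (mk (pdiff ?e \<psi>)) (cmp b (mk (\<lambda>z. indicator ?O z *\<^sub>R \<phi> k z)))"
  let ?b = "\<lambda>k. inner (mk \<psi>) (cmp b (mk (\<lambda>z. indicator ?O z *\<^sub>R pdiff ?e (\<phi> k) z)))"
  have ab: "?a k + ?b k = - J k" for k
  proof -
    have c: "in_L2 lebesgue (\<lambda>z. (indicator ?O z *\<^sub>R \<phi> k z) \<bullet> b)" "in_L2 lebesgue (\<lambda>z. (indicator ?O z *\<^sub>R pdiff ?e (\<phi> k) z) \<bullet> b)"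
      by (rule in_L2_inner_const[OF LO(1)], rule in_L2_inner_const[OF LO(2)])
    have "?a k + ?b k = (LINT z|lebesgue. pdiff ?e \<psi> z \<bullet> ((indicator ?O z *\<^sub>R \<phi> k z) \<bullet> b) + \<psi> z \<bullet> ((indicator ?O z *\<^sub>R pdiff ?e (\<phi> k) z) \<bullet> b))"
      unfolding cmp_mk[OF LO(1)] cmp_mk[OF LO(2)] mk_inner[OF \<psi>L(2) c(1)] mk_inner[OF \<psi>L(1) c(2)]
      by (rule Bochner_Integration.integral_add[symmetric])
        (rule in_L2_integrable_inner[OF \<psi>L(2) c(1)], rule in_L2_integrable_inner[OF \<psi>L(1) c(2)])
    also have "\<dots> = (LINT z|lebesgue. indicator ?O z * pdiff ?e (\<lambda>z. \<psi> z *\<^sub>R f k z) z)"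
      unfolding pdiff_scaleR[OF d(1) smooth_imp_differentiable[OF fs]]
      by (rule Bochner_Integration.integral_cong[OF refl])
        (simp add: f_def[abs_def] pdiff_inner[OF d(2)] algebra_simps)
    also have "\<dots> = - J k"
      unfolding J_def using lateral_gauss(2)[OF \<psi>f] by simp
    finally show ?thesis .
  qed
  have "J \<longlonglongrightarrow> 0"
  proof -
    define C where "C = (LINT z|bdry_measure T. (\<psi> z)\<^sup>2)"
    define n where "n k = L2_norm (bdry_measure T) (\<phi> k)" for k
    have i\<psi>: "integrable (bdry_measure T) (\<lambda>z. (\<psi> z)\<^sup>2)"
      using lateral_gauss(1)[OF smooth_cpt_scaleR[OF \<psi> smooth_cptD(1)[OF \<psi>]]] by (simp add: power2_eq_square)
    have n: "n \<longlonglongrightarrow> 0" "in_L2 (bdry_measure T) (\<phi> k)" for k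
      using \<phi>0 by (simp_all add: L2_tendsto_def n_def[abs_def])
    have fk: "in_L2 (bdry_measure T) (f k)" "(LINT z|bdry_measure T. (f k z)\<^sup>2) \<le> (norm b)\<^sup>2 * (n k)\<^sup>2" for k
    proof -
      show 1: "in_L2 (bdry_measure T) (f k)" unfolding f_def[abs_def] by (rule in_L2_inner_const[OF n(2)])
      have "(LINT z|bdry_measure T. (f k z)\<^sup>2) \<le> (LINT z|bdry_measure T. (norm b)\<^sup>2 * (norm (\<phi> k z))\<^sup>2)"
      proof (rule integral_mono)
        show "integrable (bdry_measure T) (\<lambda>z. (f k z)\<^sup>2)" using 1 by (simp add: in_L2_def)
        show "integrable (bdry_measure T) (\<lambda>z. (norm b)\<^sup>2 * (norm (\<phi> k z))\<^sup>2)" using n(2) by (simp add: in_L2_def)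
        have "\<bar>f k z\<bar> \<le> norm b * norm (\<phi> k z)" for z
          unfolding f_def using Cauchy_Schwarz_ineq2[of "\<phi> k z" b] by (simp add: mult.commute)
        from power_mono[OF this abs_ge_zero, of _ 2]
        show "(f k z)\<^sup>2 \<le> (norm b)\<^sup>2 * (norm (\<phi> k z))\<^sup>2" for z by (simp add: power_mult_distrib)
      qed
      also have "\<dots> = (norm b)\<^sup>2 * (n k)\<^sup>2"
        unfolding n_def L2_norm_def by (subst real_sqrt_pow2) (simp_all add: integral_nonneg_AE)
      finally show "(LINT z|bdry_measure T. (f k z)\<^sup>2) \<le> (norm b)\<^sup>2 * (n k)\<^sup>2" .
    qed
    have n0: "0 \<le> n k" for k by (simp add: n_def L2_norm_def integral_nonneg_AE)
    \<comment> \<open>The weight for Young's inequality: it dominates the boundary norm and tends to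
      0, and the added reciprocal keeps it positive.\<close>
    define r where "r k = n k + inverse (real (Suc k))" for k
    have r0: "0 < r k" "n k \<le> r k" for k
      using n0[of k] by (simp_all add: r_def add_nonneg_pos)
    have rlim: "r \<longlonglongrightarrow> 0"
      unfolding r_def[abs_def] using tendsto_add[OF n(1) LIMSEQ_inverse_real_of_nat] by simp
    have "\<bar>J k\<bar> \<le> r k / 2 * C + (norm b)\<^sup>2 * r k / 2" for k
    proof -
      have "\<bar>J k\<bar> \<le> r k / 2 * C + (LINT z|bdry_measure T. (f k z)\<^sup>2) / (2 * r k)"
        unfolding J_def C_def by (rule integral_mult_le[OF i\<psi> _ r0(1)]) (use fk(1)[of k] in \<open>simp add: in_L2_def\<close>)
      also have "(LINT z|bdry_measure T. (f k z)\<^sup>2) / (2 * r k) \<le> ((norm b)\<^sup>2 * (r k)\<^sup>2) / (2 * r k)"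
        using r0[of k] n0[of k] by (intro divide_right_mono order_trans[OF fk(2)] mult_left_mono power_mono) simp_all
      also have "((norm b)\<^sup>2 * (r k)\<^sup>2) / (2 * r k) = (norm b)\<^sup>2 * r k / 2"
        using r0[of k] by (simp add: power2_eq_square)
      finally show ?thesis by simp
    qed
    moreover have "(\<lambda>k. r k / 2 * C + (norm b)\<^sup>2 * r k / 2) \<longlonglongrightarrow> 0 / 2 * C + (norm b)\<^sup>2 * 0 / 2"
      by (intro tendsto_add tendsto_mult tendsto_divide tendsto_const rlim) simp_all
    ultimately show "J \<longlonglongrightarrow> 0"
      by (intro Lim_null_comparison[where f = J and g = "\<lambda>k. r k / 2 * C + (norm b)\<^sup>2 * r k / 2"]) simp_all
  qed
  moreover have "(\<lambda>k. ?a k + ?b k) \<longlonglongrightarrow>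
      inner (mk (pdiff ?e \<psi>)) (cmp b (mk (\<lambda>z. indicator ?O z *\<^sub>R w z))) + inner (mk \<psi>) (cmp b (mk (\<lambda>z. indicator ?O z *\<^sub>R v z)))"
    by (intro tendsto_add tendsto_inner tendsto_const bounded_linear.tendsto[OF cmp_bounded_linear] l1 l2)
  ultimately have "inner (mk (pdiff ?e \<psi>)) (cmp b (mk (\<lambda>z. indicator ?O z *\<^sub>R w z))) + inner (mk \<psi>) (cmp b (mk (\<lambda>z. indicator ?O z *\<^sub>R v z))) = - 0"
    unfolding ab by (intro LIMSEQ_unique[OF _ tendsto_minus]) 
  then show ?thesis by simp
qed

section \<open>Composition of weak derivatives\<close>

section \<open>Calculus of weak derivatives\<close>

lemma foldr_pdiff_append_Cons:
  fixes \<phi> :: "'a::euclidean_space \<Rightarrow> real"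
  assumes "smooth \<phi>" "set vs \<subseteq> Basis" "set ws \<subseteq> Basis" "v \<in> Basis"
  shows "foldr pdiff (vs @ v # ws) \<phi> = pdiff v (foldr pdiff (vs @ ws) \<phi>)"
proof -
  have sm: "smooth (foldr pdiff us \<phi>)" if "set us \<subseteq> Basis" for us
    using that assms(1) by (induction us) (auto intro: smooth_pdiff)
  show ?thesis
    using assms(2)
  proof (induction vs)
    case (Cons a vs)
    then have "set (vs @ ws) \<subseteq> Basis" using assms(3) by auto
    with Cons show ?case using pdiff_commute[OF sm, of "vs @ ws" a v] assms(4) by simp
  qed simp
qed

lemma foldr_pdiff_mset_eq:
  fixes \<phi> :: "'a::euclidean_space \<Rightarrow> real"
  assumes "smooth \<phi>" "mset vs = mset ws" "set vs \<subseteq> Basis"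
  shows "foldr pdiff vs \<phi> = foldr pdiff ws \<phi>"
  using assms(2,3)
proof (induction vs arbitrary: ws)
  case (Cons v vs)
  have "v \<in> set ws" using Cons.prems(1) by (metis list.set_intros(1) mset_eq_setD)
  then obtain as bs where ws: "ws = as @ v # bs" by (meson split_list)
  have m: "mset vs = mset (as @ bs)" using Cons.prems(1) by (simp add: ws)
  have "set (as @ bs) \<subseteq> Basis" using mset_eq_setD[OF m] Cons.prems(2) by auto
  then show ?case
    using Cons.IH[OF m] Cons.prems(2) foldr_pdiff_append_Cons[OF assms(1), of as bs v] by (simp add: ws)
qed simp

text \<open>Test the identity for f with the \<open>ws\<close>-derivative of \<phi>, again a test
  function; the order of differentiating \<phi> is immaterial. So a higher weak derivative of u,
  when it exists, is the weak derivative of a lower one.\<close>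

lemma weak_deriv_compose:
  assumes f: "has_weak_deriv S vs u f" and g: "has_weak_deriv S us u g"
    and us: "mset us = mset (vs @ ws)" "set us \<subseteq> Basis"
  shows "has_weak_deriv S ws f g"
  unfolding has_weak_deriv_def
proof (intro conjI ballI)
  show "loc_integrable S f" "loc_integrable S g" using f g by (auto simp: has_weak_deriv_def)
  fix \<phi> :: "'a \<Rightarrow> real" assume \<phi>: "\<phi> \<in> smooth_cpt S"
  have vw: "set (vs @ ws) \<subseteq> Basis" using us mset_eq_setD[OF us(1)] by simp
  have len: "length us = length vs + length ws" using mset_eq_length[OF us(1)] by simp
  have "(-1) ^ length vs *\<^sub>R (LINT z|lebesgue_on S. foldr pdiff ws \<phi> z *\<^sub>R f z)
      = (LINT z|lebesgue_on S. foldr pdiff vs (foldr pdiff ws \<phi>) z *\<^sub>R u z)"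
    using f smooth_cpt_foldr_pdiff[OF \<phi>, of ws] vw by (simp add: has_weak_deriv_def)
  also have "foldr pdiff vs (foldr pdiff ws \<phi>) = foldr pdiff us \<phi>"
    using foldr_pdiff_mset_eq[OF smooth_cptD(1)[OF \<phi>] us] by simp
  also have "(LINT z|lebesgue_on S. foldr pdiff us \<phi> z *\<^sub>R u z) = (-1) ^ length us *\<^sub>R (LINT z|lebesgue_on S. \<phi> z *\<^sub>R g z)"
    using g \<phi> by (simp add: has_weak_deriv_def)
  finally have "(-1) ^ length vs *\<^sub>R ((-1) ^ length vs *\<^sub>R (LINT z|lebesgue_on S. foldr pdiff ws \<phi> z *\<^sub>R f z))
      = (-1) ^ length vs *\<^sub>R ((-1) ^ length us *\<^sub>R (LINT z|lebesgue_on S. \<phi> z *\<^sub>R g z))" by simp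
  then show "(LINT z|lebesgue_on S. foldr pdiff ws \<phi> z *\<^sub>R f z) = (-1) ^ length ws *\<^sub>R (LINT z|lebesgue_on S. \<phi> z *\<^sub>R g z)"
    by (simp add: len power_add flip: power_mult_distrib mult.assoc)
qed

lemma weak_deriv_inner:
  assumes S: "S \<in> sets lebesgue" and wd: "has_weak_deriv S [v] f g"
    and f: "in_L2 (lebesgue_on S) f" and g: "in_L2 (lebesgue_on S) g" and \<phi>: "\<phi> \<in> smooth_cpt S" and v: "v \<in> Basis"
  shows "inner (mk (pdiff v \<phi>)) (cmp b (mk (\<lambda>z. indicator S z *\<^sub>R f z)))
    = - inner (mk \<phi>) (cmp b (mk (\<lambda>z. indicator S z *\<^sub>R g z)))"
proof -
  have L: "in_L2 lebesgue (\<lambda>z. indicator S z *\<^sub>R f z)" "in_L2 lebesgue (\<lambda>z. indicator S z *\<^sub>R g z)"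
    using f g by (simp_all add: in_L2_restrict_iff[OF S])
  have p: "inner (mk \<eta>) (cmp b (mk (\<lambda>z. indicator S z *\<^sub>R h z))) = (LINT z|lebesgue_on S. \<eta> z *\<^sub>R h z) \<bullet> b"
    if \<eta>: "\<eta> \<in> smooth_cpt S" and h: "loc_integrable S h" "in_L2 lebesgue (\<lambda>z. indicator S z *\<^sub>R h z)" for \<eta> h
  proof -
    have i: "integrable (lebesgue_on S) (\<lambda>z. \<eta> z *\<^sub>R h z)" by (rule loc_integrable_mult_test[OF h(1) \<eta> S])
    have "(LINT z|lebesgue_on S. \<eta> z *\<^sub>R h z) \<bullet> b = (LINT z|lebesgue_on S. (\<eta> z *\<^sub>R h z) \<bullet> b)"
      by (rule integral_inner_left[symmetric]) (rule i)
    also have "\<dots> = (LINT z|lebesgue. indicator S z *\<^sub>R ((\<eta> z *\<^sub>R h z) \<bullet> b))"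
      by (rule integral_restrict_space) (use S in simp)
    also have "\<dots> = (LINT z|lebesgue. \<eta> z \<bullet> ((indicator S z *\<^sub>R h z) \<bullet> b))"
      by (rule Bochner_Integration.integral_cong[OF refl]) simp
    also have "\<dots> = inner (mk \<eta>) (cmp b (mk (\<lambda>z. indicator S z *\<^sub>R h z)))"
      by (simp only: cmp_mk[OF h(2)] mk_inner[OF smooth_cpt_in_L2[OF \<eta>] in_L2_inner_const[OF h(2)]])
    finally show ?thesis by simp
  qed
  have loc: "loc_integrable S f" "loc_integrable S g" using wd by (auto simp: has_weak_deriv_def)
  have "(LINT z|lebesgue_on S. pdiff v \<phi> z *\<^sub>R f z) = - (LINT z|lebesgue_on S. \<phi> z *\<^sub>R g z)"
    using wd \<phi> by (simp add: has_weak_deriv_def)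
  then show ?thesis
    using p[OF smooth_cpt_pdiff[OF \<phi> v] loc(1) L(1)] p[OF \<phi> loc(2) L(2)] by simp
qed

lemma weak_deriv_spec: "has_weak_deriv S vs f g \<Longrightarrow> has_weak_deriv S vs f (weak_deriv S vs f)"
  unfolding weak_deriv_def by (rule someI[where P = "has_weak_deriv S vs f"])

lemma set_mi_dirs: "set (mi_dirs \<alpha>) \<subseteq> Basis"
  by (auto simp: mi_dirs_def)

lemma mset_mi_dirs: "mset (mi_dirs \<alpha>) = (\<Sum>i\<in>UNIV. replicate_mset (\<alpha> i) (x_dir i))"
  by (simp add: mi_dirs_def mset_concat comp_def sum_list_distinct_conv_sum_set)

lemma mset_mi_dirs_add: "mset (mi_dirs (count (M + N))) = mset (mi_dirs (count M) @ mi_dirs (count N))"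
proof -
  have "replicate_mset (a + b) x = replicate_mset a x + replicate_mset b x" for a b and x :: "'a spacetime"
    by (rule multiset_eqI) simp
  then show ?thesis by (simp add: mset_mi_dirs sum.distrib)
qed

lemma mset_mi_dirs_single: "mset (mi_dirs (count {#i#})) = {#x_dir i#}"
proof -
  have "(\<Sum>j\<in>UNIV. replicate_mset (count {#i#} j) (x_dir j)) = (\<Sum>j\<in>UNIV. if j = i then {#x_dir j#} else {#})"
    by (intro sum.cong refl) simp
  then show ?thesis by (simp add: mset_mi_dirs)
qed

lemma mi_dirs_zero: "mi_dirs (count {#}) = []"
  by (simp add: mi_dirs_def)

section \<open>Interchange of two-sided derivatives\<close>

section \<open>Tangential derivatives preserve vanishing traces\<close>

text \<open>Traces are prescribed only for D_1^j u; with i normal and j tangential this passes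
  normal differentiability across the boundary from f to its tangential derivative fj. The
  j-quotients of f approximate fj and are differentiable in direction i. By \<open>q_le\<close> the
  i-quotient of the remaining error is bounded by |cdiff k j fi - fij|, uniformly in its step
  h.\<close>

lemma (in shift_action) D2_tangential:
  assumes D: "D2 i f fi" "D2 j f fj" "D2 j fi fij"
  shows "D2 i fj fij"
proof -
  define q where "q h g = (1 / h) *\<^sub>R (sh (axis i h) g - g)" for h g
  have q_diff: "q h (a - b) = q h a - q h b" for h a b
    by (simp add: q_def algebra_simps)
  \<comment> \<open>First fj is replaced by a quotient with step l, to whose difference from the
    step-k quotient \<open>sh_diff_le\<close> applies; then l tends to 0.\<close>
  have q_le: "norm (q h (cdiff k j f - fj)) \<le> norm (cdiff k j fi - fij)" if "h \<noteq> 0" for h k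
  proof (rule tendsto_le[OF trivial_limit_at])
    have "norm (q h (cdiff k j f - cdiff l j f)) \<le> norm (cdiff k j fi - cdiff l j fi)" for l
    proof -
      have "D2 i (cdiff k j f - cdiff l j f) (cdiff k j fi - cdiff l j fi)"
        by (intro D2_diff D2_cdiff D)
      from sh_diff_le[OF this, of h] show ?thesis
        using that by (simp only: q_def norm_scaleR) (simp add: pos_divide_le_eq mult.commute)
    qed
    then show "\<forall>\<^sub>F l in at 0. norm (q h (cdiff k j f - cdiff l j f)) \<le> norm (cdiff k j fi - cdiff l j fi)" by simp
    show "((\<lambda>l. norm (cdiff k j fi - cdiff l j fi)) \<longlongrightarrow> norm (cdiff k j fi - fij)) (at 0)"
      by (intro tendsto_norm tendsto_diff tendsto_const tendsto_cdiff[OF D(3)])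
    show "((\<lambda>l. norm (q h (cdiff k j f - cdiff l j f))) \<longlongrightarrow> norm (q h (cdiff k j f - fj))) (at 0)"
      unfolding q_def
      by (intro tendsto_norm tendsto_scaleR tendsto_diff tendsto_const tendsto_cdiff[OF D(2)]
          bounded_linear.tendsto[OF bounded_linear_sh])
  qed
  have "((\<lambda>h. q h fj) \<longlongrightarrow> fij) (at 0)"
  proof (rule tendstoI)
    fix e :: real assume e: "0 < e"
    have "\<forall>\<^sub>F k in at 0. dist (cdiff k j fi) fij < e / 3"
      using tendstoD[OF tendsto_cdiff[OF D(3)], of "e / 3"] e by simp
    then obtain k where k: "dist (cdiff k j fi) fij < e / 3"
      using eventually_happens'[OF trivial_limit_at] by (metis (mono_tags, lifting))
    have "\<forall>\<^sub>F h in at 0. dist (q h (cdiff k j f)) (cdiff k j fi) < e / 3"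
      using tendstoD[OF D2_cdiff[OF D(1), unfolded D2_def, of k j], of "e / 3"] e by (simp add: q_def)
    moreover have "\<forall>\<^sub>F h in at (0::real). h \<noteq> 0" by (simp add: eventually_at_filter)
    ultimately show "\<forall>\<^sub>F h in at 0. dist (q h fj) fij < e"
    proof eventually_elim
      case (elim h)
      have "q h fj - fij = (q h (cdiff k j f) - cdiff k j fi) + (cdiff k j fi - fij) - q h (cdiff k j f - fj)"
        by (simp add: q_diff)
      then have "norm (q h fj - fij) \<le> norm (q h (cdiff k j f) - cdiff k j fi) + norm (cdiff k j fi - fij) + norm (q h (cdiff k j f - fj))"
        by (simp only: order_trans[OF norm_triangle_ineq4 add_right_mono[OF norm_triangle_ineq]])
      with elim k q_le[of h k] show ?case by (simp add: dist_norm)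
    qed
  qed
  then show ?thesis by (simp add: D2_def q_def)
qed

section \<open>Zero extension of the solution and the final estimate\<close>

section \<open>The estimate\<close>

text \<open>Completeness of Lebesgue measure. It gives measurability of expressions built from
  chosen representatives of weak derivatives.\<close>

lemma borel_measurable_AE_eq:
  assumes f: "f \<in> borel_measurable lebesgue" and eq: "AE z in lebesgue. f z = g z"
  shows "g \<in> borel_measurable lebesgue"
proof (rule measurableI)
  fix B :: "'b set" assume "B \<in> sets borel"
  then have A: "f -` B \<inter> space lebesgue \<in> sets lebesgue" using f by (rule measurable_sets[rotated])
  have ae: "AE z in lebesgue. z \<in> f -` B \<inter> space lebesgue \<longleftrightarrow> z \<in> g -` B \<inter> space lebesgue"
    using eq by eventually_elim simp
  show "g -` B \<inter> space lebesgue \<in> sets lebesgue"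
    by (rule completion.in_sets_AE[OF ae A Int_lower2])
qed simp

definition ze :: "ereal \<Rightarrow> ('d::{finite,linorder}, 'n::finite) vfield \<Rightarrow> ('d spacetime, (complex, 'n) vec) l2"
  where "ze T f = mk (\<lambda>z. indicator (half_cyl T) z *\<^sub>R f z)"

context
  fixes T :: ereal and f g :: "('d::{finite,linorder}, 'n::finite) vfield"
  assumes f: "in_L2 (leb_cyl T) f" and g: "in_L2 (leb_cyl T) g"
begin

lemma ze_in_L2: "in_L2 lebesgue (\<lambda>z. indicator (half_cyl T) z *\<^sub>R f z)"
  using f by (simp add: in_L2_restrict_iff)

lemma norm_ze: "norm (ze T f) = L2_norm (leb_cyl T) f"
  by (simp add: ze_def norm_mk[OF ze_in_L2] L2_norm_restrict)

lemma rst_ze: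
  assumes "half_cyl T \<subseteq> S" "S \<in> sets lebesgue"
  shows "rst S (ze T f) = ze T f"
proof -
  have "(\<lambda>z. indicator S z *\<^sub>R (indicator (half_cyl T) z *\<^sub>R f z)) = (\<lambda>z. indicator (half_cyl T) z *\<^sub>R f z)"
    using assms(1) by (auto simp: fun_eq_iff split: split_indicator)
  then show ?thesis by (simp add: ze_def rst_mk[OF assms(2) ze_in_L2])
qed

end

context
  fixes T :: ereal and f g :: "('d::{finite,linorder}, 'n::finite) vfield"
  assumes f: "in_L2 (leb_cyl T) f" and g: "in_L2 (leb_cyl T) g"
begin

text \<open>The general quotient theorem is applied with v = - \<open>x_dir i\<close>: motion
  against it increases the i-th coordinate, which never leaves the half-cylinder.\<close>

lemma ze_normal_quotient:
  assumes "has_weak_deriv (half_cyl T) [x_dir i] f g"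
  shows "((\<lambda>h. rstE T ((1 / h) *\<^sub>R (shx (axis i h) (ze T f) - ze T f))) \<longlongrightarrow> ze T g) (at_right 0)"
proof -
  let ?e = "x_dir i :: 'd spacetime"
  have lin: "linear (rst (half_cyl T) :: ('d spacetime, (complex, 'n) vec) l2 \<Rightarrow> _)"
    by (rule bounded_linear.linear[OF rst_bounded_linear[OF sets_half_cyl]])
  have "((\<lambda>h. (1 / h) *\<^sub>R rst (half_cyl T) (ze T f - sft (- h *\<^sub>R - ?e) (ze T f))) \<longlongrightarrow> - ze T g) (at_right 0)"
  proof (rule weak_derivative_difference_quotient[OF open_half_cyl])
    show "z - s *\<^sub>R - ?e \<in> half_cyl T" if "z \<in> half_cyl T" "0 \<le> s" for z s
      using that by (cases z) (auto simp: half_cyl_def x_dir_def axis_def)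
    show "rst (half_cyl T) (ze T f) = ze T f" "rst (half_cyl T) (- ze T g) = - ze T g"
      by (simp_all add: rst_ze[OF f f] rst_ze[OF g g] linear_neg[OF lin])
    fix \<phi> :: "'d spacetime \<Rightarrow> real" and b :: "(complex, 'n) vec" assume \<phi>: "\<phi> \<in> smooth_cpt (half_cyl T)"
    have "pdiff (- ?e) \<phi> = (\<lambda>z. (-1) *\<^sub>R pdiff ?e \<phi> z)"
      using linear_neg[OF has_derivative_linear[OF differentiable_derivative[OF smooth_imp_differentiable[OF smooth_cptD(1)[OF \<phi>]]]]]
      by (simp add: fun_eq_iff)
    then have "mk (pdiff (- ?e) \<phi>) = - mk (pdiff ?e \<phi>)"
      using mk_scaleR[OF smooth_cpt_in_L2[OF smooth_cpt_pdiff[OF \<phi> x_dir_Basis]], of "-1" i] by simp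
    then show "inner (mk (pdiff (- ?e) \<phi>)) (cmp b (ze T f)) = - inner (mk \<phi>) (cmp b (- ze T g))"
      using weak_deriv_inner[OF sets_half_cyl assms f g \<phi> x_dir_Basis, of b]
      by (simp add: ze_def linear_neg[OF cmp_linear])
  qed
  from tendsto_minus[OF this] show ?thesis
    by (simp add: rstE_def shx_axis linear_diff[OF lin] linear_scale[OF lin] algebra_simps)
qed

lemma ze_tangential_quotient:
  assumes "has_weak_deriv (half_cyl T) [x_dir i] f g" "i \<noteq> first_coord"
  shows "((\<lambda>h. (1 / h) *\<^sub>R (shx (axis i h) (ze T f) - ze T f)) \<longlongrightarrow> ze T g) (at 0)"
  unfolding shx_axis
proof (rule weak_imp_two_sided[OF open_half_cyl])
  show "z + s *\<^sub>R x_dir i \<in> half_cyl T" if "z \<in> half_cyl T" for z s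
    using that in_half_cyl_shift[OF assms(2), of s z T] by (simp add: add.commute)
  show "rst (half_cyl T) (ze T f) = ze T f" "rst (half_cyl T) (ze T g) = ze T g"
    by (simp_all add: rst_ze[OF f f] rst_ze[OF g g])
  show "inner (mk (pdiff (x_dir i) \<phi>)) (cmp b (ze T f)) = - inner (mk \<phi>) (cmp b (ze T g))"
    if "\<phi> \<in> smooth_cpt (half_cyl T)" for \<phi> b
    unfolding ze_def by (rule weak_deriv_inner[OF sets_half_cyl assms(1) f g that x_dir_Basis])
qed

text \<open>A zero trace makes g a weak derivative across x_1 = 0, hence on \<open>past T\<close>,
  which is invariant under normal translations in both directions.\<close>

lemma ze_trace_quotient:
  assumes "has_weak_deriv (half_cyl T) [x_dir first_coord] f g" "has_trace T f (\<lambda>_. 0)"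
  shows "((\<lambda>h. (1 / h) *\<^sub>R (shx (axis first_coord h) (ze T f) - ze T f)) \<longlongrightarrow> ze T g) (at 0)"
  unfolding shx_axis
proof (rule weak_imp_two_sided[OF open_past])
  have sub: "half_cyl T \<subseteq> (past T :: 'd spacetime set)" by (auto simp: half_cyl_eq)
  show "z + s *\<^sub>R x_dir first_coord \<in> past T" if "z \<in> past T" for z s
    using that by (cases z) (simp add: past_def x_dir_def)
  show "rst (past T) (ze T f) = ze T f" "rst (past T) (ze T g) = ze T g"
    by (simp_all add: rst_ze[OF f f sub] rst_ze[OF g g sub])
  show "inner (mk (pdiff (x_dir first_coord) \<phi>)) (cmp b (ze T f)) = - inner (mk \<phi>) (cmp b (ze T g))"
    if "\<phi> \<in> smooth_cpt (past T)" for \<phi> b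
    unfolding ze_def by (rule zero_trace_weak[OF assms(2,1) f g that])
qed

lemma ze_time_quotient:
  assumes "has_weak_deriv (half_cyl T) [t_dir] f g"
  shows "((\<lambda>h. (1 / h) *\<^sub>R rstE T (ze T f - sft (- h, 0) (ze T f))) \<longlongrightarrow> ze T g) (at_right 0)"
proof -
  have "((\<lambda>h. (1 / h) *\<^sub>R rst (half_cyl T) (ze T f - sft (- h *\<^sub>R t_dir) (ze T f))) \<longlongrightarrow> ze T g) (at_right 0)"
  proof (rule weak_derivative_difference_quotient[OF open_half_cyl])
    show "z - s *\<^sub>R t_dir \<in> half_cyl T" if z: "z \<in> half_cyl T" "0 \<le> s" for z s
    proof -
      obtain t x where tx: "z = (t, x)" by (cases z)
      have "ereal t < T" using z(1) by (simp add: tx half_cyl_def)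
      moreover have "ereal (t - s) \<le> ereal t" using z(2) by simp
      ultimately have "ereal (t - s) < T" by (rule le_less_trans[rotated])
      then show ?thesis using z by (simp add: tx half_cyl_def t_dir_def)
    qed
    show "rst (half_cyl T) (ze T f) = ze T f" "rst (half_cyl T) (ze T g) = ze T g"
      by (simp_all add: rst_ze[OF f f] rst_ze[OF g g])
    show "inner (mk (pdiff t_dir \<phi>)) (cmp b (ze T f)) = - inner (mk \<phi>) (cmp b (ze T g))"
      if "\<phi> \<in> smooth_cpt (half_cyl T)" for \<phi> b
      unfolding ze_def by (rule weak_deriv_inner[OF sets_half_cyl assms(1) f g that t_dir_Basis])
  qed
  then show ?thesis by (simp add: rstE_def t_dir_def)
qed

end

lemma Dx_sobolev:
  fixes u :: "('d::{finite,linorder}, 'n::finite) vfield"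
  assumes u: "u \<in> sobolev_W T k" and M: "size M \<le> k"
  shows "has_weak_deriv (half_cyl T) (mi_dirs (count M)) u (Dx T (count M) u)"
    and "in_L2 (leb_cyl T) (Dx T (count M) u)"
proof -
  have "count M \<in> mi_le k" using M by (simp add: mi_le_def mi_size_count)
  then show "has_weak_deriv (half_cyl T) (mi_dirs (count M)) u (Dx T (count M) u)" "in_L2 (leb_cyl T) (Dx T (count M) u)"
    using u weak_deriv_spec unfolding sobolev_W_def Dx_def by blast+
qed

text \<open>\<open>L0\<close> differentiates a chosen representative a second time. By uniqueness
  the outcome agrees almost everywhere with the derivative of u of the total order.\<close>

lemma Dx_Dx:
  fixes u :: "('d::{finite,linorder}, 'n::finite) vfield"
  assumes u: "u \<in> sobolev_W T k" and MN: "size M + size N \<le> k"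
  shows "has_weak_deriv (half_cyl T) (mi_dirs (count M)) (Dx T (count N) u) (Dx T (count (M + N)) u)"
    and "AE z in lebesgue. z \<in> half_cyl T \<longrightarrow> Dx T (count M) (Dx T (count N) u) z = Dx T (count (M + N)) u z"
proof -
  show w: "has_weak_deriv (half_cyl T) (mi_dirs (count M)) (Dx T (count N) u) (Dx T (count (M + N)) u)"
  proof (rule weak_deriv_compose[OF Dx_sobolev(1)[OF u] Dx_sobolev(1)[OF u] _ set_mi_dirs])
    show "mset (mi_dirs (count (M + N))) = mset (mi_dirs (count N) @ mi_dirs (count M))"
      by (simp only: mset_mi_dirs_add mset_append add.commute)
  qed (use MN in simp_all)
  show "AE z in lebesgue. z \<in> half_cyl T \<longrightarrow> Dx T (count M) (Dx T (count N) u) z = Dx T (count (M + N)) u z"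
    by (rule weak_deriv_unique[OF open_half_cyl _ w]) (unfold Dx_def[of T "count M"], rule weak_deriv_spec[OF w])
qed

lemma Dx_add_mset:
  fixes u :: "('d::{finite,linorder}, 'n::finite) vfield"
  assumes u: "u \<in> sobolev_W T k" and M: "size M < k"
  shows "has_weak_deriv (half_cyl T) [x_dir i] (Dx T (count M) u) (Dx T (count (add_mset i M)) u)"
proof (rule weak_deriv_compose[OF Dx_sobolev(1)[OF u] Dx_sobolev(1)[OF u] _ set_mi_dirs])
  show "mset (mi_dirs (count (add_mset i M))) = mset (mi_dirs (count M) @ [x_dir i])"
    using mset_mi_dirs_add[of "{#i#}" M] mset_mi_dirs_single[of i] by simp
qed (use M in simp_all)

lemma Dx_zero:
  fixes u :: "('d::{finite,linorder}, 'n::finite) vfield"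
  assumes u: "u \<in> sobolev_W T k"
  shows "AE z in lebesgue. z \<in> half_cyl T \<longrightarrow> Dx T (count {#}) u z = u z"
proof (rule weak_deriv_unique[OF open_half_cyl])
  show w: "has_weak_deriv (half_cyl T) (mi_dirs (count {#})) u (Dx T (count {#}) u)"
    by (rule Dx_sobolev(1)[OF u]) simp
  then show "has_weak_deriv (half_cyl T) (mi_dirs (count {#})) u u"
    unfolding mi_dirs_zero by (simp add: has_weak_deriv_def)
qed

lemma finite_size_eq: "finite {M :: 'd::finite multiset. size M = k}"
  using bij_betw_finite[OF bij_count_eq] finite_mi_eq by blast

context
  fixes m :: nat and \<delta> lam :: real and T :: ereal
    and A :: "('d::{finite,linorder}, 'n::finite) coeffs" and u :: "('d, 'n) vfield"
  assumes m: "1 \<le> m" and \<delta>: "0 < \<delta>" and A: "admissible_coeffs m \<delta> A" and lam: "0 \<le> lam"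
    and u: "u \<in> sobolev_W T (2 * m)" and zero: "zero_dirichlet T m u"
begin

interpretation hs: half_space shx "rstE T" first_coord "rst (past T)" "\<lambda>h. sft (- h, 0)" dl "opA m A" m \<delta>
  by (rule half_space_cyl[OF A \<delta>])

text \<open>The zero traces of D_1^j u for j < m give the case without tangential directions; these
  are then added one at a time by \<open>D2_tangential\<close>.\<close>

lemma normal_derivative_two_sided:
  assumes "size M < 2 * m" "count M first_coord < m"
  shows "hs.D2 first_coord (ze T (Dx T (count M) u)) (ze T (Dx T (count (add_mset first_coord M)) u))"
proof -
  let ?U = "\<lambda>M. ze T (Dx T (count M) u)"
  have step: "hs.D2 first_coord (?U (replicate_mset j first_coord + K)) (?U (add_mset first_coord (replicate_mset j first_coord + K)))"
    if "j < m" "first_coord \<notin># K" "j + size K < 2 * m" for j K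
    using that(2,3)
  proof (induction K)
    case empty
    let ?J = "replicate_mset j first_coord :: 'd multiset"
    have J: "count ?J = (\<lambda>_. 0)(first_coord := j)" by (auto simp: fun_eq_iff)
    have "((\<lambda>h. (1 / h) *\<^sub>R (shx (axis first_coord h) (?U ?J) - ?U ?J)) \<longlongrightarrow> ?U (add_mset first_coord ?J)) (at 0)"
    proof (rule ze_trace_quotient)
      show "in_L2 (leb_cyl T) (Dx T (count ?J) u)" "in_L2 (leb_cyl T) (Dx T (count (add_mset first_coord ?J)) u)"
        using empty by (auto intro!: Dx_sobolev(2)[OF u])
      show "has_weak_deriv (half_cyl T) [x_dir first_coord] (Dx T (count ?J) u) (Dx T (count (add_mset first_coord ?J)) u)"
        using empty by (intro Dx_add_mset[OF u]) simp
      show "has_trace T (Dx T (count ?J) u) (\<lambda>_. 0)"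
        unfolding J using zero \<open>j < m\<close> by (simp add: zero_dirichlet_def)
    qed
    then show ?case by (simp only: hs.D2_def add_0_right)
  next
    case (add i K)
    let ?J = "replicate_mset j first_coord + K"
    have i: "i \<noteq> first_coord" and size: "size ?J + 1 < 2 * m" using add.prems by auto
    have tan: "hs.D2 i (?U M) (?U (add_mset i M))" if "size M < 2 * m" for M
      unfolding hs.D2_def
      by (rule ze_tangential_quotient[OF Dx_sobolev(2)[OF u] Dx_sobolev(2)[OF u] Dx_add_mset[OF u] i]) (use that in simp_all)
    have "hs.D2 first_coord (?U (add_mset i ?J)) (?U (add_mset i (add_mset first_coord ?J)))"
      by (rule hs.D2_tangential[OF add.IH tan tan]) (use add.prems size in auto)
    then show ?case by (simp only: add_mset_commute[of i first_coord] union_mset_add_mset_right)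
  qed
  let ?K = "{#i \<in># M. i \<noteq> first_coord#}"
  have eq: "replicate_mset (count M first_coord) first_coord + ?K = M"
    by (rule multiset_eqI) simp
  from arg_cong[OF this, of size] have "count M first_coord + size ?K = size M" by simp
  with step[of "count M first_coord" ?K] assms show ?thesis unfolding eq by simp
qed

lemma fam_ze: "hs.fam (\<lambda>M. ze T (Dx T (count M) u))"
  unfolding hs.fam_def
proof (intro conjI allI impI)
  fix M :: "'d multiset" and i :: 'd
  show "rstE T (ze T (Dx T (count M) u)) = ze T (Dx T (count M) u)" if "size M \<le> 2 * m"
    unfolding rstE_def using Dx_sobolev(2)[OF u that] by (intro rst_ze) simp_all
  assume M: "size M < 2 * m"
  have L: "in_L2 (leb_cyl T) (Dx T (count M) u)" "in_L2 (leb_cyl T) (Dx T (count (add_mset i M)) u)"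
    by (rule Dx_sobolev(2)[OF u], use M in simp)+
  show "hs.DH i (ze T (Dx T (count M) u)) (ze T (Dx T (count (add_mset i M)) u))"
    unfolding hs.DH_def by (rule ze_normal_quotient[OF L Dx_add_mset[OF u M]])
  show "hs.D2 i (ze T (Dx T (count M) u)) (ze T (Dx T (count (add_mset i M)) u))"
    if "i = first_coord \<longrightarrow> count M first_coord < m"
  proof (cases "i = first_coord")
    case True
    then show ?thesis using normal_derivative_two_sided[OF M] that by simp
  next
    case False
    show ?thesis unfolding hs.D2_def by (rule ze_tangential_quotient[OF L Dx_add_mset[OF u M] False])
  qed
qed

lemma Dt_sobolev: "has_weak_deriv (half_cyl T) [t_dir] u (Dt T u)" "in_L2 (leb_cyl T) (Dt T u)"
  using u weak_deriv_spec unfolding sobolev_W_def Dt_def by blast+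

lemma DT_ze: "hs.DT (ze T (Dx T (count {#}) u)) (ze T (Dt T u))"
proof -
  have D0: "in_L2 (leb_cyl T) (Dx T (count {#}) u)" by (rule Dx_sobolev(2)[OF u]) simp
  have "has_weak_deriv (half_cyl T) [t_dir] (Dx T (count {#}) u) (Dt T u)"
    by (rule weak_deriv_compose[OF Dx_sobolev(1)[OF u] Dt_sobolev(1)]) (simp_all add: mi_dirs_zero)
  from ze_time_quotient[OF D0 Dt_sobolev(2) this] show ?thesis by (simp add: hs.DT_def)
qed

text \<open>The two sides are norms of the same class: the integrands agree almost everywhere by
  \<open>Dx_Dx\<close> and \<open>Dx_zero\<close>, and the concrete one is measurable because the
  abstract one is.\<close>

lemma right_hand_side:
  "norm (ze T (Dt T u) + (-1) ^ m *\<^sub>R hs.Lop (\<lambda>M. ze T (Dx T (count M) u)) + lam *\<^sub>R ze T (Dx T (count {#}) u))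
    = L2_norm (leb_cyl T) (\<lambda>z. Dt T u z + (-1) ^ m *\<^sub>R L0 T m A u z + lam *\<^sub>R u z)"
proof -
  let ?I = "{M :: 'd multiset. size M = m}" and ?O = "half_cyl T :: 'd spacetime set"
  define G where "G M N z = A (count M) (count N) (fst z) *v (indicator ?O z *\<^sub>R Dx T (count (M + N)) u z)" for M N z
  have L: "in_L2 lebesgue (\<lambda>z. indicator ?O z *\<^sub>R Dx T (count (M + N)) u z)" if "M \<in> ?I" "N \<in> ?I" for M N
    using that ze_in_L2[OF Dx_sobolev(2)[OF u, of "M + N"] Dx_sobolev(2)[OF u, of "M + N"]] by simp
  have GL: "in_L2 lebesgue (G M N)" if "M \<in> ?I" "N \<in> ?I" for M N
    unfolding G_def[abs_def] using that by (intro bdd_field_in_L2[OF coeff_bdd_field(1)[OF A]] L) auto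
  have op: "opA m A M N (ze T (Dx T (count (M + N)) u)) = mk (G M N)" if MN: "M \<in> ?I" "N \<in> ?I" for M N
  proof -
    have "mop (\<lambda>z x. A (count M) (count N) (fst z) *v x) (ze T (Dx T (count (M + N)) u)) = mk (G M N)"
      unfolding ze_def G_def[abs_def] using MN by (intro mop_mk coeff_bdd_field(1)[OF A] L) auto
    then show ?thesis using MN by (simp add: opA_def)
  qed
  have s1: "in_L2 lebesgue (\<lambda>z. \<Sum>N\<in>?I. G M N z) \<and> (\<Sum>N\<in>?I. mk (G M N)) = mk (\<lambda>z. \<Sum>N\<in>?I. G M N z)" if "M \<in> ?I" for M
    by (rule mk_sum[OF GL[OF that]])
  have s2: "in_L2 lebesgue (\<lambda>z. \<Sum>M\<in>?I. \<Sum>N\<in>?I. G M N z) \<and> (\<Sum>M\<in>?I. mk (\<lambda>z. \<Sum>N\<in>?I. G M N z)) = mk (\<lambda>z. \<Sum>M\<in>?I. \<Sum>N\<in>?I. G M N z)"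
    by (rule mk_sum[OF conjunct1[OF s1]])
  have "hs.Lop (\<lambda>M. ze T (Dx T (count M) u)) = (\<Sum>M\<in>?I. \<Sum>N\<in>?I. mk (G M N))"
    unfolding hs.Lop_def by (intro sum.cong refl op)
  also have "\<dots> = (\<Sum>M\<in>?I. mk (\<lambda>z. \<Sum>N\<in>?I. G M N z))"
    by (intro sum.cong refl conjunct2[OF s1])
  finally have Lop: "hs.Lop (\<lambda>M. ze T (Dx T (count M) u)) = mk (\<lambda>z. \<Sum>M\<in>?I. \<Sum>N\<in>?I. G M N z)"
    using s2 by simp
  let ?D0 = "\<lambda>z. indicator ?O z *\<^sub>R Dx T (count {#}) u z" and ?Dt = "\<lambda>z. indicator ?O z *\<^sub>R Dt T u z"
    and ?L = "\<lambda>z. \<Sum>M\<in>?I. \<Sum>N\<in>?I. G M N z"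
  have D0: "in_L2 lebesgue ?D0"
    using ze_in_L2[OF Dx_sobolev(2)[OF u, of "{#}"] Dx_sobolev(2)[OF u, of "{#}"]] by simp
  have Dt: "in_L2 lebesgue ?Dt" by (rule ze_in_L2[OF Dt_sobolev(2) Dt_sobolev(2)])
  let ?F = "\<lambda>z. ?Dt z + (-1) ^ m *\<^sub>R ?L z + lam *\<^sub>R ?D0 z"
    and ?R = "\<lambda>z. indicator ?O z *\<^sub>R (Dt T u z + (-1) ^ m *\<^sub>R L0 T m A u z + lam *\<^sub>R u z)"
  have F: "in_L2 lebesgue ?F"
    by (intro in_L2_add in_L2_scaleR Dt D0 conjunct1[OF s2])
  have "AE z in lebesgue. \<forall>M\<in>?I. \<forall>N\<in>?I. z \<in> ?O \<longrightarrow> Dx T (count M) (Dx T (count N) u) z = Dx T (count (M + N)) u z"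
    by (intro eventually_ball_finite finite_size_eq ballI Dx_Dx(2)[OF u]) simp
  with Dx_zero[OF u] have eq: "AE z in lebesgue. ?F z = ?R z"
  proof eventually_elim
    case (elim z)
    show "?F z = ?R z"
    proof (cases "z \<in> ?O")
      case True
      have "L0 T m A u z = (\<Sum>M\<in>?I. \<Sum>N\<in>?I. A (count M) (count N) (fst z) *v Dx T (count M) (Dx T (count N) u) z)"
        unfolding L0_def by (simp only: sum.reindex_bij_betw[OF bij_count_eq, symmetric])
      also have "\<dots> = ?L z"
        using elim(2) True by (intro sum.cong refl) (simp add: G_def)
      finally show ?thesis using elim(1) True by simp
    qed (simp add: G_def)
  qed
  have R: "in_L2 lebesgue ?R"
    by (rule in_L2_cong_AE[OF F eq borel_measurable_AE_eq[OF _ eq]]) (use F in \<open>simp add: in_L2_def\<close>)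
  have "ze T (Dt T u) + (-1) ^ m *\<^sub>R hs.Lop (\<lambda>M. ze T (Dx T (count M) u)) + lam *\<^sub>R ze T (Dx T (count {#}) u) = mk ?F"
    unfolding Lop ze_def[of T "Dt T u"] ze_def[of T "Dx T (count {#}) u"] mk_scaleR[OF conjunct1[OF s2]] mk_scaleR[OF D0]
      mk_plus[OF Dt in_L2_scaleR[OF conjunct1[OF s2]]] mk_plus[OF in_L2_add[OF Dt in_L2_scaleR[OF conjunct1[OF s2]]] in_L2_scaleR[OF D0]] ..
  also have "mk ?F = mk ?R" using eq by (simp only: mk_eq_iff[OF F R])
  finally show ?thesis by (simp only: norm_mk[OF R] L2_norm_restrict[OF sets_half_cyl])
qed

text \<open>The norms of the zero-extended derivatives satisfy all hypotheses of the numerical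
  inequality. It is assumed here as a premise, so that its constant N can be chosen before T, A, lam
  and u.\<close>

lemma estimate:
  assumes N: "\<forall>(u :: 'd multiset \<Rightarrow> real) f ut lam. (\<forall>M. 0 \<le> u M) \<longrightarrow> 0 \<le> f \<longrightarrow> 0 \<le> lam \<longrightarrow>
     (\<forall>K S. size K = m \<longrightarrow> size S = m \<longrightarrow> first_coord \<notin># S \<longrightarrow> \<delta> * u (K + S) \<le> f) \<longrightarrow>
     \<delta> * u (replicate_mset m first_coord + replicate_mset m first_coord) \<le> f + inverse \<delta> *
       (\<Sum>(M, N)\<in>{M. size M = m} \<times> {N. size N = m} - {(replicate_mset m first_coord, replicate_mset m first_coord)}. u (M + N)) \<longrightarrow>
     (\<forall>K j. size K + 2 \<le> 2 * m \<longrightarrow> j \<noteq> first_coord \<longrightarrow>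
        (u (add_mset first_coord (add_mset j K)))\<^sup>2 \<le> 49 * u (add_mset first_coord (add_mset first_coord K)) * u (add_mset j (add_mset j K))) \<longrightarrow>
     (\<forall>K i. size K + 2 \<le> 2 * m \<longrightarrow>
        (u (add_mset i K))\<^sup>2 \<le> 49 * u K * u (add_mset i (add_mset i K))) \<longrightarrow>
     ut \<le> f + inverse \<delta> * (\<Sum>(M, N)\<in>{M. size M = m} \<times> {N. size N = m}. u (M + N)) \<longrightarrow>
     lam * u {#} \<le> f + inverse \<delta> * (\<Sum>(M, N)\<in>{M. size M = m} \<times> {N. size N = m}. u (M + N)) \<longrightarrow>
     ut + (\<Sum>M | size M \<le> 2 * m. rpow lam (1 - real (size M) / real (2 * m)) * u M) \<le> N * f"
  shows "L2_norm (leb_cyl T) (Dt T u)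
      + (\<Sum>\<alpha>\<in>mi_le (2 * m). rpow lam (1 - real (mi_size \<alpha>) / real (2 * m)) * L2_norm (leb_cyl T) (Dx T \<alpha> u))
    \<le> N * L2_norm (leb_cyl T) (\<lambda>z. Dt T u z + (-1) ^ m *\<^sub>R L0 T m A u z + lam *\<^sub>R u z)"
proof -
  let ?U = "\<lambda>M. ze T (Dx T (count M) u)"
  define F where "F = ze T (Dt T u) + (-1) ^ m *\<^sub>R hs.Lop ?U + lam *\<^sub>R ?U {#}"
  note est = fam_ze DT_ze lam F_def
  have nU: "norm (?U M) = L2_norm (leb_cyl T) (Dx T (count M) u)" if "size M \<le> 2 * m" for M
    using Dx_sobolev(2)[OF u that] by (intro norm_ze)
  have "norm (ze T (Dt T u)) + (\<Sum>M | size M \<le> 2 * m. rpow lam (1 - real (size M) / real (2 * m)) * norm (?U M)) \<le> N * norm F"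
    by (rule N[rule_format, where u = "\<lambda>M. norm (?U M)" and f = "norm F", OF norm_ge_zero norm_ge_zero lam
          hs.tangential[OF est] hs.normal[OF est] hs.mixed_interpolation[OF fam_ze] hs.pure_interpolation[OF fam_ze]
          hs.time_and_zero_order(1)[OF est] hs.time_and_zero_order(2)[OF est]])
  also have "(\<Sum>M | size M \<le> 2 * m. rpow lam (1 - real (size M) / real (2 * m)) * norm (?U M))
      = (\<Sum>M | size M \<le> 2 * m. rpow lam (1 - real (mi_size (count M)) / real (2 * m)) * L2_norm (leb_cyl T) (Dx T (count M) u))"
    by (intro sum.cong refl) (simp add: nU mi_size_count)
  also have "\<dots> = (\<Sum>\<alpha>\<in>mi_le (2 * m). rpow lam (1 - real (mi_size \<alpha>) / real (2 * m)) * L2_norm (leb_cyl T) (Dx T \<alpha> u))"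
    by (rule sum.reindex_bij_betw[OF bij_count_le])
  finally show ?thesis
    unfolding F_def right_hand_side norm_ze[OF Dt_sobolev(2) Dt_sobolev(2)] .
qed

end

theorem theorem6p6:
  fixes m :: nat and \<delta> :: real
  assumes "1 \<le> m" and "0 < \<delta>"
  shows "\<exists>N :: real. \<forall>(T :: ereal)
           (A :: ('d::{finite,linorder}, 'n::finite) coeffs)
           (lam :: real) (u :: ('d, 'n) vfield).
           T \<noteq> -\<infinity> \<longrightarrow> admissible_coeffs m \<delta> A \<longrightarrow> 0 \<le> lam \<longrightarrow>
           u \<in> sobolev_W T (2 * m) \<longrightarrow> zero_dirichlet T m u \<longrightarrow>
           L2_norm (leb_cyl T) (Dt T u)
             + (\<Sum>\<alpha>\<in>mi_le (2 * m). rpow lam (1 - real (mi_size \<alpha>) / real (2 * m))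
                  * L2_norm (leb_cyl T) (Dx T \<alpha> u))
           \<le> N * L2_norm (leb_cyl T)
                (\<lambda>z. Dt T u z + (-1) ^ m *\<^sub>R L0 T m A u z + lam *\<^sub>R u z)"
  using all_orders_bound[OF assms, of "first_coord :: 'd"]
proof (elim exE, goal_cases)
  case (1 N)
  show ?case by (intro exI[of _ N] allI impI estimate[OF assms _ _ _ _ 1])
qed

end
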